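(* Let $R$ be a principal ideal domain and let $\mathscr{O}$ be a binary operad in $R$-modules. The inclusion $\mathrm{Der}^{(1)}_{\mathrm{Lie}}(\mathscr{O}(V))\subset\mathrm{Der}^+(\mathscr{O}(V))$ and the generalized divergence $\mathsf{Div}^{\mathscr{O}}_V:\mathrm{Der}^+(\mathscr{O}(V))\to|\mathrm{Der}_\bullet^+(\mathscr{O}(R\oplus V))|$ induce a sequence $$0\to\mathrm{Der}^{(1)}_{\mathrm{Lie}}(\mathscr{O}(V))\to\mathrm{Der}^+(\mathscr{O}(V))\to|\mathrm{Der}_\bullet^+(\mathscr{O}(R\oplus V))|/\mathbf{Im}^{\mathscr{O}}(V)\to0$$ that is natural in $V\in\mathrm{Ob}\,\mathcal{S}(R)$ and that is exact up to torsion as a sequence of functors on $\mathcal{S}(R)$ (i.e. it is a complex whose homology functors are torsion functors on $\mathcal{S}(R)$).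
   Context: Operads are symmetric operads in $R$-modules. A binary operad is an operad admitting a surjective morphism of operads from the free operad on a set $B$ of generators of arity $2$ (no symmetry imposed); in particular $\mathscr{O}(0)=0$ and $\mathscr{O}(1)$ is generated by the unit. Free algebras. $\mathscr{O}(V)=\bigoplus_n\mathscr{O}_n(V)$, $\mathscr{O}_n(V)=\mathscr{O}(n)\otimes_{\mathfrak{S}_n}V^{\otimes n}$, is the free $\mathscr{O}$-algebra on $V$; $\mathscr{O}(V;W)=\bigoplus_{n\ge1}\mathscr{O}(n)\otimes_{\mathfrak{S}_{n-1}}(V^{\otimes n-1}\otimes W)$ is the summand of $\mathscr{O}(V\oplus W)$ of terms linear in $W$. The category $\mathcal{S}(R)$ has objects the free $R$-modules of finite rank and morphisms $V\to W$ the pairs $(i:V\to W,\ r:W\to V)$ of $R$-linear maps with $r\circ i=\mathrm{id}_V$. Derivations. For $V$ free of finite rank, $\mathrm{Der}(\mathscr{O}(V))$ is the module of derivations of the $\mathscr{O}$-algebra $\mathscr{O}(V)$; restriction to $V$ gives $\mathrm{Der}(\mathscr{O}(V))\cong\mathrm{Hom}_R(V,\mathscr{O}(V))\cong\mathscr{O}(V)\otimes V^\sharp$, where $V^\sharp=\mathrm{Hom}_R(V,R)$. It is graded with $\mathrm{Hom}_R(V,\mathscr{O}_n(V))$ in degree $n-1$; $\mathrm{Der}^+$ is the part of positive degree. It is a functor on $\mathcal{S}(R)$: $(i,r)$ sends $d$ to the derivation whose restriction to $W$ is $\mathscr{O}(i)\circ d|_V\circ r$. The preLie product is $(d\lhd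 e)|_V=e\circ(d|_V)$, with Lie bracket $[d,e]=d\lhd e-e\lhd d$. $\mathrm{Der}^{(1)}_{\mathrm{Lie}}(\mathscr{O}(V))$ is the sub Lie algebra of $\mathrm{Der}(\mathscr{O}(V))$ generated by the degree one part $\mathrm{Hom}_R(V,\mathscr{O}_2(V))$. Pointed derivations. $\mathrm{Der}_\bullet(\mathscr{O}(R\oplus V)):=\mathrm{Hom}_R(R,\mathscr{O}(V;R))\cong\mathscr{O}(V;R)$, a submodule of $\mathrm{Der}(\mathscr{O}(R\oplus V))$ via $R\oplus V\twoheadrightarrow R$ and $\mathscr{O}(V;R)\subset\mathscr{O}(R\oplus V)$; $\lhd$ restricts to an associative unital product on it. $\mathrm{Der}^+_\bullet(\mathscr{O}(R\oplus V))$ is its intersection with $\mathrm{Der}^+(\mathscr{O}(R\oplus V))$. For an associative (possibly non-unital) algebra $A$, $|A|=A/[A,A]$ with $[A,A]$ the submodule generated by commutators. Divergence. Let $\delta_V:\mathscr{O}(V)\to\mathscr{O}(V;V)$ send $\mu(v_1,\dots,v_n)$ to $\sum_i\mu(v_1,\dots,\overline{v_i},\dots,v_n)$, with $\overline{v_i}$ in the linear argument. $\Phi^{\mathscr{O}}_V:\mathrm{Der}(\mathscr{O}(V))\cong\mathscr{O}(V)\otimes V^\sharp\to\mathscr{O}(V;R)\cong\mathrm{Der}_\bullet(\mathscr{O}(R\oplus V))$ is $x\otimes f\mapsto\mathscr{O}(V;f)(\delta_V(x))$; it preserves degree. $\mathsf{Div}^{\mathscr{O}}_V:\mathrm{Der}^+(\mathscr{O}(V))\to|\mathrm{Der}^+_\bullet(\mathscr{O}(R\oplus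 V))|$ is the restriction of $\Phi^{\mathscr{O}}_V$ followed by the quotient map. $\mathbf{Im}^{\mathscr{O}}(V):=\mathsf{Div}^{\mathscr{O}}_V(\mathrm{Der}^{(1)}_{\mathrm{Lie}}(\mathscr{O}(V)))$. Torsion. For a functor $F:\mathcal{S}(R)\to R\text{-modules}$, an element $x\in F(V)$ is torsion if the smallest subfunctor $\langle x\rangle\subset F$ containing $x$ satisfies $\langle x\rangle(W)=0$ for $\mathrm{rank}_R W\gg0$; for $R$ a PID this is equivalent to $F(j_t)(x)=0$ for some $t\in\mathbb{N}$, where $j_t:V\to V\oplus R^t$ is the canonical split inclusion. $F$ is torsion if all its elements are torsion. *)

theory Defs
  imports "HOL-Combinatorics.Permutations" "HOL-Algebra.Ring_Divisibility" "HOL-Algebra.Module"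
begin

section \<open>Modules\<close>

text \<open>The fields \<open>mult\<close> and \<open>one\<close> of a module record play no role for the locale \<^locale>\<open>module\<close>
  and are left undefined in the constructions below.\<close>

text \<open>Linear maps are taken extensional, so that sets of linear maps are genuine Hom-sets.\<close>

definition lin_hom :: "'r ring \<Rightarrow> ('r, 'm) module \<Rightarrow> ('r, 'n) module \<Rightarrow> ('m \<Rightarrow> 'n) set" where
  "lin_hom R M N = {f \<in> carrier M \<rightarrow>\<^sub>E carrier N.
     (\<forall>x\<in>carrier M. \<forall>y\<in>carrier M. f (x \<oplus>\<^bsub>M\<^esub> y) = f x \<oplus>\<^bsub>N\<^esub> f y) \<and>
     (\<forall>a\<in>carrier R. \<forall>x\<in>carrier M. f (a \<odot>\<^bsub>M\<^esub> x) = a \<odot>\<^bsub>N\<^esub> f x)}"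

definition hom_mod :: "'r ring \<Rightarrow> ('r, 'm) module \<Rightarrow> ('r, 'n) module \<Rightarrow> ('r, 'm \<Rightarrow> 'n) module" where
  "hom_mod R M N = \<lparr>carrier = lin_hom R M N, mult = undefined, one = undefined,
     zero = (\<lambda>x\<in>carrier M. \<zero>\<^bsub>N\<^esub>), add = (\<lambda>f g. \<lambda>x\<in>carrier M. f x \<oplus>\<^bsub>N\<^esub> g x),
     smult = (\<lambda>a f. \<lambda>x\<in>carrier M. a \<odot>\<^bsub>N\<^esub> f x)\<rparr>"

definition mspan :: "'r ring \<Rightarrow> ('r, 'm) module \<Rightarrow> 'm set \<Rightarrow> 'm set" where
  "mspan R M S = \<Inter>{H. submodule H R M \<and> S \<subseteq> H}"

definition quot_mod :: "('r, 'm) module \<Rightarrow> 'm set \<Rightarrow> ('r, 'm set) module" where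
  "quot_mod M N = \<lparr>carrier = a_rcosets\<^bsub>M\<^esub> N, mult = undefined, one = undefined, zero = N,
     add = set_add M, smult = (\<lambda>a X. \<Union>x\<in>X. N +>\<^bsub>M\<^esub> (a \<odot>\<^bsub>M\<^esub> x))\<rparr>"

text \<open>A representative of a coset; it is only used to define maps that do not depend on it.\<close>

definition repr :: "'m set \<Rightarrow> 'm" where
  "repr X = (SOME x. x \<in> X)"

definition reg_mod :: "'r ring \<Rightarrow> ('r, 'r) module" where
  "reg_mod R = \<lparr>carrier = carrier R, mult = mult R, one = one R, zero = zero R,
     add = add R, smult = mult R\<rparr>"

definition dsum :: "('r, 'm) module \<Rightarrow> ('r, 'n) module \<Rightarrow> ('r, 'm \<times> 'n) module" where
  "dsum M N = \<lparr>carrier = carrier M \<times> carrier N, mult = undefined, one = undefined,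
     zero = (\<zero>\<^bsub>M\<^esub>, \<zero>\<^bsub>N\<^esub>),
     add = (\<lambda>(x, y) (x', y'). (x \<oplus>\<^bsub>M\<^esub> x', y \<oplus>\<^bsub>N\<^esub> y')),
     smult = (\<lambda>a (x, y). (a \<odot>\<^bsub>M\<^esub> x, a \<odot>\<^bsub>N\<^esub> y))\<rparr>"

definition dsum_map :: "('r, 'm) module \<Rightarrow> ('r, 'n) module \<Rightarrow> ('m \<Rightarrow> 'm') \<Rightarrow> ('n \<Rightarrow> 'n') \<Rightarrow>
    'm \<times> 'n \<Rightarrow> 'm' \<times> 'n'" where
  "dsum_map M N f g = (\<lambda>(x, y)\<in>carrier M \<times> carrier N. (f x, g y))"

definition supp :: "'r ring \<Rightarrow> ('b \<Rightarrow> 'r) \<Rightarrow> 'b set" where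
  "supp R x = {b. x b \<noteq> \<zero>\<^bsub>R\<^esub>}"

definition free_mod :: "'r ring \<Rightarrow> 'b set \<Rightarrow> ('r, 'b \<Rightarrow> 'r) module" where
  "free_mod R B = \<lparr>carrier = {x. range x \<subseteq> carrier R \<and> supp R x \<subseteq> B \<and> finite (supp R x)},
     mult = undefined, one = undefined, zero = (\<lambda>b. \<zero>\<^bsub>R\<^esub>),
     add = (\<lambda>x y b. x b \<oplus>\<^bsub>R\<^esub> y b), smult = (\<lambda>a x b. a \<otimes>\<^bsub>R\<^esub> x b)\<rparr>"

definition single :: "'r ring \<Rightarrow> 'b \<Rightarrow> 'b \<Rightarrow> 'r" where
  "single R b = (\<lambda>c. if c = b then \<one>\<^bsub>R\<^esub> else \<zero>\<^bsub>R\<^esub>)"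

definition lin_ext :: "'r ring \<Rightarrow> ('r, 'm) module \<Rightarrow> ('b \<Rightarrow> 'm) \<Rightarrow> ('b \<Rightarrow> 'r) \<Rightarrow> 'm" where
  "lin_ext R M g x = (\<Oplus>\<^bsub>M\<^esub>b\<in>supp R x. x b \<odot>\<^bsub>M\<^esub> g b)"

definition multilin_ext :: "'r ring \<Rightarrow> ('r, 'm) module \<Rightarrow> ('b list \<Rightarrow> 'm) \<Rightarrow> ('b \<Rightarrow> 'r) list \<Rightarrow> 'm" where
  "multilin_ext R M g xs =
     (\<Oplus>\<^bsub>M\<^esub>bs\<in>listset (map (supp R) xs). (\<Otimes>\<^bsub>R\<^esub>i\<in>{..<length xs}. (xs ! i) (bs ! i)) \<odot>\<^bsub>M\<^esub> g bs)"

definition has_rank :: "'r ring \<Rightarrow> ('r, 'm) module \<Rightarrow> nat \<Rightarrow> bool" where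
  "has_rank R M n \<longleftrightarrow> (\<exists>B. finite B \<and> card B = n \<and> B \<subseteq> carrier M \<and>
     (\<forall>x\<in>carrier M. \<exists>!c. c \<in> B \<rightarrow>\<^sub>E carrier R \<and> x = (\<Oplus>\<^bsub>M\<^esub>b\<in>B. c b \<odot>\<^bsub>M\<^esub> b)))"


section \<open>Symmetric operads\<close>

text \<open>\<open>op_comp P [k\<^sub>1, \<dots>, k\<^sub>n] \<mu> [\<nu>\<^sub>1, \<dots>, \<nu>\<^sub>n]\<close> is the total composition
  \<open>\<gamma>(\<mu>; \<nu>\<^sub>1, \<dots>, \<nu>\<^sub>n)\<close> of \<open>\<mu> \<in> P(n)\<close> with \<open>\<nu>\<^sub>i \<in> P(k\<^sub>i)\<close>, and \<open>op_act P n \<mu> \<sigma>\<close> is the right action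
  \<open>\<mu>\<cdot>\<sigma>\<close> of a permutation of \<open>{0, \<dots>, n - 1}\<close>. The arities are passed explicitly since all the
  modules \<open>P(n)\<close> have their elements in one type.\<close>

record ('r, 'o) operad =
  op_mod :: "nat \<Rightarrow> ('r, 'o) module"
  op_one :: 'o
  op_comp :: "nat list \<Rightarrow> 'o \<Rightarrow> 'o list \<Rightarrow> 'o"
  op_act :: "nat \<Rightarrow> 'o \<Rightarrow> (nat \<Rightarrow> nat) \<Rightarrow> 'o"

definition op_args :: "('r, 'o) operad \<Rightarrow> nat list \<Rightarrow> 'o list \<Rightarrow> bool" where
  "op_args P = list_all2 (\<lambda>k \<nu>. \<nu> \<in> carrier (op_mod P k))"

text \<open>The convention for the action is the usual one,
  \<open>(\<mu>\<cdot>\<sigma>)(v\<^sub>\<sigma>\<^sub>(\<^sub>1\<^sub>), \<dots>, v\<^sub>\<sigma>\<^sub>(\<^sub>n\<^sub>)) = \<mu>(v\<^sub>1, \<dots>, v\<^sub>n)\<close>, that is,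
  \<open>(\<mu>\<cdot>\<sigma>)(permute_list \<sigma> vs) = \<mu>(vs)\<close>. A permutation \<open>\<beta>\<close> of \<open>{0, \<dots>, m - 1}\<close> is thus determined by
  \<open>permute_list \<beta> [0..<m]\<close>, which is how the block permutations in the equivariance axioms are
  given: \<open>block_perm \<sigma> ks\<close> permutes the consecutive blocks of lengths \<open>ks\<close>, and \<open>sum_perm \<tau>s ks\<close>
  applies the permutations \<open>\<tau>s\<close> inside the blocks.\<close>

definition blocks :: "nat list \<Rightarrow> nat list list" where
  "blocks ks = map (\<lambda>i. [sum_list (take i ks)..<sum_list (take (Suc i) ks)]) [0..<length ks]"

definition list_perm :: "nat list \<Rightarrow> nat \<Rightarrow> nat" where
  "list_perm xs p = (if p < length xs then xs ! p else p)"

definition block_perm :: "(nat \<Rightarrow> nat) \<Rightarrow> nat list \<Rightarrow> nat \<Rightarrow> nat" where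
  "block_perm \<sigma> ks = list_perm (concat (permute_list \<sigma> (blocks ks)))"

definition sum_perm :: "(nat \<Rightarrow> nat) list \<Rightarrow> nat list \<Rightarrow> nat \<Rightarrow> nat" where
  "sum_perm \<tau>s ks = list_perm (concat (map2 permute_list \<tau>s (blocks ks)))"

locale operad =
  fixes R :: "'r ring" (structure) and P :: "('r, 'o) operad"
  assumes cring: "cring R"
    and mod: "module R (op_mod P n)"
    and one_closed: "op_one P \<in> carrier (op_mod P 1)"
    and comp_closed: "\<lbrakk>\<mu> \<in> carrier (op_mod P (length ks)); op_args P ks \<nu>s\<rbrakk> \<Longrightarrow>
      op_comp P ks \<mu> \<nu>s \<in> carrier (op_mod P (sum_list ks))"
    and comp_add_left: "\<lbrakk>\<mu> \<in> carrier (op_mod P (length ks)); \<mu>' \<in> carrier (op_mod P (length ks));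
      op_args P ks \<nu>s\<rbrakk> \<Longrightarrow>
      op_comp P ks (\<mu> \<oplus>\<^bsub>op_mod P (length ks)\<^esub> \<mu>') \<nu>s =
        op_comp P ks \<mu> \<nu>s \<oplus>\<^bsub>op_mod P (sum_list ks)\<^esub> op_comp P ks \<mu>' \<nu>s"
    and comp_smult_left: "\<lbrakk>a \<in> carrier R; \<mu> \<in> carrier (op_mod P (length ks)); op_args P ks \<nu>s\<rbrakk> \<Longrightarrow>
      op_comp P ks (a \<odot>\<^bsub>op_mod P (length ks)\<^esub> \<mu>) \<nu>s =
        a \<odot>\<^bsub>op_mod P (sum_list ks)\<^esub> op_comp P ks \<mu> \<nu>s"
    and comp_add_right: "\<lbrakk>\<mu> \<in> carrier (op_mod P (length ks)); op_args P ks \<nu>s; i < length ks;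
      \<nu>' \<in> carrier (op_mod P (ks ! i))\<rbrakk> \<Longrightarrow>
      op_comp P ks \<mu> (\<nu>s[i := \<nu>s ! i \<oplus>\<^bsub>op_mod P (ks ! i)\<^esub> \<nu>']) =
        op_comp P ks \<mu> \<nu>s \<oplus>\<^bsub>op_mod P (sum_list ks)\<^esub> op_comp P ks \<mu> (\<nu>s[i := \<nu>'])"
    and comp_smult_right: "\<lbrakk>a \<in> carrier R; \<mu> \<in> carrier (op_mod P (length ks)); op_args P ks \<nu>s;
      i < length ks\<rbrakk> \<Longrightarrow>
      op_comp P ks \<mu> (\<nu>s[i := a \<odot>\<^bsub>op_mod P (ks ! i)\<^esub> (\<nu>s ! i)]) =
        a \<odot>\<^bsub>op_mod P (sum_list ks)\<^esub> op_comp P ks \<mu> \<nu>s"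
    and one_left: "\<mu> \<in> carrier (op_mod P n) \<Longrightarrow> op_comp P [n] (op_one P) [\<mu>] = \<mu>"
    and one_right: "\<mu> \<in> carrier (op_mod P n) \<Longrightarrow>
      op_comp P (replicate n 1) \<mu> (replicate n (op_one P)) = \<mu>"
    and comp_assoc: "\<lbrakk>\<mu> \<in> carrier (op_mod P (length ks)); op_args P ks \<nu>s;
      length lss = length ks; length \<xi>ss = length ks;
      \<And>i. i < length ks \<Longrightarrow> length (lss ! i) = ks ! i \<and> op_args P (lss ! i) (\<xi>ss ! i)\<rbrakk> \<Longrightarrow>
      op_comp P (concat lss) (op_comp P ks \<mu> \<nu>s) (concat \<xi>ss) =
        op_comp P (map sum_list lss) \<mu>
          (map (\<lambda>i. op_comp P (lss ! i) (\<nu>s ! i) (\<xi>ss ! i)) [0..<length ks])"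
    and act_closed: "\<lbrakk>\<mu> \<in> carrier (op_mod P n); \<sigma> permutes {..<n}\<rbrakk> \<Longrightarrow>
      op_act P n \<mu> \<sigma> \<in> carrier (op_mod P n)"
    and act_add: "\<lbrakk>\<mu> \<in> carrier (op_mod P n); \<mu>' \<in> carrier (op_mod P n); \<sigma> permutes {..<n}\<rbrakk> \<Longrightarrow>
      op_act P n (\<mu> \<oplus>\<^bsub>op_mod P n\<^esub> \<mu>') \<sigma> = op_act P n \<mu> \<sigma> \<oplus>\<^bsub>op_mod P n\<^esub> op_act P n \<mu>' \<sigma>"
    and act_smult: "\<lbrakk>a \<in> carrier R; \<mu> \<in> carrier (op_mod P n); \<sigma> permutes {..<n}\<rbrakk> \<Longrightarrow>
      op_act P n (a \<odot>\<^bsub>op_mod P n\<^esub> \<mu>) \<sigma> = a \<odot>\<^bsub>op_mod P n\<^esub> op_act P n \<mu> \<sigma>"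
    and act_id: "\<mu> \<in> carrier (op_mod P n) \<Longrightarrow> op_act P n \<mu> id = \<mu>"
    and act_act: "\<lbrakk>\<mu> \<in> carrier (op_mod P n); \<sigma> permutes {..<n}; \<tau> permutes {..<n}\<rbrakk> \<Longrightarrow>
      op_act P n (op_act P n \<mu> \<sigma>) \<tau> = op_act P n \<mu> (\<sigma> \<circ> \<tau>)"
    and equivariance_outer: "\<lbrakk>\<mu> \<in> carrier (op_mod P (length ks)); op_args P ks \<nu>s;
      \<sigma> permutes {..<length ks}\<rbrakk> \<Longrightarrow>
      op_comp P (permute_list \<sigma> ks) (op_act P (length ks) \<mu> \<sigma>) (permute_list \<sigma> \<nu>s) =
        op_act P (sum_list ks) (op_comp P ks \<mu> \<nu>s) (block_perm \<sigma> ks)"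
    and equivariance_inner: "\<lbrakk>\<mu> \<in> carrier (op_mod P (length ks)); op_args P ks \<nu>s;
      length \<tau>s = length ks; \<And>i. i < length ks \<Longrightarrow> (\<tau>s ! i) permutes {..<ks ! i}\<rbrakk> \<Longrightarrow>
      op_comp P ks \<mu> (map (\<lambda>i. op_act P (ks ! i) (\<nu>s ! i) (\<tau>s ! i)) [0..<length ks]) =
        op_act P (sum_list ks) (op_comp P ks \<mu> \<nu>s) (sum_perm \<tau>s ks)"

definition operad_hom :: "'r ring \<Rightarrow> ('r, 'o) operad \<Rightarrow> ('r, 'p) operad \<Rightarrow> (nat \<Rightarrow> 'o \<Rightarrow> 'p) \<Rightarrow> bool" where
  "operad_hom R P Q \<phi> \<longleftrightarrow>
     (\<forall>n. \<phi> n \<in> lin_hom R (op_mod P n) (op_mod Q n)) \<and>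
     \<phi> 1 (op_one P) = op_one Q \<and>
     (\<forall>ks \<mu> \<nu>s. \<mu> \<in> carrier (op_mod P (length ks)) \<longrightarrow> op_args P ks \<nu>s \<longrightarrow>
        \<phi> (sum_list ks) (op_comp P ks \<mu> \<nu>s) = op_comp Q ks (\<phi> (length ks) \<mu>) (map2 \<phi> ks \<nu>s)) \<and>
     (\<forall>n \<mu> \<sigma>. \<mu> \<in> carrier (op_mod P n) \<longrightarrow> \<sigma> permutes {..<n} \<longrightarrow>
        \<phi> n (op_act P n \<mu> \<sigma>) = op_act Q n (\<phi> n \<mu>) \<sigma>)"

text \<open>The free operad on a set \<open>B\<close> of generators of arity 2 (without symmetry): its arity \<open>n\<close> part
  has as basis the planar binary trees with inner nodes labelled by \<open>B\<close> and leaves labelled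
  bijectively by \<open>{0, \<dots>, n - 1}\<close>, a leaf label being the index of the argument inserted there.\<close>

datatype (node_labels: 'b) btree = Leaf nat | Node 'b "'b btree" "'b btree"

primrec leaves :: "'b btree \<Rightarrow> nat list" where
  "leaves (Leaf i) = [i]"
| "leaves (Node b s t) = leaves s @ leaves t"

primrec graft :: "(nat \<Rightarrow> 'b btree) \<Rightarrow> 'b btree \<Rightarrow> 'b btree" where
  "graft f (Leaf i) = f i"
| "graft f (Node b s t) = Node b (graft f s) (graft f t)"

definition relabel :: "(nat \<Rightarrow> nat) \<Rightarrow> 'b btree \<Rightarrow> 'b btree" where
  "relabel g = graft (\<lambda>i. Leaf (g i))"

definition labelled_trees :: "'b set \<Rightarrow> nat \<Rightarrow> 'b btree set" where
  "labelled_trees B n = {t. node_labels t \<subseteq> B \<and> distinct (leaves t) \<and> set (leaves t) = {..<n}}"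

definition tree_comp :: "nat list \<Rightarrow> 'b btree \<Rightarrow> 'b btree list \<Rightarrow> 'b btree" where
  "tree_comp ks t ss = graft (\<lambda>i. relabel (\<lambda>j. sum_list (take i ks) + j) (ss ! i)) t"

definition free_binary_operad :: "'r ring \<Rightarrow> 'b set \<Rightarrow> ('r, 'b btree \<Rightarrow> 'r) operad" where
  "free_binary_operad R B = \<lparr>
     op_mod = (\<lambda>n. free_mod R (labelled_trees B n)),
     op_one = single R (Leaf 0),
     op_comp = (\<lambda>ks x ys. let M = free_mod R (labelled_trees B (sum_list ks)) in
       lin_ext R M (\<lambda>t. multilin_ext R M (\<lambda>ss. single R (tree_comp ks t ss)) ys) x),
     op_act = (\<lambda>n x \<sigma>. lin_ext R (free_mod R (labelled_trees B n))
       (\<lambda>t. single R (relabel (inv_into UNIV \<sigma>) t)) x)\<rparr>"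

definition binary_operad :: "'r ring \<Rightarrow> 'b set \<Rightarrow> ('r, 'o) operad \<Rightarrow> bool" where
  "binary_operad R B P \<longleftrightarrow> operad R P \<and>
     (\<exists>\<phi>. operad_hom R (free_binary_operad R B) P \<phi> \<and>
       (\<forall>n. \<phi> n ` carrier (op_mod (free_binary_operad R B) n) = carrier (op_mod P n)))"


section \<open>Free algebras\<close>

text \<open>The module \<open>\<Oplus>\<^sub>n P(n) \<otimes>\<^bsub>S_n\<^esub> V\<^sup>\<otimes>\<^sup>n\<close> is the free module on the formal symbols \<open>\<mu>(v\<^sub>1, \<dots>, v\<^sub>n)\<close>,
  encoded as \<open>(\<mu>, [v\<^sub>1, \<dots>, v\<^sub>n])\<close>, modulo multilinearity and the identification of
  \<open>(\<mu>\<cdot>\<sigma>)(v\<^sub>\<sigma>\<^sub>(\<^sub>1\<^sub>), \<dots>, v\<^sub>\<sigma>\<^sub>(\<^sub>n\<^sub>))\<close> with \<open>\<mu>(v\<^sub>1, \<dots>, v\<^sub>n)\<close>.\<close>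

type_synonym ('r, 'o, 'v) fa = "('o \<times> 'v list \<Rightarrow> 'r) set"

definition fa_words :: "('r, 'o) operad \<Rightarrow> ('r, 'v) module \<Rightarrow> ('o \<times> 'v list) set" where
  "fa_words P V = {(\<mu>, vs). set vs \<subseteq> carrier V \<and> \<mu> \<in> carrier (op_mod P (length vs))}"

definition fa_rels :: "'r ring \<Rightarrow> ('r, 'o) operad \<Rightarrow> ('r, 'v) module \<Rightarrow> ('o \<times> 'v list \<Rightarrow> 'r) set" where
  "fa_rels R P V = (let F = free_mod R (fa_words P V); w = (\<lambda>\<mu> vs. single R (\<mu>, vs)) in
     {w (\<mu> \<oplus>\<^bsub>op_mod P (length vs)\<^esub> \<mu>') vs \<ominus>\<^bsub>F\<^esub> (w \<mu> vs \<oplus>\<^bsub>F\<^esub> w \<mu>' vs) | \<mu> \<mu>' vs.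
        (\<mu>, vs) \<in> fa_words P V \<and> (\<mu>', vs) \<in> fa_words P V} \<union>
     {w (a \<odot>\<^bsub>op_mod P (length vs)\<^esub> \<mu>) vs \<ominus>\<^bsub>F\<^esub> a \<odot>\<^bsub>F\<^esub> w \<mu> vs | a \<mu> vs.
        a \<in> carrier R \<and> (\<mu>, vs) \<in> fa_words P V} \<union>
     {w \<mu> (vs[i := vs ! i \<oplus>\<^bsub>V\<^esub> v]) \<ominus>\<^bsub>F\<^esub> (w \<mu> vs \<oplus>\<^bsub>F\<^esub> w \<mu> (vs[i := v])) | \<mu> vs i v.
        (\<mu>, vs) \<in> fa_words P V \<and> i < length vs \<and> v \<in> carrier V} \<union>
     {w \<mu> (vs[i := a \<odot>\<^bsub>V\<^esub> (vs ! i)]) \<ominus>\<^bsub>F\<^esub> a \<odot>\<^bsub>F\<^esub> w \<mu> vs | a \<mu> vs i.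
        a \<in> carrier R \<and> (\<mu>, vs) \<in> fa_words P V \<and> i < length vs} \<union>
     {w (op_act P (length vs) \<mu> \<sigma>) (permute_list \<sigma> vs) \<ominus>\<^bsub>F\<^esub> w \<mu> vs | \<mu> vs \<sigma>.
        (\<mu>, vs) \<in> fa_words P V \<and> \<sigma> permutes {..<length vs}})"

definition fa_relmod :: "'r ring \<Rightarrow> ('r, 'o) operad \<Rightarrow> ('r, 'v) module \<Rightarrow> ('o \<times> 'v list \<Rightarrow> 'r) set" where
  "fa_relmod R P V = mspan R (free_mod R (fa_words P V)) (fa_rels R P V)"

definition FA :: "'r ring \<Rightarrow> ('r, 'o) operad \<Rightarrow> ('r, 'v) module \<Rightarrow> ('r, ('r, 'o, 'v) fa) module" where
  "FA R P V = quot_mod (free_mod R (fa_words P V)) (fa_relmod R P V)"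

definition fa_elem :: "'r ring \<Rightarrow> ('r, 'o) operad \<Rightarrow> ('r, 'v) module \<Rightarrow> 'o \<Rightarrow> 'v list \<Rightarrow> ('r, 'o, 'v) fa" where
  "fa_elem R P V \<mu> vs = fa_relmod R P V +>\<^bsub>free_mod R (fa_words P V)\<^esub> single R (\<mu>, vs)"

definition fa_inc :: "'r ring \<Rightarrow> ('r, 'o) operad \<Rightarrow> ('r, 'v) module \<Rightarrow> 'v \<Rightarrow> ('r, 'o, 'v) fa" where
  "fa_inc R P V v = fa_elem R P V (op_one P) [v]"

definition fa_deg :: "'r ring \<Rightarrow> ('r, 'o) operad \<Rightarrow> ('r, 'v) module \<Rightarrow> nat \<Rightarrow> ('r, 'o, 'v) fa set" where
  "fa_deg R P V n = mspan R (FA R P V)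
     {fa_elem R P V \<mu> vs | \<mu> vs. (\<mu>, vs) \<in> fa_words P V \<and> length vs = n}"

definition fa_map :: "'r ring \<Rightarrow> ('r, 'o) operad \<Rightarrow> ('r, 'v) module \<Rightarrow> ('r, 'w) module \<Rightarrow>
    ('v \<Rightarrow> 'w) \<Rightarrow> ('r, 'o, 'v) fa \<Rightarrow> ('r, 'o, 'w) fa" where
  "fa_map R P V W i = (\<lambda>X\<in>carrier (FA R P V).
     lin_ext R (FA R P W) (\<lambda>(\<mu>, vs). fa_elem R P W \<mu> (map i vs)) (repr X))"

text \<open>The \<open>P\<close>-algebra structure \<open>\<mu>(X\<^sub>1, \<dots>, X\<^sub>n)\<close> on the free algebra.\<close>

definition fa_act :: "'r ring \<Rightarrow> ('r, 'o) operad \<Rightarrow> ('r, 'v) module \<Rightarrow>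
    'o \<Rightarrow> ('r, 'o, 'v) fa list \<Rightarrow> ('r, 'o, 'v) fa" where
  "fa_act R P V \<mu> Xs = multilin_ext R (FA R P V)
     (\<lambda>bs. fa_elem R P V (op_comp P (map (length \<circ> snd) bs) \<mu> (map fst bs)) (concat (map snd bs)))
     (map repr Xs)"

text \<open>The summand \<open>P(V;W)\<close> of terms linear in \<open>W\<close>. The linear variable is placed
  first: this is a submodule of the free algebra on \<open>W \<oplus> V\<close>.\<close>

definition fa_lin :: "'r ring \<Rightarrow> ('r, 'o) operad \<Rightarrow> ('r, 'v) module \<Rightarrow> ('r, 'w) module \<Rightarrow>
    ('r, 'o, 'w \<times> 'v) fa set" where
  "fa_lin R P V W = mspan R (FA R P (dsum W V))
     {fa_elem R P (dsum W V) \<mu> (map (\<lambda>v. (\<zero>\<^bsub>W\<^esub>, v)) vs @ [(w, \<zero>\<^bsub>V\<^esub>)]) | \<mu> vs w.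
        \<mu> \<in> carrier (op_mod P (length vs + 1)) \<and> set vs \<subseteq> carrier V \<and> w \<in> carrier W}"

definition fa_lin_mod :: "'r ring \<Rightarrow> ('r, 'o) operad \<Rightarrow> ('r, 'v) module \<Rightarrow> ('r, 'w) module \<Rightarrow>
    ('r, ('r, 'o, 'w \<times> 'v) fa) module" where
  "fa_lin_mod R P V W = (FA R P (dsum W V))\<lparr>carrier := fa_lin R P V W\<rparr>"

definition fa_lin_map :: "'r ring \<Rightarrow> ('r, 'o) operad \<Rightarrow> ('r, 'v) module \<Rightarrow> ('r, 'w) module \<Rightarrow>
    ('r, 'u) module \<Rightarrow> ('w \<Rightarrow> 'u) \<Rightarrow> ('r, 'o, 'w \<times> 'v) fa \<Rightarrow> ('r, 'o, 'u \<times> 'v) fa" where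
  "fa_lin_map R P V W U f = (\<lambda>X\<in>fa_lin R P V W.
     fa_map R P (dsum W V) (dsum U V) (dsum_map W V f id) X)"

definition fa_delta :: "'r ring \<Rightarrow> ('r, 'o) operad \<Rightarrow> ('r, 'v) module \<Rightarrow>
    ('r, 'o, 'v) fa \<Rightarrow> ('r, 'o, 'v \<times> 'v) fa" where
  "fa_delta R P V = (\<lambda>X\<in>carrier (FA R P V). lin_ext R (FA R P (dsum V V))
     (\<lambda>(\<mu>, vs). \<Oplus>\<^bsub>FA R P (dsum V V)\<^esub>i\<in>{..<length vs}.
        fa_elem R P (dsum V V) \<mu> ((map (\<lambda>v. (\<zero>\<^bsub>V\<^esub>, v)) vs)[i := (vs ! i, \<zero>\<^bsub>V\<^esub>)]))
     (repr X))"


section \<open>Derivations\<close>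

type_synonym ('r, 'o, 'v) der = "('r, 'o, 'v) fa \<Rightarrow> ('r, 'o, 'v) fa"

definition Der :: "'r ring \<Rightarrow> ('r, 'o) operad \<Rightarrow> ('r, 'v) module \<Rightarrow> ('r, ('r, 'o, 'v) der) module" where
  "Der R P V = (hom_mod R (FA R P V) (FA R P V))\<lparr>carrier :=
     {D \<in> lin_hom R (FA R P V) (FA R P V).
       \<forall>\<mu> Xs. \<mu> \<in> carrier (op_mod P (length Xs)) \<and> set Xs \<subseteq> carrier (FA R P V) \<longrightarrow>
         D (fa_act R P V \<mu> Xs) =
           (\<Oplus>\<^bsub>FA R P V\<^esub>i\<in>{..<length Xs}. fa_act R P V \<mu> (Xs[i := D (Xs ! i)]))}\<rparr>"

text \<open>The derivation with a given restriction to \<open>V\<close>, i.e. the inverse of the restriction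
  isomorphism from derivations to linear maps \<open>V \<rightarrow> P(V)\<close>.\<close>

definition der_ext :: "'r ring \<Rightarrow> ('r, 'o) operad \<Rightarrow> ('r, 'v) module \<Rightarrow>
    ('v \<Rightarrow> ('r, 'o, 'v) fa) \<Rightarrow> ('r, 'o, 'v) der" where
  "der_ext R P V f =
     (THE D. D \<in> carrier (Der R P V) \<and> (\<forall>v\<in>carrier V. D (fa_inc R P V v) = f v))"

definition Der_deg :: "'r ring \<Rightarrow> ('r, 'o) operad \<Rightarrow> ('r, 'v) module \<Rightarrow> nat \<Rightarrow> ('r, 'o, 'v) der set" where
  "Der_deg R P V n = {D \<in> carrier (Der R P V).
     \<forall>v\<in>carrier V. D (fa_inc R P V v) \<in> fa_deg R P V (n + 1)}"

definition Der_plus :: "'r ring \<Rightarrow> ('r, 'o) operad \<Rightarrow> ('r, 'v) module \<Rightarrow> ('r, 'o, 'v) der set" where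
  "Der_plus R P V = mspan R (Der R P V) (\<Union>n\<in>{1..}. Der_deg R P V n)"

definition preLie :: "'r ring \<Rightarrow> ('r, 'o) operad \<Rightarrow> ('r, 'v) module \<Rightarrow>
    ('r, 'o, 'v) der \<Rightarrow> ('r, 'o, 'v) der \<Rightarrow> ('r, 'o, 'v) der" where
  "preLie R P V d e = der_ext R P V (\<lambda>v. e (d (fa_inc R P V v)))"

definition der_bracket :: "'r ring \<Rightarrow> ('r, 'o) operad \<Rightarrow> ('r, 'v) module \<Rightarrow>
    ('r, 'o, 'v) der \<Rightarrow> ('r, 'o, 'v) der \<Rightarrow> ('r, 'o, 'v) der" where
  "der_bracket R P V d e = preLie R P V d e \<ominus>\<^bsub>Der R P V\<^esub> preLie R P V e d"

definition Der_Lie1 :: "'r ring \<Rightarrow> ('r, 'o) operad \<Rightarrow> ('r, 'v) module \<Rightarrow> ('r, 'o, 'v) der set" where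
  "Der_Lie1 R P V = \<Inter>{L. submodule L R (Der R P V) \<and> Der_deg R P V 1 \<subseteq> L \<and>
     (\<forall>d\<in>L. \<forall>e\<in>L. der_bracket R P V d e \<in> L)}"

definition Der_map :: "'r ring \<Rightarrow> ('r, 'o) operad \<Rightarrow> ('r, 'v) module \<Rightarrow> ('r, 'w) module \<Rightarrow>
    ('v \<Rightarrow> 'w) \<times> ('w \<Rightarrow> 'v) \<Rightarrow> ('r, 'o, 'v) der \<Rightarrow> ('r, 'o, 'w) der" where
  "Der_map R P V W = (\<lambda>(i, r). \<lambda>d\<in>carrier (Der R P V).
     der_ext R P W (\<lambda>w. fa_map R P V W i (d (fa_inc R P V (r w)))))"

subsection \<open>Pointed derivations\<close>

abbreviation R_plus :: "'r ring \<Rightarrow> ('r, 'v) module \<Rightarrow> ('r, 'r \<times> 'v) module" where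
  "R_plus R V \<equiv> dsum (reg_mod R) V"

text \<open>\<open>Hom(R, P(V;R))\<close>, embedded in the derivations of \<open>P(R \<oplus> V)\<close> by precomposition with the projection
  onto \<open>R\<close>.\<close>

definition Der_pt :: "'r ring \<Rightarrow> ('r, 'o) operad \<Rightarrow> ('r, 'v) module \<Rightarrow> ('r, 'o, 'r \<times> 'v) der set" where
  "Der_pt R P V = {D \<in> carrier (Der R P (R_plus R V)).
     \<exists>g \<in> lin_hom R (reg_mod R) (fa_lin_mod R P V (reg_mod R)).
       \<forall>a\<in>carrier R. \<forall>v\<in>carrier V. D (fa_inc R P (R_plus R V) (a, v)) = g a}"

definition Der_pt_mod :: "'r ring \<Rightarrow> ('r, 'o) operad \<Rightarrow> ('r, 'v) module \<Rightarrow>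
    ('r, ('r, 'o, 'r \<times> 'v) der) module" where
  "Der_pt_mod R P V = (Der R P (R_plus R V))\<lparr>carrier := Der_pt R P V\<rparr>"

text \<open>The isomorphism from \<open>P(V;R)\<close> to pointed derivations.\<close>

definition pt_der :: "'r ring \<Rightarrow> ('r, 'o) operad \<Rightarrow> ('r, 'v) module \<Rightarrow>
    ('r, 'o, 'r \<times> 'v) fa \<Rightarrow> ('r, 'o, 'r \<times> 'v) der" where
  "pt_der R P V y = der_ext R P (R_plus R V) (\<lambda>(a, v). a \<odot>\<^bsub>FA R P (R_plus R V)\<^esub> y)"

definition Der_pt_plus :: "'r ring \<Rightarrow> ('r, 'o) operad \<Rightarrow> ('r, 'v) module \<Rightarrow> ('r, 'o, 'r \<times> 'v) der set" where
  "Der_pt_plus R P V = Der_pt R P V \<inter> Der_plus R P (R_plus R V)"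

definition Der_pt_plus_mod :: "'r ring \<Rightarrow> ('r, 'o) operad \<Rightarrow> ('r, 'v) module \<Rightarrow>
    ('r, ('r, 'o, 'r \<times> 'v) der) module" where
  "Der_pt_plus_mod R P V = (Der R P (R_plus R V))\<lparr>carrier := Der_pt_plus R P V\<rparr>"

definition comm_span :: "'r ring \<Rightarrow> ('r, 'a) module \<Rightarrow> ('a \<Rightarrow> 'a \<Rightarrow> 'a) \<Rightarrow> 'a set" where
  "comm_span R A m = mspan R A {m x y \<ominus>\<^bsub>A\<^esub> m y x | x y. x \<in> carrier A \<and> y \<in> carrier A}"

definition Der_pt_plus_comm :: "'r ring \<Rightarrow> ('r, 'o) operad \<Rightarrow> ('r, 'v) module \<Rightarrow>
    ('r, 'o, 'r \<times> 'v) der set" where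
  "Der_pt_plus_comm R P V = comm_span R (Der_pt_plus_mod R P V) (preLie R P (R_plus R V))"


section \<open>Divergence\<close>

text \<open>For \<open>V\<close> free of finite rank the derivations correspond to \<open>P(V) \<otimes> V\<^sup>#\<close>; the derivation
  corresponding to \<open>x \<otimes> f\<close> restricts to \<open>v \<mapsto> f(v)x\<close> on \<open>V\<close>, and these span the derivations.
  Hence there is exactly one linear map with the prescribed values.\<close>

definition Phi :: "'r ring \<Rightarrow> ('r, 'o) operad \<Rightarrow> ('r, 'v) module \<Rightarrow>
    ('r, 'o, 'v) der \<Rightarrow> ('r, 'o, 'r \<times> 'v) der" where
  "Phi R P V = (THE \<phi>. \<phi> \<in> lin_hom R (Der R P V) (Der_pt_mod R P V) \<and>
     (\<forall>x\<in>carrier (FA R P V). \<forall>f\<in>lin_hom R V (reg_mod R).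
        \<phi> (der_ext R P V (\<lambda>v. f v \<odot>\<^bsub>FA R P V\<^esub> x)) =
          pt_der R P V (fa_lin_map R P V V (reg_mod R) f (fa_delta R P V x))))"

definition Div :: "'r ring \<Rightarrow> ('r, 'o) operad \<Rightarrow> ('r, 'v) module \<Rightarrow>
    ('r, 'o, 'v) der \<Rightarrow> ('r, 'o, 'r \<times> 'v) der set" where
  "Div R P V = (\<lambda>d\<in>Der_plus R P V.
     Der_pt_plus_comm R P V +>\<^bsub>Der_pt_plus_mod R P V\<^esub> Phi R P V d)"

definition Div_image :: "'r ring \<Rightarrow> ('r, 'o) operad \<Rightarrow> ('r, 'v) module \<Rightarrow>
    ('r, 'o, 'r \<times> 'v) der set set" where
  "Div_image R P V = Div R P V ` Der_Lie1 R P V"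


section \<open>Functors on split monomorphisms of free modules\<close>

text \<open>The objects of \<open>S(R)\<close> are all free modules of finite rank whose elements lie in the
  type \<open>'v\<close>, which acts as a universe. It is a type variable throughout; instances such as
  \<open>nat \<Rightarrow> 'r\<close> contain free modules of every finite rank, and only for these is
  the condition \<open>torsion_element\<close> below the intended one (otherwise it may hold trivially).\<close>

definition SR_obj :: "'r ring \<Rightarrow> ('r, 'v) module \<Rightarrow> bool" where
  "SR_obj R V \<longleftrightarrow> module R V \<and> (\<exists>n. has_rank R V n)"

definition SR_hom :: "'r ring \<Rightarrow> ('r, 'v) module \<Rightarrow> ('r, 'w) module \<Rightarrow> (('v \<Rightarrow> 'w) \<times> ('w \<Rightarrow> 'v)) set" where
  "SR_hom R V W = {(i, r). i \<in> lin_hom R V W \<and> r \<in> lin_hom R W V \<and> (\<forall>v\<in>carrier V. r (i v) = v)}"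

definition SR_id :: "('r, 'v) module \<Rightarrow> ('v \<Rightarrow> 'v) \<times> ('v \<Rightarrow> 'v)" where
  "SR_id V = ((\<lambda>v\<in>carrier V. v), (\<lambda>v\<in>carrier V. v))"

text \<open>\<open>SR_comp U W m' m\<close> is the composite of \<open>m : U \<rightarrow> V\<close> followed by \<open>m' : V \<rightarrow> W\<close>.\<close>

definition SR_comp :: "('r, 'u) module \<Rightarrow> ('r, 'w) module \<Rightarrow>
    ('v \<Rightarrow> 'w) \<times> ('w \<Rightarrow> 'v) \<Rightarrow> ('u \<Rightarrow> 'v) \<times> ('v \<Rightarrow> 'u) \<Rightarrow> ('u \<Rightarrow> 'w) \<times> ('w \<Rightarrow> 'u)" where
  "SR_comp U W m' m =
     (compose (carrier U) (fst m') (fst m), compose (carrier W) (snd m) (snd m'))"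

record ('r, 'v, 'f) sr_functor =
  ob :: "('r, 'v) module \<Rightarrow> ('r, 'f) module"
  mor :: "('r, 'v) module \<Rightarrow> ('r, 'v) module \<Rightarrow> ('v \<Rightarrow> 'v) \<times> ('v \<Rightarrow> 'v) \<Rightarrow> 'f \<Rightarrow> 'f"

definition SR_functor :: "'r ring \<Rightarrow> ('r, 'v, 'f) sr_functor \<Rightarrow> bool" where
  "SR_functor R F \<longleftrightarrow>
     (\<forall>V. SR_obj R V \<longrightarrow> module R (ob F V)) \<and>
     (\<forall>V W m. SR_obj R V \<longrightarrow> SR_obj R W \<longrightarrow> m \<in> SR_hom R V W \<longrightarrow>
        mor F V W m \<in> lin_hom R (ob F V) (ob F W)) \<and>
     (\<forall>V. SR_obj R V \<longrightarrow> (\<forall>x\<in>carrier (ob F V). mor F V V (SR_id V) x = x)) \<and>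
     (\<forall>U V W m m'. SR_obj R U \<longrightarrow> SR_obj R V \<longrightarrow> SR_obj R W \<longrightarrow>
        m \<in> SR_hom R U V \<longrightarrow> m' \<in> SR_hom R V W \<longrightarrow>
        (\<forall>x\<in>carrier (ob F U). mor F U W (SR_comp U W m' m) x = mor F V W m' (mor F U V m x)))"

definition SR_nat :: "'r ring \<Rightarrow> ('r, 'v, 'f) sr_functor \<Rightarrow> ('r, 'v, 'g) sr_functor \<Rightarrow>
    (('r, 'v) module \<Rightarrow> 'f \<Rightarrow> 'g) \<Rightarrow> bool" where
  "SR_nat R F G \<eta> \<longleftrightarrow>
     (\<forall>V. SR_obj R V \<longrightarrow> \<eta> V \<in> lin_hom R (ob F V) (ob G V)) \<and>
     (\<forall>V W m. SR_obj R V \<longrightarrow> SR_obj R W \<longrightarrow> m \<in> SR_hom R V W \<longrightarrow>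
        (\<forall>x\<in>carrier (ob F V). \<eta> W (mor F V W m x) = mor G V W m (\<eta> V x)))"

definition sub_functor :: "('r, 'v, 'f) sr_functor \<Rightarrow> (('r, 'v) module \<Rightarrow> 'f set) \<Rightarrow>
    ('r, 'v, 'f) sr_functor" where
  "sub_functor F S = \<lparr>ob = (\<lambda>V. (ob F V)\<lparr>carrier := S V\<rparr>),
     mor = (\<lambda>V W m. restrict (mor F V W m) (S V))\<rparr>"

definition quot_functor :: "('r, 'v, 'f) sr_functor \<Rightarrow> (('r, 'v) module \<Rightarrow> 'f set) \<Rightarrow>
    ('r, 'v, 'f set) sr_functor" where
  "quot_functor F S = \<lparr>ob = (\<lambda>V. quot_mod (ob F V) (S V)),
     mor = (\<lambda>V W m. \<lambda>X\<in>carrier (quot_mod (ob F V) (S V)). S W +>\<^bsub>ob F W\<^esub> mor F V W m (repr X))\<rparr>"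

definition is_subfunctor :: "'r ring \<Rightarrow> ('r, 'v, 'f) sr_functor \<Rightarrow>
    (('r, 'v) module \<Rightarrow> 'f set) \<Rightarrow> bool" where
  "is_subfunctor R F S \<longleftrightarrow>
     (\<forall>V. SR_obj R V \<longrightarrow> submodule (S V) R (ob F V)) \<and>
     (\<forall>V W m. SR_obj R V \<longrightarrow> SR_obj R W \<longrightarrow> m \<in> SR_hom R V W \<longrightarrow> mor F V W m ` S V \<subseteq> S W)"

definition generated_subfunctor :: "'r ring \<Rightarrow> ('r, 'v, 'f) sr_functor \<Rightarrow> ('r, 'v) module \<Rightarrow> 'f \<Rightarrow>
    ('r, 'v) module \<Rightarrow> 'f set" where
  "generated_subfunctor R F V x W = \<Inter>{S W | S. is_subfunctor R F S \<and> x \<in> S V}"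

definition torsion_element :: "'r ring \<Rightarrow> ('r, 'v, 'f) sr_functor \<Rightarrow> ('r, 'v) module \<Rightarrow> 'f \<Rightarrow> bool" where
  "torsion_element R F V x \<longleftrightarrow>
     (\<exists>N. \<forall>n\<ge>N. \<forall>W. SR_obj R W \<and> has_rank R W n \<longrightarrow>
        generated_subfunctor R F V x W = {\<zero>\<^bsub>ob F W\<^esub>})"

definition torsion_functor :: "'r ring \<Rightarrow> ('r, 'v, 'f) sr_functor \<Rightarrow> bool" where
  "torsion_functor R F \<longleftrightarrow> SR_functor R F \<and>
     (\<forall>V. SR_obj R V \<longrightarrow> (\<forall>x\<in>carrier (ob F V). torsion_element R F V x))"

text \<open>The homology at the middle term of \<open>A \<rightarrow> B \<rightarrow> C\<close>.\<close>

definition homology_functor :: "('r, 'v, 'a) sr_functor \<Rightarrow> ('r, 'v, 'b) sr_functor \<Rightarrow>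
    ('r, 'v, 'c) sr_functor \<Rightarrow> (('r, 'v) module \<Rightarrow> 'a \<Rightarrow> 'b) \<Rightarrow> (('r, 'v) module \<Rightarrow> 'b \<Rightarrow> 'c) \<Rightarrow>
    ('r, 'v, 'b set) sr_functor" where
  "homology_functor A B C f g = quot_functor
     (sub_functor B (\<lambda>V. {x \<in> carrier (ob B V). g V x = \<zero>\<^bsub>ob C V\<^esub>}))
     (\<lambda>V. f V ` carrier (ob A V))"

definition zero_functor :: "('r, 'v, unit) sr_functor" where
  "zero_functor = \<lparr>ob = (\<lambda>V. \<lparr>carrier = {()}, mult = undefined, one = undefined, zero = (),
     add = (\<lambda>x y. ()), smult = (\<lambda>a x. ())\<rparr>), mor = (\<lambda>V W m x. ())\<rparr>"

definition zero_nat :: "('r, 'v, 'f) sr_functor \<Rightarrow> ('r, 'v, 'g) sr_functor \<Rightarrow>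
    ('r, 'v) module \<Rightarrow> 'f \<Rightarrow> 'g" where
  "zero_nat F G V = (\<lambda>x\<in>carrier (ob F V). \<zero>\<^bsub>ob G V\<^esub>)"

text \<open>A natural sequence \<open>0 \<rightarrow> A \<rightarrow> B \<rightarrow> C \<rightarrow> 0\<close> that is exact up to torsion.\<close>

definition short_exact_up_to_torsion :: "'r ring \<Rightarrow> ('r, 'v, 'a) sr_functor \<Rightarrow>
    ('r, 'v, 'b) sr_functor \<Rightarrow> ('r, 'v, 'c) sr_functor \<Rightarrow>
    (('r, 'v) module \<Rightarrow> 'a \<Rightarrow> 'b) \<Rightarrow> (('r, 'v) module \<Rightarrow> 'b \<Rightarrow> 'c) \<Rightarrow> bool" where
  "short_exact_up_to_torsion R A B C f g \<longleftrightarrow>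
     SR_functor R A \<and> SR_functor R B \<and> SR_functor R C \<and> SR_nat R A B f \<and> SR_nat R B C g \<and>
     (\<forall>V. SR_obj R V \<longrightarrow> (\<forall>x\<in>carrier (ob A V). g V (f V x) = \<zero>\<^bsub>ob C V\<^esub>)) \<and>
     torsion_functor R (homology_functor zero_functor A B (zero_nat zero_functor A) f) \<and>
     torsion_functor R (homology_functor A B C f g) \<and>
     torsion_functor R (homology_functor B C zero_functor g (zero_nat C zero_functor))"


section \<open>The functors of derivations\<close>

definition Der_functor :: "'r ring \<Rightarrow> ('r, 'o) operad \<Rightarrow> ('r, 'v, ('r, 'o, 'v) der) sr_functor" where
  "Der_functor R P = \<lparr>ob = Der R P, mor = Der_map R P\<rparr>"

definition Der_plus_functor :: "'r ring \<Rightarrow> ('r, 'o) operad \<Rightarrow>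
    ('r, 'v, ('r, 'o, 'v) der) sr_functor" where
  "Der_plus_functor R P = sub_functor (Der_functor R P) (Der_plus R P)"

definition Der_Lie1_functor :: "'r ring \<Rightarrow> ('r, 'o) operad \<Rightarrow>
    ('r, 'v, ('r, 'o, 'v) der) sr_functor" where
  "Der_Lie1_functor R P = sub_functor (Der_functor R P) (Der_Lie1 R P)"

text \<open>Precomposition with the endofunctor \<open>V \<mapsto> R \<oplus> V\<close> of \<open>S(R)\<close>.\<close>

definition shift_functor :: "'r ring \<Rightarrow> ('r, 'r \<times> 'v, 'f) sr_functor \<Rightarrow> ('r, 'v, 'f) sr_functor" where
  "shift_functor R F = \<lparr>ob = (\<lambda>V. ob F (R_plus R V)),
     mor = (\<lambda>V W (i, r). mor F (R_plus R V) (R_plus R W)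
       (dsum_map (reg_mod R) V id i, dsum_map (reg_mod R) W id r))\<rparr>"

definition Der_pt_plus_functor :: "'r ring \<Rightarrow> ('r, 'o) operad \<Rightarrow>
    ('r, 'v, ('r, 'o, 'r \<times> 'v) der) sr_functor" where
  "Der_pt_plus_functor R P = sub_functor (shift_functor R (Der_functor R P)) (Der_pt_plus R P)"

definition trace_functor :: "'r ring \<Rightarrow> ('r, 'o) operad \<Rightarrow>
    ('r, 'v, ('r, 'o, 'r \<times> 'v) der set) sr_functor" where
  "trace_functor R P = quot_functor (Der_pt_plus_functor R P) (Der_pt_plus_comm R P)"

definition trace_mod_image_functor :: "'r ring \<Rightarrow> ('r, 'o) operad \<Rightarrow>
    ('r, 'v, ('r, 'o, 'r \<times> 'v) der set set) sr_functor" where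
  "trace_mod_image_functor R P = quot_functor (trace_functor R P) (Div_image R P)"

definition Lie1_inclusion :: "'r ring \<Rightarrow> ('r, 'o) operad \<Rightarrow> ('r, 'v) module \<Rightarrow>
    ('r, 'o, 'v) der \<Rightarrow> ('r, 'o, 'v) der" where
  "Lie1_inclusion R P V = (\<lambda>d\<in>Der_Lie1 R P V. d)"

definition Div_mod_image :: "'r ring \<Rightarrow> ('r, 'o) operad \<Rightarrow> ('r, 'v) module \<Rightarrow>
    ('r, 'o, 'v) der \<Rightarrow> ('r, 'o, 'r \<times> 'v) der set set" where
  "Div_mod_image R P V = (\<lambda>d\<in>Der_plus R P V.
     Div_image R P V +>\<^bsub>ob (trace_functor R P) V\<^esub> Div R P V d)"

end

theory Submission
  imports Defs
begin

text \<open>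
 Everything is expressed through derivations of rank one: for \<open>x\<close> in the free algebra and a functional \<open>f\<close>,
 the derivation \<open>x \<otimes> f\<close> (\<open>rk\<close> below) sends a generator \<open>v\<close> to \<open>f(v) x\<close>. Such derivations span when \<open>V\<close> is free of
 finite rank, and \<open>[x \<otimes> f, y \<otimes> h] = (y \<otimes> h)(x) \<otimes> f - (x \<otimes> f)(y) \<otimes> h\<close>. Fix a morphism \<open>(i, r)\<close> from \<open>V\<close> to
 a module \<open>W\<close> of large rank. Over a principal ideal domain there are many vectors \<open>e\<^sub>l\<close> in the kernel of \<open>r\<close>, with
 functionals \<open>\<eta>\<^sub>l\<close> dual to them that vanish on \<open>i(V)\<close> (\<open>fam_exists\<close>). These spare directions make all of the
 following brackets consist of one or two terms.

 \<^item> A functional that vanishes on \<open>i(V)\<close> and on the \<open>e\<^sub>l\<close> gives \<open>x \<otimes> f\<close> in the Lie algebra \<open>L\<close> generated in degree one,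
 for each \<open>x\<close> of positive degree that comes from \<open>V\<close> (\<open>mon_L1\<close>). As the operad is binary, \<open>x\<close> may be taken to be
 \<open>b(X, Y)\<close>. Starting from \<open>b(e\<^sub>p, e\<^sub>q) \<otimes> f\<close>, which has degree one, brackets with \<open>X \<otimes> \<eta>\<^sub>p\<close> and \<open>Y \<otimes> \<eta>\<^sub>q\<close> put \<open>X\<close> and
 \<open>Y\<close> in place of \<open>e\<^sub>p\<close> and \<open>e\<^sub>q\<close>. These two derivations lie in \<open>L\<close> by induction, unless they have degree zero; but
 by the Jacobi identity \<open>L\<close> is stable under brackets with degree zero.

 \<^item> The bracket of \<open>x \<otimes> \<eta>\<^sub>l \<in> L\<close> with \<open>e\<^sub>l \<otimes> f\<close> is \<open>(e\<^sub>l \<otimes> f)(x) \<otimes> \<eta>\<^sub>l - x \<otimes> f\<close>. In \<open>(e\<^sub>l \<otimes> f)(x)\<close> one variable \<open>v\<close> at a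
 time is replaced by \<open>f(v) e\<^sub>l\<close>, so this is the divergence of \<open>x \<otimes> f\<close>, before passing to the quotient by
 commutators, with \<open>e\<^sub>l\<close> in the linear argument. Hence modulo \<open>L\<close> the image in \<open>W\<close> of any derivation \<open>d\<close> of positive
 degree is \<open>y(e\<^sub>l) \<otimes> \<eta>\<^sub>l\<close>, where \<open>y\<close> is the value of \<open>\<Phi>(d)\<close> (\<open>Fm_mod_L1\<close>).

 \<^item> If \<open>y\<close> is a commutator of pointed derivations of positive degree, then \<open>y(e\<^sub>l) \<otimes> \<eta>\<^sub>l\<close> lies in \<open>L\<close>, because the
 commutator can be realised by a bracket of two elements of \<open>L\<close> that use two different directions
 (\<open>commutator_L1\<close>). So a derivation whose divergence is that of an element of \<open>L\<close> ends up in \<open>L\<close>.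

 \<^item> Conversely \<open>\<Phi>(y(e\<^sub>l) \<otimes> \<eta>\<^sub>l)\<close> is the image of \<open>y\<close> (\<open>Phi_ps\<close>), so \<open>\<Phi>\<close> becomes surjective in large rank.

 The homology is therefore killed by every morphism into large rank, which makes it torsion
 (\<open>torsion_elementI\<close>).
\<close>

text \<open>Several modules occur in each formula, so their operations carry the module as a bracketed index.\<close>

abbreviation (input) madd ("_ +[_] _" [65, 0, 66] 65) where "x +[M] y \<equiv> x \<oplus>\<^bsub>M\<^esub> y"
abbreviation (input) mdiff ("_ -[_] _" [65, 0, 66] 65) where "x -[M] y \<equiv> x \<ominus>\<^bsub>M\<^esub> y"
abbreviation (input) mneg ("-[_] _" [0, 81] 80) where "-[M] x \<equiv> \<ominus>\<^bsub>M\<^esub> x"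
abbreviation (input) mscale ("_ *[_] _" [70, 0, 71] 70) where "a *[M] x \<equiv> a \<odot>\<^bsub>M\<^esub> x"
abbreviation (input) mnull ("0[_]") where "0[M] \<equiv> \<zero>\<^bsub>M\<^esub>"
abbreviation (input) mcoset ("_ +>[_] _" [65, 0, 66] 65) where "H +>[M] x \<equiv> H +>\<^bsub>M\<^esub> x"
notation (input) carrier ("\<U>")

section \<open>Linear algebra over a commutative ring\<close>

locale base_ring = cring R for R :: "'r ring" (structure)
begin

lemma mod_zero [simp]: "module R M ==> 0[M] : \<U> M"
 by (rule abelian_monoid.zero_closed) (simp add: module_def abelian_group_def)

lemma mod_add [simp]: "module R M ==> x : \<U> M ==> y : \<U> M ==> x +[M] y : \<U> M"
 by (rule abelian_monoid.a_closed) (simp_all add: module_def abelian_group_def)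

lemma mod_uminus [simp]: "module R M ==> x : \<U> M ==> -[M] x : \<U> M"
 by (rule abelian_group.a_inv_closed) (simp_all add: module_def)

lemma mod_minus [simp]: "module R M ==> x : \<U> M ==> y : \<U> M ==> x -[M] y : \<U> M"
 by (rule abelian_group.minus_closed) (simp_all add: module_def)

lemma mod_smult [simp]: "module R M ==> a : \<U> R ==> x : \<U> M ==> a *[M] x : \<U> M"
 by (rule module.smult_closed)

lemma mod_smult_one [simp]: "module R M ==> x : \<U> M ==> \<one> *[M] x = x"
 by (rule module.smult_one)

lemma mod_l_zero [simp]: "module R M ==> x : \<U> M ==> 0[M] +[M] x = x"
 by (rule abelian_monoid.l_zero) (simp_all add: module_def abelian_group_def)

lemma mod_r_zero [simp]: "module R M ==> x : \<U> M ==> x +[M] 0[M] = x"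
 by (rule abelian_monoid.r_zero) (simp_all add: module_def abelian_group_def)

lemma mod_smult_l_null [simp]: "module R M ==> x : \<U> M ==> \<zero> *[M] x = 0[M]"
 by (rule module.smult_l_null)

lemma mod_smult_r_null [simp]: "module R M ==> a : \<U> R ==> a *[M] 0[M] = 0[M]"
 by (rule module.smult_r_null)

lemma mod_finsum_closed [simp]:
 "module R M ==> (!!i. i : A ==> f i : \<U> M) ==> finsum M f A : \<U> M"
 by (rule abelian_monoid.finsum_closed) (auto simp: module_def abelian_group_def)

lemma mod_finsum_cong:
 "module R M ==> A = B ==> (!!i. i : B ==> f i = g i) ==> (!!i. i : B ==> g i : \<U> M) ==>
  finsum M f A = finsum M g B"
 by (rule abelian_monoid.finsum_cong') (auto simp: module_def abelian_group_def)

lemma mod_finsum_empty [simp]: "module R M ==> finsum M f {} = 0[M]"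
 by (rule abelian_monoid.finsum_empty) (simp add: module_def abelian_group_def)

lemma mod_finsum_insert:
 "module R M ==> finite A ==> a \<notin> A ==> (!!i. i : insert a A ==> f i : \<U> M) ==>
  finsum M f (insert a A) = f a +[M] finsum M f A"
 by (rule abelian_monoid.finsum_insert) (auto simp: module_def abelian_group_def)

lemma mod_finsum_zero: "module R M ==> (!!i. i : A ==> f i = 0[M]) ==> finsum M f A = 0[M]"
 using abelian_monoid.finsum_zero[of M A] mod_finsum_cong[of M A A f "%_. 0[M]"]
 by (auto simp: module_def abelian_group_def)

lemma mod_finsum_reindex:
 "module R M ==> inj_on h A ==> (!!i. i : A ==> f (h i) : \<U> M) ==>
  finsum M f (h ` A) = finsum M (%i. f (h i)) A"
 by (rule abelian_monoid.finsum_reindex) (auto simp: module_def abelian_group_def)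

lemma mod_minus_eq: "module R M ==> x -[M] y = x +[M] -[M] y"
 by (simp add: a_minus_def)

lemma mod_minus_zero_iff:
 assumes "module R M" "x : \<U> M" "y : \<U> M"
 shows "x -[M] y = 0[M] \<longleftrightarrow> x = y"
proof -
 interpret M: module R M by fact
 show ?thesis using assms M.minus_equality[of x "-[M] y"] M.r_neg[of y] by (auto simp: a_minus_def)
qed

lemma mod_uminus_smult: "module R M ==> x : \<U> M ==> -[M] x = (\<ominus> \<one>) *[M] x"
 using module.smult_l_minus[of R M \<one> x] by simp

text \<open>Since the carriers of modules are never empty, closure under addition and scalars suffices:
 \<open>-x\<close> is \<open>(-1)x\<close>.\<close>

lemma submoduleI2:
 assumes "module R M" "H <= \<U> M" "0[M] : H"
  and "!!x y. x : H ==> y : H ==> x +[M] y : H"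
  and "!!a x. a : \<U> R ==> x : H ==> a *[M] x : H"
 shows "submodule H R M"
 by (rule module.submoduleI[OF assms(1)]) (use assms in \<open>auto simp: mod_uminus_smult subsetD\<close>)

lemma sub_carrier: "submodule H R M ==> x : H ==> x : \<U> M"
 unfolding submodule_def using subgroup.mem_carrier by fastforce

lemma sub_zero: "submodule H R M ==> 0[M] : H"
 unfolding submodule_def using subgroup.one_closed by fastforce

lemma sub_add: "submodule H R M ==> x : H ==> y : H ==> x +[M] y : H"
 unfolding submodule_def using subgroup.m_closed by fastforce

lemma sub_smult: "submodule H R M ==> a : \<U> R ==> x : H ==> a *[M] x : H"
 by (rule submodule.smult_closed)

lemma sub_uminus: "module R M ==> submodule H R M ==> x : H ==> -[M] x : H"
 by (simp add: mod_uminus_smult sub_carrier sub_smult)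

lemma sub_minus: "module R M ==> submodule H R M ==> x : H ==> y : H ==> x -[M] y : H"
 by (simp add: mod_minus_eq sub_add sub_uminus)

lemma sub_finsum:
 assumes "module R M" "submodule H R M" "!!i. i : A ==> f i : H"
 shows "finsum M f A : H"
proof (cases "finite A")
 case True
 then show ?thesis using assms(3)
 proof (induction A)
  case empty
  then show ?case by (simp add: sub_zero[OF assms(2)] assms(1))
 next
  case (insert x F)
  then have "finsum M f (insert x F) = f x +[M] finsum M f F"
   by (intro mod_finsum_insert assms(1)) (auto intro: sub_carrier[OF assms(2)])
  with insert show ?case by (simp add: sub_add[OF assms(2)])
 qed
next
 case False
 then have "finsum M f A = 0[M]"
  by (intro abelian_monoid.finsum_infinite) (use assms in \<open>auto simp: module_def abelian_group_def\<close>)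
 then show ?thesis using sub_zero[OF assms(2)] by simp
qed

lemma sub_module: "module R M ==> submodule H R M ==> module R (M\<lparr>carrier := H\<rparr>)"
 by (rule submodule.submodule_is_module)

lemma sub_uminus_eq:
 assumes "module R M" "submodule H R M" "x : H"
 shows "-[M\<lparr>carrier := H\<rparr>] x = -[M] x"
 using mod_uminus_smult[OF sub_module[OF assms(1,2)], of x] assms
  mod_uminus_smult[OF assms(1) sub_carrier[OF assms(2,3)]] by simp

lemma sub_minus_eq:
 assumes "module R M" "submodule H R M" "x : H" "y : H"
 shows "x -[M\<lparr>carrier := H\<rparr>] y = x -[M] y"
 using sub_uminus_eq[OF assms(1,2,4)] by (simp add: a_minus_def)

lemma sub_sub_iff:
 assumes M: "module R M" and H: "submodule H R M"
 shows "submodule K R (M\<lparr>carrier := H\<rparr>) \<longleftrightarrow> submodule K R M & K <= H"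
proof
 assume K: "submodule K R (M\<lparr>carrier := H\<rparr>)"
 have KH: "K <= H" using sub_carrier[OF K] by auto
 have "submodule K R M"
 proof (rule submoduleI2[OF M])
  show "K <= \<U> M" using KH sub_carrier[OF H] by blast
  show "0[M] : K" using sub_zero[OF K] by simp
  show "x +[M] y : K" if "x : K" "y : K" for x y using sub_add[OF K that] by simp
  show "a *[M] x : K" if "a : \<U> R" "x : K" for a x using sub_smult[OF K that] by simp
 qed
 with KH show "submodule K R M & K <= H" by simp
next
 assume "submodule K R M & K <= H"
 then have K: "submodule K R M" and KH: "K <= H" by simp_all
 show "submodule K R (M\<lparr>carrier := H\<rparr>)"
 proof (rule submoduleI2[OF sub_module[OF M H]])
  show "K <= \<U> (M\<lparr>carrier := H\<rparr>)" using KH by simp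
  show "0[M\<lparr>carrier := H\<rparr>] : K" using sub_zero[OF K] by simp
  show "x +[M\<lparr>carrier := H\<rparr>] y : K" if "x : K" "y : K" for x y using sub_add[OF K that] by simp
  show "a *[M\<lparr>carrier := H\<rparr>] x : K" if "a : \<U> R" "x : K" for a x using sub_smult[OF K that] by simp
 qed
qed

subsection \<open>Spans\<close>

lemma mspan_submodule: "module R M ==> S <= \<U> M ==> submodule (mspan R M S) R M"
proof -
 assume M: "module R M" and S: "S <= \<U> M"
 have "submodule (\<U> M) R M" using M by (rule module.carrier_is_submodule)
 then have "mspan R M S <= \<U> M" using S by (auto simp: mspan_def)
 then show ?thesis
 proof (rule submoduleI2[OF M])
  show "0[M] : mspan R M S" unfolding mspan_def by (simp add: sub_zero)
  show "x +[M] y : mspan R M S" if "x : mspan R M S" "y : mspan R M S" for x y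
   using that unfolding mspan_def by (simp add: sub_add)
  show "a *[M] x : mspan R M S" if "a : \<U> R" "x : mspan R M S" for a x
   using that unfolding mspan_def by (simp add: sub_smult)
 qed
qed

lemma mspan_base: "x : S ==> x : mspan R M S"
 by (auto simp: mspan_def)

lemma mspan_least: "submodule H R M ==> S <= H ==> mspan R M S <= H"
 by (auto simp: mspan_def)

lemma mspan_carrier: "module R M ==> S <= \<U> M ==> x : mspan R M S ==> x : \<U> M"
 by (rule sub_carrier[OF mspan_submodule])

lemma mspan_induct [consumes 3, case_names zero base add smult]:
 assumes "module R M" "S <= \<U> M" "x : mspan R M S"
  and "Q 0[M]" "!!x. x : S ==> Q x"
  and "!!x y. x : mspan R M S ==> y : mspan R M S ==> Q x ==> Q y ==> Q (x +[M] y)"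
  and "!!a x. a : \<U> R ==> x : mspan R M S ==> Q x ==> Q (a *[M] x)"
 shows "Q x"
proof -
 note sub = mspan_submodule[OF assms(1,2)]
 have "submodule {x : mspan R M S. Q x} R M"
 proof (rule submoduleI2[OF assms(1)])
  show "{x : mspan R M S. Q x} <= \<U> M" using sub_carrier[OF sub] by auto
  show "0[M] : {x : mspan R M S. Q x}" using sub_zero[OF sub] assms(4) by simp
  show "x +[M] y : {x : mspan R M S. Q x}"
   if "x : {x : mspan R M S. Q x}" "y : {x : mspan R M S. Q x}" for x y
   using that sub_add[OF sub] assms(6) by simp
  show "a *[M] x : {x : mspan R M S. Q x}"
   if "a : \<U> R" "x : {x : mspan R M S. Q x}" for a x
   using that sub_smult[OF sub] assms(7) by simp
 qed
 from mspan_least[OF this] show ?thesis using assms(3,5) mspan_base[of _ S M] by blast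
qed

lemma mspan_carrier_update:
 assumes "module R M" "submodule H R M" "S <= H"
 shows "mspan R (M\<lparr>carrier := H\<rparr>) S = mspan R M S"
proof
 have S: "S <= \<U> M" using assms(3) sub_carrier[OF assms(2)] by auto
 have H: "module R (M\<lparr>carrier := H\<rparr>)" by (rule sub_module) fact+
 have "submodule (mspan R M S) R (M\<lparr>carrier := H\<rparr>)"
  unfolding sub_sub_iff[OF assms(1,2)]
  using mspan_submodule[OF assms(1) S] mspan_least[OF assms(2,3)] by simp
 then show "mspan R (M\<lparr>carrier := H\<rparr>) S <= mspan R M S"
  by (rule mspan_least) (auto intro: mspan_base)
 have "submodule (mspan R (M\<lparr>carrier := H\<rparr>) S) R M"
  using mspan_submodule[OF H, of S] assms(3) sub_sub_iff[OF assms(1,2)] by simp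
 then show "mspan R M S <= mspan R (M\<lparr>carrier := H\<rparr>) S"
  by (rule mspan_least) (auto intro: mspan_base)
qed

subsection \<open>Linear maps\<close>

definition is_lin :: "('r, 'm) module => ('r, 'n) module => ('m => 'n) => bool" where
 "is_lin M N f \<longleftrightarrow> f : \<U> M \<rightarrow> \<U> N &
   (ALL x:\<U> M. ALL y:\<U> M. f (x +[M] y) = f x +[N] f y) &
   (ALL a:\<U> R. ALL x:\<U> M. f (a *[M] x) = a *[N] f x)"

lemma is_linI:
 assumes "!!x. x : \<U> M ==> f x : \<U> N"
  and "!!x y. x : \<U> M ==> y : \<U> M ==> f (x +[M] y) = f x +[N] f y"
  and "!!a x. a : \<U> R ==> x : \<U> M ==> f (a *[M] x) = a *[N] f x"
 shows "is_lin M N f"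
 using assms by (auto simp: is_lin_def)

lemma lin_closed: "is_lin M N f ==> x : \<U> M ==> f x : \<U> N"
 by (auto simp: is_lin_def)

lemma lin_add: "is_lin M N f ==> x : \<U> M ==> y : \<U> M ==> f (x +[M] y) = f x +[N] f y"
 by (auto simp: is_lin_def)

lemma lin_smult: "is_lin M N f ==> a : \<U> R ==> x : \<U> M ==> f (a *[M] x) = a *[N] f x"
 by (auto simp: is_lin_def)

lemma lin_zero:
 assumes "module R M" "module R N" "is_lin M N f" shows "f 0[M] = 0[N]"
 using lin_smult[OF assms(3), of \<zero> "0[M]"] lin_closed[OF assms(3), of "0[M]"] assms by simp

lemma lin_uminus:
 assumes "module R M" "module R N" "is_lin M N f" "x : \<U> M"
 shows "f (-[M] x) = -[N] f x"
 using assms mod_uminus_smult[of M x] mod_uminus_smult[of N "f x"] lin_smult[OF assms(3), of "\<ominus> \<one>" x]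
  lin_closed[OF assms(3,4)] by simp

lemma lin_minus:
 assumes "module R M" "module R N" "is_lin M N f" "x : \<U> M" "y : \<U> M"
 shows "f (x -[M] y) = f x -[N] f y"
 using assms by (simp add: a_minus_def lin_add[OF assms(3)] lin_uminus[OF assms(1-3)])

lemma lin_finsum:
 assumes "module R M" "module R N" "is_lin M N f" "finite A" "!!i. i : A ==> g i : \<U> M"
 shows "f (finsum M g A) = finsum N (%i. f (g i)) A"
 using assms(4,5)
proof (induction A)
 case empty then show ?case by (simp add: assms lin_zero)
next
 case (insert a A)
 have "finsum M g (insert a A) = g a +[M] finsum M g A"
  "finsum N (%i. f (g i)) (insert a A) = f (g a) +[N] finsum N (%i. f (g i)) A"
  by (rule mod_finsum_insert; use insert(1,2,4) assms(1,2) lin_closed[OF assms(3)] in auto)+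
 with insert show ?case
  by (simp add: lin_add[OF assms(3)] assms(1))
qed

lemma lin_cong: "is_lin M N f ==> (!!x. x : \<U> M ==> g x = f x) ==> module R M ==> is_lin M N g"
 by (auto simp: is_lin_def)

lemma lin_comp: "is_lin M N f ==> is_lin N K g ==> is_lin M K (%x. g (f x))"
 unfolding is_lin_def Pi_def by simp

lemma lin_ident: "is_lin M M (%x. x)"
 by (auto simp: is_lin_def)

lemma lin_const_zero: "module R N ==> is_lin M N (%x. 0[N])"
 by (auto simp: is_lin_def)

lemma mod_add4:
 assumes "module R M" "x : \<U> M" "y : \<U> M" "z : \<U> M" "w : \<U> M"
 shows "(x +[M] y) +[M] (z +[M] w) = (x +[M] z) +[M] (y +[M] w)"
proof -
 interpret M: module R M by fact
 show ?thesis using assms by (simp add: M.a_ac)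
qed

lemma lin_plus:
 assumes "module R M" "module R N" "is_lin M N f" "is_lin M N g"
 shows "is_lin M N (%x. f x +[N] g x)"
 by (rule is_linI)
  (simp_all add: lin_closed[OF assms(3)] lin_closed[OF assms(4)] lin_add[OF assms(3)] lin_add[OF assms(4)]
   lin_smult[OF assms(3)] lin_smult[OF assms(4)] assms(1,2) mod_add4 module.smult_r_distr[OF assms(2)])

lemma mod_smult_comm:
 "module R N ==> a : \<U> R ==> b : \<U> R ==> y : \<U> N ==>
  a *[N] (b *[N] y) = b *[N] (a *[N] y)"
 by (simp flip: module.smult_assoc1 add: m_comm)

lemma lin_scale:
 assumes "module R N" "is_lin M N f" "a : \<U> R"
 shows "is_lin M N (%x. a *[N] f x)"
 by (rule is_linI)
  (simp_all add: lin_closed[OF assms(2)] lin_add[OF assms(2)] lin_smult[OF assms(2)] assms(1,3)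
   module.smult_r_distr[OF assms(1)] mod_smult_comm[OF assms(1)])

lemma lin_diff:
 assumes M: "module R M" and N: "module R N" and f: "is_lin M N f" and g: "is_lin M N g"
 shows "is_lin M N (%x. f x -[N] g x)"
proof (rule lin_cong[OF lin_plus[OF M N f lin_scale[OF N g, of "\<ominus> \<one>"]] _ M])
 fix x assume "x : \<U> M"
 then have "g x : \<U> N" by (rule lin_closed[OF g])
 then show "f x -[N] g x = f x +[N] (\<ominus> \<one>) *[N] g x"
  using N by (simp add: mod_minus_eq mod_uminus_smult)
qed simp

lemma lin_finsum_fun:
 assumes "module R M" "module R N" "!!i. i : A ==> is_lin M N (f i)" "finite A"
 shows "is_lin M N (%x. finsum N (%i. f i x) A)"
 using assms(4,3)
proof (induction A)
 case empty
 then show ?case using assms by (simp add: lin_const_zero)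
next
 case (insert a A)
 then have "is_lin M N (%x. f a x +[N] finsum N (%i. f i x) A)"
  using assms by (intro lin_plus) auto
 then show ?case
 proof (rule lin_cong[OF _ _ assms(1)])
  fix x assume "x : \<U> M"
  then show "finsum N (%i. f i x) (insert a A) = f a x +[N] finsum N (%i. f i x) A"
   using lin_closed[OF insert(4)] insert(1,2) \<open>x : \<U> M\<close> by (intro mod_finsum_insert assms(2)) blast+
 qed
qed

lemma lin_eq_on_mspan:
 assumes "module R M" "module R N" "is_lin M N f" "is_lin M N g" "S <= \<U> M"
  "!!s. s : S ==> f s = g s" "x : mspan R M S"
 shows "f x = g x"
 using assms(1,5,7)
proof (induction rule: mspan_induct)
 case zero
 then show ?case by (simp add: lin_zero[OF assms(1,2)] assms(3,4))
next
 case (add x y)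
 then show ?case
  by (simp add: lin_add[OF assms(3)] lin_add[OF assms(4)] mspan_carrier[OF assms(1,5)])
next
 case (smult a x)
 then show ?case
  by (simp add: lin_smult[OF assms(3)] lin_smult[OF assms(4)] mspan_carrier[OF assms(1,5)])
qed (rule assms(6))

lemma lin_mspan_into:
 assumes "module R M" "module R N" "is_lin M N f" "S <= \<U> M" "submodule H R N"
  "!!s. s : S ==> f s : H" "x : mspan R M S"
 shows "f x : H"
 using assms(1,4,7)
proof (induction rule: mspan_induct)
 case zero
 then show ?case by (simp add: lin_zero[OF assms(1-3)] sub_zero[OF assms(5)])
next
 case (add x y)
 then show ?case
  by (simp add: lin_add[OF assms(3)] mspan_carrier[OF assms(1,4)] sub_add[OF assms(5)])
next
 case (smult a x)
 then show ?case
  by (simp add: lin_smult[OF assms(3)] mspan_carrier[OF assms(1,4)] sub_smult[OF assms(5)])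
qed (rule assms(6))

lemma lin_hom_iff: "f : lin_hom R M N \<longleftrightarrow> is_lin M N f & f : extensional (\<U> M)"
 by (auto simp: lin_hom_def is_lin_def PiE_def)

lemma lin_hom_lin: "f : lin_hom R M N ==> is_lin M N f"
 by (simp add: lin_hom_iff)

lemma lin_restrict: "module R M ==> is_lin M N f ==> restrict f (\<U> M) : lin_hom R M N"
 using lin_cong[of M N f "restrict f (\<U> M)"] by (simp add: lin_hom_iff)

lemma lin_hom_eqI:
 "f : lin_hom R M N ==> g : lin_hom R M N ==> (!!x. x : \<U> M ==> f x = g x) ==> f = g"
 by (auto simp: lin_hom_iff intro: extensionalityI)

lemma lin_sub_codomain:
 "is_lin M N f ==> (!!x. x : \<U> M ==> f x : H) ==> is_lin M (N\<lparr>carrier := H\<rparr>) f"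
 by (auto simp: is_lin_def)

lemma lin_sub_domain: "is_lin M N f ==> H <= \<U> M ==> is_lin (M\<lparr>carrier := H\<rparr>) N f"
 by (auto simp: is_lin_def subset_iff)

lemma hom_mod_module:
 assumes "module R M" "module R N" shows "module R (hom_mod R M N)"
proof -
 interpret N: module R N by fact
 have cl: "(\<lambda>x\<in>\<U> M. f x) : \<U> (hom_mod R M N)" if "is_lin M N f" for f
  using lin_restrict[OF assms(1) that] by (simp add: hom_mod_def)
 have c: "f : \<U> (hom_mod R M N) \<longleftrightarrow> is_lin M N f & f : extensional (\<U> M)" for f
  by (simp add: hom_mod_def lin_hom_iff)
 show ?thesis
 proof (intro moduleI abelian_groupI)
  show "cring R" by (rule is_cring)
  fix f g h a b
  {
   assume "f : \<U> (hom_mod R M N)" "g : \<U> (hom_mod R M N)"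
   then show "f +[hom_mod R M N] g : \<U> (hom_mod R M N)"
    by (simp add: hom_mod_def lin_hom_iff lin_plus assms lin_restrict[unfolded lin_hom_iff, THEN conjunct1])
  }
  show "0[hom_mod R M N] : \<U> (hom_mod R M N)"
   by (simp add: hom_mod_def lin_hom_iff lin_const_zero assms lin_restrict[unfolded lin_hom_iff])
  {
   assume "a : \<U> R" "f : \<U> (hom_mod R M N)"
   then show "a *[hom_mod R M N] f : \<U> (hom_mod R M N)"
    by (simp add: hom_mod_def lin_hom_iff lin_scale assms lin_restrict[unfolded lin_hom_iff])
  }
  {
   assume "f : \<U> (hom_mod R M N)" "g : \<U> (hom_mod R M N)"
    "h : \<U> (hom_mod R M N)"
   then show "(f +[hom_mod R M N] g) +[hom_mod R M N] h
     = f +[hom_mod R M N] (g +[hom_mod R M N] h)"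
    unfolding c is_lin_def Pi_def by (auto simp: hom_mod_def N.a_assoc intro!: restrict_ext)
  }
  {
   assume "f : \<U> (hom_mod R M N)" "g : \<U> (hom_mod R M N)"
   then show "f +[hom_mod R M N] g = g +[hom_mod R M N] f"
    unfolding c is_lin_def Pi_def by (auto simp: hom_mod_def N.a_comm intro!: restrict_ext)
  }
  assume f: "f : \<U> (hom_mod R M N)"
  have ext: "(\<lambda>x\<in>\<U> M. f x) = f" using f by (simp add: c extensional_restrict)
  show "0[hom_mod R M N] +[hom_mod R M N] f = f"
  proof -
   have "0[hom_mod R M N] +[hom_mod R M N] f = (\<lambda>x\<in>\<U> M. f x)"
    using f unfolding c is_lin_def Pi_def by (auto simp: hom_mod_def intro!: restrict_ext)
   then show ?thesis using ext by simp
  qed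
  show "\<one> *[hom_mod R M N] f = f"
  proof -
   have "\<one> *[hom_mod R M N] f = (\<lambda>x\<in>\<U> M. f x)"
    using f unfolding c is_lin_def Pi_def by (auto simp: hom_mod_def intro!: restrict_ext)
   then show ?thesis using ext by simp
  qed
  show "EX g:\<U> (hom_mod R M N). g +[hom_mod R M N] f = 0[hom_mod R M N]"
  proof
   show "(\<lambda>x\<in>\<U> M. (\<ominus> \<one>) *[N] f x) : \<U> (hom_mod R M N)"
    by (rule cl) (use f in \<open>simp add: c lin_scale assms\<close>)
   show "(\<lambda>x\<in>\<U> M. (\<ominus> \<one>) *[N] f x) +[hom_mod R M N] f = 0[hom_mod R M N]"
    using f unfolding c is_lin_def Pi_def
    by (auto simp: hom_mod_def N.l_neg assms(2) mod_uminus_smult[OF assms(2), symmetric]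
      intro!: restrict_ext)
  qed
  { fix a b assume "a : \<U> R" "b : \<U> R"
   then show "(a \<oplus> b) *[hom_mod R M N] f = (a *[hom_mod R M N] f) +[hom_mod R M N] (b *[hom_mod R M N] f)"
    using f unfolding c is_lin_def Pi_def by (auto simp: hom_mod_def N.smult_l_distr intro!: restrict_ext)
  }
  { fix a b assume "a : \<U> R" "b : \<U> R"
   then show "(a \<otimes> b) *[hom_mod R M N] f = a *[hom_mod R M N] (b *[hom_mod R M N] f)"
    using f unfolding c is_lin_def Pi_def by (auto simp: hom_mod_def N.smult_assoc1 intro!: restrict_ext)
  }
  { fix a g assume "a : \<U> R" "g : \<U> (hom_mod R M N)"
   then show "a *[hom_mod R M N] (f +[hom_mod R M N] g)
     = (a *[hom_mod R M N] f) +[hom_mod R M N] (a *[hom_mod R M N] g)"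
    using f unfolding c is_lin_def Pi_def by (auto simp: hom_mod_def N.smult_r_distr intro!: restrict_ext)
  }
 qed
qed

lemma reg_sel [simp]: "\<U> (reg_mod R) = \<U> R" "0[reg_mod R] = \<zero>" "add (reg_mod R) = add R"
 "smult (reg_mod R) = mult R"
 by (simp_all add: reg_mod_def)

lemma reg_module [simp]: "module R (reg_mod R)"
proof (intro moduleI abelian_groupI)
 fix x assume "x : \<U> (reg_mod R)"
 then show "EX y:\<U> (reg_mod R). y +[reg_mod R] x = 0[reg_mod R]"
  by (intro bexI[of _ "\<ominus> x"]) (auto simp: l_neg)
qed (simp_all add: is_cring a_ac m_assoc l_distr r_distr)

lemma dsum_sel [simp]: "\<U> (dsum M N) = \<U> M \<times> \<U> N"
 "0[dsum M N] = (0[M], 0[N])"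
 "(x, y) +[dsum M N] (x', y') = (x +[M] x', y +[N] y')"
 "a *[dsum M N] (x, y) = (a *[M] x, a *[N] y)"
 by (simp_all add: dsum_def)

lemma dsum_module [simp]:
 assumes "module R M" "module R N" shows "module R (dsum M N)"
proof -
 interpret M: module R M by fact
 interpret N: module R N by fact
 show ?thesis
 proof (intro moduleI abelian_groupI)
  fix p assume "p : \<U> (dsum M N)"
  then obtain x y where p: "p = (x, y)" "x : \<U> M" "y : \<U> N" by auto
  show "EX q:\<U> (dsum M N). q +[dsum M N] p = 0[dsum M N]"
   by (rule bexI[of _ "(-[M] x, -[N] y)"]) (use p in \<open>simp_all add: M.l_neg N.l_neg\<close>)
 next
  fix p q assume "p : \<U> (dsum M N)" "q : \<U> (dsum M N)"
  then show "p +[dsum M N] q = q +[dsum M N] p"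
   using M.a_comm N.a_comm by (auto simp del: mod_add)
 qed (auto simp: is_cring M.a_assoc N.a_assoc M.smult_l_distr N.smult_l_distr M.smult_r_distr
    N.smult_r_distr M.smult_assoc1 N.smult_assoc1)
qed

subsection \<open>Free modules\<close>

lemma free_carrier:
 "x : \<U> (free_mod R B) \<longleftrightarrow> (ALL b. x b : \<U> R) & supp R x <= B & finite (supp R x)"
 by (auto simp: free_mod_def)

lemma free_module [simp]: "module R (free_mod R B)"
proof (intro moduleI abelian_groupI)
 show "cring R" by (rule is_cring)
 fix x y z a b
 show "0[free_mod R B] : \<U> (free_mod R B)" unfolding free_carrier by (auto simp: free_mod_def supp_def)
 assume x: "x : \<U> (free_mod R B)"
 { assume y: "y : \<U> (free_mod R B)"
  have "supp R (x +[free_mod R B] y) <= supp R x \<union> supp R y"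
   by (auto simp: supp_def free_mod_def)
  then have "finite (supp R (x +[free_mod R B] y))" "supp R (x +[free_mod R B] y) <= B"
   using x y finite_subset[of "supp R (x +[free_mod R B] y)" "supp R x \<union> supp R y"] unfolding free_carrier by simp_all blast?
  then show "x +[free_mod R B] y : \<U> (free_mod R B)"
   unfolding free_carrier using x y by (simp add: free_mod_def image_subset_iff) }
 { assume a: "a : \<U> R"
  have "supp R (a *[free_mod R B] x) <= supp R x"
   using a by (auto simp: supp_def free_mod_def)
  then have "finite (supp R (a *[free_mod R B] x))" "supp R (a *[free_mod R B] x) <= B"
   using x finite_subset[of "supp R (a *[free_mod R B] x)" "supp R x"] unfolding free_carrier by simp_all blast?
  then show "a *[free_mod R B] x : \<U> (free_mod R B)"
   unfolding free_carrier using x a by (simp add: free_mod_def image_subset_iff) }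
 { assume "y : \<U> (free_mod R B)" "z : \<U> (free_mod R B)"
  then show "x +[free_mod R B] y +[free_mod R B] z = x +[free_mod R B] (y +[free_mod R B] z)"
   using x unfolding free_carrier by (auto simp: free_mod_def a_assoc) }
 { assume "y : \<U> (free_mod R B)"
  then show "x +[free_mod R B] y = y +[free_mod R B] x"
   using x unfolding free_carrier by (auto simp: free_mod_def a_comm) }
 show "0[free_mod R B] +[free_mod R B] x = x" "\<one> *[free_mod R B] x = x"
  using x unfolding free_carrier by (auto simp: free_mod_def)
 show "EX y:\<U> (free_mod R B). y +[free_mod R B] x = 0[free_mod R B]"
 proof
  have "supp R (%b. \<ominus> x b) <= supp R x" by (auto simp: supp_def)
  then show "(%b. \<ominus> x b) : \<U> (free_mod R B)"
   using x finite_subset[of "supp R (%b. \<ominus> x b)" "supp R x"] unfolding free_carrier by simp blast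
  show "(%b. \<ominus> x b) +[free_mod R B] x = 0[free_mod R B]"
   using x unfolding free_carrier by (auto simp: free_mod_def l_neg)
 qed
 { assume "a : \<U> R" "b : \<U> R"
  then show "(a \<oplus> b) *[free_mod R B] x = (a *[free_mod R B] x) +[free_mod R B] (b *[free_mod R B] x)"
   "(a \<otimes> b) *[free_mod R B] x = a *[free_mod R B] (b *[free_mod R B] x)"
   using x unfolding free_carrier by (auto simp: free_mod_def l_distr m_assoc) }
 { assume "a : \<U> R" "y : \<U> (free_mod R B)"
  then show "a *[free_mod R B] (x +[free_mod R B] y)
     = (a *[free_mod R B] x) +[free_mod R B] (a *[free_mod R B] y)"
   using x unfolding free_carrier by (auto simp: free_mod_def r_distr) }
qed

lemma single_closed [simp]: "b : B ==> single R b : \<U> (free_mod R B)"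
 unfolding free_carrier by (auto simp: single_def supp_def intro: finite_subset[of _ "{b}"])

lemma lin_ext_on:
 assumes "module R M" "finite T" "supp R x <= T" "!!b. b : T ==> g b : \<U> M" "!!b. x b : \<U> R"
 shows "lin_ext R M g x = (\<Oplus>\<^bsub>M\<^esub>b\<in>T. x b *[M] g b)"
proof -
 interpret M: module R M by fact
 show ?thesis unfolding lin_ext_def
  by (rule M.add.finprod_mono_neutral_cong_left[OF assms(2,3)])
   (use assms in \<open>auto simp: supp_def\<close>)
qed

lemma lin_ext_lin:
 assumes M: "module R M" and g: "!!b. b : B ==> g b : \<U> M"
 shows "is_lin (free_mod R B) M (lin_ext R M g)"
proof (rule is_linI)
 interpret M: module R M by fact
 fix x assume x: "x : \<U> (free_mod R B)"
 then show "lin_ext R M g x : \<U> M"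
  unfolding lin_ext_def by (auto simp: free_carrier M intro!: mod_finsum_closed mod_smult g)
 { fix y assume y: "y : \<U> (free_mod R B)"
  let ?T = "supp R x \<union> supp R y"
  have T: "finite ?T" "!!b. b : ?T ==> g b : \<U> M" "!!b. x b : \<U> R" "!!b. y b : \<U> R"
   using x y g by (auto simp: free_carrier)
  have xy: "(x +[free_mod R B] y) b = x b \<oplus> y b" for b by (simp add: free_mod_def)
  have s: "supp R (x +[free_mod R B] y) <= ?T" using T(3,4) by (auto simp: supp_def xy)
  have "lin_ext R M g (x +[free_mod R B] y) = (\<Oplus>\<^bsub>M\<^esub>b\<in>?T. (x b \<oplus> y b) *[M] g b)"
   using lin_ext_on[OF M T(1) s] T xy by simp
  also have "... = (\<Oplus>\<^bsub>M\<^esub>b\<in>?T. x b *[M] g b +[M] y b *[M] g b)"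
   by (rule mod_finsum_cong[OF M]) (use T M in \<open>auto simp: M.smult_l_distr\<close>)
  also have "... = (\<Oplus>\<^bsub>M\<^esub>b\<in>?T. x b *[M] g b) +[M] (\<Oplus>\<^bsub>M\<^esub>b\<in>?T. y b *[M] g b)"
   by (rule M.finsum_addf) (use T in auto)
  also have "... = lin_ext R M g x +[M] lin_ext R M g y"
   using lin_ext_on[OF M T(1), of x g] lin_ext_on[OF M T(1), of y g] T by simp
  finally show "lin_ext R M g (x +[free_mod R B] y) = lin_ext R M g x +[M] lin_ext R M g y" . }
 { fix a assume a: "a : \<U> R"
  let ?T = "supp R x"
  have T: "finite ?T" "!!b. b : ?T ==> g b : \<U> M" "!!b. x b : \<U> R"
   using x g by (auto simp: free_carrier)
  have xy: "(a *[free_mod R B] x) b = a \<otimes> x b" for b by (simp add: free_mod_def)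
  have s: "supp R (a *[free_mod R B] x) <= ?T" using a by (auto simp: supp_def xy)
  have "lin_ext R M g (a *[free_mod R B] x) = (\<Oplus>\<^bsub>M\<^esub>b\<in>?T. (a \<otimes> x b) *[M] g b)"
   using lin_ext_on[OF M T(1) s] T xy a by simp
  also have "... = (\<Oplus>\<^bsub>M\<^esub>b\<in>?T. a *[M] (x b *[M] g b))"
   by (rule mod_finsum_cong[OF M]) (use T M a in \<open>auto simp: M.smult_assoc1\<close>)
  also have "... = a *[M] lin_ext R M g x" unfolding lin_ext_def
   by (rule M.finsum_smult_ldistr[symmetric]) (use T a in auto)
  finally show "lin_ext R M g (a *[free_mod R B] x) = a *[M] lin_ext R M g x" . }
qed

lemma lin_ext_single:
 assumes "module R M" "g b : \<U> M" shows "lin_ext R M g (single R b) = g b"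
proof -
 interpret M: module R M by fact
 have "lin_ext R M g (single R b) = (\<Oplus>\<^bsub>M\<^esub>c\<in>{b}. single R b c *[M] g c)"
  by (rule lin_ext_on) (use assms in \<open>auto simp: single_def supp_def\<close>)
 then show ?thesis using assms by (simp add: mod_finsum_insert single_def)
qed

text \<open>Every element of a free module is the linear extension of the inclusion of the basis.\<close>

lemma free_span: "mspan R (free_mod R B) (single R ` B) = \<U> (free_mod R B)"
proof
 let ?F = "free_mod R B"
 have S: "single R ` B <= carrier ?F" by auto
 show "mspan R ?F (single R ` B) <= carrier ?F" using mspan_carrier[OF free_module S] by auto
 show "carrier ?F <= mspan R ?F (single R ` B)"
 proof
  fix x assume x: "x : carrier ?F"
  note sub = mspan_submodule[OF free_module S]
  have ev: "(finsum ?F (%b. x b *[?F] single R b) T) c = (if c : T then x c else \<zero>)"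
   if "finite T" "T <= B" for T c using that
  proof (induction T)
   case empty
   have "0[?F] c = \<zero>" by (simp add: free_mod_def)
   then show ?case by (simp only: mod_finsum_empty[OF free_module]) simp
  next
   case (insert b T)
   have xb: "x b : \<U> R" "x c : \<U> R" for b c using x by (auto simp: free_carrier)
   have "finsum ?F (%b. x b *[?F] single R b) (insert b T)
    = (x b *[?F] single R b) +[?F] finsum ?F (%b. x b *[?F] single R b) T"
    by (rule mod_finsum_insert) (use insert xb in \<open>auto intro!: mod_smult\<close>)
   then have "(finsum ?F (%b. x b *[?F] single R b) (insert b T)) c
    = (x b \<otimes> single R b c) \<oplus> (finsum ?F (%b. x b *[?F] single R b) T) c"
    by (simp add: free_mod_def)
   then show ?case using insert xb by (auto simp: single_def)
  qed
  have "x = finsum ?F (%b. x b *[?F] single R b) (supp R x)"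
   by (rule ext, subst ev) (use x in \<open>auto simp: free_carrier supp_def\<close>)
  also have "... : mspan R ?F (single R ` B)"
   by (rule sub_finsum[OF free_module sub])
    (use x in \<open>auto simp: free_carrier intro!: sub_smult[OF sub] mspan_base[OF imageI]\<close>)
  finally show "x : mspan R ?F (single R ` B)" .
 qed
qed

subsection \<open>Quotient modules\<close>

lemma sub_abelian_subgroup: "module R M ==> submodule H R M ==> abelian_subgroup H M"
 by (rule abelian_subgroupI3)
  (auto simp: additive_subgroup_def submodule_def module_def)

lemma coset_eq_iff:
 assumes "module R M" "submodule H R M" "x : \<U> M" "y : \<U> M"
 shows "H +>[M] x = H +>[M] y \<longleftrightarrow> x -[M] y : H"
proof -
 interpret H: abelian_subgroup H M by (rule sub_abelian_subgroup) fact+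
 show ?thesis
  using H.a_repr_independence'[of x y] H.a_rcos_module[OF assms(4,3)]
   H.a_rcos_self[of x] assms(3,4) by (auto simp: a_minus_def)
qed

lemma coset_eq_zero_iff:
 assumes "module R M" "submodule H R M" "x : \<U> M"
 shows "H +>[M] x = H \<longleftrightarrow> x : H"
proof -
 interpret H: abelian_subgroup H M by (rule sub_abelian_subgroup) fact+
 show ?thesis
  using H.a_coset_join2[OF assms(3) H.a_subgroup] coset_eq_iff[OF assms(1,2) assms(3), of "0[M]"]
   H.a_coset_join2[of "0[M]", OF _ H.a_subgroup] assms H.a_rcos_self[of x] by auto
qed

lemma quot_carrier: "X : \<U> (quot_mod M H) \<longleftrightarrow> (EX x:\<U> M. X = H +>[M] x)"
 by (auto simp: quot_mod_def A_RCOSETS_def')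

lemma quot_zero: "0[quot_mod M H] = H"
 by (simp add: quot_mod_def)

lemma quot_add:
 assumes "module R M" "submodule H R M" "x : \<U> M" "y : \<U> M"
 shows "(H +>[M] x) +[quot_mod M H] (H +>[M] y) = H +>[M] (x +[M] y)"
proof -
 interpret H: abelian_subgroup H M by (rule sub_abelian_subgroup) fact+
 show ?thesis using assms H.a_rcos_sum by (simp add: quot_mod_def)
qed

lemma coset_mem:
 assumes "module R M" "submodule H R M" "x : \<U> M" "y : H +>[M] x"
 shows "y : \<U> M" "H +>[M] y = H +>[M] x"
proof -
 interpret H: abelian_subgroup H M by (rule sub_abelian_subgroup) fact+
 show "y : \<U> M" using assms H.a_elemrcos_carrier by blast
 show "H +>[M] y = H +>[M] x" using H.a_repr_independence'[OF assms(4,3)] by simp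
qed

lemma coset_self:
 assumes "module R M" "submodule H R M" "x : \<U> M" shows "x : H +>[M] x"
proof -
 interpret H: abelian_subgroup H M by (rule sub_abelian_subgroup) fact+
 show ?thesis using assms(3) by (rule H.a_rcos_self)
qed

lemma quot_smult:
 assumes "module R M" "submodule H R M" "x : \<U> M" "a : \<U> R"
 shows "a *[quot_mod M H] (H +>[M] x) = H +>[M] (a *[M] x)"
proof -
 interpret M: module R M by fact
 have "H +>[M] (a *[M] y) = H +>[M] (a *[M] x)" if "y : H +>[M] x" for y
 proof -
  note y = coset_mem[OF assms(1-3) that]
  then have "y -[M] x : H" using coset_eq_iff[OF assms(1,2) y(1) assms(3)] by simp
  then have "a *[M] (y -[M] x) : H" using sub_smult[OF assms(2,4)] by simp
  then have "a *[M] y -[M] a *[M] x : H"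
   using y(1) assms(1,3,4) by (simp add: a_minus_def M.smult_r_distr M.smult_r_minus)
  then show ?thesis using coset_eq_iff[OF assms(1,2)] y(1) assms(1,3,4) by simp
 qed
 then have "(\<Union>y\<in>H +>[M] x. H +>[M] (a *[M] y)) = (\<Union>y\<in>H +>[M] x. H +>[M] (a *[M] x))"
  by (rule SUP_cong[OF refl])
 then show ?thesis using coset_self[OF assms(1-3)] unfolding quot_mod_def by auto
qed

lemma quot_module:
 assumes M: "module R M" and H: "submodule H R M" shows "module R (quot_mod M H)"
proof -
 interpret M: module R M by fact
 have Hz: "H +>[M] 0[M] = H" using coset_eq_zero_iff[OF M H, of "0[M]"] sub_zero[OF H] by simp
 have q [simp]: "H +>[M] x : \<U> (quot_mod M H)" if "x : \<U> M" for x
  using that by (auto simp: quot_carrier)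
 have ob: "EX x:\<U> M. X = H +>[M] x" if "X : \<U> (quot_mod M H)" for X
  using that by (simp add: quot_carrier)
 note qs [simp] = quot_add[OF M H] quot_smult[OF M H]
 show ?thesis
 proof (intro moduleI abelian_groupI)
  show "cring R" by (rule is_cring)
  show "0[quot_mod M H] : \<U> (quot_mod M H)" using q[of "0[M]"] Hz by (simp add: quot_zero)
  fix X assume "X : \<U> (quot_mod M H)"
  then obtain x where x: "x : \<U> M" "X = H +>[M] x" using ob by meson
  show "0[quot_mod M H] +[quot_mod M H] X = X"
   using qs(1)[of "0[M]" x] x Hz by (simp add: quot_zero)
  show "EX Y:\<U> (quot_mod M H). Y +[quot_mod M H] X = 0[quot_mod M H]"
   by (rule bexI[of _ "H +>[M] (-[M] x)"]) (use x Hz in \<open>simp_all add: M.l_neg quot_zero\<close>)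
  show "\<one> *[quot_mod M H] X = X" using x by simp
  { fix a assume a: "a : \<U> R"
   then show "a *[quot_mod M H] X : \<U> (quot_mod M H)" using x by simp
   fix b assume b: "b : \<U> R"
   show "(a \<oplus> b) *[quot_mod M H] X = a *[quot_mod M H] X +[quot_mod M H] b *[quot_mod M H] X"
    "(a \<otimes> b) *[quot_mod M H] X = a *[quot_mod M H] (b *[quot_mod M H] X)"
    using a b x by (simp_all add: M.smult_l_distr M.smult_assoc1) }
  fix Y assume "Y : \<U> (quot_mod M H)"
  then obtain y where y: "y : \<U> M" "Y = H +>[M] y" using ob by meson
  show "X +[quot_mod M H] Y : \<U> (quot_mod M H)"
   "X +[quot_mod M H] Y = Y +[quot_mod M H] X" using x y by (simp_all add: M.a_comm)
  { fix a assume a: "a : \<U> R"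
   show "a *[quot_mod M H] (X +[quot_mod M H] Y)
     = a *[quot_mod M H] X +[quot_mod M H] a *[quot_mod M H] Y"
    using a x y by (simp add: M.smult_r_distr) }
  fix Z assume "Z : \<U> (quot_mod M H)"
  then obtain z where z: "z : \<U> M" "Z = H +>[M] z" using ob by meson
  show "X +[quot_mod M H] Y +[quot_mod M H] Z = X +[quot_mod M H] (Y +[quot_mod M H] Z)"
   using x y z by (simp add: M.a_assoc)
 qed
qed

lemma quot_proj_lin:
 assumes "module R M" "submodule H R M" shows "is_lin M (quot_mod M H) (%x. H +>[M] x)"
proof (rule is_linI)
 fix x assume "x : \<U> M"
 then show "H +>[M] x : \<U> (quot_mod M H)" unfolding quot_carrier by blast
qed (simp_all add: quot_add[OF assms] quot_smult[OF assms])

lemma repr_coset: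
 assumes "module R M" "submodule H R M" "x : \<U> M"
 shows "repr (H +>[M] x) : H +>[M] x"
 unfolding repr_def by (rule someI[of _ x]) (rule coset_self[OF assms])

lemma repr_carrier:
 assumes "module R M" "submodule H R M" "X : \<U> (quot_mod M H)"
 shows "repr X : \<U> M" "H +>[M] repr X = X"
proof -
 obtain x where x: "x : \<U> M" "X = H +>[M] x" using assms(3) by (auto simp: quot_carrier)
 note coset_mem[OF assms(1,2) x(1) repr_coset[OF assms(1,2) x(1)]]
 then show "repr X : \<U> M" "H +>[M] repr X = X" by (simp_all add: x(2))
qed

lemma lin_repr:
 assumes "module R M" "module R N" "submodule H R M" "is_lin M N g" "!!h. h : H ==> g h = 0[N]"
  "x : \<U> M"
 shows "g (repr (H +>[M] x)) = g x"
proof -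
 have X: "H +>[M] x : \<U> (quot_mod M H)" using assms(6) unfolding quot_carrier by blast
 note r = repr_carrier[OF assms(1,3) X]
 have "repr (H +>[M] x) -[M] x : H" using r coset_eq_iff[OF assms(1,3) r(1) assms(6)] by simp
 then have "g (repr (H +>[M] x)) -[N] g x = 0[N]"
  using assms(5) lin_minus[OF assms(1,2,4) r(1) assms(6)] by simp
 then show ?thesis using mod_minus_zero_iff[OF assms(2) lin_closed[OF assms(4) r(1)] lin_closed[OF assms(4) assms(6)]] by simp
qed

lemma lin_lift:
 assumes "module R M" "module R N" "submodule H R M" "is_lin M N g" "!!h. h : H ==> g h = 0[N]"
 shows "is_lin (quot_mod M H) N (%X. g (repr X))"
proof (rule is_linI)
 note l = lin_repr[OF assms]
 fix X assume "X : \<U> (quot_mod M H)"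
 then obtain x where x: "x : \<U> M" "X = H +>[M] x" by (auto simp: quot_carrier)
 show "g (repr X) : \<U> N" using x by (simp add: l[of x] lin_closed[OF assms(4)])
 { fix a assume a: "a : \<U> R"
  show "g (repr (a *[quot_mod M H] X)) = a *[N] g (repr X)"
   using x a by (simp add: l quot_smult[OF assms(1,3)] assms(1) lin_smult[OF assms(4)]) }
 fix Y assume "Y : \<U> (quot_mod M H)"
 then obtain y where y: "y : \<U> M" "Y = H +>[M] y" by (auto simp: quot_carrier)
 show "g (repr (X +[quot_mod M H] Y)) = g (repr X) +[N] g (repr Y)"
  using x y by (simp add: l quot_add[OF assms(1,3)] assms(1) lin_add[OF assms(4)])
qed

end

section \<open>Multilinear maps on lists\<close>

context base_ring begin

text \<open>Arguments come in lists, so that operations of all arities fit into one type; linearity in each position is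
 expressed by splitting the list there.\<close>

definition multilin :: "nat => ('r, 'm) module => ('r, 'n) module => ('m list => 'n) => bool" where
 "multilin n M N G \<longleftrightarrow> (ALL as bs. Suc (length as + length bs) = n --> set as <= \<U> M -->
   set bs <= \<U> M --> is_lin M N (%x. G (as @ x # bs)))"

lemma multilinI:
 "(!!as bs. Suc (length as + length bs) = n ==> set as <= \<U> M ==> set bs <= \<U> M ==>
   is_lin M N (%x. G (as @ x # bs))) ==> multilin n M N G"
 by (simp add: multilin_def)

lemma multilinD:
 "multilin n M N G ==> Suc (length as + length bs) = n ==> set as <= \<U> M ==> set bs <= \<U> M ==>
   is_lin M N (%x. G (as @ x # bs))"
 by (simp add: multilin_def)

text \<open>Induction on the number of entries that are allowed to leave the spanning sets.\<close>

lemma multilin_eq_on_spans: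
 assumes M: "module R M" and N: "module R N" and G: "multilin n M N G" and H: "multilin n M N H"
  and S: "!!i. i < n ==> S i <= \<U> M"
  and eq: "!!xs. length xs = n ==> (!!i. i < n ==> xs ! i : S i) ==> G xs = H xs"
  and xs: "length xs = n" "!!i. i < n ==> xs ! i : mspan R M (S i)"
 shows "G xs = H xs"
proof -
 have "G xs = H xs" if "k <= n" "length xs = n" "!!i. i < k ==> xs ! i : mspan R M (S i)"
  "!!i. k <= i ==> i < n ==> xs ! i : S i" for k xs
  using that
 proof (induction k arbitrary: xs)
  case 0
  then show ?case by (intro eq) auto
 next
  case (Suc k)
  let ?as = "take k xs" and ?bs = "drop (Suc k) xs"
  have car: "xs ! i : \<U> M" if "i < n" for i
  proof (cases "i < Suc k")
   case True
   then show ?thesis using mspan_carrier[OF M S[OF that]] Suc.prems(3) by simp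
  next
   case False
   then show ?thesis using S[OF that] Suc.prems(4)[of i] that by auto
  qed
  have cars: "set ?as <= \<U> M" "set ?bs <= \<U> M"
   using car Suc.prems(1,2) by (auto simp: in_set_conv_nth)
  have len: "Suc (length ?as + length ?bs) = n" using Suc.prems(1,2) by simp
  have k: "k < n" using Suc.prems(1) by simp
  have dec: "xs = ?as @ xs ! k # ?bs" using k Suc.prems(2) by (simp add: id_take_nth_drop)
  have "G (?as @ (xs ! k) # ?bs) = H (?as @ (xs ! k) # ?bs)"
  proof (rule lin_eq_on_mspan[OF M N multilinD[OF G len cars] multilinD[OF H len cars] S[OF k]])
   show "xs ! k : mspan R M (S k)" using Suc.prems(3) by simp
   fix s assume s: "s : S k"
   show "G (?as @ s # ?bs) = H (?as @ s # ?bs)"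
   proof (rule Suc.IH)
    show "k <= n" "length (?as @ s # ?bs) = n" using k Suc.prems(2) by auto
    show "(?as @ s # ?bs) ! i : mspan R M (S i)" if "i < k" for i
     using that Suc.prems by (simp add: nth_append)
    show "(?as @ s # ?bs) ! i : S i" if "k <= i" "i < n" for i
    proof (cases "i = k")
     case True
     then show ?thesis using s k Suc.prems(2) by (simp add: nth_append)
    next
     case False
     then have "i = Suc k + (i - Suc k)" using that by simp
     then have "(?as @ s # ?bs) ! i = xs ! i"
      using that False k Suc.prems(2) by (simp add: nth_append nth_Cons')
     then show ?thesis using Suc.prems(4)[of i] that False by simp
    qed
   qed
  qed
  with dec show ?case by simp
 qed
 from this[of n xs] xs show ?thesis by simp
qed

lemma multilin_eq:
 assumes "module R M" "module R N" "multilin n M N G" "multilin n M N H"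
  and "S <= \<U> M" "mspan R M S = \<U> M"
  and "!!xs. length xs = n ==> set xs <= S ==> G xs = H xs"
  and "length xs = n" "set xs <= \<U> M"
 shows "G xs = H xs"
proof (rule multilin_eq_on_spans[OF assms(1-4), of "%_. S"])
 show "G xs = H xs" if "length xs = n" "!!i. i < n ==> xs ! i : S" for xs
  using that by (intro assms(7)) (auto simp: in_set_conv_nth)
 show "xs ! i : mspan R M S" if "i < n" for i
  unfolding assms(6) using assms(8,9) that nth_mem[of i xs] by blast
qed (use assms(5,8) in auto)

lemma multilin_const_zero: "module R N ==> multilin n M N (%_. 0[N])"
 by (intro multilinI lin_const_zero)

lemma multilin_plus:
 assumes "module R M" "module R N" "multilin n M N G" "multilin n M N H"
 shows "multilin n M N (%xs. G xs +[N] H xs)"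
 by (rule multilinI, rule lin_plus[OF assms(1,2)], rule multilinD[OF assms(3)], assumption+,
   rule multilinD[OF assms(4)])

lemma multilin_scale:
 assumes "module R N" "multilin n M N G" "a : \<U> R"
 shows "multilin n M N (%xs. a *[N] G xs)"
 by (rule multilinI, rule lin_scale[OF assms(1) _ assms(3)], rule multilinD[OF assms(2)])

lemma multilin_comp_lin: "multilin n M N G ==> is_lin N K f ==> multilin n M K (%xs. f (G xs))"
 by (rule multilinI, rule lin_comp, rule multilinD)

lemma lin_map_carrier: "is_lin M N h ==> set xs <= \<U> M ==> set (map h xs) <= \<U> N"
 using lin_closed[of M N h] by auto

lemma multilin_map:
 assumes "multilin n N K G" "is_lin M N h" shows "multilin n M K (%xs. G (map h xs))"
proof (rule multilinI)
 fix as bs assume ab: "Suc (length as + length bs) = n" "set as <= \<U> M" "set bs <= \<U> M"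
 have "is_lin N K (%x. G (map h as @ x # map h bs))"
  by (rule multilinD[OF assms(1)]) (use ab lin_map_carrier[OF assms(2)] in simp_all)
 then show "is_lin M K (%x. G (map h (as @ x # bs)))"
  using lin_comp[OF assms(2)] by simp
qed

lemma multilin_context:
 assumes "multilin n M N G" "set cs <= \<U> M" "set ds <= \<U> M" "n = length cs + k + length ds"
 shows "multilin k M N (%xs. G (cs @ xs @ ds))"
proof (rule multilinI)
 fix as bs assume ab: "Suc (length as + length bs) = k" "set as <= \<U> M" "set bs <= \<U> M"
 have "is_lin M N (%x. G ((cs @ as) @ x # (bs @ ds)))"
  by (rule multilinD[OF assms(1)]) (use ab assms(2-4) in auto)
 then show "is_lin M N (%x. G (cs @ (as @ x # bs) @ ds))" by simp
qed

lemma multilin_cong: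
 assumes "module R M" "multilin n M N G" "!!xs. length xs = n ==> set xs <= \<U> M ==> H xs = G xs"
 shows "multilin n M N H"
proof (rule multilinI)
 fix as bs assume ab: "Suc (length as + length bs) = n" "set as <= \<U> M" "set bs <= \<U> M"
 show "is_lin M N (%x. H (as @ x # bs))"
  by (rule lin_cong[OF multilinD[OF assms(2) ab] _ assms(1)]) (use assms(3) ab in simp)
qed

subsection \<open>Multilinear extension from a basis\<close>

lemma finsum_lessThan_Suc:
 assumes "module R M" "!!i. i < Suc n ==> f i : \<U> M"
 shows "finsum M f {..<Suc n} = f 0 +[M] finsum M (%i. f (Suc i)) {..<n}"
proof -
 have "finsum M f (insert 0 (Suc ` {..<n})) = f 0 +[M] finsum M f (Suc ` {..<n})"
  by (rule mod_finsum_insert) (use assms in auto)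
 also have "finsum M f (Suc ` {..<n}) = finsum M (%i. f (Suc i)) {..<n}"
  by (rule mod_finsum_reindex) (use assms in auto)
 finally show ?thesis by (simp add: lessThan_Suc_eq_insert_0)
qed

lemma finprod_lessThan_Suc:
 assumes "!!i. i < Suc n ==> f i : \<U> R"
 shows "(\<Otimes>i\<in>{..<Suc n}. f i) = f 0 \<otimes> (\<Otimes>i\<in>{..<n}. f (Suc i))"
proof -
 have "(\<Otimes>i\<in>insert 0 (Suc ` {..<n}). f i) = f 0 \<otimes> (\<Otimes>i\<in>Suc ` {..<n}. f i)"
  by (rule finprod_insert) (use assms in auto)
 also have "(\<Otimes>i\<in>Suc ` {..<n}. f i) = (\<Otimes>i\<in>{..<n}. f (Suc i))"
  by (rule finprod_reindex) (use assms in auto)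
 finally show ?thesis by (simp add: lessThan_Suc_eq_insert_0)
qed

lemma finsum_set_Cons:
 assumes M: "module R M" and "finite A" "finite L" "!!b bs. b : A ==> bs : L ==> h (b # bs) : \<U> M"
 shows "finsum M h (set_Cons A L) = (\<Oplus>\<^bsub>M\<^esub>b\<in>A. \<Oplus>\<^bsub>M\<^esub>bs\<in>L. h (b # bs))"
 using assms(2,4)
proof (induction A)
 case empty
 have "set_Cons {} L = {}" by (auto simp: set_Cons_def)
 then show ?case by (simp add: M)
next
 case (insert a A)
 interpret M: module R M by fact
 have fin: "finite (set_Cons A L)"
 proof -
  have "set_Cons A L = (%(b, bs). b # bs) ` (A \<times> L)" by (auto simp: set_Cons_def)
  then show ?thesis using insert(1) assms(3) by simp
 qed
 have eq: "set_Cons (insert a A) L = (%bs. a # bs) ` L \<union> set_Cons A L"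
  by (auto simp: set_Cons_def)
 have "finsum M h (set_Cons (insert a A) L) = finsum M h ((%bs. a # bs) ` L) +[M] finsum M h (set_Cons A L)"
  unfolding eq
  by (rule M.finsum_Un_disjoint) (use insert fin assms(3) in \<open>auto simp: set_Cons_def\<close>)
 also have "finsum M h ((%bs. a # bs) ` L) = (\<Oplus>\<^bsub>M\<^esub>bs\<in>L. h (a # bs))"
  by (rule mod_finsum_reindex[OF M]) (use insert in \<open>auto simp: inj_on_def\<close>)
 also have "finsum M h (set_Cons A L) = (\<Oplus>\<^bsub>M\<^esub>b\<in>A. \<Oplus>\<^bsub>M\<^esub>bs\<in>L. h (b # bs))"
  using insert by simp
 also have "(\<Oplus>\<^bsub>M\<^esub>bs\<in>L. h (a # bs)) +[M] ... = (\<Oplus>\<^bsub>M\<^esub>b\<in>insert a A. \<Oplus>\<^bsub>M\<^esub>bs\<in>L. h (b # bs))"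
  by (rule mod_finsum_insert[OF M, symmetric]) (use insert in \<open>auto intro!: mod_finsum_closed[OF M]\<close>)
 finally show ?case .
qed

lemma finite_listset: "(!!A. A : set As ==> finite A) ==> finite (listset As)"
proof (induction As)
 case (Cons A As)
 have "listset (A # As) = (%(b, bs). b # bs) ` (A \<times> listset As)" by (auto simp: set_Cons_def)
 then show ?case using Cons by simp
qed simp

lemma listset_supp:
 "set xs <= \<U> (free_mod R B) ==> bs : listset (map (supp R) xs) ==>
  length bs = length xs & set bs <= B"
proof (induction xs arbitrary: bs)
 case (Cons x xs)
 then obtain c cs where bs: "bs = c # cs" "c : supp R x" "cs : listset (map (supp R) xs)"
  by (auto simp: set_Cons_def)
 have "length cs = length xs & set cs <= B" by (rule Cons.IH) (use Cons.prems(1) bs(3) in auto)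
 moreover have "c : B" using Cons.prems(1) bs(2) by (auto simp: free_carrier)
 ultimately show ?case using bs(1) by simp
qed simp

lemma prod_coeffs_closed:
 "set xs <= \<U> (free_mod R B) ==> (\<Otimes>i\<in>{..<length xs}. (xs ! i) (f i)) : \<U> R"
proof (rule finprod_closed, rule Pi_I)
 fix i assume "set xs <= \<U> (free_mod R B)" "i : {..<length xs}"
 then have "xs ! i : \<U> (free_mod R B)" using nth_mem by auto
 then show "(xs ! i) (f i) : \<U> R" by (simp add: free_carrier)
qed

lemma multilin_ext_closed:
 assumes "module R M" "set xs <= \<U> (free_mod R B)"
  "!!bs. length bs = length xs ==> set bs <= B ==> g bs : \<U> M"
 shows "multilin_ext R M g xs : \<U> M"
 unfolding multilin_ext_def
 by (intro mod_finsum_closed[OF assms(1)] mod_smult[OF assms(1)] prod_coeffs_closed[OF assms(2)])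
  (use listset_supp[OF assms(2)] assms(3) in blast)

lemma multilin_ext_Nil: "module R M ==> g [] : \<U> M ==> multilin_ext R M g [] = g []"
 using mod_finsum_insert[of M "{}" "[]" "%bs. \<one> *[M] g bs"] by (simp add: multilin_ext_def)

lemma multilin_ext_Cons:
 assumes M: "module R M" and x: "x : \<U> (free_mod R B)" and xs: "set xs <= \<U> (free_mod R B)"
  and g: "!!bs. length bs = Suc (length xs) ==> set bs <= B ==> g bs : \<U> M"
 shows "multilin_ext R M g (x # xs) = lin_ext R M (%b. multilin_ext R M (%bs. g (b # bs)) xs) x"
proof -
 interpret M: module R M by fact
 let ?A = "supp R x" and ?L = "listset (map (supp R) xs)"
 let ?c = "%bs. (\<Otimes>i\<in>{..<length xs}. (xs ! i) (bs ! i))"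
 have fin: "finite ?A" "finite ?L"
  using x xs by (auto simp: free_carrier subset_iff intro!: finite_listset)
 have gc: "g (b # bs) : \<U> M" if "b : ?A" "bs : ?L" for b bs
  using listset_supp[OF xs that(2)] that(1) x by (intro g) (auto simp: free_carrier)
 have xb: "x b : \<U> R" for b using x by (simp add: free_carrier)
 have c: "?c bs : \<U> R" for bs by (rule prod_coeffs_closed[OF xs])
 have xsi: "(xs ! i) b : \<U> R" if "i < length xs" for i b
 proof -
  have "xs ! i : \<U> (free_mod R B)" using xs nth_mem[OF that] by blast
  then show ?thesis by (simp add: free_carrier)
 qed
 have c1: "(\<Otimes>i\<in>{..<length (x # xs)}. ((x # xs) ! i) ((b # bs) ! i)) = x b \<otimes> ?c bs" for b bs
 proof -
  have "(\<Otimes>i\<in>{..<Suc (length xs)}. ((x # xs) ! i) ((b # bs) ! i)) =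
   ((x # xs) ! 0) ((b # bs) ! 0) \<otimes> (\<Otimes>i\<in>{..<length xs}. ((x # xs) ! Suc i) ((b # bs) ! Suc i))"
   by (rule finprod_lessThan_Suc) (use xb xsi in \<open>simp add: nth_Cons split: nat.split\<close>)
  then show ?thesis by simp
 qed
 have ls: "listset (map (supp R) (x # xs)) = set_Cons ?A ?L" by simp
 have "multilin_ext R M g (x # xs) = (\<Oplus>\<^bsub>M\<^esub>b\<in>?A. \<Oplus>\<^bsub>M\<^esub>bs\<in>?L. (x b \<otimes> ?c bs) *[M] g (b # bs))"
  unfolding multilin_ext_def ls
  by (subst finsum_set_Cons[OF M fin])
   (use gc xb c in \<open>auto simp only: c1 intro!: mod_finsum_cong[OF M] mod_smult[OF M] mod_finsum_closed[OF M] m_closed\<close>)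
 also have "... = (\<Oplus>\<^bsub>M\<^esub>b\<in>?A. x b *[M] (\<Oplus>\<^bsub>M\<^esub>bs\<in>?L. ?c bs *[M] g (b # bs)))"
 proof (rule mod_finsum_cong[OF M refl])
  fix b assume b: "b : ?A"
  have "x b *[M] (\<Oplus>\<^bsub>M\<^esub>bs\<in>?L. ?c bs *[M] g (b # bs))
   = (\<Oplus>\<^bsub>M\<^esub>bs\<in>?L. x b *[M] (?c bs *[M] g (b # bs)))"
   by (rule M.finsum_smult_ldistr[OF fin(2) xb]) (use gc[OF b] c in auto)
  also have "... = (\<Oplus>\<^bsub>M\<^esub>bs\<in>?L. (x b \<otimes> ?c bs) *[M] g (b # bs))"
   by (rule mod_finsum_cong[OF M refl]) (use gc[OF b] c xb in \<open>simp_all add: M.smult_assoc1 M\<close>)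
  finally show "(\<Oplus>\<^bsub>M\<^esub>bs\<in>?L. (x b \<otimes> ?c bs) *[M] g (b # bs))
   = x b *[M] (\<Oplus>\<^bsub>M\<^esub>bs\<in>?L. ?c bs *[M] g (b # bs))" by simp
  show "x b *[M] (\<Oplus>\<^bsub>M\<^esub>bs\<in>?L. ?c bs *[M] g (b # bs)) : \<U> M"
   by (intro mod_smult[OF M] xb mod_finsum_closed[OF M] c gc[OF b])
 qed
 finally show ?thesis unfolding lin_ext_def multilin_ext_def .
qed

lemma multilin_ext_multilin:
 assumes M: "module R M" and g: "!!bs. length bs = n ==> set bs <= B ==> g bs : \<U> M"
 shows "multilin n (free_mod R B) M (multilin_ext R M g)"
proof (rule multilinI)
 fix as bs assume ab: "Suc (length as + length bs) = n"
  "set as <= \<U> (free_mod R B)" "set bs <= \<U> (free_mod R B)"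
 then show "is_lin (free_mod R B) M (%x. multilin_ext R M g (as @ x # bs))"
  using g
 proof (induction as arbitrary: n g)
  case Nil
  have "is_lin (free_mod R B) M (lin_ext R M (%b. multilin_ext R M (%zs. g (b # zs)) bs))"
   by (rule lin_ext_lin[OF M], rule multilin_ext_closed[OF M Nil.prems(3)]) (use Nil in auto)
  then show ?case
   by (rule lin_cong) (use Nil in \<open>auto intro!: multilin_ext_Cons[OF M]\<close>)
 next
  case (Cons a as)
  have a: "a : \<U> (free_mod R B)" using Cons.prems(2) by simp
  have "is_lin (free_mod R B) M (%x. \<Oplus>\<^bsub>M\<^esub>b\<in>supp R a. a b *[M] multilin_ext R M (%zs. g (b # zs)) (as @ x # bs))"
  proof (rule lin_finsum_fun[OF free_module M])
   fix b assume "b : supp R a"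
   then have b: "b : B" using a by (auto simp: free_carrier)
   have "is_lin (free_mod R B) M (%x. multilin_ext R M (%zs. g (b # zs)) (as @ x # bs))"
    by (rule Cons.IH[of "n - 1"]) (use Cons.prems b in auto)
   then show "is_lin (free_mod R B) M (%x. a b *[M] multilin_ext R M (%zs. g (b # zs)) (as @ x # bs))"
    by (rule lin_scale[OF M]) (use a in \<open>simp add: free_carrier\<close>)
  qed (use a in \<open>simp add: free_carrier\<close>)
  then show ?case
  proof (rule lin_cong[OF _ _ free_module])
   fix x assume x: "x : \<U> (free_mod R B)"
   have "multilin_ext R M g (a # (as @ x # bs)) =
    lin_ext R M (%b. multilin_ext R M (%zs. g (b # zs)) (as @ x # bs)) a"
    by (rule multilin_ext_Cons[OF M a]) (use Cons.prems x in auto)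
   then show "multilin_ext R M g ((a # as) @ x # bs) =
    (\<Oplus>\<^bsub>M\<^esub>b\<in>supp R a. a b *[M] multilin_ext R M (%zs. g (b # zs)) (as @ x # bs))"
    by (simp add: lin_ext_def)
  qed
 qed
qed

lemma multilin_ext_singles:
 assumes M: "module R M" and g: "!!bs. length bs = length cs ==> set bs <= set cs ==> g bs : \<U> M"
 shows "multilin_ext R M g (map (single R) cs) = g cs"
 using g
proof (induction cs arbitrary: g)
 case Nil
 then show ?case by (simp add: multilin_ext_Nil[OF M])
next
 case (Cons c cs)
 have cl: "set (map (single R) cs) <= \<U> (free_mod R (set (c # cs)))" by auto
 have IH: "multilin_ext R M (%bs. g (c # bs)) (map (single R) cs) = g (c # cs)"
 proof (rule Cons.IH)
  fix bs assume "length bs = length cs" "set bs <= set cs"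
  then show "g (c # bs) : \<U> M" by (intro Cons.prems) auto
 qed
 have "multilin_ext R M g (map (single R) (c # cs)) =
  lin_ext R M (%b. multilin_ext R M (%bs. g (b # bs)) (map (single R) cs)) (single R c)"
  using multilin_ext_Cons[OF M single_closed cl, of c g] Cons.prems by simp
 also have "... = multilin_ext R M (%bs. g (c # bs)) (map (single R) cs)"
  by (rule lin_ext_single[OF M]) (use Cons.prems IH in simp)
 finally show ?case using IH by simp
qed

subsection \<open>Sums over the positions of a list\<close>

text \<open>The shape of the right-hand side of the Leibniz rule: \<open>E\<close> is applied at one position and \<open>h\<close>
 everywhere else.\<close>

definition posum :: "('r, 'n) module => ('m list => 'n) => ('x => 'm) => ('x => 'm) => 'x list => 'n" where
 "posum N G h E xs = (\<Oplus>\<^bsub>N\<^esub>i\<in>{..<length xs}. G ((map h xs)[i := E (xs ! i)]))"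

definition posum_ok :: "('r, 'm) module => ('r, 'n) module => ('m list => 'n) => ('x => 'm) => ('x => 'm) => 'x list => bool"
 where "posum_ok M N G h E xs \<longleftrightarrow> module R N &
  (ALL zs. length zs = length xs --> set zs <= \<U> M --> G zs : \<U> N) &
  (ALL x:set xs. h x : \<U> M & E x : \<U> M)"

lemma posum_okI:
 "module R N ==> (!!zs. length zs = length xs ==> set zs <= \<U> M ==> G zs : \<U> N) ==>
  (!!x. x : set xs ==> h x : \<U> M) ==> (!!x. x : set xs ==> E x : \<U> M) ==> posum_ok M N G h E xs"
 by (auto simp: posum_ok_def)

lemma posum_list_carrier:
 assumes "posum_ok M N G h E xs" "i < length xs"
 shows "set ((map h xs)[i := E (xs ! i)]) <= \<U> M"
proof -
 have "set ((map h xs)[i := E (xs ! i)]) <= insert (E (xs ! i)) (set (map h xs))"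
  by (rule set_update_subset_insert)
 also have "... <= \<U> M" using assms nth_mem[OF assms(2)] by (auto simp: posum_ok_def)
 finally show ?thesis .
qed

lemma posum_term_closed:
 assumes "posum_ok M N G h E xs" "i < length xs"
 shows "G ((map h xs)[i := E (xs ! i)]) : \<U> N"
 using assms(1) posum_list_carrier[OF assms] by (simp add: posum_ok_def)

lemma posum_closed: "posum_ok M N G h E xs ==> posum N G h E xs : \<U> N"
 unfolding posum_def by (rule mod_finsum_closed) (auto simp: posum_ok_def posum_term_closed)

lemma posum_Nil [simp]: "module R N ==> posum N G h E [] = 0[N]"
 by (simp add: posum_def)

lemma posum_cong:
 assumes "posum_ok M N G h E xs"
  and "!!zs. length zs = length xs ==> set zs <= \<U> M ==> G zs = G' zs"
  and "!!x. x : set xs ==> h x = h' x" "!!x. x : set xs ==> E x = E' x"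
 shows "posum N G h E xs = posum N G' h' E' xs"
proof -
 have m: "map h xs = map h' xs" using assms(3) by simp
 have N: "module R N" using assms(1) by (simp add: posum_ok_def)
 show ?thesis unfolding posum_def
 proof (rule mod_finsum_cong[OF N refl])
  fix i assume "i : {..<length xs}"
  then have i: "i < length xs" by simp
  show e: "G ((map h xs)[i := E (xs ! i)]) = G' ((map h' xs)[i := E' (xs ! i)])"
   using assms(2)[OF _ posum_list_carrier[OF assms(1) i]] unfolding m assms(4)[OF nth_mem[OF i]] by simp
  show "G' ((map h' xs)[i := E' (xs ! i)]) : \<U> N"
   using posum_term_closed[OF assms(1) i] e by simp
 qed
qed

lemma posum_Cons:
 assumes "posum_ok M N G h E (x # xs)"
 shows "posum N G h E (x # xs) = G (E x # map h xs) +[N] posum N (%zs. G (h x # zs)) h E xs"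
proof -
 have N: "module R N" using assms by (simp add: posum_ok_def)
 have "posum N G h E (x # xs) = (\<Oplus>\<^bsub>N\<^esub>i\<in>{..<Suc (length xs)}. G ((map h (x # xs))[i := E ((x # xs) ! i)]))"
  by (simp add: posum_def)
 also have "... = G ((map h (x # xs))[0 := E ((x # xs) ! 0)]) +[N]
   (\<Oplus>\<^bsub>N\<^esub>i\<in>{..<length xs}. G ((map h (x # xs))[Suc i := E ((x # xs) ! Suc i)]))"
  by (rule finsum_lessThan_Suc[OF N]) (use posum_term_closed[OF assms] in simp)
 finally show ?thesis by (simp add: posum_def)
qed

lemma posum_append:
 assumes "posum_ok M N G h E (xs @ ys)"
 shows "posum N G h E (xs @ ys) = posum N (%zs. G (zs @ map h ys)) h E xs +[N]
  posum N (%zs. G (map h xs @ zs)) h E ys"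
 using assms
proof (induction xs arbitrary: G)
 case Nil
 then have "posum N G h E ys : \<U> N" "module R N" using posum_closed[of M N G h E ys] by (auto simp: posum_ok_def)
 then show ?case by simp
next
 case (Cons x xs)
 have N: "module R N" using Cons.prems by (simp add: posum_ok_def)
 interpret N: module R N by fact
 have ok: "posum_ok M N (%zs. G (h x # zs)) h E (xs @ ys)" "posum_ok M N (%zs. G (zs @ map h ys)) h E (x # xs)"
  "posum_ok M N (%zs. G (h x # zs @ map h ys)) h E xs" "posum_ok M N (%zs. G (h x # map h xs @ zs)) h E ys"
  "G (E x # map h xs @ map h ys) : \<U> N"
  using Cons.prems by (auto simp: posum_ok_def image_subset_iff)
 have "posum N G h E ((x # xs) @ ys) = G (E x # map h (xs @ ys)) +[N] posum N (%zs. G (h x # zs)) h E (xs @ ys)"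
  using posum_Cons[of M N G h E x "xs @ ys"] Cons.prems by simp
 also have "... = G (E x # map h xs @ map h ys) +[N]
   (posum N (%zs. G (h x # zs @ map h ys)) h E xs +[N] posum N (%zs. G (h x # map h xs @ zs)) h E ys)"
  using Cons.IH[OF ok(1)] by simp
 also have "... = (G (E x # map h xs @ map h ys) +[N]
   posum N (%zs. G (h x # zs @ map h ys)) h E xs) +[N] posum N (%zs. G (h x # map h xs @ zs)) h E ys"
  using ok(5) posum_closed[OF ok(3)] posum_closed[OF ok(4)] by (simp add: N.a_assoc)
 finally show ?case using posum_Cons[OF ok(2)] by simp
qed

lemma posum_lin:
 assumes "posum_ok M N G h E xs" "is_lin N K f" "module R K"
 shows "f (posum N G h E xs) = posum K (%zs. f (G zs)) h E xs"
 unfolding posum_def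
 by (rule lin_finsum[OF _ assms(3,2)]) (use assms(1) posum_term_closed[OF assms(1)] in \<open>auto simp: posum_ok_def\<close>)

lemma posum_map:
 assumes "posum_ok M N G h E (map g xs)"
 shows "posum N G h E (map g xs) = posum N G (%x. h (g x)) (%x. E (g x)) xs"
proof -
 have N: "module R N" using assms by (simp add: posum_ok_def)
 show ?thesis unfolding posum_def length_map
 proof (rule mod_finsum_cong[OF N refl])
  fix i assume "i : {..<length xs}"
  then show "G ((map h (map g xs))[i := E (map g xs ! i)]) = G ((map (%x. h (g x)) xs)[i := E (g (xs ! i))])"
   "G ((map (%x. h (g x)) xs)[i := E (g (xs ! i))]) : \<U> N"
   using posum_term_closed[OF assms, of i] by (simp_all add: comp_def)
 qed
qed

lemma posum_permute:
 assumes ok: "posum_ok M N G h E xs" and s: "\<sigma> permutes {..<length xs}"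
  and G': "!!zs. length zs = length xs ==> set zs <= \<U> M ==> G' (permute_list \<sigma> zs) = G zs"
 shows "posum N G' h E (permute_list \<sigma> xs) = posum N G h E xs"
proof -
 have N: "module R N" using ok by (simp add: posum_ok_def)
 have upd: "(map h (permute_list \<sigma> xs))[i := E (permute_list \<sigma> xs ! i)]
  = permute_list \<sigma> ((map h xs)[\<sigma> i := E (xs ! \<sigma> i)])" if "i < length xs" for i
 proof (rule nth_equalityI)
  fix j assume "j < length ((map h (permute_list \<sigma> xs))[i := E (permute_list \<sigma> xs ! i)])"
  then have j: "j < length xs" by simp
  have sj: "\<sigma> k < length xs" if "k < length xs" for k using permutes_in_image[OF s, of k] that by simp
  have "\<sigma> j = \<sigma> i \<longleftrightarrow> j = i" using permutes_inj[OF s] by (auto simp: inj_def)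
  then show "(map h (permute_list \<sigma> xs))[i := E (permute_list \<sigma> xs ! i)] ! j
   = permute_list \<sigma> ((map h xs)[\<sigma> i := E (xs ! \<sigma> i)]) ! j"
   using j that sj s by (cases "j = i") (simp_all add: permute_list_nth nth_list_update)
 qed simp
 have im: "\<sigma> ` {..<length xs} = {..<length xs}" by (rule permutes_image[OF s])
 have "posum N G' h E (permute_list \<sigma> xs) = (\<Oplus>\<^bsub>N\<^esub>i\<in>{..<length xs}. G ((map h xs)[\<sigma> i := E (xs ! \<sigma> i)]))"
  unfolding posum_def length_permute_list
 proof (rule mod_finsum_cong[OF N refl])
  fix i assume "i : {..<length xs}"
  then have i: "i < length xs" "\<sigma> i < length xs" using im by auto
  show "G' ((map h (permute_list \<sigma> xs))[i := E (permute_list \<sigma> xs ! i)]) = G ((map h xs)[\<sigma> i := E (xs ! \<sigma> i)])"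
   unfolding upd[OF i(1)] by (rule G'[OF _ posum_list_carrier[OF ok i(2)]]) simp
  show "G ((map h xs)[\<sigma> i := E (xs ! \<sigma> i)]) : \<U> N" by (rule posum_term_closed[OF ok i(2)])
 qed
 also have "... = (\<Oplus>\<^bsub>N\<^esub>i\<in>\<sigma> ` {..<length xs}. G ((map h xs)[i := E (xs ! i)]))"
 proof (rule mod_finsum_reindex[OF N, symmetric])
  show "inj_on \<sigma> {..<length xs}" using permutes_inj[OF s] by (rule inj_on_subset) simp
  show "G ((map h xs)[\<sigma> i := E (xs ! \<sigma> i)]) : \<U> N" if "i : {..<length xs}" for i
   using im that by (intro posum_term_closed[OF ok]) auto
 qed
 finally show ?thesis unfolding im by (simp add: posum_def)
qed

lemma posum_concat:
 assumes "posum_ok M N G1 h E xs" "posum_ok K N G2 h' E' (concat (map f xs))"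
  and "!!as x bs. xs = as @ x # bs ==> G1 (map h as @ E x # map h bs) =
   posum N (%zs. G2 (map h' (concat (map f as)) @ zs @ map h' (concat (map f bs)))) h' E' (f x)"
 shows "posum N G1 h E xs = posum N G2 h' E' (concat (map f xs))"
 using assms
proof (induction xs arbitrary: G1 G2)
 case Nil
 then show ?case by (simp add: posum_ok_def)
next
 case (Cons x xs)
 have ok: "posum_ok M N (%zs. G1 (h x # zs)) h E xs"
  "posum_ok K N (%zs. G2 (map h' (f x) @ zs)) h' E' (concat (map f xs))"
  using Cons.prems(1,2) by (auto simp: posum_ok_def image_subset_iff)
 have "posum N (%zs. G1 (h x # zs)) h E xs = posum N (%zs. G2 (map h' (f x) @ zs)) h' E' (concat (map f xs))"
 proof (rule Cons.IH[OF ok])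
  fix as y bs assume "xs = as @ y # bs"
  then show "G1 (h x # (map h as @ E y # map h bs)) =
   posum N (%zs. G2 (map h' (f x) @ (map h' (concat (map f as)) @ zs @ map h' (concat (map f bs))))) h' E' (f y)"
   using Cons.prems(3)[of "x # as" y bs] by simp
 qed
 then show ?case
  using posum_Cons[OF Cons.prems(1)] posum_append[of K N G2 h' E' "f x" "concat (map f xs)"]
   Cons.prems(2) Cons.prems(3)[of "[]" x xs] by simp
qed

lemma multilin_posum:
 assumes V: "module R V" and M: "module R M" and N: "module R N" and G: "multilin n M N G"
  and cl: "!!zs. length zs = n ==> set zs <= \<U> M ==> G zs : \<U> N"
  and h: "is_lin V M h" and E: "is_lin V M E"
 shows "multilin n V N (posum N G h E)"
proof (rule multilinI)
 fix as bs assume ab: "Suc (length as + length bs) = n" "set as <= \<U> V" "set bs <= \<U> V"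
 have ha: "set (map h as) <= \<U> M" "set (map h bs) <= \<U> M"
  using lin_map_carrier[OF h] ab by auto
 have cla: "h x : \<U> M" "E x : \<U> M" if "x : \<U> V" for x
  using that lin_closed[OF h] lin_closed[OF E] by auto
 have L1: "is_lin V N (%x. G (map h as @ E x # map h bs))"
  by (rule lin_comp[OF E], rule multilinD[OF G]) (use ab ha in auto)
 have upd: "set (ys[i := z]) <= \<U> M" if "set ys <= \<U> M" "z : \<U> M" for ys i z
  using set_update_subset_insert[of ys i z] that by auto
 have nthc: "ys ! i : \<U> V" if "set ys <= \<U> V" "i < length ys" for ys i
  using nth_mem[OF that(2)] that(1) by blast
 have L2: "is_lin V N (%x. posum N (%zs. G (zs @ h x # map h bs)) h E as)"
  unfolding posum_def
 proof (rule lin_finsum_fun[OF V N])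
  fix i assume i: "i : {..<length as}"
  show "is_lin V N (%x. G ((map h as)[i := E (as ! i)] @ h x # map h bs))"
   by (rule lin_comp[OF h], rule multilinD[OF G])
    (use ab ha i in \<open>simp_all add: upd cla nthc\<close>)
 qed simp
 have L3: "is_lin V N (%x. posum N (%zs. G (map h as @ h x # zs)) h E bs)"
  unfolding posum_def
 proof (rule lin_finsum_fun[OF V N])
  fix i assume i: "i : {..<length bs}"
  show "is_lin V N (%x. G (map h as @ h x # (map h bs)[i := E (bs ! i)]))"
   by (rule lin_comp[OF h], rule multilinD[OF G])
    (use ab ha i in \<open>simp_all add: upd cla nthc\<close>)
 qed simp
 have "is_lin V N (%x. posum N (%zs. G (zs @ h x # map h bs)) h E as +[N]
  (G (map h as @ E x # map h bs) +[N] posum N (%zs. G (map h as @ h x # zs)) h E bs))"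
  by (rule lin_plus[OF V N L2 lin_plus[OF V N L1 L3]])
 then show "is_lin V N (%x. posum N G h E (as @ x # bs))"
 proof (rule lin_cong[OF _ _ V])
  fix x assume x: "x : \<U> V"
  have ok: "posum_ok M N G h E (as @ x # bs)"
   using ab x cla cl N by (intro posum_okI) auto
  have ok2: "posum_ok M N (%zs. G (map h as @ zs)) h E (x # bs)"
   using ab x cla cl N ha by (intro posum_okI) auto
  show "posum N G h E (as @ x # bs) = posum N (%zs. G (zs @ h x # map h bs)) h E as +[N]
  (G (map h as @ E x # map h bs) +[N] posum N (%zs. G (map h as @ h x # zs)) h E bs)"
   using posum_append[OF ok] posum_Cons[OF ok2] by simp
 qed
qed

lemma posum_zero:
 assumes "posum_ok M N G h E xs" "module R M" "multilin (length xs) M N G"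
  "!!x. x : set xs ==> E x = 0[M]"
 shows "posum N G h E xs = 0[N]"
proof -
 have N: "module R N" using assms(1) by (simp add: posum_ok_def)
 show ?thesis unfolding posum_def
 proof (rule mod_finsum_zero[OF N])
  fix i assume "i : {..<length xs}"
  then have i: "i < length xs" by simp
  have c: "set (map h (take i xs)) <= \<U> M" "set (map h (drop (Suc i) xs)) <= \<U> M"
   using assms(1) by (auto simp: posum_ok_def dest!: in_set_takeD in_set_dropD)
  have "(map h xs)[i := E (xs ! i)] = map h (take i xs) @ 0[M] # map h (drop (Suc i) xs)"
   using i assms(4)[OF nth_mem[OF i]] by (simp add: upd_conv_take_nth_drop take_map drop_map)
  then show "G ((map h xs)[i := E (xs ! i)]) = 0[N]"
   using lin_zero[OF assms(2) N multilinD[OF assms(3) _ c]] i by simp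
 qed
qed

lemma posum_add:
 assumes "posum_ok M N G h E xs" "posum_ok M N G h E' xs" "module R M" "multilin (length xs) M N G"
 shows "posum N G h (%x. E x +[M] E' x) xs = posum N G h E xs +[N] posum N G h E' xs"
proof -
 have N: "module R N" using assms(1) by (simp add: posum_ok_def)
 interpret N: module R N by fact
 have "posum N G h (%x. E x +[M] E' x) xs = (\<Oplus>\<^bsub>N\<^esub>i\<in>{..<length xs}.
  G ((map h xs)[i := E (xs ! i)]) +[N] G ((map h xs)[i := E' (xs ! i)]))"
  unfolding posum_def
 proof (rule mod_finsum_cong[OF N refl])
  fix i assume "i : {..<length xs}"
  then have i: "i < length xs" by simp
  have c: "set (map h (take i xs)) <= \<U> M" "set (map h (drop (Suc i) xs)) <= \<U> M"
   using assms(1) by (auto simp: posum_ok_def dest!: in_set_takeD in_set_dropD)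
  have u: "(map h xs)[i := z] = map h (take i xs) @ z # map h (drop (Suc i) xs)" for z
   using i by (simp add: upd_conv_take_nth_drop take_map drop_map)
  have e: "E (xs ! i) : \<U> M" "E' (xs ! i) : \<U> M"
   using assms(1,2) nth_mem[OF i] by (simp_all add: posum_ok_def)
  show "G ((map h xs)[i := E (xs ! i) +[M] E' (xs ! i)])
   = G ((map h xs)[i := E (xs ! i)]) +[N] G ((map h xs)[i := E' (xs ! i)])"
   unfolding u by (rule lin_add[OF multilinD[OF assms(4) _ c] e]) (use i in simp)
  show "G ((map h xs)[i := E (xs ! i)]) +[N] G ((map h xs)[i := E' (xs ! i)]) : \<U> N"
   by (intro mod_add[OF N] posum_term_closed[OF assms(1) i] posum_term_closed[OF assms(2) i])
 qed
 also have "... = posum N G h E xs +[N] posum N G h E' xs"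
  unfolding posum_def
  by (rule N.finsum_addf) (use posum_term_closed[OF assms(1)] posum_term_closed[OF assms(2)] in auto)
 finally show ?thesis .
qed

lemma posum_smult:
 assumes "posum_ok M N G h E xs" "module R M" "multilin (length xs) M N G" "a : \<U> R"
 shows "posum N G h (%x. a *[M] E x) xs = a *[N] posum N G h E xs"
proof -
 have N: "module R N" using assms(1) by (simp add: posum_ok_def)
 interpret N: module R N by fact
 have "posum N G h (%x. a *[M] E x) xs = (\<Oplus>\<^bsub>N\<^esub>i\<in>{..<length xs}. a *[N] G ((map h xs)[i := E (xs ! i)]))"
  unfolding posum_def
 proof (rule mod_finsum_cong[OF N refl])
  fix i assume "i : {..<length xs}"
  then have i: "i < length xs" by simp
  have c: "set (map h (take i xs)) <= \<U> M" "set (map h (drop (Suc i) xs)) <= \<U> M"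
   using assms(1) by (auto simp: posum_ok_def dest!: in_set_takeD in_set_dropD)
  have u: "(map h xs)[i := z] = map h (take i xs) @ z # map h (drop (Suc i) xs)" for z
   using i by (simp add: upd_conv_take_nth_drop take_map drop_map)
  have e: "E (xs ! i) : \<U> M"
   using assms(1) nth_mem[OF i] by (simp_all add: posum_ok_def)
  show "G ((map h xs)[i := a *[M] E (xs ! i)]) = a *[N] G ((map h xs)[i := E (xs ! i)])"
   unfolding u by (rule lin_smult[OF multilinD[OF assms(3) _ c] assms(4) e]) (use i in simp)
  show "a *[N] G ((map h xs)[i := E (xs ! i)]) : \<U> N"
   by (intro mod_smult[OF N] assms(4) posum_term_closed[OF assms(1) i])
 qed
 also have "... = a *[N] posum N G h E xs"
  unfolding posum_def
  by (rule N.finsum_smult_ldistr[symmetric]) (use posum_term_closed[OF assms(1)] assms(4) in auto)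
 finally show ?thesis .
qed

end

subsection \<open>Block permutations\<close>

lemma map_plus_upt: "map ((+) k) [m..<n] = [k + m..<k + n]"
 by (induction n) auto

lemma blocks_Cons: "blocks (k # ks) = [0..<k] # map (map ((+) k)) (blocks ks)"
proof -
 have "[0..<length (k # ks)] = 0 # map Suc [0..<length ks]"
  by (simp add: upt_conv_Cons map_Suc_upt del: upt_Suc)
 then show ?thesis
  by (simp add: blocks_def map_plus_upt comp_def add.commute[of k] del: upt_Suc)
qed

lemma map_nth_blocks: "map (map ((!) (concat vss))) (blocks (map length vss)) = vss"
proof (induction vss)
 case (Cons vs vss)
 have "map (%b. map (%i. concat (vs # vss) ! (length vs + i)) b) (blocks (map length vss)) =
  map (map ((!) (concat vss))) (blocks (map length vss))"
  by (simp add: nth_append)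
 moreover have "map ((!) (concat (vs # vss))) [0..<length vs] = vs"
  by (rule nth_equalityI) (simp_all add: nth_append)
 ultimately show ?case using Cons by (simp add: blocks_Cons comp_def)
qed (simp add: blocks_def)

lemma length_blocks: "length (blocks ks) = length ks"
 by (simp add: blocks_def)

lemma concat_blocks: "concat (blocks ks) = [0..<sum_list ks]"
proof (induction ks)
 case (Cons k ks)
 have "concat (map (map ((+) k)) (blocks ks)) = map ((+) k) [0..<sum_list ks]"
  by (simp flip: map_concat add: Cons)
 then show ?case
  using upt_add_eq_append[of 0 k "sum_list ks"] by (simp add: blocks_Cons map_plus_upt)
qed (simp add: blocks_def)

lemma permute_list_perm:
 "length xs = length ys ==> permute_list (list_perm xs) ys = map ((!) ys) xs"
 by (rule nth_equalityI) (simp_all add: permute_list_def list_perm_def)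

lemma list_perm_permutes:
 assumes "mset xs = mset [0..<n]" shows "list_perm xs permutes {..<n}"
proof (rule bij_imp_permutes)
 have len: "length xs = n" using mset_eq_length[OF assms] by simp
 have "distinct xs" unfolding mset_eq_imp_distinct_iff[OF assms] by (rule distinct_upt)
 moreover have "set xs = {..<n}" unfolding mset_eq_setD[OF assms] by auto
 ultimately have "bij_betw ((!) xs) {..<n} {..<n}" using len by (intro bij_betw_nth) auto
 then show "bij_betw (list_perm xs) {..<n} {..<n}"
  by (rule bij_betw_cong[THEN iffD1, rotated]) (simp add: list_perm_def len)
 show "list_perm xs x = x" if "x \<notin> {..<n}" for x using that by (simp add: list_perm_def len)
qed

lemma mset_concat_perm:
 assumes "\<sigma> permutes {..<length xss}" shows "mset (concat (permute_list \<sigma> xss)) = mset (concat xss)"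
proof -
 have e: "mset (concat ys) = sum_mset (image_mset mset (mset ys))" for ys :: "'a list list"
  unfolding mset_concat mset_map[symmetric] sum_mset_sum_list by (rule refl)
 show ?thesis unfolding e mset_permute_list[OF assms] by (rule refl)
qed

lemma block_perm:
 assumes "\<sigma> permutes {..<length vss}"
 shows "block_perm \<sigma> (map length vss) permutes {..<length (concat vss)}"
  "permute_list (block_perm \<sigma> (map length vss)) (concat vss) = concat (permute_list \<sigma> vss)"
proof -
 let ?b = "concat (permute_list \<sigma> (blocks (map length vss)))"
 have s: "\<sigma> permutes {..<length (blocks (map length vss))}" using assms by (simp add: length_blocks)
 have m: "mset ?b = mset [0..<length (concat vss)]"
  unfolding mset_concat_perm[OF s] concat_blocks by (simp add: length_concat)
 show "block_perm \<sigma> (map length vss) permutes {..<length (concat vss)}"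
  unfolding block_perm_def by (rule list_perm_permutes[OF m])
 have "permute_list (block_perm \<sigma> (map length vss)) (concat vss) = map ((!) (concat vss)) ?b"
  unfolding block_perm_def
  by (rule permute_list_perm) (use mset_eq_length[OF m] in simp)
 also have "... = concat (permute_list \<sigma> (map (map ((!) (concat vss))) (blocks (map length vss))))"
  by (simp add: map_concat permute_list_map[OF s])
 finally show "permute_list (block_perm \<sigma> (map length vss)) (concat vss) = concat (permute_list \<sigma> vss)"
  by (simp only: map_nth_blocks)
qed

lemma sum_perm:
 assumes "length \<tau>s = length vss" "!!i. i < length vss ==> (\<tau>s ! i) permutes {..<length (vss ! i)}"
 shows "sum_perm \<tau>s (map length vss) permutes {..<length (concat vss)}"
  "permute_list (sum_perm \<tau>s (map length vss)) (concat vss) = concat (map2 permute_list \<tau>s vss)"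
proof -
 let ?bl = "blocks (map length vss)"
 let ?b = "concat (map2 permute_list \<tau>s ?bl)"
 have lb: "length (?bl ! i) = length (vss ! i)" if "i < length vss" for i
 proof -
  have "map (map ((!) (concat vss))) ?bl ! i = vss ! i" by (simp only: map_nth_blocks)
  moreover have "map (map ((!) (concat vss))) ?bl ! i = map ((!) (concat vss)) (?bl ! i)"
   using that by (simp add: length_blocks)
  ultimately show ?thesis by (metis length_map)
 qed
 have p: "(\<tau>s ! i) permutes {..<length (?bl ! i)}" if "i < length vss" for i
  using assms(2)[OF that] lb[OF that] by simp
 have "map mset (map2 permute_list \<tau>s ?bl) = map mset ?bl"
  by (rule nth_equalityI) (use assms(1) p in \<open>simp_all add: length_blocks\<close>)
 then have "mset ?b = mset (concat ?bl)" by (simp only: mset_concat)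
 then have m: "mset ?b = mset [0..<length (concat vss)]" by (simp add: concat_blocks length_concat)
 show "sum_perm \<tau>s (map length vss) permutes {..<length (concat vss)}"
  unfolding sum_perm_def by (rule list_perm_permutes[OF m])
 have "permute_list (sum_perm \<tau>s (map length vss)) (concat vss) = map ((!) (concat vss)) ?b"
  unfolding sum_perm_def
  by (rule permute_list_perm) (use mset_eq_length[OF m] in simp)
 also have "... = concat (map (map ((!) (concat vss))) (map2 permute_list \<tau>s ?bl))"
  by (simp only: map_concat)
 also have "map (map ((!) (concat vss))) (map2 permute_list \<tau>s ?bl)
   = map2 permute_list \<tau>s (map (map ((!) (concat vss))) ?bl)"
  by (rule nth_equalityI) (use assms(1) p in \<open>simp_all add: length_blocks permute_list_map\<close>)
 finally show "permute_list (sum_perm \<tau>s (map length vss)) (concat vss) = concat (map2 permute_list \<tau>s vss)"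
  by (simp only: map_nth_blocks)
qed

section \<open>Free algebras over an operad\<close>

lemmas (in operad) unit_closed = one_closed

sublocale operad \<subseteq> base_ring R
 by (intro base_ring.intro cring)

lemma split_index:
 assumes "i < Suc (m + n)"
 obtains (left) "i < m" | (mid) "i = m" | (right) j where "i = Suc (m + j)" "j < n"
proof (cases "i < m | i = m")
 case False
 then show thesis using assms by (intro right[of "i - Suc m"]) auto
qed (use left mid in blast)

lemma map_preimage: "set ys <= f ` A ==> EX xs. set xs <= A & ys = map f xs"
proof (induction ys)
 case (Cons y ys)
 then obtain x xs where "x : A" "y = f x" "set xs <= A" "ys = map f xs" by auto
 then show ?case by (intro exI[of _ "x # xs"]) simp
qed simp

context operad begin

abbreviation "Op n \<equiv> op_mod P n"
abbreviation "\<A> V \<equiv> FA R P V"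
abbreviation "\<AA> V \<equiv> \<U> (FA R P V)"
abbreviation "\<OO> n \<equiv> \<U> (op_mod P n)"
abbreviation "wd V \<equiv> fa_words P V"
abbreviation "\<F> V \<equiv> free_mod R (wd V)"
abbreviation "rel V \<equiv> fa_relmod R P V"
abbreviation "el V \<equiv> fa_elem R P V"
abbreviation "inc V \<equiv> fa_inc R P V"
abbreviation "act V \<equiv> fa_act R P V"
abbreviation "fm V W \<equiv> fa_map R P V W"

lemma Op_module [simp]: "module R (Op n)" by (rule mod)

lemma wd_iff: "(\<mu>, vs) : wd V \<longleftrightarrow> set vs <= \<U> V & \<mu> : \<OO> (length vs)"
 by (simp add: fa_words_def)

text \<open>The three conditions match the relations that define the free algebra, so these are the families that
 factor through it.\<close>

definition resp :: "('r, 'v) module => ('r, 'n) module => ('o => 'v list => 'n) => bool" where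
 "resp V N g \<longleftrightarrow> (ALL vs. set vs <= \<U> V --> is_lin (Op (length vs)) N (%\<mu>. g \<mu> vs)) &
   (ALL n. ALL \<mu>:\<OO> n. multilin n V N (g \<mu>)) &
   (ALL \<mu> vs \<sigma>. (\<mu>, vs) : wd V --> \<sigma> permutes {..<length vs} -->
    g (op_act P (length vs) \<mu> \<sigma>) (permute_list \<sigma> vs) = g \<mu> vs)"

lemma respI:
 "(!!vs. set vs <= \<U> V ==> is_lin (Op (length vs)) N (%\<mu>. g \<mu> vs)) ==>
  (!!n \<mu>. \<mu> : \<OO> n ==> multilin n V N (g \<mu>)) ==>
  (!!\<mu> vs \<sigma>. set vs <= \<U> V ==> \<mu> : \<OO> (length vs) ==> \<sigma> permutes {..<length vs} ==>
    g (op_act P (length vs) \<mu> \<sigma>) (permute_list \<sigma> vs) = g \<mu> vs) ==> resp V N g"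
 by (simp add: resp_def wd_iff)

lemma respD:
 assumes "resp V N g"
 shows "set vs <= \<U> V ==> is_lin (Op (length vs)) N (%\<mu>. g \<mu> vs)"
  "\<mu> : \<OO> n ==> multilin n V N (g \<mu>)"
  "(\<mu>, vs) : wd V ==> \<sigma> permutes {..<length vs} ==>
    g (op_act P (length vs) \<mu> \<sigma>) (permute_list \<sigma> vs) = g \<mu> vs"
 using assms by (simp_all add: resp_def)

lemma resp_closed: "resp V N g ==> (\<mu>, vs) : wd V ==> g \<mu> vs : \<U> N"
 using lin_closed[OF respD(1)[of V N g vs]] by (simp add: wd_iff)

lemma wd_update:
 "(\<mu>, vs) : wd V ==> x : \<U> V ==> (\<mu>, vs[i := x]) : wd V"
 using set_update_subset_insert[of vs i x] by (auto simp: wd_iff)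

lemma wd_permute:
 "(\<mu>, vs) : wd V ==> \<sigma> permutes {..<length vs} ==> (op_act P (length vs) \<mu> \<sigma>, permute_list \<sigma> vs) : wd V"
 by (simp add: wd_iff act_closed)

lemma fa_rels_cases:
 assumes "r : fa_rels R P V"
 obtains (add_op) \<mu> \<mu>' vs where "(\<mu>, vs) : wd V" "(\<mu>', vs) : wd V"
   "r = single R (\<mu> +[Op (length vs)] \<mu>', vs) -[\<F> V] (single R (\<mu>, vs) +[\<F> V] single R (\<mu>', vs))"
 | (smult_op) a \<mu> vs where "a : \<U> R" "(\<mu>, vs) : wd V"
   "r = single R (a *[Op (length vs)] \<mu>, vs) -[\<F> V] (a *[\<F> V] single R (\<mu>, vs))"
 | (add_arg) \<mu> vs i v where "(\<mu>, vs) : wd V" "i < length vs" "v : \<U> V"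
   "r = single R (\<mu>, vs[i := vs ! i +[V] v]) -[\<F> V] (single R (\<mu>, vs) +[\<F> V] single R (\<mu>, vs[i := v]))"
 | (smult_arg) a \<mu> vs i where "a : \<U> R" "(\<mu>, vs) : wd V" "i < length vs"
   "r = single R (\<mu>, vs[i := a *[V] (vs ! i)]) -[\<F> V] (a *[\<F> V] single R (\<mu>, vs))"
 | (sym) \<mu> vs \<sigma> where "(\<mu>, vs) : wd V" "\<sigma> permutes {..<length vs}"
   "r = single R (op_act P (length vs) \<mu> \<sigma>, permute_list \<sigma> vs) -[\<F> V] single R (\<mu>, vs)"
 using assms unfolding fa_rels_def Let_def Un_iff mem_Collect_eq   apply (elim disjE exE conjE)
 subgoal by (rule add_op, assumption+)
 subgoal by (rule smult_op, assumption+)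
 subgoal by (rule add_arg, assumption+)
 subgoal by (rule smult_arg, assumption+)
 subgoal by (rule sym, assumption+)
 done

lemma wd_nth: "(\<mu>, vs) : wd V ==> i < length vs ==> vs ! i : \<U> V"
 using nth_mem[of i vs] by (auto simp: wd_iff)

lemma wd_add_op: "(\<mu>, vs) : wd V ==> (\<mu>', vs) : wd V ==> (\<mu> +[Op (length vs)] \<mu>', vs) : wd V"
 by (simp add: wd_iff)

lemma wd_smult_op: "(\<mu>, vs) : wd V ==> a : \<U> R ==> (a *[Op (length vs)] \<mu>, vs) : wd V"
 by (simp add: wd_iff)

lemma fa_rels_carrier:
 assumes "module R V" shows "fa_rels R P V <= \<U> (\<F> V)"
proof
 fix r assume "r : fa_rels R P V"
 then show "r : \<U> (\<F> V)"
  by (cases rule: fa_rels_cases)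
   (simp_all add: assms wd_update wd_permute wd_nth wd_add_op wd_smult_op)
qed

lemma rel_submodule: "module R V ==> submodule (rel V) R (\<F> V)"
 unfolding fa_relmod_def by (rule mspan_submodule[OF free_module fa_rels_carrier])

lemma zero_submodule: "module R M ==> submodule {0[M]} R M"
 by (rule submoduleI2) simp_all

text \<open>A linear map on words is determined by its values on the relations, which are treated case by case.\<close>

lemma resp_kills_rel:
 assumes V: "module R V" and N: "module R N" and g: "resp V N g" and f: "is_lin (\<F> V) N f"
  and fg: "!!\<mu> vs. (\<mu>, vs) : wd V ==> f (single R (\<mu>, vs)) = g \<mu> vs"
  and r: "r : rel V"
 shows "f r = 0[N]"
proof -
 note gc = resp_closed[OF g]
 note wds = wd_update wd_permute wd_nth wd_add_op wd_smult_op
 have "f s : {0[N]}" if "s : fa_rels R P V" for s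
  using that
 proof (cases rule: fa_rels_cases)
  case (add_op \<mu> \<mu>' vs)
  have "g (\<mu> +[Op (length vs)] \<mu>') vs = g \<mu> vs +[N] g \<mu>' vs"
   using lin_add[OF respD(1)[OF g]] add_op(1,2) by (simp add: wd_iff)
  then show ?thesis unfolding add_op(3)
   using add_op(1,2) by (simp add: lin_minus[OF free_module N f] lin_add[OF f] fg wds gc N mod_minus_zero_iff)
 next
  case (smult_op a \<mu> vs)
  have "g (a *[Op (length vs)] \<mu>) vs = a *[N] g \<mu> vs"
   using lin_smult[OF respD(1)[OF g]] smult_op(1,2) by (simp add: wd_iff)
  then show ?thesis unfolding smult_op(3)
   using smult_op(1,2) by (simp add: lin_minus[OF free_module N f] lin_smult[OF f] fg wds gc N mod_minus_zero_iff)
 next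
  case (add_arg \<mu> vs i v)
  let ?as = "take i vs" and ?bs = "drop (Suc i) vs"
  have u: "vs[i := x] = ?as @ x # ?bs" for x using add_arg(2) by (simp add: upd_conv_take_nth_drop)
  have c: "set ?as <= \<U> V" "set ?bs <= \<U> V" "\<mu> : \<OO> (length vs)"
   using add_arg(1) by (auto simp: wd_iff dest!: in_set_takeD in_set_dropD)
  have L: "is_lin V N (%x. g \<mu> (?as @ x # ?bs))"
   by (rule multilinD[OF respD(2)[OF g c(3)] _ c(1,2)]) (use add_arg(2) in simp)
  have "g \<mu> (vs[i := vs ! i +[V] v]) = g \<mu> (vs[i := vs ! i]) +[N] g \<mu> (vs[i := v])"
   unfolding u by (rule lin_add[OF L wd_nth[OF add_arg(1,2)] add_arg(3)])
  then show ?thesis unfolding add_arg(4)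
   using add_arg(1-3) by (simp add: lin_minus[OF free_module N f] lin_add[OF f] fg wds gc N V mod_minus_zero_iff)
 next
  case (smult_arg a \<mu> vs i)
  let ?as = "take i vs" and ?bs = "drop (Suc i) vs"
  have u: "vs[i := x] = ?as @ x # ?bs" for x using smult_arg(3) by (simp add: upd_conv_take_nth_drop)
  have c: "set ?as <= \<U> V" "set ?bs <= \<U> V" "\<mu> : \<OO> (length vs)"
   using smult_arg(2) by (auto simp: wd_iff dest!: in_set_takeD in_set_dropD)
  have L: "is_lin V N (%x. g \<mu> (?as @ x # ?bs))"
   by (rule multilinD[OF respD(2)[OF g c(3)] _ c(1,2)]) (use smult_arg(3) in simp)
  have "g \<mu> (vs[i := a *[V] (vs ! i)]) = a *[N] g \<mu> (vs[i := vs ! i])"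
   unfolding u by (rule lin_smult[OF L smult_arg(1) wd_nth[OF smult_arg(2,3)]])
  then show ?thesis unfolding smult_arg(4)
   using smult_arg(1-3) by (simp add: lin_minus[OF free_module N f] lin_smult[OF f] fg wds gc N V mod_minus_zero_iff)
 next
  case (sym \<mu> vs \<sigma>)
  then show ?thesis
   using respD(3)[OF g sym(1,2)] by (simp add: lin_minus[OF free_module N f] fg wds gc N mod_minus_zero_iff)
 qed
 then have "f r : {0[N]}"
  by (rule lin_mspan_into[OF free_module N f fa_rels_carrier[OF V] zero_submodule[OF N]])
   (use r in \<open>simp_all add: fa_relmod_def\<close>)
 then show ?thesis by simp
qed

lemma FA_module [simp]: "module R V ==> module R (\<A> V)"
 unfolding FA_def by (rule quot_module[OF free_module rel_submodule])

lemma FA_proj: "module R V ==> is_lin (\<F> V) (\<A> V) (%x. rel V +>[\<F> V] x)"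
 unfolding FA_def by (rule quot_proj_lin[OF free_module rel_submodule])

lemma el_closed: "module R V ==> (\<mu>, vs) : wd V ==> el V \<mu> vs : \<AA> V"
 unfolding fa_elem_def by (rule lin_closed[OF FA_proj single_closed])

text \<open>Each clause of \<open>resp\<close> is one of the relations, read in the quotient.\<close>

lemma el_resp:
 assumes V: "module R V" shows "resp V (\<A> V) (el V)"
proof (rule respI)
 note rs = rel_submodule[OF V]
 note wds = wd_update wd_permute wd_nth wd_add_op wd_smult_op
 have rel: "rel V +>[\<F> V] x = rel V +>[\<F> V] y" if "x -[\<F> V] y : fa_rels R P V" "x : \<U> (\<F> V)" "y : \<U> (\<F> V)" for x y
  using that mspan_base[OF that(1)] coset_eq_iff[OF free_module rs that(2,3)] by (simp add: fa_relmod_def)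
 { fix vs :: "'a list" assume vs: "set vs <= \<U> V"
  show "is_lin (Op (length vs)) (\<A> V) (%\<mu>. el V \<mu> vs)"
  proof (rule is_linI)
   fix \<mu> assume m: "\<mu> : \<OO> (length vs)"
   then have w: "(\<mu>, vs) : wd V" using vs by (simp add: wd_iff)
   show "el V \<mu> vs : \<AA> V" by (rule el_closed[OF V w])
   { fix \<mu>' assume m': "\<mu>' : \<OO> (length vs)"
    then have w': "(\<mu>', vs) : wd V" using vs by (simp add: wd_iff)
    have "el V (\<mu> +[Op (length vs)] \<mu>') vs = rel V +>[\<F> V] (single R (\<mu>, vs) +[\<F> V] single R (\<mu>', vs))"
     unfolding fa_elem_def
    proof (rule rel)
     show "single R (\<mu> +[Op (length vs)] \<mu>', vs) -[\<F> V] (single R (\<mu>, vs) +[\<F> V] single R (\<mu>', vs)) : fa_rels R P V"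
      using w w' unfolding fa_rels_def Let_def by blast
    qed (use w w' in \<open>simp_all add: wds\<close>)
    also have "... = el V \<mu> vs +[\<A> V] el V \<mu>' vs"
     unfolding fa_elem_def by (rule lin_add[OF FA_proj[OF V]]) (use w w' in simp_all)
    finally show "el V (\<mu> +[Op (length vs)] \<mu>') vs = el V \<mu> vs +[\<A> V] el V \<mu>' vs" . }
   { fix a assume a: "a : \<U> R"
    have "el V (a *[Op (length vs)] \<mu>) vs = rel V +>[\<F> V] (a *[\<F> V] single R (\<mu>, vs))"
     unfolding fa_elem_def
    proof (rule rel)
     show "single R (a *[Op (length vs)] \<mu>, vs) -[\<F> V] (a *[\<F> V] single R (\<mu>, vs)) : fa_rels R P V"
      using w a unfolding fa_rels_def Let_def by blast
    qed (use w a in \<open>simp_all add: wds\<close>)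
    also have "... = a *[\<A> V] el V \<mu> vs"
     unfolding fa_elem_def by (rule lin_smult[OF FA_proj[OF V]]) (use w a in simp_all)
    finally show "el V (a *[Op (length vs)] \<mu>) vs = a *[\<A> V] el V \<mu> vs" . }
  qed }
 { fix n \<mu> assume m: "\<mu> : \<OO> n"
  show "multilin n V (\<A> V) (el V \<mu>)"
  proof (rule multilinI)
   fix as bs assume ab: "Suc (length as + length bs) = n" "set as <= \<U> V" "set bs <= \<U> V"
   have w: "(\<mu>, as @ x # bs) : wd V" if "x : \<U> V" for x
    using m ab that by (simp add: wd_iff)
   have up: "(as @ x # bs)[length as := y] = as @ y # bs" "(as @ x # bs) ! length as = x" for x y by simp_all
   show "is_lin V (\<A> V) (%x. el V \<mu> (as @ x # bs))"
   proof (rule is_linI)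
    fix x assume x: "x : \<U> V"
    show "el V \<mu> (as @ x # bs) : \<AA> V" by (rule el_closed[OF V w[OF x]])
    { fix y assume y: "y : \<U> V"
     have "el V \<mu> (as @ (x +[V] y) # bs) = rel V +>[\<F> V] (single R (\<mu>, as @ x # bs) +[\<F> V] single R (\<mu>, as @ y # bs))"
      unfolding fa_elem_def
     proof (rule rel)
      have "EX vs i v. single R (\<mu>, as @ (x +[V] y) # bs) -[\<F> V] (single R (\<mu>, as @ x # bs) +[\<F> V] single R (\<mu>, as @ y # bs))
       = single R (\<mu>, vs[i := vs ! i +[V] v]) -[\<F> V] (single R (\<mu>, vs) +[\<F> V] single R (\<mu>, vs[i := v]))
       & (\<mu>, vs) : wd V & i < length vs & v : \<U> V"
       by (rule exI[of _ "as @ x # bs"], rule exI[of _ "length as"], rule exI[of _ y]) (use w[OF x] y in simp)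
      then show "single R (\<mu>, as @ (x +[V] y) # bs) -[\<F> V] (single R (\<mu>, as @ x # bs) +[\<F> V] single R (\<mu>, as @ y # bs)) : fa_rels R P V"
       unfolding fa_rels_def Let_def by blast
     qed (use w x y V in simp_all)
     also have "... = el V \<mu> (as @ x # bs) +[\<A> V] el V \<mu> (as @ y # bs)"
      unfolding fa_elem_def by (rule lin_add[OF FA_proj[OF V]]) (use w x y in simp_all)
     finally show "el V \<mu> (as @ (x +[V] y) # bs) = el V \<mu> (as @ x # bs) +[\<A> V] el V \<mu> (as @ y # bs)" . }
    { fix a assume a: "a : \<U> R"
     have "el V \<mu> (as @ (a *[V] x) # bs) = rel V +>[\<F> V] (a *[\<F> V] single R (\<mu>, as @ x # bs))"
      unfolding fa_elem_def
     proof (rule rel)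
      have "EX vs i. single R (\<mu>, as @ (a *[V] x) # bs) -[\<F> V] (a *[\<F> V] single R (\<mu>, as @ x # bs))
       = single R (\<mu>, vs[i := a *[V] (vs ! i)]) -[\<F> V] (a *[\<F> V] single R (\<mu>, vs))
       & (\<mu>, vs) : wd V & i < length vs"
       by (rule exI[of _ "as @ x # bs"], rule exI[of _ "length as"]) (use w[OF x] in simp)
      then show "single R (\<mu>, as @ (a *[V] x) # bs) -[\<F> V] (a *[\<F> V] single R (\<mu>, as @ x # bs)) : fa_rels R P V"
       unfolding fa_rels_def Let_def using a by blast
     qed (use w x a V in simp_all)
     also have "... = a *[\<A> V] el V \<mu> (as @ x # bs)"
      unfolding fa_elem_def by (rule lin_smult[OF FA_proj[OF V]]) (use w x a in simp_all)
     finally show "el V \<mu> (as @ (a *[V] x) # bs) = a *[\<A> V] el V \<mu> (as @ x # bs)" . }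
   qed
  qed }
 { fix \<mu> vs \<sigma> assume "set vs <= \<U> V" "\<mu> : \<OO> (length vs)" and s: "\<sigma> permutes {..<length vs}"
  then have w: "(\<mu>, vs) : wd V" by (simp add: wd_iff)
  show "el V (op_act P (length vs) \<mu> \<sigma>) (permute_list \<sigma> vs) = el V \<mu> vs"
   unfolding fa_elem_def
  proof (rule rel)
   show "single R (op_act P (length vs) \<mu> \<sigma>, permute_list \<sigma> vs) -[\<F> V] single R (\<mu>, vs) : fa_rels R P V"
    using w s unfolding fa_rels_def Let_def by blast
  qed (use w s in \<open>simp_all add: wds\<close>) }
qed

lemmas el_lin = respD(1)[OF el_resp] and el_multilin = respD(2)[OF el_resp] and el_sym = respD(3)[OF el_resp]

text \<open>The universal property of the free algebra as a module.\<close>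

definition lift :: "('r, 'n) module => ('o => 'v list => 'n) => ('r, 'o, 'v) fa => 'n" where
 "lift N g X = lin_ext R N (%(\<mu>, vs). g \<mu> vs) (repr X)"

lemma lift_lin:
 assumes "module R V" "module R N" "resp V N g"
 shows "is_lin (\<A> V) N (lift N g)"
  "(\<mu>, vs) : wd V ==> lift N g (el V \<mu> vs) = g \<mu> vs"
proof -
 have c: "(%(\<mu>, vs). g \<mu> vs) w : \<U> N" if "w : wd V" for w
  using resp_closed[OF assms(3)] that by (cases w) simp
 note L = lin_ext_lin[where M = N and B = "wd V", OF assms(2) c]
 have s: "lin_ext R N (%(\<mu>, vs). g \<mu> vs) (single R (\<mu>, vs)) = g \<mu> vs" if "(\<mu>, vs) : wd V" for \<mu> vs
  using lin_ext_single[OF assms(2), where g = "%(\<mu>, vs). g \<mu> vs" and b = "(\<mu>, vs)"] c[OF that] by simp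
 have k: "lin_ext R N (%(\<mu>, vs). g \<mu> vs) h = 0[N]" if "h : rel V" for h
  by (rule resp_kills_rel[OF assms L s that])
 show "is_lin (\<A> V) N (lift N g)"
  unfolding FA_def lift_def by (rule lin_lift[OF free_module assms(2) rel_submodule[OF assms(1)] L k])
 show "lift N g (el V \<mu> vs) = g \<mu> vs" if w: "(\<mu>, vs) : wd V"
  unfolding lift_def fa_elem_def
  using lin_repr[OF free_module assms(2) rel_submodule[OF assms(1)] L k single_closed[OF w]] s[OF w] by simp
qed

definition els :: "('r, 'v) module => ('r, 'o, 'v) fa set" where
 "els V = (%(\<mu>, vs). el V \<mu> vs) ` wd V"

lemma els_carrier: "module R V ==> els V <= \<AA> V"
 by (auto simp: els_def el_closed)

lemma FA_span:
 assumes "module R V" shows "mspan R (\<A> V) (els V) = \<AA> V"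
proof
 note sub = mspan_submodule[OF FA_module[OF assms] els_carrier[OF assms]]
 show "mspan R (\<A> V) (els V) <= \<AA> V" using sub_carrier[OF sub] by blast
 show "\<AA> V <= mspan R (\<A> V) (els V)"
 proof
  fix X assume "X : \<AA> V"
  then obtain x where x: "x : \<U> (\<F> V)" "X = rel V +>[\<F> V] x"
   unfolding FA_def quot_carrier by blast
  have "rel V +>[\<F> V] x : mspan R (\<A> V) (els V)"
  proof (rule lin_mspan_into[OF free_module FA_module[OF assms] FA_proj[OF assms] _ sub])
   show "single R ` wd V <= \<U> (\<F> V)" by auto
   show "x : mspan R (\<F> V) (single R ` wd V)" using x(1) by (simp only: free_span)
   fix s assume "s : single R ` wd V"
   then show "rel V +>[\<F> V] s : mspan R (\<A> V) (els V)"
    by (auto simp: els_def fa_elem_def intro!: mspan_base)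
  qed
  then show "X : mspan R (\<A> V) (els V)" using x(2) by simp
 qed
qed

lemma FA_lin_eq:
 assumes "module R V" "module R N" "is_lin (\<A> V) N f" "is_lin (\<A> V) N g"
  "!!\<mu> vs. (\<mu>, vs) : wd V ==> f (el V \<mu> vs) = g (el V \<mu> vs)" "X : \<AA> V"
 shows "f X = g X"
 by (rule lin_eq_on_mspan[OF FA_module[OF assms(1)] assms(2-4) els_carrier[OF assms(1)]])
  (use assms(5,6) FA_span[OF assms(1)] in \<open>auto simp: els_def\<close>)

lemma FA_multilin_eq:
 assumes "module R V" "module R N" "multilin n (\<A> V) N G" "multilin n (\<A> V) N H"
  and "!!bs. length bs = n ==> set bs <= wd V ==>
   G (map (%(\<mu>, vs). el V \<mu> vs) bs) = H (map (%(\<mu>, vs). el V \<mu> vs) bs)"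
  and "length Xs = n" "set Xs <= \<AA> V"
 shows "G Xs = H Xs"
proof (rule multilin_eq[OF FA_module[OF assms(1)] assms(2-4) els_carrier[OF assms(1)] FA_span[OF assms(1)] _ assms(6,7)])
 fix xs assume xs: "length xs = n" "set xs <= els V"
 then obtain bs where "set bs <= wd V" "xs = map (%(\<mu>, vs). el V \<mu> vs) bs"
  unfolding els_def using map_preimage by meson
 then show "G xs = H xs" using assms(5)[of bs] xs(1) by simp
qed

subsection \<open>The algebra structure\<close>

text \<open>The operadic composite on words; the algebra structure is its multilinear extension.\<close>

definition wact :: "('r, 'v) module => 'o => ('o \<times> 'v list) list => ('r, 'o, 'v) fa" where
 "wact V \<mu> bs = el V (op_comp P (map (length o snd) bs) \<mu> (map fst bs)) (concat (map snd bs))"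

lemma wd_concat: "set bs <= wd V ==> set (concat (map snd bs)) <= \<U> V"
 by (induction bs) (auto simp: wd_iff)

lemma wd_args: "set bs <= wd V ==> op_args P (map (length o snd) bs) (map fst bs)"
 by (induction bs) (auto simp: op_args_def wd_iff)

lemma wd_comp:
 assumes "set bs <= wd V" "\<mu> : \<OO> (length bs)"
 shows "(op_comp P (map (length o snd) bs) \<mu> (map fst bs), concat (map snd bs)) : wd V"
proof -
 have "op_comp P (map (length o snd) bs) \<mu> (map fst bs) : \<U> (Op (sum_list (map (length o snd) bs)))"
  by (rule comp_closed[OF _ wd_args[OF assms(1)]]) (use assms(2) in simp)
 moreover have "sum_list (map (length o snd) bs) = length (concat (map snd bs))"
  by (simp add: length_concat)
 moreover note wd_concat[OF assms(1)]
 ultimately show ?thesis by (simp add: wd_iff)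
qed

lemma wact_closed: "module R V ==> set bs <= wd V ==> \<mu> : \<OO> (length bs) ==> wact V \<mu> bs : \<AA> V"
 unfolding wact_def by (rule el_closed[OF _ wd_comp])

text \<open>For the symmetry condition, a permutation of one inner word is the block sum of that permutation and
 identities; inner equivariance turns it into an action on the composite.\<close>

lemma wact_resp:
 assumes V: "module R V" and m: "\<mu> : \<OO> (Suc (length cs + length ds))"
  and cd: "set cs <= wd V" "set ds <= wd V"
 shows "resp V (\<A> V) (%\<nu> us. wact V \<mu> (cs @ (\<nu>, us) # ds))"
proof (rule respI)
 let ?ks = "%k. map (length o snd) cs @ k # map (length o snd) ds"
 let ?ns = "%\<nu>. map fst cs @ \<nu> # map fst ds"
 let ?us = "%us. concat (map snd cs) @ us @ concat (map snd ds)"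
 have wa: "wact V \<mu> (cs @ (\<nu>, us) # ds) = el V (op_comp P (?ks (length us)) \<mu> (?ns \<nu>)) (?us us)" for \<nu> us
  by (simp add: wact_def)
 have args: "op_args P (?ks k) (?ns \<nu>)" if "\<nu> : \<OO> k" for k \<nu>
  using wd_args[OF cd(1)] wd_args[OF cd(2)] that
  by (auto simp: op_args_def intro!: list_all2_appendI)
 have m': "\<mu> : \<OO> (length (?ks k))" for k using m by simp
 have up: "(?ns \<nu>)[length cs := x] = ?ns x" "(?ns \<nu>) ! length cs = \<nu>" "?ks k ! length cs = k"
   "length cs < length (?ks k)" for \<nu> x k
  using list_update_length[of "map fst cs"] nth_append_length[of "map fst cs"] nth_append_length[of "map (length o snd) cs"]
  by simp_all
 have sumk: "sum_list (?ks (length us)) = length (?us us)" for us :: "'a list"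
  by (simp add: length_concat comp_def)
 have usc: "set (?us us) <= \<U> V" if "set us <= \<U> V" for us
  using wd_concat[OF cd(1)] wd_concat[OF cd(2)] that by simp
 have wdc: "(op_comp P (?ks (length us)) \<mu> (?ns \<nu>), ?us us) : wd V" if "set us <= \<U> V" "\<nu> : \<OO> (length us)" for \<nu> us
  using wd_comp[of "cs @ (\<nu>, us) # ds" V \<mu>] m cd that by (simp add: wd_iff)
 { fix us :: "'a list" assume us: "set us <= \<U> V"
  have "is_lin (Op (length us)) (Op (length (?us us))) (%\<nu>. op_comp P (?ks (length us)) \<mu> (?ns \<nu>))"
  proof (rule is_linI)
   fix \<nu> assume n: "\<nu> : \<OO> (length us)"
   show "op_comp P (?ks (length us)) \<mu> (?ns \<nu>) : \<OO> (length (?us us))"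
    using wdc[OF us n] by (simp add: wd_iff)
   { fix \<nu>' assume "\<nu>' : \<OO> (length us)"
    then show "op_comp P (?ks (length us)) \<mu> (?ns (\<nu> +[Op (length us)] \<nu>')) =
     op_comp P (?ks (length us)) \<mu> (?ns \<nu>) +[Op (length (?us us))] op_comp P (?ks (length us)) \<mu> (?ns \<nu>')"
     using comp_add_right[OF m' args[OF n] up(4), of \<nu>'] unfolding up sumk by simp }
   { fix a assume "a : \<U> R"
    then show "op_comp P (?ks (length us)) \<mu> (?ns (a *[Op (length us)] \<nu>)) =
     a *[Op (length (?us us))] op_comp P (?ks (length us)) \<mu> (?ns \<nu>)"
     using comp_smult_right[OF _ m' args[OF n] up(4), of a] unfolding up sumk by simp }
  qed
  from lin_comp[OF this el_lin[OF V usc[OF us]]]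
  show "is_lin (Op (length us)) (\<A> V) (%\<nu>. wact V \<mu> (cs @ (\<nu>, us) # ds))"
   unfolding wa . }
 { fix n \<nu> assume n: "\<nu> : \<OO> n"
  have c: "op_comp P (?ks n) \<mu> (?ns \<nu>) : \<OO> (sum_list (?ks n))"
   by (rule comp_closed[OF m' args[OF n]])
  have "multilin n V (\<A> V) (%us. el V (op_comp P (?ks n) \<mu> (?ns \<nu>)) (?us us))"
   by (rule multilin_context[OF el_multilin[OF V c]])
    (use usc[of "[]"] in \<open>simp_all add: length_concat comp_def\<close>)
  then show "multilin n V (\<A> V) (%us. wact V \<mu> (cs @ (\<nu>, us) # ds))"
   by (rule multilin_cong[OF V]) (simp add: wa) }
 { fix \<nu> us \<sigma> assume us: "set us <= \<U> V" and n: "\<nu> : \<OO> (length us)" and s: "\<sigma> permutes {..<length us}"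
  let ?\<tau> = "replicate (length cs) id @ \<sigma> # replicate (length ds) id"
  let ?vss = "map snd cs @ us # map snd ds"
  let ?k = "?ks (length us)"
  have lk: "map length ?vss = ?k" by simp
  have lt: "length ?\<tau> = length ?vss" by simp
  have pt: "(?\<tau> ! i) permutes {..<length (?vss ! i)}" if "i < length ?vss" for i
   using that s by (auto simp: nth_append nth_Cons' permutes_id)
  have acts: "map (%i. op_act P (?k ! i) (?ns \<nu> ! i) (?\<tau> ! i)) [0..<length ?k] = ?ns (op_act P (length us) \<nu> \<sigma>)"
  proof (rule nth_equalityI)
   fix i assume "i < length (map (%i. op_act P (?k ! i) (?ns \<nu> ! i) (?\<tau> ! i)) [0..<length ?k])"
   then have i: "i < Suc (length cs + length ds)" by simp
   have "op_act P (length (snd b)) (fst b) id = fst b" if "b : wd V" for b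
    using act_id[of "fst b" "length (snd b)"] that by (cases b) (simp add: wd_iff)
   then have ci: "op_act P (length (snd (cs ! j))) (fst (cs ! j)) id = fst (cs ! j)" if "j < length cs" for j
    using nth_mem[OF that] cd(1) by blast
   have di: "op_act P (length (snd (ds ! j))) (fst (ds ! j)) id = fst (ds ! j)" if "j < length ds" for j
    using \<open>!!b. b : wd V ==> op_act P (length (snd b)) (fst b) id = fst b\<close> nth_mem[OF that] cd(2) by blast
   have lhs: "map (%i. op_act P (?k ! i) (?ns \<nu> ! i) (?\<tau> ! i)) [0..<length ?k] ! i = op_act P (?k ! i) (?ns \<nu> ! i) (?\<tau> ! i)"
    using i by (simp del: upt_Suc)
   from i show "map (%i. op_act P (?k ! i) (?ns \<nu> ! i) (?\<tau> ! i)) [0..<length ?k] ! i = ?ns (op_act P (length us) \<nu> \<sigma>) ! i"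
    unfolding lhs by (cases rule: split_index) (simp_all add: nth_append ci di)
  qed (simp del: upt_Suc)
  have "(?\<tau> ! i) permutes {..<?k ! i}" if "i < length ?k" for i
  proof -
   have "i < length ?vss" using that by simp
   then show ?thesis using pt[of i] unfolding lk[symmetric] by (simp only: nth_map)
  qed
  from equivariance_inner[OF m' args[OF n] _ this]
  have f1: "op_comp P ?k \<mu> (?ns (op_act P (length us) \<nu> \<sigma>)) =
    op_act P (sum_list ?k) (op_comp P ?k \<mu> (?ns \<nu>)) (sum_perm ?\<tau> ?k)"
   unfolding acts by simp
  have f2: "?us (permute_list \<sigma> us) = permute_list (sum_perm ?\<tau> ?k) (?us us)"
  proof -
   have "concat (map2 permute_list ?\<tau> ?vss) = ?us (permute_list \<sigma> us)"
   proof -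
    have "map2 permute_list (replicate (length xs) id) xs = xs" for xs :: "'a list list"
     by (induction xs) simp_all
    from this[of "map snd cs"] this[of "map snd ds"] show ?thesis by simp
   qed
   then show ?thesis using sum_perm(2)[OF lt pt] unfolding lk by simp
  qed
  have f3: "sum_perm ?\<tau> ?k permutes {..<length (?us us)}"
   using sum_perm(1)[OF lt pt] unfolding lk by simp
  show "wact V \<mu> (cs @ (op_act P (length us) \<nu> \<sigma>, permute_list \<sigma> us) # ds) = wact V \<mu> (cs @ (\<nu>, us) # ds)"
   by (simp only: wa length_permute_list f1 f2 sumk el_sym[OF V wdc[OF us n] f3]) }
qed

definition wext :: "('r, 'v) module => 'o => ('o \<times> 'v list => 'r) list => ('r, 'o, 'v) fa" where
 "wext V \<mu> = multilin_ext R (\<A> V) (wact V \<mu>)"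

lemma act_wext: "act V \<mu> Xs = wext V \<mu> (map repr Xs)"
 unfolding fa_act_def wext_def wact_def ..

lemma wext_multilin: "module R V ==> \<mu> : \<OO> n ==> multilin n (\<F> V) (\<A> V) (wext V \<mu>)"
 unfolding wext_def by (rule multilin_ext_multilin) (simp_all add: wact_closed)

lemma wext_singles: "module R V ==> \<mu> : \<OO> (length bs) ==> set bs <= wd V ==>
  wext V \<mu> (map (single R) bs) = wact V \<mu> bs"
 unfolding wext_def by (rule multilin_ext_singles) (auto intro!: wact_closed)

lemma wext_closed: "module R V ==> \<mu> : \<OO> (length xs) ==> set xs <= \<U> (\<F> V) ==>
  wext V \<mu> xs : \<AA> V"
 unfolding wext_def by (rule multilin_ext_closed[where B = "wd V"]) (simp_all only: FA_module wact_closed)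

lemma wext_rel:
 assumes V: "module R V" and m: "\<mu> : \<OO> (Suc (length as + length bs))"
  and ab: "set as <= \<U> (\<F> V)" "set bs <= \<U> (\<F> V)" and r: "r : rel V"
 shows "wext V \<mu> (as @ r # bs) = 0[\<A> V]"
proof -
 let ?n = "Suc (length as + length bs)"
 let ?S = "%i. if i = length as then {r} else single R ` wd V"
 have rc: "r : \<U> (\<F> V)" using r sub_carrier[OF rel_submodule[OF V]] by blast
 show ?thesis
 proof (rule multilin_eq_on_spans[OF free_module FA_module[OF V] wext_multilin[OF V m] multilin_const_zero[OF FA_module[OF V]], of ?S])
  show "?S i <= \<U> (\<F> V)" for i using rc by auto
  show "length (as @ r # bs) = ?n" by simp
  fix i assume i: "i < ?n"
  show "(as @ r # bs) ! i : mspan R (\<F> V) (?S i)"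
  proof (cases "i = length as")
   case True
   then show ?thesis by (simp add: mspan_base)
  next
   case False
   then have "(as @ r # bs) ! i : set as \<union> set bs"
    using i by (auto simp: nth_append nth_Cons')
   then have "(as @ r # bs) ! i : \<U> (\<F> V)" using ab by blast
   then show ?thesis using False by (simp add: free_span)
  qed
 next
  fix xs assume xs: "length xs = ?n" "!!i. i < ?n ==> xs ! i : ?S i"
  have "xs ! length as = r" using xs(2)[of "length as"] by simp
  then have dec: "xs = take (length as) xs @ r # drop (Suc (length as)) xs"
   using id_take_nth_drop[of "length as" xs] xs(1) by simp
  have "set (take (length as) xs) <= single R ` wd V"
  proof
   fix x assume "x : set (take (length as) xs)"
   then obtain i where "i < length as" "x = xs ! i" by (auto simp: in_set_conv_nth)
   then show "x : single R ` wd V" using xs(2)[of i] by simp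
  qed
  moreover have "set (drop (Suc (length as)) xs) <= single R ` wd V"
  proof
   fix x assume "x : set (drop (Suc (length as)) xs)"
   then obtain i where "i < length (drop (Suc (length as)) xs)" "drop (Suc (length as)) xs ! i = x"
    unfolding in_set_conv_nth by blast
   then have "Suc (length as) + i < length xs" "x = xs ! (Suc (length as) + i)" by auto
   then show "x : single R ` wd V" using xs(2)[of "Suc (length as) + i"] xs(1) by simp
  qed
  ultimately obtain cs ds where c: "set cs <= wd V" "take (length as) xs = map (single R) cs"
   "set ds <= wd V" "drop (Suc (length as)) xs = map (single R) ds"
   using map_preimage[of "take (length as) xs"] map_preimage[of "drop (Suc (length as)) xs"] by meson
  have len: "length cs = length as" "length ds = length bs"
   using arg_cong[OF c(2), of length] arg_cong[OF c(4), of length] xs(1) by auto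
  have L: "is_lin (\<F> V) (\<A> V) (%x. wext V \<mu> (map (single R) cs @ x # map (single R) ds))"
   by (rule multilinD[OF wext_multilin[OF V m]]) (use len c in auto)
  have m': "\<mu> : \<OO> (Suc (length cs + length ds))" using m len by simp
  have "wext V \<mu> (map (single R) cs @ r # map (single R) ds) = 0[\<A> V]"
  proof (rule resp_kills_rel[OF V FA_module[OF V] wact_resp[OF V m' c(1,3)] L _ r])
   fix \<nu> us assume "(\<nu>, us) : wd V"
   then show "wext V \<mu> (map (single R) cs @ single R (\<nu>, us) # map (single R) ds) = wact V \<mu> (cs @ (\<nu>, us) # ds)"
    using wext_singles[OF V, of \<mu> "cs @ (\<nu>, us) # ds"] m' c by simp
  qed
  then show "wext V \<mu> xs = 0[\<A> V]" using dec c(2,4) by simp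
 qed
qed

lemma repr_FA: "module R V ==> X : \<AA> V ==> repr X : \<U> (\<F> V)"
 "module R V ==> X : \<AA> V ==> rel V +>[\<F> V] repr X = X"
 unfolding FA_def using repr_carrier[OF free_module rel_submodule] by blast+

lemma repr_FA_list: "module R V ==> set Xs <= \<AA> V ==> set (map repr Xs) <= \<U> (\<F> V)"
 using repr_FA(1) by auto

text \<open>The action is defined on chosen representatives of cosets. Independence of the choice is shown by exchanging
 the representatives one position at a time.\<close>

lemma wext_cong:
 assumes V: "module R V" and m: "\<mu> : \<OO> (length as + length xs)"
  and c: "set as <= \<U> (\<F> V)" "set xs <= \<U> (\<F> V)" "set ys <= \<U> (\<F> V)"
  and eq: "map (%x. rel V +>[\<F> V] x) xs = map (%x. rel V +>[\<F> V] x) ys"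
 shows "wext V \<mu> (as @ xs) = wext V \<mu> (as @ ys)"
 using m c eq
proof (induction xs arbitrary: as ys)
 case Nil
 then show ?case by simp
next
 case (Cons x xs)
 then obtain y zs where ys: "ys = y # zs" by (cases ys) auto
 have car: "x : \<U> (\<F> V)" "y : \<U> (\<F> V)" "set zs <= \<U> (\<F> V)" "set xs <= \<U> (\<F> V)"
  using Cons.prems ys by auto
 have m: "\<mu> : \<OO> (Suc (length as + length xs))" using Cons.prems(1) by simp
 have L: "is_lin (\<F> V) (\<A> V) (%x. wext V \<mu> (as @ x # xs))"
  by (rule multilinD[OF wext_multilin[OF V m]]) (use Cons.prems in auto)
 have "rel V +>[\<F> V] x = rel V +>[\<F> V] y" using Cons.prems(5) ys by simp
 then have "x -[\<F> V] y : rel V" using coset_eq_iff[OF free_module rel_submodule[OF V] car(1,2)] by simp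
 then have "wext V \<mu> (as @ (x -[\<F> V] y) # xs) = 0[\<A> V]"
  using wext_rel[OF V m] Cons.prems by simp
 then have "wext V \<mu> (as @ x # xs) -[\<A> V] wext V \<mu> (as @ y # xs) = 0[\<A> V]"
  using lin_minus[OF free_module FA_module[OF V] L car(1,2)] by simp
 then have "wext V \<mu> (as @ x # xs) = wext V \<mu> (as @ y # xs)"
  using mod_minus_zero_iff[OF FA_module[OF V] lin_closed[OF L car(1)] lin_closed[OF L car(2)]] by simp
 also have "... = wext V \<mu> ((as @ [y]) @ zs)"
  using Cons.IH[of "as @ [y]" zs] Cons.prems car ys by simp
 finally show ?case using ys by simp
qed

lemma act_mem: "module R V ==> \<mu> : \<OO> (length Xs) ==> set Xs <= \<AA> V ==>
  act V \<mu> Xs : \<AA> V"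
 unfolding act_wext by (rule wext_closed) (simp_all only: length_map repr_FA_list)

lemma act_multilin:
 assumes V: "module R V" and m: "\<mu> : \<OO> n"
 shows "multilin n (\<A> V) (\<A> V) (act V \<mu>)"
proof (rule multilinI)
 fix as bs assume ab: "Suc (length as + length bs) = n" "set as <= \<AA> V" "set bs <= \<AA> V"
 have L: "is_lin (\<F> V) (\<A> V) (%x. wext V \<mu> (map repr as @ x # map repr bs))"
  by (rule multilinD[OF wext_multilin[OF V m]]) (use ab repr_FA_list[OF V] in \<open>simp_all only: length_map\<close>)
 have "is_lin (\<A> V) (\<A> V) (%X. wext V \<mu> (map repr as @ repr X # map repr bs))"
  unfolding FA_def[of R P V]
 proof (rule lin_lift[OF free_module _ rel_submodule[OF V]], fold FA_def)
  show "wext V \<mu> (map repr as @ h # map repr bs) = 0[\<A> V]" if "h : rel V" for h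
   by (rule wext_rel[OF V _ _ _ that]) (use ab m repr_FA_list[OF V] in \<open>simp_all only: length_map\<close>)
 qed (use V L in simp_all)
 then show "is_lin (\<A> V) (\<A> V) (%X. act V \<mu> (as @ X # bs))" by (simp add: act_wext)
qed

lemma act_els:
 assumes V: "module R V" and bs: "set bs <= wd V" and m: "\<mu> : \<OO> (length bs)"
 shows "act V \<mu> (map (%(\<nu>, us). el V \<nu> us) bs) = wact V \<mu> bs"
proof -
 let ?Xs = "map (%(\<nu>, us). el V \<nu> us) bs"
 have Xs: "set ?Xs <= \<AA> V" using bs by (auto intro!: el_closed[OF V])
 have "wext V \<mu> ([] @ map repr ?Xs) = wext V \<mu> ([] @ map (single R) bs)"
 proof (rule wext_cong[OF V])
  have "rel V +>[\<F> V] repr X = X" if "X : set ?Xs" for X using repr_FA(2)[OF V] that Xs by blast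
  then have "map (%x. rel V +>[\<F> V] x) (map repr ?Xs) = ?Xs" by (simp add: map_idI)
  also have "... = map (%x. rel V +>[\<F> V] x) (map (single R) bs)" by (auto simp: fa_elem_def)
  finally show "map (%x. rel V +>[\<F> V] x) (map repr ?Xs) = map (%x. rel V +>[\<F> V] x) (map (single R) bs)" .
  show "set (map repr ?Xs) <= \<U> (\<F> V)" by (rule repr_FA_list[OF V Xs])
  show "set (map (single R) bs) <= \<U> (\<F> V)" using bs by auto
 qed (use m in simp_all)
 then show ?thesis using wext_singles[OF V m bs] by (simp add: act_wext)
qed

lemma act_els2:
 assumes V: "module R V" and bs: "set bs <= wd V" and m: "\<mu> : \<OO> (length bs)"
 shows "act V \<mu> (map (%(\<nu>, us). el V \<nu> us) bs) =
  el V (op_comp P (map (length o snd) bs) \<mu> (map fst bs)) (concat (map snd bs))"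
 using act_els[OF assms] by (simp add: wact_def)

lemma act_lin_op:
 assumes V: "module R V" and Xs: "set Xs <= \<AA> V"
 shows "is_lin (Op (length Xs)) (\<A> V) (%\<mu>. act V \<mu> Xs)"
proof (rule is_linI)
 fix \<mu> assume m: "\<mu> : \<OO> (length Xs)"
 note [simp] = V
 show "act V \<mu> Xs : \<AA> V" by (rule act_mem[OF V m Xs])
 { fix \<mu>' assume m': "\<mu>' : \<OO> (length Xs)"
  have mm: "\<mu> +[Op (length Xs)] \<mu>' : \<OO> (length Xs)" using m m' by simp
  show "act V (\<mu> +[Op (length Xs)] \<mu>') Xs = act V \<mu> Xs +[\<A> V] act V \<mu>' Xs"
  proof (rule FA_multilin_eq[OF V FA_module[OF V] act_multilin[OF V mm]
     multilin_plus[OF FA_module[OF V] FA_module[OF V] act_multilin[OF V m] act_multilin[OF V m']] _ refl Xs])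
   fix bs assume bs: "length bs = length Xs" "set bs <= wd V"
   let ?k = "map (length o snd) bs"
   have lk: "length ?k = length Xs" "sum_list ?k = length (concat (map snd bs))" using bs by (simp_all add: length_concat)
   note ar = wd_args[OF bs(2)]
   have us: "set (concat (map snd bs)) <= \<U> V" by (rule wd_concat[OF bs(2)])
   have "op_comp P ?k (\<mu> +[Op (length Xs)] \<mu>') (map fst bs) = op_comp P ?k \<mu> (map fst bs)
     +[Op (length (concat (map snd bs)))] op_comp P ?k \<mu>' (map fst bs)"
    using comp_add_left[of \<mu> ?k \<mu>' "map fst bs", OF _ _ ar] m m' unfolding lk by simp
   then have "wact V (\<mu> +[Op (length Xs)] \<mu>') bs = wact V \<mu> bs +[\<A> V] wact V \<mu>' bs"
    unfolding wact_def
    using lin_add[OF el_lin[OF V us], of "op_comp P ?k \<mu> (map fst bs)" "op_comp P ?k \<mu>' (map fst bs)"]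
     wd_comp[OF bs(2), of \<mu>] wd_comp[OF bs(2), of \<mu>'] m m' bs(1) by (simp add: wd_iff)
   then show "act V (\<mu> +[Op (length Xs)] \<mu>') (map (%(\<mu>, vs). el V \<mu> vs) bs) =
    act V \<mu> (map (%(\<mu>, vs). el V \<mu> vs) bs) +[\<A> V] act V \<mu>' (map (%(\<mu>, vs). el V \<mu> vs) bs)"
    using m m' mm bs(1) by (simp add: act_els[OF V bs(2)])
  qed }
 { fix a assume a: "a : \<U> R"
  have mm: "a *[Op (length Xs)] \<mu> : \<OO> (length Xs)" using m a by simp
  show "act V (a *[Op (length Xs)] \<mu>) Xs = a *[\<A> V] act V \<mu> Xs"
  proof (rule FA_multilin_eq[OF V FA_module[OF V] act_multilin[OF V mm]
     multilin_scale[OF FA_module[OF V] act_multilin[OF V m] a] _ refl Xs])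
   fix bs assume bs: "length bs = length Xs" "set bs <= wd V"
   let ?k = "map (length o snd) bs"
   have lk: "length ?k = length Xs" "sum_list ?k = length (concat (map snd bs))" using bs by (simp_all add: length_concat)
   note ar = wd_args[OF bs(2)]
   have us: "set (concat (map snd bs)) <= \<U> V" by (rule wd_concat[OF bs(2)])
   have "op_comp P ?k (a *[Op (length Xs)] \<mu>) (map fst bs) =
     a *[Op (length (concat (map snd bs)))] op_comp P ?k \<mu> (map fst bs)"
    using comp_smult_left[of a \<mu> ?k "map fst bs", OF a _ ar] m unfolding lk by simp
   then have "wact V (a *[Op (length Xs)] \<mu>) bs = a *[\<A> V] wact V \<mu> bs"
    unfolding wact_def
    using lin_smult[OF el_lin[OF V us] a, of "op_comp P ?k \<mu> (map fst bs)"]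
     wd_comp[OF bs(2), of \<mu>] m bs(1) by (simp add: wd_iff)
   then show "act V (a *[Op (length Xs)] \<mu>) (map (%(\<mu>, vs). el V \<mu> vs) bs) =
    a *[\<A> V] act V \<mu> (map (%(\<mu>, vs). el V \<mu> vs) bs)"
    using m mm bs(1) by (simp add: act_els[OF V bs(2)])
  qed }
qed

text \<open>By multilinearity it suffices to permute words, where this is outer equivariance of the composition.\<close>

lemma act_sym:
 assumes V: "module R V" and m: "\<mu> : \<OO> (length Xs)" and Xs: "set Xs <= \<AA> V"
  and s: "\<sigma> permutes {..<length Xs}"
 shows "act V (op_act P (length Xs) \<mu> \<sigma>) (permute_list \<sigma> Xs) = act V \<mu> Xs"
proof -
 let ?n = "length Xs"
 let ?m = "op_act P ?n \<mu> \<sigma>"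
 have m': "?m : \<OO> ?n" by (rule act_closed[OF m s])
 have perm_upd: "is_lin (\<A> V) (\<A> V) (%X. act V ?m (permute_list \<sigma> (as @ X # bs)))"
  if ab: "Suc (length as + length bs) = ?n" "set as <= \<AA> V" "set bs <= \<AA> V" for as bs
 proof -
  have "length as : \<sigma> ` {..<?n}" using permutes_image[OF s] ab(1) by simp
  then obtain i where i: "i < ?n" "\<sigma> i = length as" by force
  let ?ys = "permute_list \<sigma> (as @ 0[\<A> V] # bs)"
  have sl: "\<sigma> permutes {..<length (as @ X # bs)}" for X using s ab(1) by simp
  have e: "permute_list \<sigma> (as @ X # bs) = take i ?ys @ X # drop (Suc i) ?ys" for X
  proof -
   have "permute_list \<sigma> (as @ X # bs) = ?ys[i := X]"
   proof (rule nth_equalityI)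
    fix j assume "j < length (permute_list \<sigma> (as @ X # bs))"
    then have j: "j < ?n" using ab(1) by simp
    have "\<sigma> j = length as \<longleftrightarrow> j = i" using i(2) inj_eq[OF permutes_inj[OF s], of j i] by simp
    moreover have "(as @ X # bs) ! k = (as @ 0[\<A> V] # bs) ! k" if "k ~= length as" for k
     using that by (simp add: nth_append nth_Cons')
    ultimately show "permute_list \<sigma> (as @ X # bs) ! j = ?ys[i := X] ! j"
     using j ab(1) i permute_list_nth[OF sl, of j X] permute_list_nth[OF sl, of j "0[\<A> V]"]
     by (cases "j = i") simp_all
   qed simp
   then show ?thesis using i ab(1) by (simp add: upd_conv_take_nth_drop)
  qed
  have "set ?ys <= \<AA> V" unfolding set_permute_list[OF sl] using ab V by simp
  then have c: "set (take i ?ys) <= \<AA> V" "set (drop (Suc i) ?ys) <= \<AA> V"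
   by (meson in_set_takeD in_set_dropD subset_iff)+
  have L: "is_lin (\<A> V) (\<A> V) (%X. act V ?m (take i ?ys @ X # drop (Suc i) ?ys))"
   by (rule multilinD[OF act_multilin[OF V m'] _ c]) (use ab i in simp)
  show ?thesis
   by (rule lin_cong[OF L _ FA_module[OF V]]) (rule arg_cong[OF e])
 qed
 show ?thesis
 proof (rule FA_multilin_eq[OF V FA_module[OF V] multilinI[OF perm_upd] act_multilin[OF V m] _ refl Xs])
  fix bs assume bs: "length bs = ?n" "set bs <= wd V"
  have sb: "\<sigma> permutes {..<length bs}" using s bs by simp
  let ?k = "map (length o snd) bs"
  let ?vss = "map snd bs"
  have lk: "length ?k = ?n" "map length ?vss = ?k" "sum_list ?k = length (concat ?vss)" using bs by (simp_all add: length_concat)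
  have "act V ?m (permute_list \<sigma> (map (%(\<mu>, vs). el V \<mu> vs) bs)) = wact V ?m (permute_list \<sigma> bs)"
   using act_els[OF V, of "permute_list \<sigma> bs" ?m] bs m' sb by (simp add: permute_list_map)
  also have "... = el V (op_comp P (permute_list \<sigma> ?k) ?m (permute_list \<sigma> (map fst bs))) (concat (permute_list \<sigma> ?vss))"
   unfolding wact_def using sb by (simp add: permute_list_map)
  also have "op_comp P (permute_list \<sigma> ?k) ?m (permute_list \<sigma> (map fst bs)) =
    op_act P (length (concat ?vss)) (op_comp P ?k \<mu> (map fst bs)) (block_perm \<sigma> ?k)"
   using equivariance_outer[of \<mu> ?k "map fst bs" \<sigma>, OF _ wd_args[OF bs(2)]] m s unfolding lk by simp
  also have "concat (permute_list \<sigma> ?vss) = permute_list (block_perm \<sigma> ?k) (concat ?vss)"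
   using block_perm(2)[of \<sigma> ?vss] sb unfolding lk by simp
  also have "el V (op_act P (length (concat ?vss)) (op_comp P ?k \<mu> (map fst bs)) (block_perm \<sigma> ?k))
    (permute_list (block_perm \<sigma> ?k) (concat ?vss)) = wact V \<mu> bs"
   unfolding wact_def
   by (rule el_sym[OF V wd_comp[OF bs(2)]]) (use m bs block_perm(1)[of \<sigma> ?vss] sb lk in simp_all)
  finally show "act V ?m (permute_list \<sigma> (map (%(\<mu>, vs). el V \<mu> vs) bs)) = act V \<mu> (map (%(\<mu>, vs). el V \<mu> vs) bs)"
   using act_els[OF V bs(2)] m bs(1) by simp
 qed
qed

lemma inc_wd: "v : \<U> V ==> (op_one P, [v]) : wd V"
 using unit_closed by (simp add: wd_iff)

lemma inc_lin: "module R V ==> is_lin V (\<A> V) (inc V)"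
 using multilinD[OF el_multilin[of V "op_one P" 1], of "[]" "[]"] unit_closed by (simp add: fa_inc_def[abs_def])

lemma inc_closed: "module R V ==> v : \<U> V ==> inc V v : \<AA> V"
 by (rule lin_closed[OF inc_lin])

lemma incs_closed: "module R V ==> set vs <= \<U> V ==> set (map (inc V) vs) <= \<AA> V"
 by (rule lin_map_carrier[OF inc_lin])

lemma act_incs:
 assumes V: "module R V" and w: "(\<mu>, vs) : wd V"
 shows "act V \<mu> (map (inc V) vs) = el V \<mu> vs"
proof -
 let ?bs = "map (%v. (op_one P, [v])) vs"
 have bs: "set ?bs <= wd V" using w by (auto simp: wd_iff intro!: inc_wd)
 have m: "\<mu> : \<OO> (length vs)" using w by (simp add: wd_iff)
 have e: "map (inc V) vs = map (%(\<nu>, us). el V \<nu> us) ?bs" by (simp add: fa_inc_def)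
 have "act V \<mu> (map (inc V) vs) = el V (op_comp P (map (length o snd) ?bs) \<mu> (map fst ?bs)) (concat (map snd ?bs))"
  unfolding e by (rule act_els2[OF V bs]) (use m in simp)
 also have "map (length o snd) ?bs = replicate (length vs) 1" by (simp add: map_replicate_const comp_def)
 also have "map fst ?bs = replicate (length vs) (op_one P)" by (simp add: map_replicate_const comp_def)
 also have "concat (map snd ?bs) = vs" by (simp add: comp_def)
 finally show ?thesis using one_right[OF m] by simp
qed

text \<open>Associativity of the algebra structure reduces, by multilinearity in \<open>Zs\<close>, to that of the operad. It is
 needed only when the inner arguments other than \<open>act V \<nu> Zs\<close> are
 symbols \<open>\<nu>(u\<^sub>1, \<dots>, u\<^sub>k)\<close>.\<close>

lemma act_act:
 assumes V: "module R V" and m: "\<mu> : \<OO> (Suc (length cs + length ds))"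
  and cd: "set cs <= wd V" "set ds <= wd V"
  and n: "\<nu> : \<OO> (length Zs)" and Zs: "set Zs <= \<AA> V"
 shows "act V \<mu> (map (%(\<nu>, us). el V \<nu> us) cs @ act V \<nu> Zs # map (%(\<nu>, us). el V \<nu> us) ds) =
  act V (op_comp P (map (length o snd) cs @ length Zs # map (length o snd) ds) \<mu> (map fst cs @ \<nu> # map fst ds))
   (map (inc V) (concat (map snd cs)) @ Zs @ map (inc V) (concat (map snd ds)))"
proof -
 let ?e = "%(\<nu>, us). el V \<nu> us"
 let ?u = "%bs. concat (map snd bs)"
 let ?k = "map (length o snd) cs @ length Zs # map (length o snd) ds"
 let ?n = "map fst cs @ \<nu> # map fst ds"
 let ?m = "op_comp P ?k \<mu> ?n"
 have cdc: "set (map ?e cs) <= \<AA> V" "set (map ?e ds) <= \<AA> V"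
  using cd by (auto intro!: el_closed[OF V])
 have args: "op_args P ?k ?n"
  using wd_args[OF cd(1)] wd_args[OF cd(2)] n by (auto simp: op_args_def intro!: list_all2_appendI)
 have mc: "?m : \<OO> (length (?u cs) + length Zs + length (?u ds))"
  using comp_closed[OF _ args, of \<mu>] m by (simp add: length_concat comp_def add.assoc)
 note uc = wd_concat[OF cd(1)] wd_concat[OF cd(2)]
 note ic = incs_closed[OF V uc(1)] incs_closed[OF V uc(2)]
 show ?thesis
 proof (rule FA_multilin_eq[OF V FA_module[OF V], where n = "length Zs" and
   G = "%Zs. act V \<mu> (map ?e cs @ act V \<nu> Zs # map ?e ds)" and
   H = "%Zs. act V ?m (map (inc V) (?u cs) @ Zs @ map (inc V) (?u ds))", OF _ _ _ refl Zs])
  show "multilin (length Zs) (\<A> V) (\<A> V) (%Zs. act V \<mu> (map ?e cs @ act V \<nu> Zs # map ?e ds))"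
   by (rule multilin_comp_lin[OF act_multilin[OF V n]], rule multilinD[OF act_multilin[OF V m]])
    (use cdc in simp_all)
  show "multilin (length Zs) (\<A> V) (\<A> V) (%Zs. act V ?m (map (inc V) (?u cs) @ Zs @ map (inc V) (?u ds)))"
   by (rule multilin_context[OF act_multilin[OF V mc] ic]) simp
  fix bs assume bs: "length bs = length Zs" "set bs <= wd V"
  let ?kb = "map (length o snd) bs"
  have nb: "\<nu> : \<OO> (length bs)" using n bs by simp
  let ?c = "op_comp P ?kb \<nu> (map fst bs)"
  let ?one = "%u. (op_one P, [u])"
  have wc: "(?c, ?u bs) : wd V" by (rule wd_comp[OF bs(2) nb])
  have "act V \<mu> (map ?e cs @ act V \<nu> (map ?e bs) # map ?e ds) = act V \<mu> (map ?e (cs @ (?c, ?u bs) # ds))"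
   using act_els2[OF V bs(2) nb] by simp
  also have "... = el V (op_comp P (map (length o snd) (cs @ (?c, ?u bs) # ds)) \<mu> (map fst (cs @ (?c, ?u bs) # ds)))
    (concat (map snd (cs @ (?c, ?u bs) # ds)))"
   by (rule act_els2[OF V]) (use wc cd m in auto)
  finally have L: "act V \<mu> (map ?e cs @ act V \<nu> (map ?e bs) # map ?e ds) =
   el V (op_comp P (map (length o snd) cs @ length (?u bs) # map (length o snd) ds) \<mu> (map fst cs @ ?c # map fst ds))
    (?u cs @ ?u bs @ ?u ds)" by simp
  let ?B = "map ?one (?u cs) @ bs @ map ?one (?u ds)"
  have B: "set ?B <= wd V" using bs uc by (auto intro!: inc_wd)
  have e1: "map (inc V) us = map ?e (map ?one us)" for us by (simp add: fa_inc_def)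
  have "act V ?m (map (inc V) (?u cs) @ map ?e bs @ map (inc V) (?u ds)) = act V ?m (map ?e ?B)"
   by (simp only: e1 map_append)
  also have "... = el V (op_comp P (map (length o snd) ?B) ?m (map fst ?B)) (concat (map snd ?B))"
   by (rule act_els2[OF V B]) (use mc bs(1) in \<open>simp add: add.assoc\<close>)
  finally have Rr: "act V ?m (map (inc V) (?u cs) @ map ?e bs @ map (inc V) (?u ds)) =
    el V (op_comp P (map (length o snd) ?B) ?m (map fst ?B)) (?u cs @ ?u bs @ ?u ds)" by (simp add: comp_def)
  have "op_comp P (map (length o snd) ?B) ?m (map fst ?B) =
   op_comp P (map (length o snd) cs @ length (?u bs) # map (length o snd) ds) \<mu> (map fst cs @ ?c # map fst ds)"
  proof -
   let ?lr = "%bs. map (%b. replicate (length (snd b)) (1::nat)) bs"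
   let ?xr = "%bs. map (%b. replicate (length (snd b)) (op_one P)) bs"
   let ?ls = "?lr cs @ ?kb # ?lr ds"
   let ?xs = "?xr cs @ map fst bs # ?xr ds"
   have rep: "concat (map (%b. replicate (length (snd b)) x) bs) = replicate (length (?u bs)) x" for x :: 'z and bs :: "('o \<times> 'a list) list"
    by (induction bs) (simp_all add: replicate_add)
   have c1: "concat ?ls = map (length o snd) ?B"
    using rep[of "Suc 0" cs] rep[of "Suc 0" ds] by (simp add: map_replicate_const comp_def)
   have c2: "concat ?xs = map fst ?B"
    using rep[of "op_one P" cs] rep[of "op_one P" ds] by (simp add: map_replicate_const comp_def)
   have ones: "op_args P (replicate k 1) (replicate k (op_one P))" for k
    using unit_closed by (induction k) (simp_all add: op_args_def)
   have lw: "length (?ls ! i) = ?k ! i & op_args P (?ls ! i) (?xs ! i)" if "i < length ?k" for i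
   proof -
    have "i < Suc (length cs + length ds)" using that by simp
    then show ?thesis
     by (cases rule: split_index) (use ones wd_args[OF bs(2)] bs(1) in \<open>simp_all add: nth_append\<close>)
   qed
   have g1: "op_comp P (concat ?ls) (op_comp P ?k \<mu> ?n) (concat ?xs) =
    op_comp P (map sum_list ?ls) \<mu> (map (%i. op_comp P (?ls ! i) (?n ! i) (?xs ! i)) [0..<length ?k])"
    by (rule comp_assoc[OF _ args]) (use m lw in simp_all)
   have g2: "map sum_list ?ls = map (length o snd) cs @ length (?u bs) # map (length o snd) ds"
    by (simp add: sum_list_replicate comp_def length_concat)
   have g3: "map (%i. op_comp P (?ls ! i) (?n ! i) (?xs ! i)) [0..<length ?k] = map fst cs @ ?c # map fst ds"
   proof (rule nth_equalityI)
    fix i assume "i < length (map (%i. op_comp P (?ls ! i) (?n ! i) (?xs ! i)) [0..<length ?k])"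
    then have i: "i < length ?k" by simp
    then have e: "map (%i. op_comp P (?ls ! i) (?n ! i) (?xs ! i)) [0..<length ?k] ! i = op_comp P (?ls ! i) (?n ! i) (?xs ! i)"
     by (simp del: upt_Suc)
    have u: "op_comp P (replicate (length (snd b)) 1) (fst b) (replicate (length (snd b)) (op_one P)) = fst b" if "b : wd V" for b
     using one_right[of "fst b" "length (snd b)"] that by (cases b) (simp add: wd_iff)
    have uc': "op_comp P (replicate (length (snd (cs ! j))) 1) (fst (cs ! j)) (replicate (length (snd (cs ! j))) (op_one P)) = fst (cs ! j)"
     if "j < length cs" for j using u nth_mem[OF that] cd(1) by blast
    have ud': "op_comp P (replicate (length (snd (ds ! j))) 1) (fst (ds ! j)) (replicate (length (snd (ds ! j))) (op_one P)) = fst (ds ! j)"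
     if "j < length ds" for j using u nth_mem[OF that] cd(2) by blast
    have "i < Suc (length cs + length ds)" using i by simp
    then show "map (%i. op_comp P (?ls ! i) (?n ! i) (?xs ! i)) [0..<length ?k] ! i = (map fst cs @ ?c # map fst ds) ! i"
     unfolding e by (cases rule: split_index) (use uc' ud' in \<open>simp_all add: nth_append\<close>)
   qed (simp del: upt_Suc)
   show ?thesis using g1 unfolding c1 c2 g2 g3 .
  qed
  then show "act V \<mu> (map ?e cs @ act V \<nu> (map ?e bs) # map ?e ds) =
   act V ?m (map (inc V) (?u cs) @ map ?e bs @ map (inc V) (?u ds))"
   unfolding L Rr by simp
 qed
qed

end

context operad begin

section \<open>Maps and derivations of free algebras\<close>

subsection \<open>Functoriality\<close>

lemma fm_resp:
 assumes W: "module R W" and j: "is_lin V W j" shows "resp V (\<A> W) (%\<mu> vs. el W \<mu> (map j vs))"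
proof (rule respI)
 show "is_lin (Op (length vs)) (\<A> W) (%\<mu>. el W \<mu> (map j vs))" if "set vs <= \<U> V" for vs
  using el_lin[OF W lin_map_carrier[OF j that]] by simp
 show "multilin n V (\<A> W) (%vs. el W \<mu> (map j vs))" if "\<mu> : \<OO> n" for n \<mu>
  by (rule multilin_map[OF el_multilin[OF W that] j])
 show "el W (op_act P (length vs) \<mu> \<sigma>) (map j (permute_list \<sigma> vs)) = el W \<mu> (map j vs)"
  if "set vs <= \<U> V" "\<mu> : \<OO> (length vs)" "\<sigma> permutes {..<length vs}" for \<mu> vs \<sigma>
  using el_sym[OF W, of \<mu> "map j vs" \<sigma>] that lin_map_carrier[OF j that(1)]
  by (simp add: wd_iff permute_list_map)
qed

lemma fm_eq_lift: "X : \<AA> V ==> fm V W j X = lift (\<A> W) (%\<mu> vs. el W \<mu> (map j vs)) X"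
 by (simp add: fa_map_def lift_def)

lemma fm_lin: "module R V ==> module R W ==> is_lin V W j ==> is_lin (\<A> V) (\<A> W) (fm V W j)"
 by (rule lin_cong[OF lift_lin(1)[OF _ FA_module fm_resp] fm_eq_lift FA_module])

lemma fm_closed: "module R V ==> module R W ==> is_lin V W j ==> X : \<AA> V ==> fm V W j X : \<AA> W"
 by (rule lin_closed[OF fm_lin])

lemma fm_el:
 assumes "module R V" "module R W" "is_lin V W j" "(\<mu>, vs) : wd V"
 shows "fm V W j (el V \<mu> vs) = el W \<mu> (map j vs)"
 using fm_eq_lift[OF el_closed[OF assms(1,4)], of W j] lift_lin(2)[OF assms(1) FA_module[OF assms(2)] fm_resp[OF assms(2,3)] assms(4)]
 by simp

lemma fm_inc:
 "module R V ==> module R W ==> is_lin V W j ==> v : \<U> V ==> fm V W j (inc V v) = inc W (j v)"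
 unfolding fa_inc_def by (simp add: fm_el inc_wd)

lemma wd_map: "is_lin V W j ==> (\<mu>, vs) : wd V ==> (\<mu>, map j vs) : wd W"
 using lin_map_carrier[of V W j vs] by (simp add: wd_iff)

lemma fm_cong:
 assumes "!!v. v : \<U> V ==> j v = j' v" "module R V" "module R W" "is_lin V W j" "X : \<AA> V"
 shows "fm V W j X = fm V W j' X"
proof -
 have j': "is_lin V W j'" by (rule lin_cong[OF assms(4) _ assms(2)]) (simp add: assms(1))
 show ?thesis
 proof (rule FA_lin_eq[OF assms(2) FA_module[OF assms(3)] fm_lin[OF assms(2,3,4)] fm_lin[OF assms(2,3) j'] _ assms(5)])
  fix \<mu> vs assume w: "(\<mu>, vs) : wd V"
  have e: "map j vs = map j' vs" using assms(1) w by (auto simp: wd_iff)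
  show "fm V W j (el V \<mu> vs) = fm V W j' (el V \<mu> vs)"
   unfolding fm_el[OF assms(2,3,4) w] fm_el[OF assms(2,3) j' w] e ..
 qed
qed

lemma fm_fm:
 assumes V: "module R V" and W: "module R W" and U: "module R U" and j: "is_lin V W j" and k: "is_lin W U k"
  and X: "X : \<AA> V"
 shows "fm W U k (fm V W j X) = fm V U (%v. k (j v)) X"
proof (rule FA_lin_eq[OF V FA_module[OF U] lin_comp[OF fm_lin[OF V W j] fm_lin[OF W U k]] fm_lin[OF V U lin_comp[OF j k]] _ X])
 fix \<mu> vs assume w: "(\<mu>, vs) : wd V"
 show "fm W U k (fm V W j (el V \<mu> vs)) = fm V U (%v. k (j v)) (el V \<mu> vs)"
  using fm_el[OF V W j w] fm_el[OF W U k wd_map[OF j w]] fm_el[OF V U lin_comp[OF j k] w] by (simp add: comp_def)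
qed

lemma fm_ident:
 assumes V: "module R V" and X: "X : \<AA> V" shows "fm V V (%v. v) X = X"
 by (rule FA_lin_eq[OF V FA_module[OF V] fm_lin[OF V V lin_ident] lin_ident _ X]) (simp add: fm_el[OF V V lin_ident])

text \<open>Both sides are multilinear in the arguments and agree on words, since the map only relabels variables.\<close>

lemma fm_act:
 assumes V: "module R V" and W: "module R W" and j: "is_lin V W j"
  and m: "\<mu> : \<OO> (length Xs)" and Xs: "set Xs <= \<AA> V"
 shows "fm V W j (act V \<mu> Xs) = act W \<mu> (map (fm V W j) Xs)"
proof (rule FA_multilin_eq[OF V FA_module[OF W] multilin_comp_lin[OF act_multilin[OF V m] fm_lin[OF V W j]]
   multilin_map[OF act_multilin[OF W m] fm_lin[OF V W j]] _ refl Xs])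
 fix bs assume bs: "length bs = length Xs" "set bs <= wd V"
 have m': "\<mu> : \<OO> (length bs)" using m bs by simp
 let ?cs = "map (%(\<nu>, us). (\<nu>, map j us)) bs"
 have cs: "set ?cs <= wd W" using bs(2) by (auto intro!: wd_map[OF j])
 have e: "map (fm V W j) (map (%(\<nu>, us). el V \<nu> us) bs) = map (%(\<nu>, us). el W \<nu> us) ?cs"
  using bs(2) by (auto simp: fm_el[OF V W j])
 have "fm V W j (act V \<mu> (map (%(\<nu>, us). el V \<nu> us) bs)) =
  el W (op_comp P (map (length o snd) bs) \<mu> (map fst bs)) (map j (concat (map snd bs)))"
  unfolding act_els2[OF V bs(2) m'] by (rule fm_el[OF V W j wd_comp[OF bs(2) m']])
 also have "... = el W (op_comp P (map (length o snd) ?cs) \<mu> (map fst ?cs)) (concat (map snd ?cs))"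
  by (simp add: map_concat comp_def case_prod_beta)
 also have "... = act W \<mu> (map (%(\<nu>, us). el W \<nu> us) ?cs)"
  by (rule act_els2[OF W cs, symmetric]) (use m' in simp)
 finally show "fm V W j (act V \<mu> (map (%(\<mu>, vs). el V \<mu> vs) bs)) = act W \<mu> (map (fm V W j) (map (%(\<mu>, vs). el V \<mu> vs) bs))"
  unfolding e .
qed

lemma act_one: assumes V: "module R V" and X: "X : \<AA> V" shows "act V (op_one P) [X] = X"
proof -
 have L: "is_lin (\<A> V) (\<A> V) (%X. act V (op_one P) [X])"
  using multilinD[OF act_multilin[OF V, of "op_one P" 1], of "[]" "[]"] unit_closed by simp
 show ?thesis
 proof (rule FA_lin_eq[OF V FA_module[OF V] L lin_ident _ X])
  fix \<mu> vs assume w: "(\<mu>, vs) : wd V"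
  show "act V (op_one P) [el V \<mu> vs] = el V \<mu> vs"
   using act_els2[OF V, of "[(\<mu>, vs)]" "op_one P"] w unit_closed one_left[of \<mu> "length vs"] by (simp add: wd_iff)
 qed
qed

subsection \<open>Derivations along a map\<close>

text \<open>Derivations of \<open>\<A> W\<close>, their restrictions along algebra maps, and composites of derivations
 with algebra maps are all instances of this notion, and the uniqueness lemma \<open>along_unique\<close>
 below turns identities between them into identities on generators.\<close>

definition along :: "('r, 'v) module => ('r, 'w) module => (('r, 'o, 'v) fa => ('r, 'o, 'w) fa) =>
  (('r, 'o, 'v) fa => ('r, 'o, 'w) fa) => bool" where
 "along V W h E \<longleftrightarrow> is_lin (\<A> V) (\<A> W) E &
   (ALL \<mu> Xs. \<mu> : \<OO> (length Xs) --> set Xs <= \<AA> V -->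
    E (act V \<mu> Xs) = posum (\<A> W) (act W \<mu>) h E Xs)"

lemma alongI: "is_lin (\<A> V) (\<A> W) E ==>
  (!!\<mu> Xs. \<mu> : \<OO> (length Xs) ==> set Xs <= \<AA> V ==>
    E (act V \<mu> Xs) = posum (\<A> W) (act W \<mu>) h E Xs) ==> along V W h E"
 by (simp add: along_def)

lemma along_lin: "along V W h E ==> is_lin (\<A> V) (\<A> W) E"
 by (simp add: along_def)

lemma along_act: "along V W h E ==> \<mu> : \<OO> (length Xs) ==> set Xs <= \<AA> V ==>
    E (act V \<mu> Xs) = posum (\<A> W) (act W \<mu>) h E Xs"
 by (simp add: along_def)

lemma act_posum_ok:
 assumes W: "module R W" and m: "\<mu> : \<OO> (length xs)"
  and "!!x. x : set xs ==> h x : \<AA> W" "!!x. x : set xs ==> E x : \<AA> W"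
 shows "posum_ok (\<A> W) (\<A> W) (act W \<mu>) h E xs"
 by (rule posum_okI[OF FA_module[OF W] act_mem[OF W]]) (use assms(2-4) in auto)

lemma along_el:
 assumes V: "module R V" and W: "module R W" and h: "!!v. v : \<U> V ==> h (inc V v) : \<AA> W"
  and E: "along V W h E" and w: "(\<mu>, vs) : wd V"
 shows "E (el V \<mu> vs) = posum (\<A> W) (act W \<mu>) (%v. h (inc V v)) (%v. E (inc V v)) vs"
proof -
 have m: "\<mu> : \<U> (Op (length (map (inc V) vs)))" and vs: "set vs <= \<U> V" using w by (simp_all add: wd_iff)
 have "E (el V \<mu> vs) = posum (\<A> W) (act W \<mu>) h E (map (inc V) vs)"
  using along_act[OF E m incs_closed[OF V vs]] by (simp add: act_incs[OF V w])
 also have "... = posum (\<A> W) (act W \<mu>) (%v. h (inc V v)) (%v. E (inc V v)) vs"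
 proof (rule posum_map[where M = "\<A> W"], rule act_posum_ok[OF W m])
  fix x assume "x : set (map (inc V) vs)"
  then obtain v where v: "v : \<U> V" "x = inc V v" using vs by auto
  show "h x : \<AA> W" "E x : \<AA> W"
   using v h lin_closed[OF along_lin[OF E] inc_closed[OF V v(1)]] by simp_all
 qed
 finally show ?thesis .
qed

text \<open>A Leibniz rule determines the value on \<open>\<mu>(v\<^sub>1, \<dots>, v\<^sub>n)\<close> from those on the generators.\<close>

lemma along_unique:
 assumes V: "module R V" and W: "module R W" and h: "!!v. v : \<U> V ==> h (inc V v) : \<AA> W"
  and h': "!!v. v : \<U> V ==> h' (inc V v) = h (inc V v)"
  and E: "along V W h E" and E': "along V W h' E'" and eq: "!!v. v : \<U> V ==> E (inc V v) = E' (inc V v)"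
  and X: "X : \<AA> V"
 shows "E X = E' X"
proof (rule FA_lin_eq[OF V FA_module[OF W] along_lin[OF E] along_lin[OF E'] _ X])
 fix \<mu> vs assume w: "(\<mu>, vs) : wd V"
 have vs: "set vs <= \<U> V" "\<mu> : \<OO> (length vs)" using w by (simp_all add: wd_iff)
 have h'c: "h' (inc V v) : \<AA> W" if "v : \<U> V" for v using h h' that by simp
 have e1: "E (el V \<mu> vs) = posum (\<A> W) (act W \<mu>) (%v. h (inc V v)) (%v. E (inc V v)) vs"
  by (rule along_el[OF V W h E w])
 have e2: "E' (el V \<mu> vs) = posum (\<A> W) (act W \<mu>) (%v. h' (inc V v)) (%v. E' (inc V v)) vs"
  by (rule along_el[OF V W h'c E' w])
 show "E (el V \<mu> vs) = E' (el V \<mu> vs)"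
  unfolding e1 e2
 proof (rule posum_cong[where M = "\<A> W"], rule act_posum_ok[OF W vs(2)])
  fix v assume "v : set vs"
  then have v: "v : \<U> V" using vs by auto
  show "h (inc V v) : \<AA> W" "E (inc V v) : \<AA> W"
   "h (inc V v) = h' (inc V v)" "E (inc V v) = E' (inc V v)"
   using v h h' eq lin_closed[OF along_lin[OF E] inc_closed[OF V v]] by simp_all
 qed simp
qed

lemma along_fm_pre:
 assumes V: "module R V" and W: "module R W" and U: "module R U" and j: "is_lin V W j"
  and h: "!!X. X : \<AA> W ==> h X : \<AA> U" and E: "along W U h E"
 shows "along V U (%X. h (fm V W j X)) (%X. E (fm V W j X))"
proof (rule alongI[OF lin_comp[OF fm_lin[OF V W j] along_lin[OF E]]])
 fix \<mu> Xs assume m: "\<mu> : \<OO> (length Xs)" and Xs: "set Xs <= \<AA> V"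
 have Ys: "set (map (fm V W j) Xs) <= \<AA> W" by (rule lin_map_carrier[OF fm_lin[OF V W j] Xs])
 have m': "\<mu> : \<U> (Op (length (map (fm V W j) Xs)))" using m by simp
 show "E (fm V W j (act V \<mu> Xs)) = posum (\<A> U) (act U \<mu>) (%X. h (fm V W j X)) (%X. E (fm V W j X)) Xs"
  unfolding fm_act[OF V W j m Xs] along_act[OF E m' Ys]
  by (rule posum_map[where M = "\<A> U"], rule act_posum_ok[OF U m'])
   (use Ys h lin_closed[OF along_lin[OF E]] in blast)+
qed

lemma along_fm_post:
 assumes V: "module R V" and W: "module R W" and U: "module R U" and k: "is_lin W U k"
  and h: "!!X. X : \<AA> V ==> h X : \<AA> W" and E: "along V W h E"
 shows "along V U (%X. fm W U k (h X)) (%X. fm W U k (E X))"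
proof (rule alongI[OF lin_comp[OF along_lin[OF E] fm_lin[OF W U k]]])
 fix \<mu> Xs assume m: "\<mu> : \<OO> (length Xs)" and Xs: "set Xs <= \<AA> V"
 have ok: "posum_ok (\<A> W) (\<A> W) (act W \<mu>) h E Xs"
  by (rule act_posum_ok[OF W m]) (use Xs h lin_closed[OF along_lin[OF E]] in blast)+
 have hE: "h X : \<AA> W" "E X : \<AA> W" if "X : set Xs" for X
  using that Xs h lin_closed[OF along_lin[OF E]] by blast+
 have N: "module R (\<A> U)" using U by simp
 have "fm W U k (E (act V \<mu> Xs)) = posum (\<A> U) (%zs. fm W U k (act W \<mu> zs)) h E Xs"
  unfolding along_act[OF E m Xs] by (rule posum_lin[OF ok fm_lin[OF W U k] N])
 also have "... = posum (\<A> U) (act U \<mu>) (%X. fm W U k (h X)) (%X. fm W U k (E X)) Xs"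
  unfolding posum_def
 proof (rule mod_finsum_cong[OF N refl])
  fix i assume "i : {..<length Xs}"
  then have i: "i < length Xs" by simp
  have c: "set ((map h Xs)[i := E (Xs ! i)]) <= \<AA> W" by (rule posum_list_carrier[OF ok i])
  have mi: "\<mu> : \<U> (Op (length ((map h Xs)[i := E (Xs ! i)])))" using m by simp
  have e: "fm W U k (act W \<mu> ((map h Xs)[i := E (Xs ! i)])) =
    act U \<mu> (map (fm W U k) ((map h Xs)[i := E (Xs ! i)]))"
   by (rule fm_act[OF W U k mi c])
  then show "fm W U k (act W \<mu> ((map h Xs)[i := E (Xs ! i)])) =
    act U \<mu> ((map (%X. fm W U k (h X)) Xs)[i := fm W U k (E (Xs ! i))])"
   by (simp add: map_update comp_def)
  have "fm W U k (act W \<mu> ((map h Xs)[i := E (Xs ! i)])) : \<AA> U"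
   by (rule fm_closed[OF W U k act_mem[OF W mi c]])
  then show "act U \<mu> ((map (%X. fm W U k (h X)) Xs)[i := fm W U k (E (Xs ! i))]) : \<AA> U"
   unfolding e by (simp add: map_update comp_def)
 qed
 finally show "fm W U k (E (act V \<mu> Xs)) = posum (\<A> U) (act U \<mu>) (%X. fm W U k (h X)) (%X. fm W U k (E X)) Xs" .
qed

lemma along_plus:
 assumes V: "module R V" and W: "module R W" and h: "!!X. X : \<AA> V ==> h X : \<AA> W"
  and E: "along V W h E" and E': "along V W h E'"
 shows "along V W h (%X. E X +[\<A> W] E' X)"
proof (rule alongI[OF lin_plus[OF FA_module[OF V] FA_module[OF W] along_lin[OF E] along_lin[OF E']]])
 fix \<mu> Xs assume m: "\<mu> : \<OO> (length Xs)" and Xs: "set Xs <= \<AA> V"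
 have c: "h X : \<AA> W" "E X : \<AA> W" "E' X : \<AA> W" if "X : set Xs" for X
  using that Xs h lin_closed[OF along_lin[OF E]] lin_closed[OF along_lin[OF E']] by blast+
 show "E (act V \<mu> Xs) +[\<A> W] E' (act V \<mu> Xs) = posum (\<A> W) (act W \<mu>) h (%X. E X +[\<A> W] E' X) Xs"
  unfolding along_act[OF E m Xs] along_act[OF E' m Xs]
  by (rule posum_add[symmetric, OF act_posum_ok[OF W m] act_posum_ok[OF W m] FA_module[OF W] act_multilin[OF W m]])
   (use c in blast)+
qed

lemma along_scale:
 assumes V: "module R V" and W: "module R W" and h: "!!X. X : \<AA> V ==> h X : \<AA> W"
  and E: "along V W h E" and a: "a : \<U> R"
 shows "along V W h (%X. a *[\<A> W] E X)"
proof (rule alongI[OF lin_scale[OF FA_module[OF W] along_lin[OF E] a]])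
 fix \<mu> Xs assume m: "\<mu> : \<OO> (length Xs)" and Xs: "set Xs <= \<AA> V"
 have c: "h X : \<AA> W" "E X : \<AA> W" if "X : set Xs" for X
  using that Xs h lin_closed[OF along_lin[OF E]] by blast+
 show "a *[\<A> W] E (act V \<mu> Xs) = posum (\<A> W) (act W \<mu>) h (%X. a *[\<A> W] E X) Xs"
  unfolding along_act[OF E m Xs]
  by (rule posum_smult[symmetric, OF act_posum_ok[OF W m] FA_module[OF W] act_multilin[OF W m] a])
   (use c in blast)+
qed

lemma along_zero:
 assumes V: "module R V" and W: "module R W" and h: "!!X. X : \<AA> V ==> h X : \<AA> W"
 shows "along V W h (%X. 0[\<A> W])"
proof (rule alongI[OF lin_const_zero[OF FA_module[OF W]]])
 fix \<mu> Xs assume m: "\<mu> : \<OO> (length Xs)" and Xs: "set Xs <= \<AA> V"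
 show "0[\<A> W] = posum (\<A> W) (act W \<mu>) h (%X. 0[\<A> W]) Xs"
  by (rule posum_zero[symmetric, OF act_posum_ok[OF W m] FA_module[OF W] act_multilin[OF W m]])
   (use Xs h W in auto)
qed

text \<open>Existence: the Leibniz rule on the symbols \<open>\<mu>(v\<^sub>1, \<dots>, v\<^sub>n)\<close> respects the relations.\<close>

definition dext :: "('r, 'v) module => ('r, 'w) module => ('v => 'w) => ('v => ('r, 'o, 'w) fa) =>
  ('r, 'o, 'v) fa => ('r, 'o, 'w) fa" where
 "dext V W j f = lift (\<A> W) (%\<mu>. posum (\<A> W) (act W \<mu>) (%v. inc W (j v)) f)"

lemma dext_resp:
 assumes V: "module R V" and W: "module R W" and j: "is_lin V W j" and f: "is_lin V (\<A> W) f"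
 shows "resp V (\<A> W) (%\<mu>. posum (\<A> W) (act W \<mu>) (%v. inc W (j v)) f)"
proof (rule respI)
 note ij = lin_comp[OF j inc_lin[OF W]]
 have ok: "posum_ok (\<A> W) (\<A> W) (act W \<mu>) (%v. inc W (j v)) f vs" if "set vs <= \<U> V" "\<mu> : \<OO> (length vs)" for vs \<mu>
  by (rule act_posum_ok[OF W that(2)]) (use that(1) lin_closed[OF ij] lin_closed[OF f] in blast)+
 { fix vs assume vs: "set vs <= \<U> V"
  show "is_lin (Op (length vs)) (\<A> W) (%\<mu>. posum (\<A> W) (act W \<mu>) (%v. inc W (j v)) f vs)"
   unfolding posum_def
  proof (rule lin_finsum_fun[OF Op_module FA_module[OF W]])
   fix i assume i: "i : {..<length vs}"
   have "set ((map (%v. inc W (j v)) vs)[i := f (vs ! i)]) <= \<AA> W"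
    by (rule posum_list_carrier[OF ok[OF vs mod_zero[OF Op_module]]]) (use i in simp)
   from act_lin_op[OF W this]
   show "is_lin (Op (length vs)) (\<A> W) (%\<mu>. act W \<mu> ((map (%v. inc W (j v)) vs)[i := f (vs ! i)]))"
    by simp
  qed simp }
 { fix n \<mu> assume m: "\<mu> : \<OO> n"
  show "multilin n V (\<A> W) (posum (\<A> W) (act W \<mu>) (%v. inc W (j v)) f)"
   by (rule multilin_posum[OF V FA_module[OF W] FA_module[OF W] act_multilin[OF W m] _ ij f])
    (use m in \<open>simp add: act_mem[OF W]\<close>) }
 { fix \<mu> vs \<sigma> assume vs: "set vs <= \<U> V" and m: "\<mu> : \<OO> (length vs)" and s: "\<sigma> permutes {..<length vs}"
  show "posum (\<A> W) (act W (op_act P (length vs) \<mu> \<sigma>)) (%v. inc W (j v)) f (permute_list \<sigma> vs) =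
    posum (\<A> W) (act W \<mu>) (%v. inc W (j v)) f vs"
  proof (rule posum_permute[OF ok[OF vs m] s])
   fix zs assume zs: "length zs = length vs" "set zs <= \<AA> W"
   show "act W (op_act P (length vs) \<mu> \<sigma>) (permute_list \<sigma> zs) = act W \<mu> zs"
    using act_sym[OF W, of \<mu> zs \<sigma>] m s zs by simp
  qed }
qed

lemma dext_el:
 assumes "module R V" "module R W" "is_lin V W j" "is_lin V (\<A> W) f" "(\<mu>, vs) : wd V"
 shows "dext V W j f (el V \<mu> vs) = posum (\<A> W) (act W \<mu>) (%v. inc W (j v)) f vs"
 unfolding dext_def by (rule lift_lin(2)[OF assms(1) FA_module[OF assms(2)] dext_resp[OF assms(1-4)] assms(5)])

lemma dext_lin:
 assumes "module R V" "module R W" "is_lin V W j" "is_lin V (\<A> W) f"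
 shows "is_lin (\<A> V) (\<A> W) (dext V W j f)"
 unfolding dext_def by (rule lift_lin(1)[OF assms(1) FA_module[OF assms(2)] dext_resp[OF assms(1-4)]])

lemma dext_inc:
 assumes "module R V" "module R W" "is_lin V W j" "is_lin V (\<A> W) f" "v : \<U> V"
 shows "dext V W j f (inc V v) = f v"
proof -
 have ok: "posum_ok (\<A> W) (\<A> W) (act W (op_one P)) (%v. inc W (j v)) f [v]"
  by (rule act_posum_ok[OF assms(2)])
   (use assms(5) unit_closed lin_closed[OF assms(4)] lin_closed[OF lin_comp[OF assms(3) inc_lin[OF assms(2)]]] in simp_all)
 show ?thesis
  unfolding fa_inc_def[of R P V] dext_el[OF assms(1-4) inc_wd[OF assms(5)]] posum_Cons[OF ok]
  using assms(2) lin_closed[OF assms(4,5)] by (simp add: act_one)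
qed

text \<open>The Leibniz rule holds on words by construction of \<open>dext\<close>; it extends to all arguments because both
 sides are multilinear.\<close>

lemma dext_along:
 assumes V: "module R V" and W: "module R W" and j: "is_lin V W j" and f: "is_lin V (\<A> W) f"
 shows "along V W (fm V W j) (dext V W j f)"
proof (rule alongI[OF dext_lin[OF assms]])
 let ?D = "dext V W j f" and ?i = "%v. inc W (j v)" and ?N = "\<A> W"
 let ?e = "%(\<nu>, us). el V \<nu> us"
 note N = FA_module[OF W]
 note ij = lin_comp[OF j inc_lin[OF W]]
 fix \<mu> Xs assume m: "\<mu> : \<OO> (length Xs)" and Xs: "set Xs <= \<AA> V"
 have mp: "multilin (length Xs) (\<A> V) ?N (posum ?N (act W \<mu>) (fm V W j) ?D)"
  by (rule multilin_posum[OF FA_module[OF V] N N act_multilin[OF W m] _ fm_lin[OF V W j] dext_lin[OF assms]])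
   (use m in \<open>simp add: act_mem[OF W]\<close>)
 show "?D (act V \<mu> Xs) = posum ?N (act W \<mu>) (fm V W j) ?D Xs"
 proof (rule FA_multilin_eq[OF V N multilin_comp_lin[OF act_multilin[OF V m] dext_lin[OF assms]] mp _ refl Xs])
  fix bs assume bs: "length bs = length Xs" "set bs <= wd V"
  have mb: "\<mu> : \<OO> (length bs)" using m bs by simp
  let ?k = "map (length o snd) bs"
  let ?m = "op_comp P ?k \<mu> (map fst bs)"
  have wc: "(?m, concat (map snd bs)) : wd V" by (rule wd_comp[OF bs(2) mb])
  have L: "?D (act V \<mu> (map ?e bs)) = posum ?N (act W ?m) ?i f (concat (map snd bs))"
   unfolding act_els2[OF V bs(2) mb] by (rule dext_el[OF assms wc])
  have ec: "?e b : \<AA> V" if "b : set bs" for b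
  proof -
   have "b : wd V" using that bs(2) by blast
   then show ?thesis by (cases b) (simp add: el_closed[OF V])
  qed
  have okm: "posum_ok ?N ?N (act W \<mu>) (fm V W j) ?D (map ?e bs)"
   by (rule act_posum_ok[OF W]) (use mb ec fm_closed[OF V W j] lin_closed[OF dext_lin[OF assms]] in auto)
  have R1: "posum ?N (act W \<mu>) (fm V W j) ?D (map ?e bs) = posum ?N (act W \<mu>) (%b. fm V W j (?e b)) (%b. ?D (?e b)) bs"
   by (rule posum_map[OF okm])
  have R2: "posum ?N (act W \<mu>) (%b. fm V W j (?e b)) (%b. ?D (?e b)) bs = posum ?N (act W ?m) ?i f (concat (map snd bs))"
  proof (rule posum_concat[where M = ?N and K = ?N])
   show "posum_ok ?N ?N (act W \<mu>) (%b. fm V W j (?e b)) (%b. ?D (?e b)) bs"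
    by (rule act_posum_ok[OF W mb]) (use ec fm_closed[OF V W j] lin_closed[OF dext_lin[OF assms]] in auto)
   show "posum_ok ?N ?N (act W ?m) ?i f (concat (map snd bs))"
    by (rule act_posum_ok[OF W]) (use wc lin_closed[OF f] lin_closed[OF ij] in \<open>auto simp: wd_iff\<close>)
   fix cs b ds assume dec: "bs = cs @ b # ds"
   obtain \<nu> us where b: "b = (\<nu>, us)" by (cases b)
   have wb: "(\<nu>, us) : wd V" "set cs <= wd V" "set ds <= wd V" using bs(2) dec b by auto
   have m1: "\<mu> : \<OO> (Suc (length cs + length ds))" using mb dec by simp
   have us: "set us <= \<U> V" "\<nu> : \<OO> (length us)" using wb(1) by (simp_all add: wd_iff)
   let ?cs = "map (%(\<nu>, us). (\<nu>, map j us)) cs" and ?ds = "map (%(\<nu>, us). (\<nu>, map j us)) ds"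
   let ?ew = "%(\<nu>, us). el W \<nu> us"
   have csw: "set ?cs <= wd W" "set ?ds <= wd W" using wb(2,3) by (auto intro!: wd_map[OF j])
   have hc: "map (%b. fm V W j (?e b)) cs = map ?ew ?cs" "map (%b. fm V W j (?e b)) ds = map ?ew ?ds"
    using wb(2,3) by (auto simp: fm_el[OF V W j])
   have ewc: "set (map ?ew ?cs) <= carrier ?N" "set (map ?ew ?ds) <= carrier ?N"
    using csw el_closed[OF W] by auto
   have Lm: "is_lin ?N ?N (%X. act W \<mu> (map ?ew ?cs @ X # map ?ew ?ds))"
    by (rule multilinD[OF act_multilin[OF W m1] _ ewc]) simp
   have oku: "posum_ok ?N ?N (act W \<nu>) ?i f us"
    by (rule act_posum_ok[OF W us(2)]) (use us lin_closed[OF f] lin_closed[OF ij] in auto)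
   have m1': "\<mu> : \<OO> (Suc (length ?cs + length ?ds))" using m1 by simp
   have "act W \<mu> (map (%b. fm V W j (?e b)) cs @ ?D (?e b) # map (%b. fm V W j (?e b)) ds) =
     act W \<mu> (map ?ew ?cs @ posum ?N (act W \<nu>) ?i f us # map ?ew ?ds)"
    unfolding hc b using dext_el[OF assms wb(1)] by simp
   also have "... = posum ?N (%zs. act W \<mu> (map ?ew ?cs @ act W \<nu> zs # map ?ew ?ds)) ?i f us"
    by (rule posum_lin[OF oku Lm N])
   also have "... = posum ?N (%zs. act W ?m (map ?i (concat (map snd cs)) @ zs @ map ?i (concat (map snd ds)))) ?i f us"
   proof (rule posum_cong[where M = ?N])
    show "posum_ok ?N ?N (%zs. act W \<mu> (map ?ew ?cs @ act W \<nu> zs # map ?ew ?ds)) ?i f us"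
    proof (rule posum_okI[OF N])
     fix zs assume "length zs = length us" "set zs <= carrier ?N"
     then show "act W \<mu> (map ?ew ?cs @ act W \<nu> zs # map ?ew ?ds) : carrier ?N"
      by (intro lin_closed[OF Lm] act_mem[OF W]) (use us in simp_all)
    qed (use us lin_closed[OF f] lin_closed[OF ij] in auto)
    fix zs assume zs: "length zs = length us" "set zs <= carrier ?N"
    have nz: "\<nu> : \<OO> (length zs)" using us zs by simp
    have inci: "map (inc W) (concat (map snd (map (%(\<nu>, us). (\<nu>, map j us)) as))) = map ?i (concat (map snd as))" for as :: "('o \<times> 'a list) list"
     by (induction as) auto
    show "act W \<mu> (map ?ew ?cs @ act W \<nu> zs # map ?ew ?ds) =
     act W ?m (map ?i (concat (map snd cs)) @ zs @ map ?i (concat (map snd ds)))"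
     unfolding act_act[OF W m1' csw nz zs(2)] inci dec b using zs(1)
     by (simp add: comp_def case_prod_beta)
   qed simp_all
   finally show "act W \<mu> (map (%b. fm V W j (?e b)) cs @ ?D (?e b) # map (%b. fm V W j (?e b)) ds) =
    posum ?N (%zs. act W ?m (map ?i (concat (map snd cs)) @ zs @ map ?i (concat (map snd ds)))) ?i f (snd b)"
    by (simp add: b)
  qed
  show "?D (act V \<mu> (map (%(\<mu>, vs). el V \<mu> vs) bs)) = posum ?N (act W \<mu>) (fm V W j) ?D (map (%(\<mu>, vs). el V \<mu> vs) bs)"
   unfolding L R1 R2 ..
 qed
qed

subsection \<open>The module of derivations\<close>

abbreviation "\<D> V \<equiv> Der R P V"
abbreviation "\<DD> V \<equiv> \<U> (Der R P V)"

lemma Der_iff: "D : \<DD> V \<longleftrightarrow> D : extensional (\<AA> V) & along V V (%X. X) D"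
 by (auto simp: Der_def along_def lin_hom_iff posum_def)

lemma Der_along: "D : \<DD> V ==> along V V (%X. X) D"
 by (simp add: Der_iff)

lemma Der_lin: "D : \<DD> V ==> is_lin (\<A> V) (\<A> V) D"
 by (rule along_lin[OF Der_along])

lemma Der_mem: "D : \<DD> V ==> X : \<AA> V ==> D X : \<AA> V"
 by (rule lin_closed[OF Der_lin])

lemma Der_inc_mem: "module R V ==> D : \<DD> V ==> v : \<U> V ==> D (inc V v) : \<AA> V"
 by (rule Der_mem[OF _ inc_closed])

lemma Der_inc_lin: "module R V ==> D : \<DD> V ==> is_lin V (\<A> V) (%v. D (inc V v))"
 by (rule lin_comp[OF inc_lin Der_lin])

lemma along_cong:
 assumes "module R V" "along V W h E" "!!X. X : \<AA> V ==> E' X = E X" "module R W"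
  "!!X. X : \<AA> V ==> h X : \<AA> W"
 shows "along V W h E'"
proof (rule alongI[OF lin_cong[OF along_lin[OF assms(2)] assms(3) FA_module[OF assms(1)]]])
 fix \<mu> Xs assume m: "\<mu> : \<OO> (length Xs)" and Xs: "set Xs <= \<AA> V"
 have "posum (\<A> W) (act W \<mu>) h E Xs = posum (\<A> W) (act W \<mu>) h E' Xs"
  by (rule posum_cong[where M = "\<A> W"], rule act_posum_ok[OF assms(4) m])
   (use Xs assms(3,5) lin_closed[OF along_lin[OF assms(2)]] in auto)
 then show "E' (act V \<mu> Xs) = posum (\<A> W) (act W \<mu>) h E' Xs"
  using along_act[OF assms(2) m Xs] assms(3)[OF act_mem[OF assms(1) m Xs]] by simp
qed

lemma Der_restrict: "module R V ==> along V V (%X. X) E ==> (\<lambda>X\<in>\<AA> V. E X) : \<DD> V"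
 by (simp add: Der_iff along_cong[of V V "%X. X" E])

lemma Der_eqI:
 assumes "module R V" "d : \<DD> V" "e : \<DD> V" "!!v. v : \<U> V ==> d (inc V v) = e (inc V v)"
 shows "d = e"
proof (rule extensionalityI[of _ "\<AA> V"])
 show "d : extensional (\<AA> V)" "e : extensional (\<AA> V)" using assms by (simp_all add: Der_iff)
 show "d X = e X" if "X : \<AA> V" for X
  by (rule along_unique[OF assms(1,1) _ _ Der_along[OF assms(2)] Der_along[OF assms(3)] assms(4) that])
   (simp_all add: assms(1) inc_closed)
qed

lemma Der_sel:
 "d +[\<D> V] e = (\<lambda>X\<in>\<AA> V. d X +[\<A> V] e X)"
 "a *[\<D> V] d = (\<lambda>X\<in>\<AA> V. a *[\<A> V] d X)"
 "0[\<D> V] = (\<lambda>X\<in>\<AA> V. 0[\<A> V])"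
 by (simp_all add: Der_def hom_mod_def)

lemma Der_submodule:
 assumes V: "module R V" shows "submodule (\<DD> V) R (hom_mod R (\<A> V) (\<A> V))"
proof (rule submoduleI2[OF hom_mod_module[OF FA_module[OF V] FA_module[OF V]]])
 have sel: "add (\<D> V) = add (hom_mod R (\<A> V) (\<A> V))" "smult (\<D> V) = smult (hom_mod R (\<A> V) (\<A> V))"
  "0[\<D> V] = 0[hom_mod R (\<A> V) (\<A> V)]" by (simp_all add: Der_def)
 show "\<DD> V <= \<U> (hom_mod R (\<A> V) (\<A> V))" by (auto simp: Der_def hom_mod_def)
 show "0[hom_mod R (\<A> V) (\<A> V)] : \<DD> V"
  unfolding sel[symmetric] Der_sel by (rule Der_restrict[OF V along_zero[OF V V]])
 show "d +[hom_mod R (\<A> V) (\<A> V)] e : \<DD> V" if "d : \<DD> V" "e : \<DD> V" for d e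
  unfolding sel[symmetric] Der_sel by (rule Der_restrict[OF V along_plus[OF V V _ Der_along[OF that(1)] Der_along[OF that(2)]]])
 show "a *[hom_mod R (\<A> V) (\<A> V)] d : \<DD> V" if "a : \<U> R" "d : \<DD> V" for a d
  unfolding sel[symmetric] Der_sel by (rule Der_restrict[OF V along_scale[OF V V _ Der_along[OF that(2)] that(1)]])
qed

lemma Der_module [simp]: assumes V: "module R V" shows "module R (\<D> V)"
proof -
 have "\<D> V = (hom_mod R (\<A> V) (\<A> V))\<lparr>carrier := \<DD> V\<rparr>" by (simp add: Der_def)
 then show ?thesis
  using sub_module[OF hom_mod_module[OF FA_module[OF V] FA_module[OF V]] Der_submodule[OF V]] by simp
qed

lemma Der_ev_lin:
 assumes "X : \<AA> V" shows "is_lin (\<D> V) (\<A> V) (%d. d X)"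
 by (rule is_linI) (simp_all add: Der_sel assms Der_mem)

lemma der_ext_eq:
 assumes V: "module R V" and D: "D : \<DD> V" and f: "!!v. v : \<U> V ==> D (inc V v) = f v"
 shows "der_ext R P V f = D"
 unfolding der_ext_def
proof (rule the_equality)
 show "D : \<DD> V & (ALL v:\<U> V. D (inc V v) = f v)" using D f by simp
 show "E = D" if "E : \<DD> V & (ALL v:\<U> V. E (inc V v) = f v)" for E
  by (rule Der_eqI[OF V]) (use that D f in simp_all)
qed

lemma der_ext:
 assumes V: "module R V" and f: "is_lin V (\<A> V) f"
 shows "der_ext R P V f : \<DD> V" "v : \<U> V ==> der_ext R P V f (inc V v) = f v"
proof -
 let ?D = "\<lambda>X\<in>\<AA> V. dext V V (%v. v) f X"
 have "along V V (%X. X) (dext V V (%v. v) f)"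
 proof (rule alongI[OF dext_lin[OF V V lin_ident f]])
  fix \<mu> Xs assume m: "\<mu> : \<OO> (length Xs)" and Xs: "set Xs <= \<AA> V"
  show "dext V V (%v. v) f (act V \<mu> Xs) = posum (\<A> V) (act V \<mu>) (%X. X) (dext V V (%v. v) f) Xs"
   unfolding along_act[OF dext_along[OF V V lin_ident f] m Xs]
   by (rule posum_cong[where M = "\<A> V"], rule act_posum_ok[OF V m])
    (use Xs fm_closed[OF V V lin_ident] lin_closed[OF dext_lin[OF V V lin_ident f]] fm_ident[OF V] in auto)
 qed
 then have D: "?D : \<DD> V" by (rule Der_restrict[OF V])
 have Di: "?D (inc V v) = f v" if "v : \<U> V" for v
  using dext_inc[OF V V lin_ident f that] inc_closed[OF V that] by simp
 have e: "der_ext R P V f = ?D" by (rule der_ext_eq[OF V D Di])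
 show "der_ext R P V f : \<DD> V" unfolding e by (rule D)
 show "der_ext R P V f (inc V v) = f v" if "v : \<U> V" unfolding e by (rule Di[OF that])
qed

subsection \<open>The preLie product and the Lie bracket\<close>

abbreviation "pl V \<equiv> preLie R P V"
abbreviation "br V \<equiv> der_bracket R P V"

lemma pl:
 assumes V: "module R V" and d: "d : \<DD> V" and e: "e : \<DD> V"
 shows "pl V d e : \<DD> V" "v : \<U> V ==> pl V d e (inc V v) = e (d (inc V v))"
 using der_ext[OF V lin_comp[OF Der_inc_lin[OF V d] Der_lin[OF e]]] by (simp_all add: preLie_def)

lemma br_mem: "module R V ==> d : \<DD> V ==> e : \<DD> V ==> br V d e : \<DD> V"
 by (simp add: der_bracket_def pl)

lemma Der_minus_ev: "module R V ==> X : \<AA> V ==> d : \<DD> V ==> e : \<DD> V ==>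
  (d -[\<D> V] e) X = d X -[\<A> V] e X"
 using lin_minus[OF Der_module FA_module Der_ev_lin] by blast

lemma Der_plus_ev: "X : \<AA> V ==> (d +[\<D> V] e) X = d X +[\<A> V] e X"
 by (simp add: Der_sel)

lemma Der_smult_ev: "X : \<AA> V ==> (a *[\<D> V] d) X = a *[\<A> V] d X"
 by (simp add: Der_sel)

lemma Der_valued_lin:
 assumes V: "module R V" and M: "module R M" and T: "!!x. x : \<U> M ==> T x : \<DD> V"
  and l: "!!v. v : \<U> V ==> is_lin M (\<A> V) (%x. T x (inc V v))"
 shows "is_lin M (\<D> V) T"
proof (rule is_linI)
 fix x assume x: "x : \<U> M"
 show "T x : \<DD> V" by (rule T[OF x])
 show "T (x +[M] y) = T x +[\<D> V] T y" if y: "y : \<U> M" for y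
 proof (rule Der_eqI[OF V T[OF mod_add[OF M x y]] mod_add[OF Der_module[OF V] T[OF x] T[OF y]]])
  fix v assume v: "v : \<U> V"
  show "T (x +[M] y) (inc V v) = (T x +[\<D> V] T y) (inc V v)"
   unfolding Der_plus_ev[OF inc_closed[OF V v]] by (rule lin_add[OF l[OF v] x y])
 qed
 show "T (a *[M] x) = a *[\<D> V] T x" if a: "a : \<U> R" for a
 proof (rule Der_eqI[OF V T[OF mod_smult[OF M a x]] mod_smult[OF Der_module[OF V] a T[OF x]]])
  fix v assume v: "v : \<U> V"
  show "T (a *[M] x) (inc V v) = (a *[\<D> V] T x) (inc V v)"
   unfolding Der_smult_ev[OF inc_closed[OF V v]] by (rule lin_smult[OF l[OF v] a x])
 qed
qed

lemma br_inc:
 assumes V: "module R V" and d: "d : \<DD> V" and e: "e : \<DD> V" and v: "v : \<U> V"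
 shows "br V d e (inc V v) = e (d (inc V v)) -[\<A> V] d (e (inc V v))"
 unfolding der_bracket_def Der_minus_ev[OF V inc_closed[OF V v] pl(1)[OF V d e] pl(1)[OF V e d]]
 by (simp add: pl(2)[OF V d e v] pl(2)[OF V e d v])

subsection \<open>The Lie algebra generated in degree one\<close>

abbreviation "L1 V \<equiv> Der_Lie1 R P V"

lemma Der_deg_carrier: "Der_deg R P V n <= \<DD> V"
 by (auto simp: Der_deg_def)

lemma L1_least:
 assumes "submodule L R (\<D> V)" "Der_deg R P V 1 <= L" "!!d e. d : L ==> e : L ==> br V d e : L"
 shows "L1 V <= L"
 using assms by (auto simp: Der_Lie1_def)

lemma L1_carrier: assumes V: "module R V" shows "L1 V <= \<DD> V"
 by (rule L1_least[OF module.carrier_is_submodule[OF Der_module[OF V]] Der_deg_carrier br_mem[OF V]])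

lemma L1_submodule: assumes V: "module R V" shows "submodule (L1 V) R (\<D> V)"
proof (rule submoduleI2[OF Der_module[OF V] L1_carrier[OF V]])
 show "0[\<D> V] : L1 V" unfolding Der_Lie1_def by (simp add: sub_zero)
 show "x +[\<D> V] y : L1 V" if "x : L1 V" "y : L1 V" for x y
  using that unfolding Der_Lie1_def by (simp add: sub_add)
 show "a *[\<D> V] x : L1 V" if "a : \<U> R" "x : L1 V" for a x
  using that unfolding Der_Lie1_def by (simp add: sub_smult)
qed

lemma L1_deg1: "d : Der_deg R P V 1 ==> d : L1 V"
 unfolding Der_Lie1_def by auto

lemma L1_br: "d : L1 V ==> e : L1 V ==> br V d e : L1 V"
 unfolding Der_Lie1_def by simp

subsection \<open>Functoriality of derivations\<close>

abbreviation "Fm V W \<equiv> Der_map R P V W"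

lemma SR_homD:
 assumes "(i, r) : SR_hom R V W"
 shows "is_lin V W i" "is_lin W V r" "v : \<U> V ==> r (i v) = v"
 using assms by (auto simp: SR_hom_def lin_hom_iff)

lemma Fm:
 assumes V: "module R V" and W: "module R W" and m: "(i, r) : SR_hom R V W" and d: "d : \<DD> V"
 shows "Fm V W (i, r) d : \<DD> W"
  "w : \<U> W ==> Fm V W (i, r) d (inc W w) = fm V W i (d (inc V (r w)))"
proof -
 note ir = SR_homD[OF m]
 note L = lin_comp[OF lin_comp[OF ir(2) Der_inc_lin[OF V d]] fm_lin[OF V W ir(1)]]
 show "Fm V W (i, r) d : \<DD> W"
  "w : \<U> W ==> Fm V W (i, r) d (inc W w) = fm V W i (d (inc V (r w)))"
  using der_ext[OF W L] d by (simp_all add: Der_map_def)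
qed

lemma Fm_fm:
 assumes V: "module R V" and W: "module R W" and m: "(i, r) : SR_hom R V W" and d: "d : \<DD> V"
  and X: "X : \<AA> V"
 shows "Fm V W (i, r) d (fm V W i X) = fm V W i (d X)"
proof -
 note ir = SR_homD[OF m]
 note F = Fm[OF V W m d]
 note A1 = along_fm_pre[OF V W W ir(1) _ Der_along[OF F(1)]]
 note A2 = along_fm_post[OF V V W ir(1) _ Der_along[OF d]]
 show ?thesis
  by (rule along_unique[OF V W _ _ A1 A2 _ X])
   (simp_all add: V W ir inc_closed fm_closed fm_inc F(2) lin_closed[OF ir(1)])
qed

lemma Fm_lin:
 assumes V: "module R V" and W: "module R W" and m: "(i, r) : SR_hom R V W"
 shows "is_lin (\<D> V) (\<D> W) (Fm V W (i, r))"
proof (rule Der_valued_lin[OF W Der_module[OF V] Fm(1)[OF V W m]])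
 note ir = SR_homD[OF m]
 fix w assume w: "w : \<U> W"
 show "is_lin (\<D> V) (\<A> W) (%d. Fm V W (i, r) d (inc W w))"
  by (rule lin_cong[OF lin_comp[OF Der_ev_lin[OF inc_closed[OF V lin_closed[OF ir(2) w]]] fm_lin[OF V W ir(1)]]
   _ Der_module[OF V]]) (rule Fm(2)[OF V W m _ w])
qed

lemma Fm_pl:
 assumes V: "module R V" and W: "module R W" and m: "(i, r) : SR_hom R V W"
  and d: "d : \<DD> V" and e: "e : \<DD> V"
 shows "Fm V W (i, r) (pl V d e) = pl W (Fm V W (i, r) d) (Fm V W (i, r) e)"
proof (rule Der_eqI[OF W])
 note ir = SR_homD[OF m] and F = Fm[OF V W m]
 note p = pl[OF V d e] and q = pl[OF W F(1)[OF d] F(1)[OF e]]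
 show "Fm V W (i, r) (pl V d e) : \<DD> W" "pl W (Fm V W (i, r) d) (Fm V W (i, r) e) : \<DD> W"
  by (rule F(1)[OF p(1)], rule q(1))
 fix w assume w: "w : \<U> W"
 then have rw: "r w : \<U> V" by (rule lin_closed[OF ir(2)])
 show "Fm V W (i, r) (pl V d e) (inc W w) = pl W (Fm V W (i, r) d) (Fm V W (i, r) e) (inc W w)"
  unfolding F(2)[OF p(1) w] q(2)[OF w] F(2)[OF d w] p(2)[OF rw]
  by (rule Fm_fm[OF V W m e Der_inc_mem[OF V d rw], symmetric])
qed

lemma Fm_br:
 assumes V: "module R V" and W: "module R W" and m: "(i, r) : SR_hom R V W"
  and d: "d : \<DD> V" and e: "e : \<DD> V"
 shows "Fm V W (i, r) (br V d e) = br W (Fm V W (i, r) d) (Fm V W (i, r) e)"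
 unfolding der_bracket_def
 using lin_minus[OF Der_module[OF V] Der_module[OF W] Fm_lin[OF V W m] pl(1)[OF V d e] pl(1)[OF V e d]]
 by (simp add: Fm_pl[OF V W m] d e)

lemma fa_deg_gen: "module R V ==> {el V \<mu> vs | \<mu> vs. (\<mu>, vs) : wd V & Q vs} <= \<AA> V"
 using el_closed by blast

lemma fa_deg_submodule: "module R V ==> submodule (fa_deg R P V n) R (\<A> V)"
 unfolding fa_deg_def by (rule mspan_submodule[OF FA_module fa_deg_gen])

lemma fm_fa_deg:
 assumes V: "module R V" and W: "module R W" and j: "is_lin V W j" and X: "X : fa_deg R P V n"
 shows "fm V W j X : fa_deg R P W n"
proof (rule lin_mspan_into[OF FA_module[OF V] FA_module[OF W] fm_lin[OF V W j] fa_deg_gen[OF V] fa_deg_submodule[OF W] _ X[unfolded fa_deg_def]])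
 fix s assume "s : {el V \<mu> vs | \<mu> vs. (\<mu>, vs) : wd V & length vs = n}"
 then obtain \<mu> vs where s: "s = el V \<mu> vs" "(\<mu>, vs) : wd V" "length vs = n" by blast
 then show "fm V W j s : fa_deg R P W n"
  unfolding fa_deg_def using wd_map[OF j s(2)] fm_el[OF V W j s(2)] by (intro mspan_base) force
qed

lemma Fm_deg:
 assumes V: "module R V" and W: "module R W" and m: "(i, r) : SR_hom R V W" and d: "d : Der_deg R P V n"
 shows "Fm V W (i, r) d : Der_deg R P W n"
proof -
 have d': "d : \<DD> V" using d Der_deg_carrier by blast
 note ir = SR_homD[OF m]
 show ?thesis
  using Fm[OF V W m d'] d lin_closed[OF ir(2)] fm_fa_deg[OF V W ir(1)] by (simp add: Der_deg_def)
qed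

lemma Fm_L1:
 assumes V: "module R V" and W: "module R W" and m: "(i, r) : SR_hom R V W" and d: "d : L1 V"
 shows "Fm V W (i, r) d : L1 W"
proof -
 note sub = L1_submodule[OF W] and F = Fm_lin[OF V W m]
 have "L1 V <= {d : \<DD> V. Fm V W (i, r) d : L1 W}"
 proof (rule L1_least)
  show "submodule {d : \<DD> V. Fm V W (i, r) d : L1 W} R (\<D> V)"
   by (rule submoduleI2[OF Der_module[OF V]])
    (use V W in \<open>auto simp: lin_zero[OF _ _ F] lin_add[OF F] lin_smult[OF F] sub_zero[OF sub] sub_add[OF sub] sub_smult[OF sub]\<close>)
  show "Der_deg R P V 1 <= {d : \<DD> V. Fm V W (i, r) d : L1 W}"
   using Der_deg_carrier Fm_deg[OF V W m] L1_deg1 by blast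
 qed (simp add: br_mem[OF V] Fm_br[OF V W m] L1_br)
 then show ?thesis using d by blast
qed

end

section \<open>Bases and derivations of rank one\<close>

context base_ring begin

abbreviation "\<R> \<equiv> reg_mod R"

lemma lin_smult_elem: "module R M ==> y : \<U> M ==> is_lin \<R> M (%a. a *[M] y)"
 by (rule is_linI) (simp_all add: module.smult_l_distr module.smult_assoc1)

lemma lin_smult_fun:
 "module R M ==> is_lin V \<R> f ==> y : \<U> M ==> is_lin V M (%v. f v *[M] y)"
 by (rule lin_comp[OF _ lin_smult_elem])

lemma lin_fst: "is_lin (dsum W V) W fst"
 by (rule is_linI) auto

lemma lin_snd: "is_lin (dsum W V) V snd"
 by (rule is_linI) auto

lemma lin_inl: "module R V ==> is_lin W (dsum W V) (%w. (w, 0[V]))"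
 by (rule is_linI) simp_all

lemma lin_inr: "module R W ==> is_lin V (dsum W V) (%v. (0[W], v))"
 by (rule is_linI) simp_all

lemma dsum_map_apply: "x : \<U> M ==> y : \<U> N ==> dsum_map M N f g (x, y) = (f x, g y)"
 by (simp add: dsum_map_def)

lemma dsum_map_lin:
 assumes "module R M" "module R N" "is_lin M M' f" "is_lin N N' g"
 shows "is_lin (dsum M N) (dsum M' N') (dsum_map M N f g)"
 by (rule is_linI)
  (use assms(1,2) in \<open>auto simp: dsum_map_apply lin_add[OF assms(3)] lin_add[OF assms(4)] lin_smult[OF assms(3)]
   lin_smult[OF assms(4)] lin_closed[OF assms(3)] lin_closed[OF assms(4)]\<close>)

text \<open>Ranks are used only through coordinate functionals, so a basis is recorded together with them.\<close>

definition dual_basis :: "('r, 'v) module => 'v set => ('v => 'v => 'r) => bool" where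
 "dual_basis V B \<beta> \<longleftrightarrow> finite B & B <= \<U> V & (ALL b:B. is_lin V \<R> (\<beta> b)) &
   (ALL b:B. ALL c:B. \<beta> b c = (if b = c then \<one> else \<zero>)) &
   (ALL v:\<U> V. v = (\<Oplus>\<^bsub>V\<^esub>b\<in>B. \<beta> b v *[V] b))"

lemma dual_basisD:
 assumes "dual_basis V B \<beta>"
 shows "finite B" "b : B ==> b : \<U> V" "b : B ==> is_lin V \<R> (\<beta> b)"
  "b : B ==> c : B ==> \<beta> b c = (if b = c then \<one> else \<zero>)"
  "v : \<U> V ==> (\<Oplus>\<^bsub>V\<^esub>b\<in>B. \<beta> b v *[V] b) = v"
 using assms unfolding dual_basis_def by (blast, blast, blast, blast, metis)

lemma has_rank_dual_basis:
 assumes V: "module R V" and r: "has_rank R V n"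
 obtains B \<beta> where "dual_basis V B \<beta>" "card B = n"
proof -
 interpret V: module R V by fact
 obtain B where BB: "finite B & card B = n & B <= \<U> V &
   (ALL x:\<U> V. EX! c. c : B \<rightarrow>\<^sub>E \<U> R & x = (\<Oplus>\<^bsub>V\<^esub>b\<in>B. c b *[V] b))"
  using r unfolding has_rank_def by (rule exE)
 have B: "finite B" "card B = n" "B <= \<U> V" using BB by simp_all
 have u: "EX! c. c : B \<rightarrow>\<^sub>E \<U> R & x = (\<Oplus>\<^bsub>V\<^esub>b\<in>B. c b *[V] b)" if "x : \<U> V" for x
  using BB[THEN conjunct2, THEN conjunct2, THEN conjunct2] that by (rule bspec)
 let ?s = "%c. (\<Oplus>\<^bsub>V\<^esub>b\<in>B. c b *[V] b)"
 define co where "co x = (THE c. c : B \<rightarrow>\<^sub>E \<U> R & x = ?s c)" for x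
 have co': "co x : B \<rightarrow>\<^sub>E \<U> R & x = ?s (co x)" if "x : \<U> V" for x
  unfolding co_def by (rule theI'[OF u[OF that]])
 have co: "co x : B \<rightarrow>\<^sub>E \<U> R" "?s (co x) = x" if "x : \<U> V" for x
  using conjunct1[OF co'[OF that]] conjunct2[OF co'[OF that], symmetric] by this
 have uniq: "co x b = c b" if "c : B \<rightarrow> \<U> R" "x = ?s c" "x : \<U> V" "b : B" for x c b
 proof -
  have e: "?s (restrict c B) = ?s c"
   by (rule mod_finsum_cong[OF V refl]) (use that B V in auto)
  have "restrict c B : B \<rightarrow>\<^sub>E \<U> R & x = ?s (restrict c B)" unfolding e using that by auto
  then have "co x = restrict c B" using u[OF that(3)] co'[OF that(3)] by blast
  then show ?thesis using that(4) by simp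
 qed
 have coR: "co x b : \<U> R" if "x : \<U> V" "b : B" for x b using co(1)[OF that(1)] that(2) by auto
 have bV: "b : \<U> V" if "b : B" for b using B that by auto
 have "dual_basis V B (%b x. co x b)"
  unfolding dual_basis_def
 proof (intro conjI ballI)
  show "finite B" "B <= \<U> V" using B by auto
  show "v = (\<Oplus>\<^bsub>V\<^esub>b\<in>B. co v b *[V] b)" if "v : \<U> V" for v by (rule co(2)[OF that, symmetric])
  fix b assume b: "b : B"
  show "is_lin V \<R> (%x. co x b)"
  proof (rule is_linI)
   fix x assume x: "x : \<U> V"
   show "co x b : carrier \<R>" using coR[OF x b] by simp
   { fix y assume y: "y : \<U> V"
    have "?s (%b. co x b \<oplus> co y b) = (\<Oplus>\<^bsub>V\<^esub>b\<in>B. co x b *[V] b +[V] co y b *[V] b)"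
     by (rule mod_finsum_cong[OF V refl]) (use coR x y bV V in \<open>simp_all add: V.smult_l_distr\<close>)
    also have "... = ?s (co x) +[V] ?s (co y)"
     by (rule V.finsum_addf) (use coR x y bV in auto)
    finally have eq: "x +[V] y = ?s (%b. co x b \<oplus> co y b)" using co(2)[OF x] co(2)[OF y] by simp
    have "co (x +[V] y) b = (%b. co x b \<oplus> co y b) b"
     by (rule uniq[OF _ eq _ b]) (use coR x y V in auto)
    then show "co (x +[V] y) b = co x b +[\<R>] co y b" by simp }
   { fix a assume a: "a : \<U> R"
    have "?s (%b. a \<otimes> co x b) = (\<Oplus>\<^bsub>V\<^esub>b\<in>B. a *[V] (co x b *[V] b))"
     by (rule mod_finsum_cong[OF V refl]) (use coR x a bV V in \<open>simp_all add: V.smult_assoc1\<close>)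
    also have "... = a *[V] ?s (co x)"
     by (rule V.finsum_smult_ldistr[symmetric]) (use coR x a bV B in auto)
    finally have eq: "a *[V] x = ?s (%b. a \<otimes> co x b)" using co(2)[OF x] by simp
    have "co (a *[V] x) b = (%b. a \<otimes> co x b) b"
     by (rule uniq[OF _ eq _ b]) (use coR x a V in auto)
    then show "co (a *[V] x) b = a *[\<R>] co x b" by simp }
  qed
  fix c assume c: "c : B"
  have "?s (%b. if b = c then \<one> else \<zero>) = (\<Oplus>\<^bsub>V\<^esub>b\<in>B. if c = b then b else 0[V])"
   by (rule mod_finsum_cong[OF V refl]) (use bV V in auto)
  also have "... = c"
   using V.finsum_singleton[OF c B(1), of "%b. b"] bV by auto
  finally have eq: "c = ?s (%b. if b = c then \<one> else \<zero>)" by (rule sym)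
  show "co c b = (if b = c then \<one> else \<zero>)"
   by (rule uniq[OF _ eq bV[OF c] b]) auto
 qed
 then show thesis using B(2) by (rule that)
qed

lemma dual_basis_has_rank:
 assumes V: "module R V" and B: "dual_basis V B \<beta>" shows "has_rank R V (card B)"
proof -
 interpret V: module R V by fact
 have b: "finite B" "B <= \<U> V" "!!b. b : B ==> is_lin V \<R> (\<beta> b)"
  "!!b c. b : B ==> c : B ==> \<beta> b c = (if b = c then \<one> else \<zero>)"
  "!!v. v : \<U> V ==> v = (\<Oplus>\<^bsub>V\<^esub>b\<in>B. \<beta> b v *[V] b)"
  using B by (auto simp: dual_basis_def)
 have bV: "c : \<U> V" if "c : B" for c using b(2) that by auto
 have "EX! c. c : B \<rightarrow>\<^sub>E \<U> R & x = (\<Oplus>\<^bsub>V\<^esub>b\<in>B. c b *[V] b)" if x: "x : \<U> V" for x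
 proof (rule ex1I)
  have bR: "\<beta> c x : \<U> R" if "c : B" for c using lin_closed[OF b(3)[OF that] x] by simp
  have "(\<Oplus>\<^bsub>V\<^esub>b\<in>B. (\<lambda>b\<in>B. \<beta> b x) b *[V] b) = (\<Oplus>\<^bsub>V\<^esub>b\<in>B. \<beta> b x *[V] b)"
   by (rule mod_finsum_cong[OF V refl]) (use bR bV V in simp_all)
  then have "x = (\<Oplus>\<^bsub>V\<^esub>b\<in>B. (\<lambda>b\<in>B. \<beta> b x) b *[V] b)"
   by (rule trans[OF b(5)[OF x] sym])
  then show "(\<lambda>b\<in>B. \<beta> b x) : B \<rightarrow>\<^sub>E \<U> R & x = (\<Oplus>\<^bsub>V\<^esub>b\<in>B. (\<lambda>b\<in>B. \<beta> b x) b *[V] b)"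
   using bR by (intro conjI) auto
  fix c assume c: "c : B \<rightarrow>\<^sub>E \<U> R & x = (\<Oplus>\<^bsub>V\<^esub>b\<in>B. c b *[V] b)"
  have cR: "c d : \<U> R" if "d : B" for d using c that by auto
  show "c = (\<lambda>b\<in>B. \<beta> b x)"
  proof (rule extensionalityI[of _ B])
   show "c : extensional B" "(\<lambda>b\<in>B. \<beta> b x) : extensional B" using c by (auto simp: PiE_def)
   fix d assume d: "d : B"
   have "\<beta> d x = \<beta> d (\<Oplus>\<^bsub>V\<^esub>b\<in>B. c b *[V] b)" using arg_cong[OF conjunct2[OF c]] .
   also have "... = (\<Oplus>\<^bsub>\<R>\<^esub>b\<in>B. \<beta> d (c b *[V] b))"
    by (rule lin_finsum[OF V reg_module b(3)[OF d] b(1)]) (use cR bV V in simp)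
   also have "... = (\<Oplus>\<^bsub>\<R>\<^esub>b\<in>B. if d = b then c b else 0[\<R>])"
    by (rule mod_finsum_cong[OF reg_module refl])
     (use cR bV b(4)[OF d] in \<open>auto simp: lin_smult[OF b(3)[OF d]]\<close>)
   also have "... = c d"
    using abelian_monoid.finsum_singleton[of \<R> d B c] d b(1) cR reg_module
    by (simp add: module_def abelian_group_def)
   finally show "c d = (\<lambda>b\<in>B. \<beta> b x) d" using d by simp
  qed
 qed
 then show ?thesis unfolding has_rank_def using b(1,2) by (intro exI[of _ B] conjI ballI refl)
qed

lemma SR_obj_module: "SR_obj R V ==> module R V"
 by (simp add: SR_obj_def)

lemma SR_obj_basis:
 assumes "SR_obj R V" obtains B \<beta> where "dual_basis V B \<beta>"
proof -
 obtain n where n: "has_rank R V n" using assms by (auto simp: SR_obj_def)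
 show thesis by (rule has_rank_dual_basis[OF SR_obj_module[OF assms] n]) (rule that)
qed

text \<open>The divergence takes values over \<open>R \<oplus> V\<close>, which gets the basis of \<open>V\<close> extended by the generator of \<open>R\<close>.\<close>

lemma SR_obj_R_plus:
 assumes V: "SR_obj R V" shows "SR_obj R (R_plus R V)"
proof -
 note M = SR_obj_module[OF V]
 interpret V: module R V by fact
 let ?W = "R_plus R V"
 have W: "module R ?W" using M by simp
 interpret W: module R ?W by fact
 obtain B \<beta> where B: "dual_basis V B \<beta>" using SR_obj_basis[OF V] .
 have b: "finite B" "B <= \<U> V" "!!b. b : B ==> is_lin V \<R> (\<beta> b)"
  "!!b c. b : B ==> c : B ==> \<beta> b c = (if b = c then \<one> else \<zero>)"
  "!!v. v : \<U> V ==> v = (\<Oplus>\<^bsub>V\<^esub>b\<in>B. \<beta> b v *[V] b)"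
  using B by (auto simp: dual_basis_def)
 show ?thesis
 proof (cases "\<one> = \<zero>")
  case True
  \<comment> \<open>Over the zero ring every module is trivial, and the empty family is a basis.\<close>
  have "x = 0[?W]" if "x : carrier ?W" for x
   using mod_smult_one[OF W that] mod_smult_l_null[OF W that] True by simp
  then have "dual_basis ?W {} (%_ _. \<zero>)" using W by (simp add: dual_basis_def)
  then show ?thesis using dual_basis_has_rank[OF W] W unfolding SR_obj_def by blast
 next
  case False
  let ?e = "(\<one>, 0[V])" and ?j = "%b. (\<zero>, b)"
  let ?\<gamma> = "%c p. if c = ?e then fst p else \<beta> (snd c) (snd p)"
  have ne0: "\<one> ~= \<zero>" by fact
  have inj: "inj_on ?j B" by (simp add: inj_on_def)
  have ne: "?e ~= (\<zero>, c)" for c using False by simp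
  have bV: "c : \<U> V" if "c : B" for c using b(2) that by auto
  have "dual_basis ?W (insert ?e (?j ` B)) ?\<gamma>"
   unfolding dual_basis_def
  proof (intro conjI ballI)
   show "finite (insert ?e (?j ` B))" using b(1) by simp
   show "insert ?e (?j ` B) <= carrier ?W" using b(2) M by auto
   show "is_lin ?W \<R> (?\<gamma> c)" if "c : insert ?e (?j ` B)" for c
   proof (cases "c = ?e")
    case True
    then show ?thesis using lin_fst[of \<R> V] by (simp add: fun_eq_iff)
   next
    case False
    then have "c : ?j ` B" using that by blast
    then obtain b where "b : B" "c = (\<zero>, b)" by blast
    then have "?\<gamma> c = (%p. \<beta> b (snd p))" using ne0 by auto
    then show ?thesis using lin_comp[OF lin_snd b(3)[OF \<open>b : B\<close>]] by simp
   qed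
   have z: "\<beta> d 0[V] = \<zero>" if "d : B" for d using lin_zero[OF M reg_module b(3)[OF that]] by simp
   show "?\<gamma> c d = (if c = d then \<one> else \<zero>)" if "c : insert ?e (?j ` B)" "d : insert ?e (?j ` B)" for c d
    using that ne0 b(4) z by (auto split: if_splits)
   fix p assume "p : carrier ?W"
   then obtain a v where p: "p = (a, v)" "a : \<U> R" "v : \<U> V" by auto
   have bR: "\<beta> d v : \<U> R" if "d : B" for d using lin_closed[OF b(3)[OF that] p(3)] by simp
   have s: "(\<Oplus>\<^bsub>?W\<^esub>c\<in>?j ` B. ?\<gamma> c p *[?W] c) = (\<zero>, v)"
   proof -
    have "(\<Oplus>\<^bsub>?W\<^esub>c\<in>?j ` B. ?\<gamma> c p *[?W] c) = (\<Oplus>\<^bsub>?W\<^esub>b\<in>B. ?\<gamma> (?j b) p *[?W] ?j b)"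
     by (rule mod_finsum_reindex[OF W inj]) (use p bR bV M ne False in auto)
    also have "... = (\<Oplus>\<^bsub>?W\<^esub>b\<in>B. ?j (\<beta> b v *[V] b))"
     by (rule mod_finsum_cong[OF W refl]) (use p bR bV M False in auto)
    also have "... = ?j (\<Oplus>\<^bsub>V\<^esub>b\<in>B. \<beta> b v *[V] b)"
     using lin_finsum[OF M W lin_inr[OF reg_module, of V] b(1), of "%b. \<beta> b v *[V] b"] bR bV M by simp
    finally show ?thesis using b(5)[OF p(3), symmetric] by simp
   qed
   have "(\<Oplus>\<^bsub>?W\<^esub>c\<in>insert ?e (?j ` B). ?\<gamma> c p *[?W] c) = (?\<gamma> ?e p *[?W] ?e) +[?W] (\<Oplus>\<^bsub>?W\<^esub>c\<in>?j ` B. ?\<gamma> c p *[?W] c)"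
    by (rule mod_finsum_insert[OF W]) (use b(1) p bR bV M ne False in auto)
   then show "p = (\<Oplus>\<^bsub>?W\<^esub>c\<in>insert ?e (?j ` B). ?\<gamma> c p *[?W] c)"
    unfolding s using p M by simp
  qed
  then show ?thesis using dual_basis_has_rank[OF W] W unfolding SR_obj_def by blast
 qed
qed

end

context operad begin

definition rk :: "('r, 'v) module => ('r, 'o, 'v) fa => ('v => 'r) => ('r, 'o, 'v) der" where
 "rk V x f = der_ext R P V (%v. f v *[\<A> V] x)"

lemma rk:
 assumes V: "module R V" and f: "is_lin V \<R> f" and x: "x : \<AA> V"
 shows "rk V x f : \<DD> V" "v : \<U> V ==> rk V x f (inc V v) = f v *[\<A> V] x"
 using der_ext[OF V lin_smult_fun[OF FA_module[OF V] f x]] by (simp_all add: rk_def)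

lemma rk_lin:
 assumes V: "module R V" and f: "is_lin V \<R> f" shows "is_lin (\<A> V) (\<D> V) (%x. rk V x f)"
proof (rule Der_valued_lin[OF V FA_module[OF V] rk(1)[OF V f]])
 fix v assume v: "v : \<U> V"
 have fv: "f v : \<U> R" using lin_closed[OF f v] by simp
 show "is_lin (\<A> V) (\<A> V) (%x. rk V x f (inc V v))"
  by (rule lin_cong[OF lin_scale[OF FA_module[OF V] lin_ident fv] rk(2)[OF V f _ v] FA_module[OF V]])
qed

lemma Der_finsum_ev:
 assumes V: "module R V" and "finite A" "!!i. i : A ==> d i : \<DD> V" "X : \<AA> V"
 shows "(\<Oplus>\<^bsub>\<D> V\<^esub>i\<in>A. d i) X = (\<Oplus>\<^bsub>\<A> V\<^esub>i\<in>A. d i X)"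
 by (rule lin_finsum[OF Der_module[OF V] FA_module[OF V] Der_ev_lin[OF assms(4)] assms(2,3)])

text \<open>This reduces identities that are linear in a derivation to derivations of rank one.\<close>

lemma Der_rk_sum:
 assumes V: "module R V" and B: "dual_basis V B \<beta>" and d: "d : \<DD> V"
 shows "d = (\<Oplus>\<^bsub>\<D> V\<^esub>b\<in>B. rk V (d (inc V b)) (\<beta> b))"
proof -
 have b: "finite B" "!!b. b : B ==> b : \<U> V" "!!b. b : B ==> is_lin V \<R> (\<beta> b)"
  "!!v. v : \<U> V ==> v = (\<Oplus>\<^bsub>V\<^esub>b\<in>B. \<beta> b v *[V] b)"
  using B by (auto simp: dual_basis_def)
 have db: "d (inc V c) : \<AA> V" if "c : B" for c by (rule Der_inc_mem[OF V d b(2)[OF that]])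
 have rb: "rk V (d (inc V c)) (\<beta> c) : \<DD> V" if "c : B" for c by (rule rk(1)[OF V b(3)[OF that] db[OF that]])
 show ?thesis
 proof (rule Der_eqI[OF V d])
  show "(\<Oplus>\<^bsub>\<D> V\<^esub>b\<in>B. rk V (d (inc V b)) (\<beta> b)) : \<DD> V"
   by (rule mod_finsum_closed[OF Der_module[OF V] rb])
  fix v assume v: "v : \<U> V"
  have bR: "\<beta> c v : \<U> R" if "c : B" for c using lin_closed[OF b(3)[OF that] v] by simp
  note L = Der_inc_lin[OF V d]
  have "d (inc V v) = d (inc V (\<Oplus>\<^bsub>V\<^esub>b\<in>B. \<beta> b v *[V] b))"
   by (rule arg_cong[where f = "%v. d (inc V v)", OF b(4)[OF v]])
  also have "... = (\<Oplus>\<^bsub>\<A> V\<^esub>b\<in>B. d (inc V (\<beta> b v *[V] b)))"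
   by (rule lin_finsum[OF V FA_module[OF V] L b(1)]) (use bR b(2) V in simp)
  also have "... = (\<Oplus>\<^bsub>\<A> V\<^esub>b\<in>B. rk V (d (inc V b)) (\<beta> b) (inc V v))"
  proof (rule mod_finsum_cong[OF FA_module[OF V] refl])
   fix c assume c: "c : B"
   have "d (inc V (\<beta> c v *[V] c)) = \<beta> c v *[\<A> V] d (inc V c)"
    by (rule lin_smult[OF L bR[OF c] b(2)[OF c]])
   then show "d (inc V (\<beta> c v *[V] c)) = rk V (d (inc V c)) (\<beta> c) (inc V v)"
    using rk(2)[OF V b(3)[OF c] db[OF c] v] by simp
   show "rk V (d (inc V c)) (\<beta> c) (inc V v) : \<AA> V" by (rule Der_inc_mem[OF V rb[OF c] v])
  qed
  also have "... = (\<Oplus>\<^bsub>\<D> V\<^esub>b\<in>B. rk V (d (inc V b)) (\<beta> b)) (inc V v)"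
   by (rule Der_finsum_ev[OF V b(1) rb inc_closed[OF V v], symmetric])
  finally show "d (inc V v) = (\<Oplus>\<^bsub>\<D> V\<^esub>b\<in>B. rk V (d (inc V b)) (\<beta> b)) (inc V v)" .
 qed
qed

subsection \<open>Positive degree\<close>

text \<open>\<open>Der_plus\<close> and \<open>Der_pt_plus\<close> are spanned by their graded pieces. A single submodule of values, spanned by the
 words with at least two letters, describes both; see \<open>Der_plus_iff\<close> and \<open>Der_pt_plus_iff\<close>.\<close>

definition fpos :: "('r, 'v) module => ('r, 'o, 'v) fa set" where
 "fpos V = mspan R (\<A> V) {el V \<mu> vs | \<mu> vs. (\<mu>, vs) : wd V & 2 <= length vs}"

lemma fpos_submodule: "module R V ==> submodule (fpos V) R (\<A> V)"
 unfolding fpos_def by (rule mspan_submodule[OF FA_module fa_deg_gen])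

lemma fpos_carrier: "module R V ==> x : fpos V ==> x : \<AA> V"
 using sub_carrier[OF fpos_submodule] by blast

lemma fpos_el: "(\<mu>, vs) : wd V ==> 2 <= length vs ==> el V \<mu> vs : fpos V"
 unfolding fpos_def by (rule mspan_base) blast

lemma fpos_lin:
 assumes V: "module R V" and N: "module R N" and L: "is_lin (\<A> V) N f" and H: "submodule H R N"
  and g: "!!\<mu> vs. (\<mu>, vs) : wd V ==> 2 <= length vs ==> f (el V \<mu> vs) : H" and x: "x : fpos V"
 shows "f x : H"
 by (rule lin_mspan_into[OF FA_module[OF V] N L fa_deg_gen[OF V] H _ x[unfolded fpos_def]]) (use g in blast)

lemma fm_fpos: "module R V ==> module R W ==> is_lin V W j ==> x : fpos V ==> fm V W j x : fpos W"
 by (rule fpos_lin[OF _ FA_module fm_lin fpos_submodule]) (simp_all add: fm_el fpos_el wd_map)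

lemma Der_plus_submodule: "module R V ==> submodule (Der_plus R P V) R (\<D> V)"
 unfolding Der_plus_def by (rule mspan_submodule[OF Der_module]) (auto simp: Der_deg_def)

lemma Der_plus_carrier: "module R V ==> d : Der_plus R P V ==> d : \<DD> V"
 using sub_carrier[OF Der_plus_submodule] by blast

lemma fa_deg_fpos:
 assumes V: "module R V" and n: "2 <= n" shows "fa_deg R P V n <= fpos V"
 unfolding fa_deg_def by (rule mspan_least[OF fpos_submodule[OF V]]) (use n fpos_el in blast)

lemma Der_plus_fpos:
 assumes V: "module R V" and d: "d : Der_plus R P V" and v: "v : \<U> V"
 shows "d (inc V v) : fpos V"
proof (rule lin_mspan_into[OF Der_module[OF V] FA_module[OF V] Der_ev_lin[OF inc_closed[OF V v]] _ fpos_submodule[OF V] _ d[unfolded Der_plus_def]])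
 show "(\<Union>n\<in>{1..}. Der_deg R P V n) <= \<DD> V" by (auto simp: Der_deg_def)
 fix s assume "s : (\<Union>n\<in>{1..}. Der_deg R P V n)"
 then obtain n where n: "1 <= n" "s : Der_deg R P V n" by auto
 then have "s (inc V v) : fa_deg R P V (n + 1)" using v by (simp add: Der_deg_def)
 then show "s (inc V v) : fpos V" using fa_deg_fpos[OF V, of "n + 1"] n(1) by auto
qed

lemma rk_deg:
 assumes V: "module R V" and f: "is_lin V \<R> f" and x: "x : fa_deg R P V (n + 1)"
 shows "rk V x f : Der_deg R P V n"
proof -
 note sub = fa_deg_submodule[OF V, of "n + 1"]
 note r = rk[OF V f sub_carrier[OF sub x]]
 show ?thesis using r lin_closed[OF f] sub_smult[OF sub _ x] by (simp add: Der_deg_def)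
qed

lemma rk_plus:
 assumes V: "module R V" and f: "is_lin V \<R> f" and x: "x : fpos V"
 shows "rk V x f : Der_plus R P V"
proof (rule fpos_lin[OF V Der_module[OF V] rk_lin[OF V f] Der_plus_submodule[OF V] _ x])
 fix \<mu> vs assume w: "(\<mu>, vs) : wd V" "2 <= length vs"
 have "el V \<mu> vs : fa_deg R P V ((length vs - 1) + 1)"
  unfolding fa_deg_def by (rule mspan_base) (use w in force)
 then have "rk V (el V \<mu> vs) f : Der_deg R P V (length vs - 1)" by (rule rk_deg[OF V f])
 then show "rk V (el V \<mu> vs) f : Der_plus R P V"
  unfolding Der_plus_def using w(2) by (intro mspan_base) (auto intro!: bexI[of _ "length vs - 1"])
qed

lemma Der_plus_iff:
 assumes V: "SR_obj R V"
 shows "d : Der_plus R P V \<longleftrightarrow> d : \<DD> V & (ALL v:\<U> V. d (inc V v) : fpos V)"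
proof
 note M = SR_obj_module[OF V]
 show "d : \<DD> V & (ALL v:\<U> V. d (inc V v) : fpos V)" if "d : Der_plus R P V"
  using that Der_plus_carrier[OF M] Der_plus_fpos[OF M] by blast
 assume d: "d : \<DD> V & (ALL v:\<U> V. d (inc V v) : fpos V)"
 obtain B \<beta> where B: "dual_basis V B \<beta>" using SR_obj_basis[OF V] .
 have S: "(\<Oplus>\<^bsub>\<D> V\<^esub>b\<in>B. rk V (d (inc V b)) (\<beta> b)) : Der_plus R P V"
  by (rule sub_finsum[OF Der_module[OF M] Der_plus_submodule[OF M]], rule rk_plus[OF M])
   (use B d in \<open>auto simp: dual_basis_def\<close>)
 then show "d : Der_plus R P V" using Der_rk_sum[OF M B] d by simp
qed

lemma act_fpos:
 assumes V: "module R V" and m: "\<mu> : \<OO> (Suc (length as + length bs))"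
  and ab: "set as <= \<U> V" "set bs <= \<U> V" and x: "x : fpos V"
 shows "act V \<mu> (map (inc V) as @ x # map (inc V) bs) : fpos V"
proof (rule fpos_lin[OF V FA_module[OF V] multilinD[OF act_multilin[OF V m]] fpos_submodule[OF V] _ x])
 show "set (map (inc V) as) <= \<AA> V" "set (map (inc V) bs) <= \<AA> V"
  using incs_closed[OF V] ab by simp_all
 fix \<nu> us assume w: "(\<nu>, us) : wd V" "2 <= length us"
 let ?o = "map (%v. (op_one P, [v]))"
 let ?B = "?o as @ (\<nu>, us) # ?o bs"
 have B: "set ?B <= wd V" using w ab by (auto intro!: inc_wd)
 have mB: "\<mu> : \<OO> (length ?B)" using m by simp
 have e: "map (inc V) as @ el V \<nu> us # map (inc V) bs = map (%(\<nu>, us). el V \<nu> us) ?B" by (simp add: fa_inc_def)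
 show "act V \<mu> (map (inc V) as @ el V \<nu> us # map (inc V) bs) : fpos V"
  unfolding e act_els2[OF V B mB] by (rule fpos_el[OF wd_comp[OF B mB]]) (use w(2) in simp)
qed simp

lemma list_updates:
 "i < length vs ==> (map g vs)[i := x] = map g (take i vs) @ x # map g (drop (Suc i) vs)"
 by (simp add: upd_conv_take_nth_drop take_map drop_map)

text \<open>Each term of the Leibniz rule applies an operation to generators and one value \<open>d v\<close>, and substituting an
 element of positive degree into an operation leaves the degree positive.\<close>

lemma Der_plus_into_fpos:
 assumes V: "module R V" and d: "d : \<DD> V" and dp: "!!v. v : \<U> V ==> d (inc V v) : fpos V"
  and X: "X : \<AA> V"
 shows "d X : fpos V"
proof (rule lin_mspan_into[OF FA_module[OF V] FA_module[OF V] Der_lin[OF d] els_carrier[OF V] fpos_submodule[OF V]])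
 show "X : mspan R (\<A> V) (els V)" using X by (simp add: FA_span[OF V])
 fix s assume "s : els V"
 then obtain \<mu> vs where s: "s = el V \<mu> vs" and w: "(\<mu>, vs) : wd V" by (auto simp: els_def)
 have vs: "set vs <= \<U> V" "\<mu> : \<OO> (length vs)" using w by (simp_all add: wd_iff)
 have e: "d (el V \<mu> vs) = posum (\<A> V) (act V \<mu>) (%v. inc V v) (%v. d (inc V v)) vs"
  by (rule along_el[OF V V inc_closed[OF V] Der_along[OF d] w])
 show "d s : fpos V" unfolding s e posum_def
 proof (rule sub_finsum[OF FA_module[OF V] fpos_submodule[OF V]])
  fix i assume "i : {..<length vs}"
  then have i: "i < length vs" by simp
  show "act V \<mu> ((map (%v. inc V v) vs)[i := d (inc V (vs ! i))]) : fpos V"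
   unfolding list_updates[OF i]
  proof (rule act_fpos[OF V])
   have "Suc (length (take i vs) + length (drop (Suc i) vs)) = length vs" using i by simp
   then show "\<mu> : \<U> (Op (Suc (length (take i vs) + length (drop (Suc i) vs))))" using vs(2) by (simp only:)
   show "set (take i vs) <= \<U> V" "set (drop (Suc i) vs) <= \<U> V"
    using vs(1) by (auto dest!: in_set_takeD in_set_dropD)
   show "d (inc V (vs ! i)) : fpos V" by (rule dp) (use vs(1) nth_mem[OF i] in blast)
  qed
 qed
qed

lemma pl_plus:
 assumes V: "SR_obj R V" and d: "d : Der_plus R P V" and e: "e : Der_plus R P V"
 shows "pl V d e : Der_plus R P V"
proof -
 note M = SR_obj_module[OF V]
 note dc = Der_plus_carrier[OF M d] and ec = Der_plus_carrier[OF M e]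
 show ?thesis unfolding Der_plus_iff[OF V]
  using pl[OF M dc ec] Der_plus_into_fpos[OF M ec Der_plus_fpos[OF M e]] Der_inc_mem[OF M dc] by simp
qed

lemma L1_plus:
 assumes V: "SR_obj R V" shows "L1 V <= Der_plus R P V"
proof -
 note M = SR_obj_module[OF V]
 note sub = Der_plus_submodule[OF M]
 show ?thesis
 proof (rule L1_least[OF sub])
  show "Der_deg R P V 1 <= Der_plus R P V" 
   unfolding Der_plus_def by (rule subsetI, rule mspan_base, rule UN_I[of 1]) simp_all
  show "br V d e : Der_plus R P V" if "d : Der_plus R P V" "e : Der_plus R P V" for d e
   unfolding der_bracket_def by (intro sub_minus[OF Der_module[OF M] sub] pl_plus[OF V] that)
 qed
qed

lemma Fm_plus:
 assumes V: "module R V" and W: "SR_obj R W" and m: "(i, r) : SR_hom R V W" and d: "d : Der_plus R P V"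
 shows "Fm V W (i, r) d : Der_plus R P W"
proof -
 note M = SR_obj_module[OF W]
 note dc = Der_plus_carrier[OF V d]
 show ?thesis unfolding Der_plus_iff[OF W]
  using Fm[OF V M m dc] fm_fpos[OF V M SR_homD(1)[OF m]] Der_plus_fpos[OF V d] lin_closed[OF SR_homD(2)[OF m]] by simp
qed

lemma Fm_rk:
 assumes V: "module R V" and W: "module R W" and m: "(i, r) : SR_hom R V W" and f: "is_lin V \<R> f"
  and x: "x : \<AA> V"
 shows "Fm V W (i, r) (rk V x f) = rk W (fm V W i x) (%w. f (r w))"
proof (rule Der_eqI[OF W])
 note ir = SR_homD[OF m] and R1 = rk[OF V f x]
 note fr = lin_comp[OF ir(2) f] and ix = fm_closed[OF V W ir(1) x]
 show "Fm V W (i, r) (rk V x f) : \<DD> W" "rk W (fm V W i x) (%w. f (r w)) : \<DD> W"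
  by (rule Fm(1)[OF V W m R1(1)], rule rk(1)[OF W fr ix])
 fix w assume w: "w : \<U> W"
 note rw = lin_closed[OF ir(2) w]
 show "Fm V W (i, r) (rk V x f) (inc W w) = rk W (fm V W i x) (%w. f (r w)) (inc W w)"
  unfolding Fm(2)[OF V W m R1(1) w] rk(2)[OF W fr ix w] R1(2)[OF rw]
  by (rule lin_smult[OF fm_lin[OF V W ir(1)] _ x]) (use lin_closed[OF f rw] in simp)
qed

section \<open>Pointed derivations\<close>

abbreviation "RP V \<equiv> R_plus R V"
abbreviation "u0 V \<equiv> inc (RP V) (\<one>, 0[V])"
abbreviation "LV V \<equiv> fa_lin R P V \<R>"

lemma RP_module: "module R V ==> module R (RP V)" by simp

lemma u0_closed: "module R V ==> u0 V : \<AA> (RP V)"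
 by (rule inc_closed) simp_all

definition lin_word :: "('r, 'v) module => ('r, 'w) module => 'v list => 'w => ('w \<times> 'v) list" where
 "lin_word V W vs w = map (%v. (0[W], v)) vs @ [(w, 0[V])]"

lemma fa_lin_alt: "fa_lin R P V W = mspan R (\<A> (dsum W V)) {el (dsum W V) \<mu> (lin_word V W vs w) | \<mu> vs w.
  \<mu> : \<OO> (length vs + 1) & set vs <= \<U> V & w : \<U> W}"
 by (simp add: fa_lin_def lin_word_def)

lemma lin_word_wd: "module R V ==> module R W ==> \<mu> : \<OO> (length vs + 1) ==> set vs <= \<U> V ==>
  w : \<U> W ==> (\<mu>, lin_word V W vs w) : wd (dsum W V)"
 by (auto simp: wd_iff lin_word_def)

lemma fa_lin_gen: "module R V ==> module R W ==> {el (dsum W V) \<mu> (lin_word V W vs w) | \<mu> vs w.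
  \<mu> : \<OO> (length vs + 1) & set vs <= \<U> V & w : \<U> W} <= \<AA> (dsum W V)"
proof
 fix x assume V: "module R V" and W: "module R W" and "x : {el (dsum W V) \<mu> (lin_word V W vs w) | \<mu> vs w.
  \<mu> : \<OO> (length vs + 1) & set vs <= \<U> V & w : \<U> W}"
 then obtain \<mu> vs w where "x = el (dsum W V) \<mu> (lin_word V W vs w)"
  "\<mu> : \<OO> (length vs + 1)" "set vs <= \<U> V" "w : \<U> W" by blast
 then show "x : \<AA> (dsum W V)" using el_closed[OF dsum_module[OF W V] lin_word_wd[OF V W]] by simp
qed

lemma fa_lin_submodule: "module R V ==> module R W ==> submodule (fa_lin R P V W) R (\<A> (dsum W V))"
 unfolding fa_lin_alt by (rule mspan_submodule[OF FA_module[OF dsum_module] fa_lin_gen])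

lemma fa_lin_el: "\<mu> : \<OO> (length vs + 1) ==> set vs <= \<U> V ==> w : \<U> W ==>
  el (dsum W V) \<mu> (lin_word V W vs w) : fa_lin R P V W"
 unfolding fa_lin_alt by (rule mspan_base) blast

lemma fa_lin_into:
 assumes V: "module R V" and W: "module R W" and N: "module R N" and L: "is_lin (\<A> (dsum W V)) N f" and H: "submodule H R N"
  and g: "!!\<mu> vs w. \<mu> : \<OO> (length vs + 1) ==> set vs <= \<U> V ==> w : \<U> W ==>
   f (el (dsum W V) \<mu> (lin_word V W vs w)) : H"
  and x: "x : fa_lin R P V W"
 shows "f x : H"
 by (rule lin_mspan_into[OF FA_module[OF dsum_module[OF W V]] N L fa_lin_gen[OF V W] H _ x[unfolded fa_lin_alt]]) (use g in blast)

lemma fa_lin_eq: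
 assumes V: "module R V" and W: "module R W" and N: "module R N" and L: "is_lin (\<A> (dsum W V)) N f" "is_lin (\<A> (dsum W V)) N f'"
  and g: "!!\<mu> vs w. \<mu> : \<OO> (length vs + 1) ==> set vs <= \<U> V ==> w : \<U> W ==>
   f (el (dsum W V) \<mu> (lin_word V W vs w)) = f' (el (dsum W V) \<mu> (lin_word V W vs w))"
  and x: "x : fa_lin R P V W"
 shows "f x = f' x"
 by (rule lin_eq_on_mspan[OF FA_module[OF dsum_module[OF W V]] N L fa_lin_gen[OF V W] _ x[unfolded fa_lin_alt]]) (use g in blast)

text \<open>The symmetric group action moves the linear argument to the last position, where \<open>lin_word\<close> has it.\<close>

lemma fa_lin_el_mid:
 assumes V: "module R V" and W: "module R W" and m: "\<mu> : \<OO> (Suc (length as + length bs))"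
  and ab: "set as <= \<U> V" "set bs <= \<U> V" and w: "w : \<U> W"
 shows "el (dsum W V) \<mu> (map (%v. (0[W], v)) as @ (w, 0[V]) # map (%v. (0[W], v)) bs) : fa_lin R P V W"
proof -
 let ?xs = "map (%v. (0[W], v)) as @ (w, 0[V]) # map (%v. (0[W], v)) bs"
 have "mset (lin_word V W (as @ bs) w) = mset ?xs" by (simp add: lin_word_def)
 then obtain \<sigma> where s: "\<sigma> permutes {..<length ?xs}" "permute_list \<sigma> ?xs = lin_word V W (as @ bs) w"
  by (rule mset_eq_permutation)
 have wx: "(\<mu>, ?xs) : wd (dsum W V)" using m ab w V W by (auto simp: wd_iff)
 have ms: "op_act P (length ?xs) \<mu> \<sigma> : \<OO> (length (as @ bs) + 1)"
  using wd_permute[OF wx s(1)] by (simp add: wd_iff)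
 have "el (dsum W V) \<mu> ?xs = el (dsum W V) (op_act P (length ?xs) \<mu> \<sigma>) (lin_word V W (as @ bs) w)"
  using el_sym[OF dsum_module[OF W V] wx s(1)] s(2) by simp
 also have "... : fa_lin R P V W" by (rule fa_lin_el[OF ms _ w]) (use ab in simp)
 finally show ?thesis .
qed

text \<open>If a derivation along \<open>h\<close> kills all but the last argument, then the Leibniz rule has one term.\<close>

lemma along_last:
 assumes V: "module R V" and W: "module R W" and h: "!!v. v : \<U> V ==> h (inc V v) : \<AA> W"
  and E: "along V W h E" and w: "(\<mu>, vs @ [v]) : wd V" and z: "!!u. u : set vs ==> E (inc V u) = 0[\<A> W]"
 shows "E (el V \<mu> (vs @ [v])) = act W \<mu> (map (%v. h (inc V v)) vs @ [E (inc V v)])"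
proof -
 let ?h = "%v. h (inc V v)" and ?E = "%v. E (inc V v)"
 have vs: "set vs <= \<U> V" "v : \<U> V" "\<mu> : \<OO> (Suc (length vs))" using w by (simp_all add: wd_iff)
 have Ec: "?E v : \<AA> W" if "v : \<U> V" for v using lin_closed[OF along_lin[OF E] inc_closed[OF V that]] .
 have ok: "posum_ok (\<A> W) (\<A> W) (act W \<mu>) ?h ?E (vs @ [v])"
  by (rule act_posum_ok[OF W]) (use vs h Ec in auto)
 have hc: "set (map ?h vs) <= \<AA> W" using vs h by auto
 have ok1: "posum_ok (\<A> W) (\<A> W) (%zs. act W \<mu> (zs @ [?h v])) ?h ?E vs"
  by (rule posum_okI[OF FA_module[OF W] act_mem[OF W]]) (use vs h Ec in auto)
 have ok2: "posum_ok (\<A> W) (\<A> W) (%zs. act W \<mu> (map ?h vs @ zs)) ?h ?E [v]"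
  by (rule posum_okI[OF FA_module[OF W] act_mem[OF W]]) (use vs h Ec hc in auto)
 have ml: "multilin (length vs) (\<A> W) (\<A> W) (%zs. act W \<mu> ([] @ zs @ [?h v]))"
  by (rule multilin_context[OF act_multilin[OF W vs(3)]]) (use vs h in simp_all)
 have ml': "multilin (length vs) (\<A> W) (\<A> W) (%zs. act W \<mu> (zs @ [?h v]))" using ml by simp
 have p0: "posum (\<A> W) (%zs. act W \<mu> (zs @ [?h v])) ?h ?E vs = 0[\<A> W]"
  by (rule posum_zero[OF ok1 FA_module[OF W] ml' z])
 have "E (el V \<mu> (vs @ [v])) = posum (\<A> W) (act W \<mu>) ?h ?E (vs @ [v])"
  by (rule along_el[OF V W h E w])
 also have "... = posum (\<A> W) (%zs. act W \<mu> (map ?h vs @ zs)) ?h ?E [v]"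
  unfolding posum_append[OF ok] using p0 posum_closed[OF ok2] W by simp
 also have "... = act W \<mu> (map ?h vs @ [?E v])"
  unfolding posum_Cons[OF ok2] using W act_mem[OF W, of \<mu> "map ?h vs @ [?E v]"] vs hc Ec by simp
 finally show ?thesis .
qed

subsection \<open>Values of pointed derivations\<close>

lemma LV_carrier: "module R V ==> y : LV V ==> y : \<AA> (RP V)"
 using sub_carrier[OF fa_lin_submodule[OF _ reg_module]] by blast

abbreviation "pt V \<equiv> pt_der R P V"

text \<open>A pointed derivation is determined by its value at the linear variable \<open>u0 V\<close>; most statements below are about
 this value.\<close>

lemma Der_pt_iff:
 assumes V: "module R V"
 shows "D : Der_pt R P V \<longleftrightarrow> D : \<DD> (RP V) & D (u0 V) : LV V &
  (ALL a:\<U> R. ALL v:\<U> V. D (inc (RP V) (a, v)) = a *[\<A> (RP V)] D (u0 V))"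
proof
 assume "D : Der_pt R P V"
 then obtain g where D: "D : \<DD> (RP V)" and g: "g : lin_hom R \<R> (fa_lin_mod R P V \<R>)"
  and Dg: "!!a v. a : \<U> R ==> v : \<U> V ==> D (inc (RP V) (a, v)) = g a"
  unfolding Der_pt_def by blast
 note gl = lin_hom_lin[OF g]
 have u: "D (u0 V) = g \<one>" using Dg[of \<one> "0[V]"] V by simp
 have ga: "g a = a *[\<A> (RP V)] g \<one>" if "a : \<U> R" for a
  using lin_smult[OF gl that, of \<one>] that by (simp add: fa_lin_mod_def)
 have "D (inc (RP V) (a, v)) = a *[\<A> (RP V)] D (u0 V)" if "a : \<U> R" "v : \<U> V" for a v
  unfolding u Dg[OF that] by (rule ga[OF that(1)])
 moreover have "D (u0 V) : LV V" unfolding u using lin_closed[OF gl, of \<one>] by (simp add: fa_lin_mod_def)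
 ultimately show "D : \<DD> (RP V) & D (u0 V) : LV V &
  (ALL a:\<U> R. ALL v:\<U> V. D (inc (RP V) (a, v)) = a *[\<A> (RP V)] D (u0 V))"
  using D by blast
next
 assume D: "D : \<DD> (RP V) & D (u0 V) : LV V &
  (ALL a:\<U> R. ALL v:\<U> V. D (inc (RP V) (a, v)) = a *[\<A> (RP V)] D (u0 V))"
 let ?y = "D (u0 V)"
 note sub = fa_lin_submodule[OF V reg_module]
 have y: "?y : \<AA> (RP V)" using LV_carrier[OF V] D by blast
 have l: "is_lin \<R> (fa_lin_mod R P V \<R>) (%a. a *[\<A> (RP V)] ?y)"
  unfolding fa_lin_mod_def
  by (rule lin_sub_codomain[OF lin_smult_elem[OF FA_module[OF RP_module[OF V]] y]]) (use D sub_smult[OF sub] in simp)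
 have "(\<lambda>a\<in>carrier \<R>. a *[\<A> (RP V)] ?y) : lin_hom R \<R> (fa_lin_mod R P V \<R>)"
  by (rule lin_restrict[OF reg_module l])
 moreover have "ALL a:\<U> R. ALL v:\<U> V. D (inc (RP V) (a, v)) = (\<lambda>a\<in>carrier \<R>. a *[\<A> (RP V)] ?y) a"
  using D by simp
 ultimately show "D : Der_pt R P V" unfolding Der_pt_def using D by blast
qed

lemma Der_ptD:
 assumes V: "module R V" and D: "D : Der_pt R P V"
 shows "D : \<DD> (RP V)" "D (u0 V) : LV V" "D (u0 V) : \<AA> (RP V)"
  "a : \<U> R ==> v : \<U> V ==> D (inc (RP V) (a, v)) = a *[\<A> (RP V)] D (u0 V)"
proof -
 note d = D[unfolded Der_pt_iff[OF V]]
 show "D : \<DD> (RP V)" using d by (rule conjunct1)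
 show u: "D (u0 V) : LV V" by (rule d[THEN conjunct2, THEN conjunct1])
 show "D (u0 V) : \<AA> (RP V)" by (rule LV_carrier[OF V u])
 show "a : \<U> R ==> v : \<U> V ==> D (inc (RP V) (a, v)) = a *[\<A> (RP V)] D (u0 V)"
  by (rule bspec[OF bspec[OF d[THEN conjunct2, THEN conjunct2]]])
qed

lemma pt_lin:
 assumes V: "module R V" and y: "y : \<AA> (RP V)"
 shows "is_lin (RP V) (\<A> (RP V)) (%(a, v). a *[\<A> (RP V)] y)"
 using lin_comp[OF lin_fst lin_smult_elem[OF FA_module[OF RP_module[OF V]] y], of V] by (simp add: case_prod_beta')

lemma pt_D:
 assumes V: "module R V" and y: "y : \<AA> (RP V)"
 shows "pt V y : \<DD> (RP V)"
  "a : \<U> R ==> v : \<U> V ==> pt V y (inc (RP V) (a, v)) = a *[\<A> (RP V)] y"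
 using der_ext[OF RP_module[OF V] pt_lin[OF V y]] by (simp_all add: pt_der_def)

lemma pt_u0: "module R V ==> y : \<AA> (RP V) ==> pt V y (u0 V) = y"
 using pt_D(2)[of V y \<one> "0[V]"] by simp

lemma pt_mem:
 assumes V: "module R V" and y: "y : LV V" shows "pt V y : Der_pt R P V"
 unfolding Der_pt_iff[OF V] pt_u0[OF V LV_carrier[OF V y]]
 using pt_D[OF V LV_carrier[OF V y]] y by blast

lemma Der_pt_eqI:
 assumes V: "module R V" and D: "D : Der_pt R P V" and E: "E : Der_pt R P V" and e: "D (u0 V) = E (u0 V)"
 shows "D = E"
proof (rule Der_eqI[OF RP_module[OF V] Der_ptD(1)[OF V D] Der_ptD(1)[OF V E]])
 fix p assume "p : \<U> (RP V)"
 then obtain a v where p: "p = (a, v)" "a : \<U> R" "v : \<U> V" by auto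
 show "D (inc (RP V) p) = E (inc (RP V) p)"
  unfolding p(1) Der_ptD(4)[OF V D p(2,3)] Der_ptD(4)[OF V E p(2,3)] e ..
qed

lemma pt_of_u0: "module R V ==> D : Der_pt R P V ==> pt V (D (u0 V)) = D"
 by (rule Der_pt_eqI[OF _ pt_mem]) (simp_all add: Der_ptD(2) pt_u0 Der_ptD(3))

lemma Der_pt_submodule:
 assumes V: "module R V" shows "submodule (Der_pt R P V) R (\<D> (RP V))"
proof (rule submoduleI2[OF Der_module[OF RP_module[OF V]]])
 let ?A = "\<A> (RP V)"
 note sub = fa_lin_submodule[OF V reg_module] and RV = RP_module[OF V]
 interpret N: module R ?A using RV by simp
 have i: "inc (RP V) (a, v) : carrier ?A" if "a : \<U> R" "v : \<U> V" for a v
  by (rule inc_closed[OF RV]) (use that in simp)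
 note u = u0_closed[OF V]
 show "Der_pt R P V <= \<DD> (RP V)" by (auto simp: Der_pt_def)
 show "0[\<D> (RP V)] : Der_pt R P V"
  unfolding Der_pt_iff[OF V] using mod_zero[OF Der_module[OF RV]] RV i u sub_zero[OF sub] by (simp add: Der_sel(3))
 show "x +[\<D> (RP V)] y : Der_pt R P V" if x: "x : Der_pt R P V" and y: "y : Der_pt R P V" for x y
 proof -
  note x' = Der_ptD[OF V x] and y' = Der_ptD[OF V y]
  show ?thesis
   unfolding Der_pt_iff[OF V] Der_plus_ev[OF u]
  proof (intro conjI ballI)
   show "x +[\<D> (RP V)] y : \<DD> (RP V)" by (rule mod_add[OF Der_module[OF RV] x'(1) y'(1)])
   show "x (u0 V) +[?A] y (u0 V) : LV V" by (rule sub_add[OF sub x'(2) y'(2)])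
   fix a v assume av: "a : \<U> R" "v : \<U> V"
   show "(x +[\<D> (RP V)] y) (inc (RP V) (a, v)) = a *[?A] (x (u0 V) +[?A] y (u0 V))"
    unfolding Der_plus_ev[OF i[OF av]] x'(4)[OF av] y'(4)[OF av]
    by (rule N.smult_r_distr[OF av(1) x'(3) y'(3), symmetric])
  qed
 qed
 show "a *[\<D> (RP V)] x : Der_pt R P V" if a: "a : \<U> R" and x: "x : Der_pt R P V" for a x
 proof -
  note x' = Der_ptD[OF V x]
  show ?thesis
   unfolding Der_pt_iff[OF V] Der_smult_ev[OF u]
  proof (intro conjI ballI)
   show "a *[\<D> (RP V)] x : \<DD> (RP V)" by (rule mod_smult[OF Der_module[OF RV] a x'(1)])
   show "a *[?A] x (u0 V) : LV V" by (rule sub_smult[OF sub a x'(2)])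
   fix b v assume bv: "b : \<U> R" "v : \<U> V"
   show "(a *[\<D> (RP V)] x) (inc (RP V) (b, v)) = b *[?A] (a *[?A] x (u0 V))"
    unfolding Der_smult_ev[OF i[OF bv]] x'(4)[OF bv]
    by (rule mod_smult_comm[OF FA_module[OF RV] a bv(1) x'(3)])
  qed
 qed
qed

lemma pt_lin_map:
 assumes V: "module R V" shows "is_lin (\<A> (RP V)) (\<D> (RP V)) (pt V)"
proof -
 have "pt V y = rk (RP V) y fst" for y by (simp add: pt_der_def rk_def case_prod_beta')
 then have "pt V = (%y. rk (RP V) y fst)" by blast
 then show ?thesis using rk_lin[OF RP_module[OF V] lin_fst[of \<R> V]] by simp
qed

text \<open>A pointed derivation acts on \<open>LV V\<close> by substitution into the linear variable.\<close>

lemma Der_pt_word: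
 assumes V: "module R V" and D: "D : Der_pt R P V" and m: "\<mu> : \<OO> (length vs + 1)"
  and vs: "set vs <= \<U> V" and a: "a : \<U> R"
 shows "D (el (RP V) \<mu> (lin_word V \<R> vs a)) =
  act (RP V) \<mu> (map (%v. inc (RP V) (\<zero>, v)) vs @ [a *[\<A> (RP V)] D (u0 V)])"
proof -
 note D' = Der_ptD[OF V D]
 have zz: "D (inc (RP V) (\<zero>, v)) = 0[\<A> (RP V)]" if "v : \<U> V" for v
  unfolding D'(4)[OF zero_closed that] by (rule mod_smult_l_null[OF FA_module[OF RP_module[OF V]] D'(3)])
 have Vz: "0[V] : \<U> V" by (rule mod_zero[OF V])
 have w: "(\<mu>, map (%v. (\<zero>, v)) vs @ [(a, 0[V])]) : wd (RP V)"
  using lin_word_wd[OF V reg_module m vs, of a] a by (simp add: lin_word_def)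
 have "D (el (RP V) \<mu> (map (%v. (\<zero>, v)) vs @ [(a, 0[V])])) =
  act (RP V) \<mu> (map (%p. inc (RP V) p) (map (%v. (\<zero>, v)) vs) @ [D (inc (RP V) (a, 0[V]))])"
  by (rule along_last[OF RP_module[OF V] RP_module[OF V] inc_closed[OF RP_module[OF V]] Der_along[OF D'(1)] w])
   (use vs zz in auto)
 then show ?thesis unfolding D'(4)[OF a Vz] by (simp add: lin_word_def comp_def)
qed

lemma act_LV:
 assumes V: "module R V" and m: "\<mu> : \<OO> (length vs + 1)" and vs: "set vs <= \<U> V" and y: "y : LV V"
 shows "act (RP V) \<mu> (map (%v. inc (RP V) (\<zero>, v)) vs @ [y]) : LV V"
proof -
 note RV = RP_module[OF V]
 have ic: "set (map (%v. inc (RP V) (\<zero>, v)) vs) <= \<AA> (RP V)"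
  using vs by (auto intro!: inc_closed[OF RV])
 have L: "is_lin (\<A> (RP V)) (\<A> (RP V)) (%y. act (RP V) \<mu> (map (%v. inc (RP V) (\<zero>, v)) vs @ y # []))"
  by (rule multilinD[OF act_multilin[OF RV m] _ ic]) simp_all
 show ?thesis
 proof (rule fa_lin_into[OF V reg_module FA_module[OF RV] L fa_lin_submodule[OF V reg_module] _ y])
  fix \<nu> us a assume n: "\<nu> : \<OO> (length us + 1)" "set us <= \<U> V" "a : carrier \<R>"
  let ?B = "map (%v. (op_one P, [(\<zero>, v)])) vs @ [(\<nu>, lin_word V \<R> us a)]"
  have B: "set ?B <= wd (RP V)" using vs lin_word_wd[OF V reg_module n] by (auto intro!: inc_wd)
  have mB: "\<mu> : \<OO> (length ?B)" using m by simp
  have e: "map (%v. inc (RP V) (\<zero>, v)) vs @ [el (RP V) \<nu> (lin_word V \<R> us a)] = map (%(\<nu>, us). el (RP V) \<nu> us) ?B"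
   by (simp add: fa_inc_def)
  have c: "concat (map snd ?B) = lin_word V \<R> (vs @ us) a" by (simp add: lin_word_def comp_def)
  have cm: "op_comp P (map (length o snd) ?B) \<mu> (map fst ?B) : \<OO> (length (vs @ us) + 1)"
   using wd_comp[OF B mB] unfolding c by (simp add: wd_iff lin_word_def)
  show "act (RP V) \<mu> (map (%v. inc (RP V) (\<zero>, v)) vs @ [el (RP V) \<nu> (lin_word V \<R> us a)]) : LV V"
   unfolding e act_els2[OF RV B mB] c by (rule fa_lin_el[OF cm]) (use vs n in simp_all)
 qed
qed

lemma Der_pt_LV:
 assumes V: "module R V" and D: "D : Der_pt R P V" and y: "y : LV V" shows "D y : LV V"
proof -
 note D' = Der_ptD[OF V D]
 note RV = RP_module[OF V] and sub = fa_lin_submodule[OF V reg_module]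
 show ?thesis
 proof (rule fa_lin_into[OF V reg_module FA_module[OF RV] Der_lin[OF D'(1)] sub _ y])
  fix \<mu> vs a assume m: "\<mu> : \<OO> (length vs + 1)" "set vs <= \<U> V" "a : carrier \<R>"
  have a: "a : \<U> R" using m(3) by simp
  show "D (el (RP V) \<mu> (lin_word V \<R> vs a)) : LV V"
   unfolding Der_pt_word[OF V D m(1,2) a] by (rule act_LV[OF V m(1,2) sub_smult[OF sub a D'(2)]])
 qed
qed

text \<open>This is the composition product, in the order in which the preLie product applies its factors.\<close>

lemma pl_pt:
 assumes V: "module R V" and D: "D : Der_pt R P V" and E: "E : Der_pt R P V"
 shows "pl (RP V) D E : Der_pt R P V" "pl (RP V) D E (u0 V) = E (D (u0 V))"
proof -
 note RV = RP_module[OF V]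
 note D' = Der_ptD[OF V D] and E' = Der_ptD(1)[OF V E]
 note p = pl[OF RV D'(1) E']
 have i: "(a, v) : \<U> (RP V)" if "a : \<U> R" "v : \<U> V" for a v using that by simp
 show u: "pl (RP V) D E (u0 V) = E (D (u0 V))" by (rule p(2)) (use V in simp)
 show "pl (RP V) D E : Der_pt R P V"
  unfolding Der_pt_iff[OF V] u
 proof (intro conjI ballI)
  show "pl (RP V) D E : \<DD> (RP V)" by (rule p(1))
  show "E (D (u0 V)) : LV V" by (rule Der_pt_LV[OF V E D'(2)])
  fix a v assume av: "a : \<U> R" "v : \<U> V"
  show "pl (RP V) D E (inc (RP V) (a, v)) = a *[\<A> (RP V)] E (D (u0 V))"
   unfolding p(2)[OF i[OF av]] D'(4)[OF av] by (rule lin_smult[OF Der_lin[OF E'] av(1) D'(3)])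
 qed
qed

section \<open>The map underlying the divergence\<close>

abbreviation "iota V \<equiv> fm V (RP V) (%v. (\<zero>, v))"

text \<open>The derivation of \<open>\<A> (RP V)\<close> that replaces a variable \<open>v\<close> by \<open>f v\<close> times the linear one.\<close>

definition Df :: "('r, 'v) module => ('v => 'r) => ('r, 'o, 'r \<times> 'v) der" where
 "Df V f = rk (RP V) (u0 V) (%p. f (snd p))"

lemma iota_lin: "module R V ==> is_lin V (RP V) (%v. (\<zero>, v))"
 using lin_inr[OF reg_module, of V] by simp

lemma Df:
 assumes V: "module R V" and f: "is_lin V \<R> f"
 shows "Df V f : \<DD> (RP V)"
  "a : \<U> R ==> v : \<U> V ==> Df V f (inc (RP V) (a, v)) = inc (RP V) (f v, 0[V])"
proof -
 note r = rk[OF RP_module[OF V] lin_comp[OF lin_snd f] u0_closed[OF V]]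
 show "Df V f : \<DD> (RP V)" unfolding Df_def by (rule r(1))
 assume av: "a : \<U> R" "v : \<U> V"
 have fv: "f v : \<U> R" using lin_closed[OF f av(2)] by simp
 have "f v *[\<A> (RP V)] u0 V = inc (RP V) (f v *[RP V] (\<one>, 0[V]))"
  by (rule lin_smult[OF inc_lin[OF RP_module[OF V]] fv, symmetric]) (use V in simp)
 then show "Df V f (inc (RP V) (a, v)) = inc (RP V) (f v, 0[V])"
  unfolding Df_def using r(2)[of "(a, v)"] av fv V by simp
qed

lemma Df_iota_along:
 assumes V: "module R V" and f: "is_lin V \<R> f"
 shows "along V (RP V) (iota V) (%x. Df V f (iota V x))"
 by (rule along_fm_pre[OF V RP_module[OF V] RP_module[OF V] iota_lin[OF V] _ Der_along[OF Df(1)[OF V f]]])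

lemma Df_iota_inc:
 assumes V: "module R V" and f: "is_lin V \<R> f" and v: "v : \<U> V"
 shows "Df V f (iota V (inc V v)) = inc (RP V) (f v, 0[V])"
 using fm_inc[OF V RP_module[OF V] iota_lin[OF V] v] Df(2)[OF V f _ v, of \<zero>] by simp

lemma wd_cases:
 assumes "w : wd V"
 obtains \<mu> vs where "w = (\<mu>, vs)" "set vs <= \<U> V" "\<mu> : \<OO> (length vs)"
proof -
 obtain a b where w: "w = (a, b)" by (rule prod.exhaust)
 have "set b <= \<U> V" "a : \<OO> (length b)" using assms w by (simp_all add: wd_iff)
 then show thesis by (rule that[OF w])
qed

lemma delta_dext:
 assumes V: "module R V" and X: "X : \<AA> V"
 shows "fa_delta R P V X = dext V (dsum V V) (%v. (0[V], v)) (%v. inc (dsum V V) (v, 0[V])) X"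
proof -
 let ?W = "dsum V V" and ?N = "\<A> (dsum V V)"
 have W: "module R ?W" and N: "module R ?N" using V by simp_all
 let ?g = "%(\<mu>, vs). \<Oplus>\<^bsub>?N\<^esub>i\<in>{..<length vs}. el ?W \<mu> ((map (%v. (0[V], v)) vs)[i := (vs ! i, 0[V])])"
 let ?k = "%(\<mu>, vs). posum ?N (act ?W \<mu>) (%v. inc ?W (0[V], v)) (%v. inc ?W (v, 0[V])) vs"
 have r: "repr X : \<U> (\<F> V)" by (rule repr_FA(1)[OF V X])
 have e: "?g w = ?k w" "?k w : carrier ?N" if ww: "w : wd V" for w
 proof -
  obtain \<mu> vs where w: "w = (\<mu>, vs)" "set vs <= \<U> V" "\<mu> : \<OO> (length vs)"
   by (rule wd_cases[OF ww])
  have wi: "(\<mu>, (map (%v. (0[V], v)) vs)[i := (vs ! i, 0[V])]) : wd ?W" if "i < length vs" for i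
  proof -
   have "set ((map (%v. (0[V], v)) vs)[i := (vs ! i, 0[V])]) <= insert (vs ! i, 0[V]) (set (map (%v. (0[V], v)) vs))"
    by (rule set_update_subset_insert)
   also have "... <= carrier ?W" using w(2) V nth_mem[OF that] by auto
   finally show ?thesis using w(3) by (simp add: wd_iff)
  qed
  have "(\<Oplus>\<^bsub>?N\<^esub>i\<in>{..<length vs}. el ?W \<mu> ((map (%v. (0[V], v)) vs)[i := (vs ! i, 0[V])]))
   = posum ?N (act ?W \<mu>) (%v. inc ?W (0[V], v)) (%v. inc ?W (v, 0[V])) vs"
   unfolding posum_def
  proof (rule mod_finsum_cong[OF N refl])
   fix i assume "i : {..<length vs}"
   then have i: "i < length vs" by simp
   have "act ?W \<mu> (map (inc ?W) ((map (%v. (0[V], v)) vs)[i := (vs ! i, 0[V])])) = el ?W \<mu> ((map (%v. (0[V], v)) vs)[i := (vs ! i, 0[V])])"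
    by (rule act_incs[OF W wi[OF i]])
   then have ee: "el ?W \<mu> ((map (%v. (0[V], v)) vs)[i := (vs ! i, 0[V])]) =
    act ?W \<mu> ((map (%v. inc ?W (0[V], v)) vs)[i := inc ?W (vs ! i, 0[V])])" by (simp add: map_update comp_def)
   show "el ?W \<mu> ((map (%v. (0[V], v)) vs)[i := (vs ! i, 0[V])]) =
    act ?W \<mu> ((map (%v. inc ?W (0[V], v)) vs)[i := inc ?W (vs ! i, 0[V])])" by (rule ee)
   show "act ?W \<mu> ((map (%v. inc ?W (0[V], v)) vs)[i := inc ?W (vs ! i, 0[V])]) : carrier ?N"
    unfolding ee[symmetric] by (rule el_closed[OF W wi[OF i]])
  qed
  then show "?g w = ?k w" using w(1) by simp
  have "posum_ok ?N ?N (act ?W \<mu>) (%v. inc ?W (0[V], v)) (%v. inc ?W (v, 0[V])) vs"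
   by (rule act_posum_ok[OF W w(3)]) (use w(2) V in \<open>auto intro!: inc_closed[OF W]\<close>)
  then show "?k w : carrier ?N" using w(1) posum_closed by fastforce
 qed
 have "lin_ext R ?N ?g (repr X) = lin_ext R ?N ?k (repr X)"
  unfolding lin_ext_def
 proof (rule mod_finsum_cong[OF N refl])
  fix w assume "w : supp R (repr X)"
  then have w: "w : wd V" "repr X w : \<U> R" using r by (cases w, auto simp: free_carrier)+
  show "repr X w *[?N] ?g w = repr X w *[?N] ?k w"
   by (rule arg_cong[OF e(1)[OF w(1)]])
  show "repr X w *[?N] ?k w : carrier ?N" by (rule mod_smult[OF N w(2) e(2)[OF w(1)]])
 qed
 then show ?thesis unfolding fa_delta_def dext_def lift_def restrict_apply'[OF X] .
qed

lemma delta_mem: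
 assumes V: "module R V" and X: "X : \<AA> V"
 shows "fa_delta R P V X : fa_lin R P V V"
proof -
 let ?W = "dsum V V" and ?N = "\<A> (dsum V V)"
 let ?f = "%v. inc ?W (v, 0[V])" and ?j = "%v. (0[V], v)"
 have W: "module R ?W" and N: "module R ?N" using V by simp_all
 have f: "is_lin V ?N ?f" by (rule lin_comp[OF lin_inl[OF V] inc_lin[OF W]])
 note j = lin_inr[OF V, of V]
 have "dext V ?W ?j ?f X : fa_lin R P V V"
 proof (rule lin_mspan_into[OF FA_module[OF V] N dext_lin[OF V W j f] els_carrier[OF V] fa_lin_submodule[OF V V]])
  show "X : mspan R (\<A> V) (els V)" using X by (simp add: FA_span[OF V])
  fix s assume "s : els V"
  then obtain \<mu> vs where s: "s = el V \<mu> vs" and w: "(\<mu>, vs) : wd V" by (auto simp: els_def)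
  have vs: "set vs <= \<U> V" "\<mu> : \<OO> (length vs)" using w by (simp_all add: wd_iff)
  show "dext V ?W ?j ?f s : fa_lin R P V V"
   unfolding s dext_el[OF V W j f w] posum_def
  proof (rule sub_finsum[OF N fa_lin_submodule[OF V V]])
   fix i assume "i : {..<length vs}"
   then have i: "i < length vs" by simp
   let ?as = "take i vs" and ?bs = "drop (Suc i) vs"
   have ab: "set ?as <= \<U> V" "set ?bs <= \<U> V" "vs ! i : \<U> V"
    using vs(1) nth_mem[OF i] by (auto dest!: in_set_takeD in_set_dropD)
   have "Suc (length ?as + length ?bs) = length vs" using i by simp
   then have m: "\<mu> : \<OO> (Suc (length ?as + length ?bs))" using vs(2) by (simp only:)
   let ?ws = "map ?j ?as @ (vs ! i, 0[V]) # map ?j ?bs"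
   have ww: "(\<mu>, ?ws) : wd ?W" using ab m V by (auto simp: wd_iff)
   have "act ?W \<mu> ((map (%v. inc ?W (?j v)) vs)[i := ?f (vs ! i)]) = el ?W \<mu> ?ws"
    unfolding list_updates[OF i] act_incs[OF W ww, symmetric] by (simp add: comp_def)
   also have "... : fa_lin R P V V" by (rule fa_lin_el_mid[OF V V m ab])
   finally show "act ?W \<mu> ((map (%v. inc ?W (?j v)) vs)[i := ?f (vs ! i)]) : fa_lin R P V V" .
  qed
 qed
 then show ?thesis by (simp add: delta_dext[OF V X])
qed

text \<open>\<open>fa_delta\<close> marks each variable in turn and the functional evaluates the marked one; \<open>Df V f\<close> does both at
 once, as a derivation.\<close>

lemma delta_Df:
 assumes V: "module R V" and f: "is_lin V \<R> f" and X: "X : \<AA> V"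
 shows "fa_lin_map R P V V \<R> f (fa_delta R P V X) = Df V f (iota V X)"
  "Df V f (iota V X) : LV V"
proof -
 let ?W = "dsum V V"
 let ?g = "%v. inc ?W (v, 0[V])" and ?j = "%v. (0[V], v)" and ?k = "dsum_map V V f id"
 have W: "module R ?W" using V by simp
 note RV = RP_module[OF V]
 have g: "is_lin V (\<A> ?W) ?g" by (rule lin_comp[OF lin_inl[OF V] inc_lin[OF W]])
 note j = lin_inr[OF V, of V]
 have k: "is_lin ?W (RP V) ?k" by (rule dsum_map_lin[OF V V f]) (simp add: is_lin_def)
 have fz: "f 0[V] = \<zero>" using lin_zero[OF V reg_module f] by simp
 have kv: "?k (0[V], v) = (\<zero>, v)" "?k (v, 0[V]) = (f v, 0[V])" if "v : \<U> V" for v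
  using that V fz by (simp_all add: dsum_map_apply)
 have A1: "along V (RP V) (%X. fm ?W (RP V) ?k (fm V ?W ?j X)) (%X. fm ?W (RP V) ?k (dext V ?W ?j ?g X))"
  by (rule along_fm_post[OF V W RV k fm_closed[OF V W j] dext_along[OF V W j g]])
 have "fm ?W (RP V) ?k (dext V ?W ?j ?g X) = Df V f (iota V X)"
 proof (rule along_unique[OF V RV _ _ A1 Df_iota_along[OF V f] _ X])
  fix v assume v: "v : \<U> V"
  have jv: "?j v : carrier ?W" "(v, 0[V]) : carrier ?W" using v V by simp_all
  have e: "fm ?W (RP V) ?k (fm V ?W ?j (inc V v)) = inc (RP V) (\<zero>, v)"
   using fm_inc[OF V W j v] fm_inc[OF W RV k jv(1)] kv[OF v] by simp
  show "fm ?W (RP V) ?k (fm V ?W ?j (inc V v)) : \<AA> (RP V)"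
   unfolding e by (rule inc_closed[OF RV]) (use v in simp)
  show "iota V (inc V v) = fm ?W (RP V) ?k (fm V ?W ?j (inc V v))"
   unfolding e by (rule fm_inc[OF V RV iota_lin[OF V] v])
  show "fm ?W (RP V) ?k (dext V ?W ?j ?g (inc V v)) = Df V f (iota V (inc V v))"
   unfolding Df_iota_inc[OF V f v] dext_inc[OF V W j g v] fm_inc[OF W RV k jv(2)] kv[OF v] ..
 qed
 then have e: "fm ?W (RP V) ?k (fa_delta R P V X) = Df V f (iota V X)" by (simp add: delta_dext[OF V X])
 then show "fa_lin_map R P V V \<R> f (fa_delta R P V X) = Df V f (iota V X)"
  using delta_mem[OF V X] by (simp add: fa_lin_map_def)
 have "fm ?W (RP V) ?k (fa_delta R P V X) : LV V"
 proof (rule fa_lin_into[OF V V FA_module[OF RV] fm_lin[OF W RV k] fa_lin_submodule[OF V reg_module] _ delta_mem[OF V X]])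
  fix \<mu> vs w assume m: "\<mu> : \<OO> (length vs + 1)" and vs: "set vs <= \<U> V" and w: "w : \<U> V"
  have "map ?k (lin_word V V vs w) = lin_word V \<R> vs (f w)"
   using vs kv w by (auto simp: lin_word_def)
  then have "fm ?W (RP V) ?k (el ?W \<mu> (lin_word V V vs w)) = el (RP V) \<mu> (lin_word V \<R> vs (f w))"
   using fm_el[OF W RV k lin_word_wd[OF V V m vs w]] by simp
  also have "... : LV V" by (rule fa_lin_el[OF m vs lin_closed[OF f w]])
  finally show "fm ?W (RP V) ?k (el ?W \<mu> (lin_word V V vs w)) : LV V" .
 qed
 then show "Df V f (iota V X) : LV V" unfolding e .
qed

text \<open>\<open>Phi\<close> is the unique linear map with prescribed values on derivations of rank one. It exists because
 \<open>x \<otimes> f \<mapsto> Df V f (iota V x)\<close> is bilinear: in terms of a dual basis, it is the sum over \<open>b\<close> of the values at the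
 rank-one pieces of \<open>d\<close>.\<close>

lemma Phi_ex:
 assumes V: "SR_obj R V"
 shows "Phi R P V : lin_hom R (\<D> V) (Der_pt_mod R P V)"
  "x : \<AA> V ==> is_lin V \<R> f ==> Phi R P V (rk V x f) = pt V (Df V f (iota V x))"
proof -
 note M = SR_obj_module[OF V]
 note RV = RP_module[OF M]
 obtain B \<beta> where B: "dual_basis V B \<beta>" using SR_obj_basis[OF V] .
 have b: "finite B" "!!b. b : B ==> b : \<U> V" "!!b. b : B ==> is_lin V \<R> (\<beta> b)"
  "!!v. v : \<U> V ==> v = (\<Oplus>\<^bsub>V\<^esub>b\<in>B. \<beta> b v *[V] b)"
  using B by (auto simp: dual_basis_def)
 let ?A = "\<A> (RP V)"
 have A: "module R ?A" using RV by simp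
 let ?Q = "%\<phi>. \<phi> : lin_hom R (\<D> V) (Der_pt_mod R P V) &
   (ALL x:\<AA> V. ALL f:lin_hom R V \<R>.
    \<phi> (der_ext R P V (%v. f v *[\<A> V] x)) = pt V (fa_lin_map R P V V \<R> f (fa_delta R P V x)))"
 define s where "s d = (\<Oplus>\<^bsub>?A\<^esub>b\<in>B. Df V (\<beta> b) (iota V (d (inc V b))))" for d
 have slin: "is_lin (\<D> V) ?A s"
  unfolding s_def
  by (rule lin_finsum_fun[OF Der_module[OF M] A _ b(1)], rule lin_comp[OF Der_ev_lin[OF inc_closed[OF M b(2)]]],
    assumption, rule lin_comp[OF fm_lin[OF M RV iota_lin[OF M]] Der_lin[OF Df(1)[OF M b(3)]]])
 have sLV: "s d : LV V" if "d : \<DD> V" for d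
  unfolding s_def
  by (rule sub_finsum[OF A fa_lin_submodule[OF M reg_module]], rule delta_Df(2)[OF M b(3) Der_inc_mem[OF M that b(2)]])
 let ?\<phi> = "\<lambda>d\<in>\<DD> V. pt V (s d)"
 have dpm: "Der_pt_mod R P V = (\<D> (RP V))\<lparr>carrier := Der_pt R P V\<rparr>" by (simp add: Der_pt_mod_def)
 have \<phi>: "?\<phi> : lin_hom R (\<D> V) (Der_pt_mod R P V)"
  unfolding dpm
  by (rule lin_restrict[OF Der_module[OF M]], rule lin_sub_codomain[OF lin_comp[OF slin pt_lin_map[OF M]]])
   (rule pt_mem[OF M sLV])
 have srk: "s (rk V x f) = Df V f (iota V x)" if x: "x : \<AA> V" and f: "is_lin V \<R> f" for x f
 proof -
  have fR: "f v : \<U> R" if "v : \<U> V" for v using lin_closed[OF f that] by simp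
  have ix: "iota V x : carrier ?A" by (rule fm_closed[OF M RV iota_lin[OF M] x])
  have DA: "Df V (\<beta> c) : \<DD> (RP V)" if "c : B" for c by (rule Df(1)[OF M b(3)[OF that]])
  have sD: "f c *[\<D> (RP V)] Df V (\<beta> c) : \<DD> (RP V)" if "c : B" for c
   by (rule mod_smult[OF Der_module[OF RV] fR[OF b(2)[OF that]] DA[OF that]])
  have "(\<Oplus>\<^bsub>\<D> (RP V)\<^esub>b\<in>B. f b *[\<D> (RP V)] Df V (\<beta> b)) = Df V f"
  proof (rule Der_eqI[OF RV mod_finsum_closed[OF Der_module[OF RV] sD] Df(1)[OF M f]], assumption)
   fix p assume "p : \<U> (RP V)"
   then obtain a v where p: "p = (a, v)" "a : \<U> R" "v : \<U> V" by auto
   have pc: "p : \<U> (RP V)" using p by simp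
   have \<beta>R: "\<beta> c v : \<U> R" if "c : B" for c using lin_closed[OF b(3)[OF that] p(3)] by simp
   have IL: "is_lin V ?A (%v. inc (RP V) (f v, 0[V]))"
    by (rule lin_comp[OF lin_comp[OF f lin_inl[OF M]] inc_lin[OF RV]])
   have "(\<Oplus>\<^bsub>\<D> (RP V)\<^esub>b\<in>B. f b *[\<D> (RP V)] Df V (\<beta> b)) (inc (RP V) p) =
    (\<Oplus>\<^bsub>?A\<^esub>b\<in>B. (f b *[\<D> (RP V)] Df V (\<beta> b)) (inc (RP V) p))"
    by (rule Der_finsum_ev[OF RV b(1) sD inc_closed[OF RV pc]])
   also have "... = (\<Oplus>\<^bsub>?A\<^esub>b\<in>B. inc (RP V) (f (\<beta> b v *[V] b), 0[V]))"
   proof (rule mod_finsum_cong[OF A refl])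
    fix c assume c: "c : B"
    have "(f c *[\<D> (RP V)] Df V (\<beta> c)) (inc (RP V) p) = f c *[?A] inc (RP V) (\<beta> c v, 0[V])"
     unfolding Der_smult_ev[OF inc_closed[OF RV pc]] using Df(2)[OF M b(3)[OF c] p(2,3)] p(1) by simp
    also have "... = inc (RP V) (f c *[RP V] (\<beta> c v, 0[V]))"
     by (rule lin_smult[OF inc_lin[OF RV] fR[OF b(2)[OF c]], symmetric]) (use \<beta>R[OF c] M in simp)
    also have "f c *[RP V] (\<beta> c v, 0[V]) = (f (\<beta> c v *[V] c), 0[V])"
     using lin_smult[OF f \<beta>R[OF c] b(2)[OF c]] fR[OF b(2)[OF c]] \<beta>R[OF c] M by (simp add: m_comm)
    finally show "(f c *[\<D> (RP V)] Df V (\<beta> c)) (inc (RP V) p) = inc (RP V) (f (\<beta> c v *[V] c), 0[V])" .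
    show "inc (RP V) (f (\<beta> c v *[V] c), 0[V]) : carrier ?A"
     by (rule lin_closed[OF IL mod_smult[OF M \<beta>R[OF c] b(2)[OF c]]])
   qed
   also have "... = inc (RP V) (f (\<Oplus>\<^bsub>V\<^esub>b\<in>B. \<beta> b v *[V] b), 0[V])"
    by (rule lin_finsum[OF M A IL b(1), symmetric]) (use \<beta>R b(2) M in simp)
   also have "... = Df V f (inc (RP V) p)"
    using Df(2)[OF M f p(2,3)] b(4)[OF p(3), symmetric] p(1) by simp
   finally show "(\<Oplus>\<^bsub>\<D> (RP V)\<^esub>b\<in>B. f b *[\<D> (RP V)] Df V (\<beta> b)) (inc (RP V) p) = Df V f (inc (RP V) p)" .
  qed
  then have "Df V f (iota V x) = (\<Oplus>\<^bsub>?A\<^esub>b\<in>B. (f b *[\<D> (RP V)] Df V (\<beta> b)) (iota V x))"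
   using Der_finsum_ev[of "RP V" B "%b. f b *[\<D> (RP V)] Df V (\<beta> b)", OF RV b(1) sD ix] by simp
  also have "... = s (rk V x f)"
   unfolding s_def
  proof (rule mod_finsum_cong[OF A refl])
   fix c assume c: "c : B"
   have L: "is_lin (\<A> V) ?A (%x. Df V (\<beta> c) (iota V x))"
    by (rule lin_comp[OF fm_lin[OF M RV iota_lin[OF M]] Der_lin[OF DA[OF c]]])
   show "(f c *[\<D> (RP V)] Df V (\<beta> c)) (iota V x) = Df V (\<beta> c) (iota V (rk V x f (inc V c)))"
    unfolding Der_smult_ev[OF ix] rk(2)[OF M f x b(2)[OF c]] by (rule lin_smult[OF L fR[OF b(2)[OF c]] x, symmetric])
   show "Df V (\<beta> c) (iota V (rk V x f (inc V c))) : carrier ?A"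
    by (rule lin_closed[OF L Der_inc_mem[OF M rk(1)[OF M f x] b(2)[OF c]]])
  qed
  finally show ?thesis by simp
 qed
 have Q: "?Q ?\<phi>"
  using \<phi> srk rk(1)[OF M] delta_Df(1)[OF M] by (auto simp: rk_def dest!: lin_hom_lin)
 have uniq: "\<psi> = ?\<phi>" if Q': "?Q \<psi>" for \<psi>
 proof (rule lin_hom_eqI[OF _ \<phi>])
  show \<psi>: "\<psi> : lin_hom R (\<D> V) (Der_pt_mod R P V)" using Q' by blast
  fix d assume d: "d : \<DD> V"
  have PM: "module R (Der_pt_mod R P V)" unfolding dpm by (rule sub_module[OF Der_module[OF RV] Der_pt_submodule[OF M]])
  have rb: "rk V (d (inc V c)) (\<beta> c) : \<DD> V" if "c : B" for c
   by (rule rk(1)[OF M b(3)[OF that] Der_inc_mem[OF M d b(2)[OF that]]])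
  have ag: "\<psi> (rk V x f) = ?\<phi> (rk V x f)" if x: "x : \<AA> V" and f: "is_lin V \<R> f" for x f
  proof -
   let ?f = "restrict f (\<U> V)"
   have fh: "?f : lin_hom R V \<R>" by (rule lin_restrict[OF M f])
   have rf: "rk V x f = der_ext R P V (%v. ?f v *[\<A> V] x)"
    unfolding rk_def[of V x f]
    by (rule der_ext_eq[OF M]) (use rk[OF M lin_hom_lin[OF fh] x] in \<open>simp_all add: rk_def\<close>)
   show ?thesis unfolding rf
    by (rule trans[OF bspec[OF bspec[OF Q'[THEN conjunct2] x] fh] sym[OF bspec[OF bspec[OF Q[THEN conjunct2] x] fh]]])
  qed
  have "\<psi> (\<Oplus>\<^bsub>\<D> V\<^esub>b\<in>B. rk V (d (inc V b)) (\<beta> b)) = (\<Oplus>\<^bsub>Der_pt_mod R P V\<^esub>b\<in>B. \<psi> (rk V (d (inc V b)) (\<beta> b)))"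
   by (rule lin_finsum[OF Der_module[OF M] PM lin_hom_lin[OF \<psi>] b(1) rb])
  also have "... = (\<Oplus>\<^bsub>Der_pt_mod R P V\<^esub>b\<in>B. ?\<phi> (rk V (d (inc V b)) (\<beta> b)))"
   by (rule mod_finsum_cong[OF PM refl ag[OF Der_inc_mem[OF M d b(2)] b(3)] lin_closed[OF lin_hom_lin[OF \<phi>] rb]])
  also have "... = ?\<phi> (\<Oplus>\<^bsub>\<D> V\<^esub>b\<in>B. rk V (d (inc V b)) (\<beta> b))"
   by (rule lin_finsum[OF Der_module[OF M] PM lin_hom_lin[OF \<phi>] b(1) rb, symmetric])
  finally show "\<psi> d = ?\<phi> d" unfolding Der_rk_sum[OF M B d, symmetric] .
 qed
 have e: "Phi R P V = ?\<phi>"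
  unfolding Phi_def by (rule the_equality[where P = ?Q, OF Q uniq])
 show "Phi R P V : lin_hom R (\<D> V) (Der_pt_mod R P V)" unfolding e by (rule \<phi>)
 show "Phi R P V (rk V x f) = pt V (Df V f (iota V x))" if "x : \<AA> V" "is_lin V \<R> f"
  unfolding e restrict_apply'[OF rk(1)[OF M that(2,1)]] srk[OF that] ..
qed

end

section \<open>Pointed derivations of positive degree\<close>

context operad begin

lemma rk_cong:
 assumes V: "module R V" and f: "is_lin V \<R> f" and g: "is_lin V \<R> g" and x: "x : \<AA> V"
  and e: "!!v. v : \<U> V ==> f v = g v"
 shows "rk V x f = rk V x g"
proof (rule Der_eqI[OF V rk(1)[OF V f x] rk(1)[OF V g x]])
 fix v assume v: "v : \<U> V"
 show "rk V x f (inc V v) = rk V x g (inc V v)"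
  unfolding rk(2)[OF V f x v] rk(2)[OF V g x v] e[OF v] ..
qed

lemma Der_pt_plus_iff:
 assumes V: "SR_obj R V"
 shows "D : Der_pt_plus R P V \<longleftrightarrow> D : Der_pt R P V & D (u0 V) : fpos (RP V)"
proof -
 note M = SR_obj_module[OF V]
 note RV = RP_module[OF M] and SR = SR_obj_R_plus[OF V]
 show ?thesis
 proof
  assume D: "D : Der_pt_plus R P V"
  then have "D : Der_plus R P (RP V)" by (simp add: Der_pt_plus_def)
  then have "D (u0 V) : fpos (RP V)"
   by (rule Der_plus_fpos[OF RV]) (use M in simp)
  then show "D : Der_pt R P V & D (u0 V) : fpos (RP V)" using D by (simp add: Der_pt_plus_def)
 next
  assume D: "D : Der_pt R P V & D (u0 V) : fpos (RP V)"
  note d = Der_ptD[OF M conjunct1[OF D]]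
  have "D (inc (RP V) p) : fpos (RP V)" if pc: "p : \<U> (RP V)" for p
  proof -
   obtain a v where p: "p = (a, v)" "a : \<U> R" "v : \<U> V" using pc by auto
   show ?thesis unfolding p(1) d(4)[OF p(2,3)] by (rule sub_smult[OF fpos_submodule[OF RV] p(2) conjunct2[OF D]])
  qed
  then have "D : Der_plus R P (RP V)" unfolding Der_plus_iff[OF SR] using d(1) by blast
  then show "D : Der_pt_plus R P V" using D by (simp add: Der_pt_plus_def)
 qed
qed

lemma Der_pt_plus_submodule:
 assumes V: "SR_obj R V" shows "submodule (Der_pt_plus R P V) R (\<D> (RP V))"
proof -
 note M = SR_obj_module[OF V]
 note RV = RP_module[OF M]
 note s1 = Der_pt_submodule[OF M] and s2 = Der_plus_submodule[OF RV]
 show ?thesis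
  unfolding Der_pt_plus_def
 proof (rule submoduleI2[OF Der_module[OF RV]])
  show "Der_pt R P V \<inter> Der_plus R P (RP V) <= \<DD> (RP V)" using sub_carrier[OF s1] by blast
  show "0[\<D> (RP V)] : Der_pt R P V \<inter> Der_plus R P (RP V)" using sub_zero[OF s1] sub_zero[OF s2] by blast
  show "x +[\<D> (RP V)] y : Der_pt R P V \<inter> Der_plus R P (RP V)"
   if "x : Der_pt R P V \<inter> Der_plus R P (RP V)" "y : Der_pt R P V \<inter> Der_plus R P (RP V)" for x y
   using that sub_add[OF s1] sub_add[OF s2] by simp
  show "a *[\<D> (RP V)] x : Der_pt R P V \<inter> Der_plus R P (RP V)"
   if "a : \<U> R" "x : Der_pt R P V \<inter> Der_plus R P (RP V)" for a x
   using that sub_smult[OF s1] sub_smult[OF s2] by simp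
 qed
qed

lemma pl_pt_plus:
 assumes V: "SR_obj R V" and D: "D : Der_pt_plus R P V" and E: "E : Der_pt_plus R P V"
 shows "pl (RP V) D E : Der_pt_plus R P V"
 using pl_pt(1)[OF SR_obj_module[OF V]] pl_plus[OF SR_obj_R_plus[OF V]] D E by (simp add: Der_pt_plus_def)

abbreviation "Cm V \<equiv> Der_pt_plus_comm R P V"

lemma Cm_gen:
 assumes V: "SR_obj R V"
 shows "{pl (RP V) D E -[\<D> (RP V)] pl (RP V) E D | D E. D : Der_pt_plus R P V & E : Der_pt_plus R P V}
  <= Der_pt_plus R P V"
 using sub_minus[OF Der_module[OF RP_module[OF SR_obj_module[OF V]]] Der_pt_plus_submodule[OF V]] pl_pt_plus[OF V] by blast

lemma Cm_alt:
 assumes V: "SR_obj R V"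
 shows "Cm V = mspan R (\<D> (RP V))
  {pl (RP V) D E -[\<D> (RP V)] pl (RP V) E D | D E. D : Der_pt_plus R P V & E : Der_pt_plus R P V}"
proof -
 note DM = Der_module[OF RP_module[OF SR_obj_module[OF V]]] and sub = Der_pt_plus_submodule[OF V]
 have "{pl (RP V) x y -[Der_pt_plus_mod R P V] pl (RP V) y x | x y.
   x : \<U> (Der_pt_plus_mod R P V) & y : \<U> (Der_pt_plus_mod R P V)} =
  {pl (RP V) D E -[\<D> (RP V)] pl (RP V) E D | D E. D : Der_pt_plus R P V & E : Der_pt_plus R P V}"
  (is "?S = ?T")
 proof -
  have "pl (RP V) x y -[Der_pt_plus_mod R P V] pl (RP V) y x = pl (RP V) x y -[\<D> (RP V)] pl (RP V) y x"
   if "x : Der_pt_plus R P V" "y : Der_pt_plus R P V" for x y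
   unfolding Der_pt_plus_mod_def
   by (rule sub_minus_eq[OF DM sub pl_pt_plus[OF V that] pl_pt_plus[OF V that(2,1)]])
  moreover have "\<U> (Der_pt_plus_mod R P V) = Der_pt_plus R P V" by (simp add: Der_pt_plus_mod_def)
  ultimately show ?thesis by (auto, metis+)
 qed
 moreover have "mspan R (Der_pt_plus_mod R P V) ?T = mspan R (\<D> (RP V)) ?T"
  unfolding Der_pt_plus_mod_def by (rule mspan_carrier_update[OF DM sub Cm_gen[OF V]])
 ultimately show ?thesis unfolding Der_pt_plus_comm_def comm_span_def by simp
qed

lemma Cm_submodule:
 assumes V: "SR_obj R V" shows "submodule (Cm V) R (\<D> (RP V))" "Cm V <= Der_pt_plus R P V"
proof -
 note DM = Der_module[OF RP_module[OF SR_obj_module[OF V]]] and sub = Der_pt_plus_submodule[OF V]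
 have "Der_pt_plus R P V <= \<DD> (RP V)" using sub_carrier[OF sub] by blast
 then show "submodule (Cm V) R (\<D> (RP V))"
  unfolding Cm_alt[OF V] by (rule mspan_submodule[OF DM order_trans[OF Cm_gen[OF V]]])
 show "Cm V <= Der_pt_plus R P V" unfolding Cm_alt[OF V] by (rule mspan_least[OF sub Cm_gen[OF V]])
qed

lemma Cm_base:
 assumes V: "SR_obj R V" and D: "D : Der_pt_plus R P V" "E : Der_pt_plus R P V"
 shows "pl (RP V) D E -[\<D> (RP V)] pl (RP V) E D : Cm V"
 unfolding Cm_alt[OF V] by (rule mspan_base) (use D in blast)

subsection \<open>The divergence in positive degree\<close>

lemma Df_fpos:
 assumes V: "module R V" and f: "is_lin V \<R> f" and x: "x : fpos V"
 shows "Df V f (iota V x) : fpos (RP V)"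
proof -
 note RV = RP_module[OF V]
 have h: "iota V (inc V v) = inc (RP V) (\<zero>, v)" if "v : \<U> V" for v
  by (rule fm_inc[OF V RV iota_lin[OF V] that])
 have hc: "iota V (inc V v) : \<AA> (RP V)" if "v : \<U> V" for v
  by (rule fm_closed[OF V RV iota_lin[OF V] inc_closed[OF V that]])
 note A = Df_iota_along[OF V f]
 show ?thesis
 proof (rule fpos_lin[OF V FA_module[OF RV] _ fpos_submodule[OF RV] _ x])
  show "is_lin (\<A> V) (\<A> (RP V)) (%x. Df V f (iota V x))"
   by (rule lin_comp[OF fm_lin[OF V RV iota_lin[OF V]] Der_lin[OF Df(1)[OF V f]]])
  fix \<mu> vs assume w: "(\<mu>, vs) : wd V" and l: "2 <= length vs"
  have vs: "set vs <= \<U> V" "\<mu> : \<OO> (length vs)" using w by (simp_all add: wd_iff)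
  have e: "Df V f (iota V (el V \<mu> vs)) =
   posum (\<A> (RP V)) (act (RP V) \<mu>) (%v. iota V (inc V v)) (%v. Df V f (iota V (inc V v))) vs"
   by (rule along_el[OF V RV hc A w])
  show "Df V f (iota V (el V \<mu> vs)) : fpos (RP V)"
   unfolding e posum_def
  proof (rule sub_finsum[OF FA_module[OF RV] fpos_submodule[OF RV]])
   fix i assume "i : {..<length vs}"
   then have i: "i < length vs" by simp
   have vi: "vs ! i : \<U> V" using vs(1) nth_mem[OF i] by blast
   let ?ws = "(map (%v. (\<zero>, v)) vs)[i := (f (vs ! i), 0[V])]"
   have pc: "(f (vs ! i), 0[V]) : \<U> (RP V)" using lin_closed[OF f vi] V by simp
   have w0: "(\<mu>, map (%v. (\<zero>, v)) vs) : wd (RP V)" by (rule wd_map[OF iota_lin[OF V] w])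
   have wi: "(\<mu>, ?ws) : wd (RP V)" by (rule wd_update[OF w0 pc])
   have m: "map (%v. iota V (inc V v)) vs = map (%v. inc (RP V) (\<zero>, v)) vs"
    by (rule map_cong[OF refl h]) (use vs(1) in blast)
   have "(map (%v. iota V (inc V v)) vs)[i := Df V f (iota V (inc V (vs ! i)))] = map (inc (RP V)) ?ws"
    unfolding m Df_iota_inc[OF V f vi] by (simp add: map_update comp_def)
   then have "act (RP V) \<mu> ((map (%v. iota V (inc V v)) vs)[i := Df V f (iota V (inc V (vs ! i)))]) = el (RP V) \<mu> ?ws"
    using act_incs[OF RV wi] by simp
   moreover have "el (RP V) \<mu> ?ws : fpos (RP V)" by (rule fpos_el[OF wi]) (use l in simp)
   ultimately show "act (RP V) \<mu> ((map (%v. iota V (inc V v)) vs)[i := Df V f (iota V (inc V (vs ! i)))]) : fpos (RP V)"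
    by simp
  qed
 qed
qed

lemma Phi_lin:
 assumes V: "SR_obj R V" shows "is_lin (\<D> V) (\<D> (RP V)) (Phi R P V)"
  "d : \<DD> V ==> Phi R P V d : Der_pt R P V"
proof -
 note M = SR_obj_module[OF V]
 have l: "is_lin (\<D> V) (Der_pt_mod R P V) (Phi R P V)" by (rule lin_hom_lin[OF Phi_ex(1)[OF V]])
 then have p: "Phi R P V d : Der_pt R P V" if "d : \<DD> V" for d
  using lin_closed[OF l that] by (simp add: Der_pt_mod_def)
 then show "d : \<DD> V ==> Phi R P V d : Der_pt R P V" .
 show "is_lin (\<D> V) (\<D> (RP V)) (Phi R P V)"
 proof (rule is_linI)
  fix x assume x: "x : \<DD> V"
  show "Phi R P V x : \<DD> (RP V)" by (rule Der_ptD(1)[OF M p[OF x]])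
  show "Phi R P V (x +[\<D> V] y) = Phi R P V x +[\<D> (RP V)] Phi R P V y" if "y : \<DD> V" for y
   using lin_add[OF l x that] by (simp add: Der_pt_mod_def)
  show "Phi R P V (a *[\<D> V] x) = a *[\<D> (RP V)] Phi R P V x" if "a : \<U> R" for a
   using lin_smult[OF l that x] by (simp add: Der_pt_mod_def)
 qed
qed

lemma Phi_plus:
 assumes V: "SR_obj R V" and d: "d : Der_plus R P V" shows "Phi R P V d : Der_pt_plus R P V"
proof -
 note M = SR_obj_module[OF V]
 note RV = RP_module[OF M] and dc = Der_plus_carrier[OF M d]
 obtain B \<beta> where B: "dual_basis V B \<beta>" using SR_obj_basis[OF V] .
 note b = dual_basisD[OF B]
 have db: "d (inc V c) : \<AA> V" if "c : B" for c by (rule Der_inc_mem[OF M dc b(2)[OF that]])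
 have rb: "rk V (d (inc V c)) (\<beta> c) : \<DD> V" if "c : B" for c by (rule rk(1)[OF M b(3)[OF that] db[OF that]])
 have "Phi R P V d = Phi R P V (\<Oplus>\<^bsub>\<D> V\<^esub>b\<in>B. rk V (d (inc V b)) (\<beta> b))"
  by (rule arg_cong[OF Der_rk_sum[OF M B dc]])
 also have "... = (\<Oplus>\<^bsub>\<D> (RP V)\<^esub>b\<in>B. Phi R P V (rk V (d (inc V b)) (\<beta> b)))"
  by (rule lin_finsum[OF Der_module[OF M] Der_module[OF RV] Phi_lin(1)[OF V] b(1) rb])
 also have "... : Der_pt_plus R P V"
 proof (rule sub_finsum[OF Der_module[OF RV] Der_pt_plus_submodule[OF V]])
  fix c assume c: "c : B"
  note y = delta_Df(2)[OF M b(3)[OF c] db[OF c]]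
  show "Phi R P V (rk V (d (inc V c)) (\<beta> c)) : Der_pt_plus R P V"
   unfolding Phi_ex(2)[OF V db[OF c] b(3)[OF c]] Der_pt_plus_iff[OF V] pt_u0[OF M LV_carrier[OF M y]]
   using pt_mem[OF M y] Df_fpos[OF M b(3)[OF c] Der_plus_fpos[OF M d b(2)[OF c]]] by (rule conjI)
 qed
 finally show ?thesis .
qed

subsection \<open>Naturality\<close>

lemma dsum_map_SR_hom:
 assumes V: "module R V" and W: "module R W" and m: "(i, r) : SR_hom R V W"
 shows "(dsum_map \<R> V id i, dsum_map \<R> W id r) : SR_hom R (RP V) (RP W)"
proof -
 note ir = SR_homD[OF m]
 have id: "is_lin \<R> \<R> id" by (simp add: is_lin_def)
 have l: "is_lin (RP V) (RP W) (dsum_map \<R> V id i)" "is_lin (RP W) (RP V) (dsum_map \<R> W id r)"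
  by (rule dsum_map_lin[OF reg_module V id ir(1)], rule dsum_map_lin[OF reg_module W id ir(2)])
 show ?thesis
  unfolding SR_hom_def
 proof (intro CollectI case_prodI conjI ballI)
  show "dsum_map \<R> V id i : lin_hom R (RP V) (RP W)" "dsum_map \<R> W id r : lin_hom R (RP W) (RP V)"
   using l by (simp_all add: lin_hom_iff) (simp_all add: dsum_map_def)
  fix p assume "p : \<U> (RP V)"
  then obtain a v where p: "p = (a, v)" "a : \<U> R" "v : \<U> V" by auto
  show "dsum_map \<R> W id r (dsum_map \<R> V id i p) = p"
   using p ir(3)[OF p(3)] lin_closed[OF ir(1) p(3)] by (simp add: dsum_map_apply)
 qed
qed

abbreviation "Sm V W i r \<equiv> Fm (RP V) (RP W) (dsum_map \<R> V id i, dsum_map \<R> W id r)"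

lemma Sm_pt:
 assumes V: "module R V" and W: "module R W" and m: "(i, r) : SR_hom R V W" and y: "y : \<AA> (RP V)"
 shows "Sm V W i r (pt V y) = pt W (fm (RP V) (RP W) (dsum_map \<R> V id i) y)"
proof -
 note m' = dsum_map_SR_hom[OF V W m] and RV = RP_module[OF V] and RW = RP_module[OF W]
 have pr: "pt U x = rk (RP U) x fst" for U :: "('r, 'u) module" and x by (simp add: pt_der_def rk_def case_prod_beta')
 note yc = fm_closed[OF RV RW SR_homD(1)[OF m'] y]
 show ?thesis
  unfolding pr Fm_rk[OF RV RW m' lin_fst y]
  by (rule rk_cong[OF RW lin_comp[OF SR_homD(2)[OF m'] lin_fst] lin_fst yc]) (auto simp: dsum_map_apply)
qed

lemma fm_LV:
 assumes V: "module R V" and W: "module R W" and i: "is_lin V W i" and y: "y : LV V"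
 shows "fm (RP V) (RP W) (dsum_map \<R> V id i) y : LV W"
proof -
 note RV = RP_module[OF V] and RW = RP_module[OF W]
 have k: "is_lin (RP V) (RP W) (dsum_map \<R> V id i)"
  by (rule dsum_map_lin[OF reg_module V _ i]) (simp add: is_lin_def)
 have iz: "i 0[V] = 0[W]" by (rule lin_zero[OF V W i])
 show ?thesis
 proof (rule fa_lin_into[OF V reg_module FA_module[OF RW] fm_lin[OF RV RW k] fa_lin_submodule[OF W reg_module] _ y])
  fix \<mu> vs a assume n: "\<mu> : \<OO> (length vs + 1)" "set vs <= \<U> V" "a : carrier \<R>"
  have e: "map (dsum_map \<R> V id i) (lin_word V \<R> vs a) = lin_word W \<R> (map i vs) a"
   using n iz V by (auto simp: lin_word_def dsum_map_apply)
  have iv: "set (map i vs) <= \<U> W" using n(2) lin_closed[OF i] by auto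
  show "fm (RP V) (RP W) (dsum_map \<R> V id i) (el (RP V) \<mu> (lin_word V \<R> vs a)) : LV W"
   unfolding fm_el[OF RV RW k lin_word_wd[OF V reg_module n]] e
   by (rule fa_lin_el[OF _ iv n(3)]) (use n(1) in simp)
 qed
qed

lemma Sm_Der_pt:
 assumes V: "module R V" and W: "module R W" and m: "(i, r) : SR_hom R V W" and D: "D : Der_pt R P V"
 shows "Sm V W i r D : Der_pt R P W"
proof -
 note d = Der_ptD[OF V D]
 have "Sm V W i r D = pt W (fm (RP V) (RP W) (dsum_map \<R> V id i) (D (u0 V)))"
  using Sm_pt[OF V W m d(3)] pt_of_u0[OF V D] by simp
 then show ?thesis using pt_mem[OF W fm_LV[OF V W SR_homD(1)[OF m] d(2)]] by simp
qed

lemma Sm_Der_pt_plus: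
 assumes V: "SR_obj R V" and W: "SR_obj R W" and m: "(i, r) : SR_hom R V W" and D: "D : Der_pt_plus R P V"
 shows "Sm V W i r D : Der_pt_plus R P W"
proof -
 note MV = SR_obj_module[OF V] and MW = SR_obj_module[OF W]
 have D': "D : Der_pt R P V" "D : Der_plus R P (RP V)" using D by (simp_all add: Der_pt_plus_def)
 show ?thesis unfolding Der_pt_plus_def
  using Sm_Der_pt[OF MV MW m D'(1)]
   Fm_plus[OF RP_module[OF MV] SR_obj_R_plus[OF W] dsum_map_SR_hom[OF MV MW m] D'(2)] by (rule IntI)
qed

text \<open>The map on pointed derivations respects the preLie product, being the map on all derivations of the algebra
 over \<open>R \<oplus> V\<close>.\<close>

lemma Sm_Cm:
 assumes V: "SR_obj R V" and W: "SR_obj R W" and m: "(i, r) : SR_hom R V W" and D: "D : Cm V"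
 shows "Sm V W i r D : Cm W"
proof -
 note MV = SR_obj_module[OF V] and MW = SR_obj_module[OF W]
 note RV = RP_module[OF MV] and RW = RP_module[OF MW]
 note m' = dsum_map_SR_hom[OF MV MW m] and sub = Der_pt_plus_submodule[OF V]
 note L = Fm_lin[OF RV RW m']
 show ?thesis
 proof (rule lin_mspan_into[OF Der_module[OF RV] Der_module[OF RW] L _ Cm_submodule(1)[OF W] _ D[unfolded Cm_alt[OF V]]])
  show "{pl (RP V) D E -[\<D> (RP V)] pl (RP V) E D | D E. D : Der_pt_plus R P V & E : Der_pt_plus R P V}
   <= \<DD> (RP V)"
   using Cm_gen[OF V] sub_carrier[OF sub] by blast
  fix s assume "s : {pl (RP V) D E -[\<D> (RP V)] pl (RP V) E D | D E. D : Der_pt_plus R P V & E : Der_pt_plus R P V}"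
  then obtain D E where s: "s = pl (RP V) D E -[\<D> (RP V)] pl (RP V) E D" and DE: "D : Der_pt_plus R P V" "E : Der_pt_plus R P V"
   by blast
  note c = sub_carrier[OF sub DE(1)] sub_carrier[OF sub DE(2)]
  have e: "Sm V W i r s = pl (RP W) (Sm V W i r D) (Sm V W i r E) -[\<D> (RP W)] pl (RP W) (Sm V W i r E) (Sm V W i r D)"
   unfolding s lin_minus[OF Der_module[OF RV] Der_module[OF RW] L pl(1)[OF RV c] pl(1)[OF RV c(2,1)]]
    Fm_pl[OF RV RW m' c] Fm_pl[OF RV RW m' c(2,1)] ..
  show "Sm V W i r s : Cm W"
   unfolding e by (rule Cm_base[OF W Sm_Der_pt_plus[OF V W m DE(1)] Sm_Der_pt_plus[OF V W m DE(2)]])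
 qed
qed

text \<open>By linearity \<open>d\<close> may be taken of rank one. There both sides replace the variables \<open>v\<close> by \<open>f v\<close> times the linear
 one, before or after applying \<open>i\<close>; this agrees as \<open>r\<close> is a left inverse of \<open>i\<close>.\<close>

lemma Phi_nat:
 assumes V: "SR_obj R V" and W: "SR_obj R W" and m: "(i, r) : SR_hom R V W" and d: "d : \<DD> V"
 shows "Phi R P W (Fm V W (i, r) d) = Sm V W i r (Phi R P V d)"
proof -
 note MV = SR_obj_module[OF V] and MW = SR_obj_module[OF W]
 note RV = RP_module[OF MV] and RW = RP_module[OF MW]
 note m' = dsum_map_SR_hom[OF MV MW m] and ir = SR_homD[OF m]
 let ?k = "dsum_map \<R> V id i"
 note k = SR_homD(1)[OF m']
 have iz: "i 0[V] = 0[W]" by (rule lin_zero[OF MV MW ir(1)])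
 have rk_case: "Phi R P W (Fm V W (i, r) (rk V x f)) = Sm V W i r (Phi R P V (rk V x f))"
  if x: "x : \<AA> V" and f: "is_lin V \<R> f" for x f
 proof -
  let ?g = "%w. f (r w)"
  note g = lin_comp[OF ir(2) f]
  note ix = fm_closed[OF MV MW ir(1) x]
  note y = LV_carrier[OF MV delta_Df(2)[OF MV f x]]
  have A1: "along V (RP W) (%X. iota W (fm V W i X)) (%X. Df W ?g (iota W (fm V W i X)))"
   by (rule along_fm_pre[OF MV MW RW ir(1) fm_closed[OF MW RW iota_lin[OF MW]] Df_iota_along[OF MW g]])
  have A2: "along V (RP W) (%X. fm (RP V) (RP W) ?k (iota V X)) (%X. fm (RP V) (RP W) ?k (Df V f (iota V X)))"
   by (rule along_fm_post[OF MV RV RW k fm_closed[OF MV RV iota_lin[OF MV]] Df_iota_along[OF MV f]])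
  have "Df W ?g (iota W (fm V W i x)) = fm (RP V) (RP W) ?k (Df V f (iota V x))"
  proof (rule along_unique[OF MV RW _ _ A1 A2 _ x])
   fix v assume v: "v : \<U> V"
   note iv = lin_closed[OF ir(1) v]
   have fv: "f v : \<U> R" using lin_closed[OF f v] by simp
   have pc: "(\<zero>, v) : \<U> (RP V)" "(f v, 0[V]) : \<U> (RP V)" using v fv MV by simp_all
   have h1: "iota W (fm V W i (inc V v)) = inc (RP W) (\<zero>, i v)"
    unfolding fm_inc[OF MV MW ir(1) v] by (rule fm_inc[OF MW RW iota_lin[OF MW] iv])
   have h2: "fm (RP V) (RP W) ?k (iota V (inc V v)) = inc (RP W) (\<zero>, i v)"
    unfolding fm_inc[OF MV RV iota_lin[OF MV] v] fm_inc[OF RV RW k pc(1)] using v by (simp add: dsum_map_apply)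
   show "iota W (fm V W i (inc V v)) : \<AA> (RP W)"
    unfolding h1 by (rule inc_closed[OF RW]) (use iv in simp)
   show "fm (RP V) (RP W) ?k (iota V (inc V v)) = iota W (fm V W i (inc V v))" unfolding h1 h2 ..
   show "Df W ?g (iota W (fm V W i (inc V v))) = fm (RP V) (RP W) ?k (Df V f (iota V (inc V v)))"
    unfolding fm_inc[OF MV MW ir(1) v] Df_iota_inc[OF MW g iv] Df_iota_inc[OF MV f v] fm_inc[OF RV RW k pc(2)]
    using fv MV iz ir(3)[OF v] by (simp add: dsum_map_apply)
  qed
  then show ?thesis
   unfolding Fm_rk[OF MV MW m f x] Phi_ex(2)[OF V x f] Phi_ex(2)[OF W ix g] Sm_pt[OF MV MW m y] by simp
 qed
 obtain B \<beta> where B: "dual_basis V B \<beta>" using SR_obj_basis[OF V] .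
 note b = dual_basisD[OF B]
 have db: "d (inc V c) : \<AA> V" if "c : B" for c by (rule Der_inc_mem[OF MV d b(2)[OF that]])
 have rb: "rk V (d (inc V c)) (\<beta> c) : \<DD> V" if "c : B" for c by (rule rk(1)[OF MV b(3)[OF that] db[OF that]])
 let ?s = "\<Oplus>\<^bsub>\<D> V\<^esub>b\<in>B. rk V (d (inc V b)) (\<beta> b)"
 note L1 = lin_comp[OF Fm_lin[OF MV MW m] Phi_lin(1)[OF W]] and L2 = lin_comp[OF Phi_lin(1)[OF V] Fm_lin[OF RV RW m']]
 note N = Der_module[OF RW]
 have "Phi R P W (Fm V W (i, r) ?s) = (\<Oplus>\<^bsub>\<D> (RP W)\<^esub>b\<in>B. Phi R P W (Fm V W (i, r) (rk V (d (inc V b)) (\<beta> b))))"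
  by (rule lin_finsum[OF Der_module[OF MV] N L1 b(1) rb])
 also have "... = (\<Oplus>\<^bsub>\<D> (RP W)\<^esub>b\<in>B. Sm V W i r (Phi R P V (rk V (d (inc V b)) (\<beta> b))))"
  by (rule mod_finsum_cong[OF N refl rk_case[OF db b(3)] lin_closed[OF L2 rb]])
 also have "... = Sm V W i r (Phi R P V ?s)"
  by (rule lin_finsum[OF Der_module[OF MV] N L2 b(1) rb, symmetric])
 finally show ?thesis unfolding Der_rk_sum[OF MV B d, symmetric] .
qed

end

section \<open>Functors on split monomorphisms\<close>

context base_ring begin

lemma SR_hom_iff:
 "m : SR_hom R V W \<longleftrightarrow> fst m : lin_hom R V W & snd m : lin_hom R W V & (ALL v:\<U> V. snd m (fst m v) = v)"
 by (cases m) (simp add: SR_hom_def)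

lemma SR_id_mem: "module R V ==> SR_id V : SR_hom R V V"
 by (simp add: SR_hom_iff SR_id_def lin_restrict[OF _ lin_ident])

lemma SR_comp_mem:
 assumes U: "module R U" and W: "module R W" and m: "m : SR_hom R U V" and m': "m' : SR_hom R V W"
 shows "SR_comp U W m' m : SR_hom R U W"
proof -
 have l: "is_lin U V (fst m)" "is_lin V U (snd m)" "is_lin V W (fst m')" "is_lin W V (snd m')"
  using m m' by (simp_all add: SR_hom_iff lin_hom_iff)
 have "restrict (%x. fst m' (fst m x)) (\<U> U) : lin_hom R U W"
  "restrict (%x. snd m (snd m' x)) (\<U> W) : lin_hom R W U"
  by (rule lin_restrict[OF U lin_comp[OF l(1,3)]], rule lin_restrict[OF W lin_comp[OF l(4,2)]])
 then show ?thesis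
  using m m' lin_closed[OF l(1)] lin_closed[OF l(3)]
  by (simp add: SR_hom_iff SR_comp_def compose_def lin_closed[OF lin_comp[OF l(1,3)]])
qed

lemma SR_functorD:
 assumes "SR_functor R F"
 shows "SR_obj R V ==> module R (ob F V)"
  "SR_obj R V ==> SR_obj R W ==> m : SR_hom R V W ==> is_lin (ob F V) (ob F W) (mor F V W m)"
  "SR_obj R V ==> x : \<U> (ob F V) ==> mor F V V (SR_id V) x = x"
  "SR_obj R U ==> SR_obj R V ==> SR_obj R W ==> m : SR_hom R U V ==> m' : SR_hom R V W ==>
    x : \<U> (ob F U) ==> mor F U W (SR_comp U W m' m) x = mor F V W m' (mor F U V m x)"
 using assms unfolding SR_functor_def by (blast, blast intro: lin_hom_lin, blast, blast)

lemma is_subfunctorD: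
 assumes "is_subfunctor R F S"
 shows "SR_obj R V ==> submodule (S V) R (ob F V)"
  "SR_obj R V ==> SR_obj R W ==> m : SR_hom R V W ==> x : S V ==> mor F V W m x : S W"
 using assms unfolding is_subfunctor_def by blast+

lemma SR_natD:
 assumes "SR_nat R F G \<eta>"
 shows "SR_obj R V ==> is_lin (ob F V) (ob G V) (\<eta> V)"
  "SR_obj R V ==> SR_obj R W ==> m : SR_hom R V W ==> x : \<U> (ob F V) ==>
    \<eta> W (mor F V W m x) = mor G V W m (\<eta> V x)"
 using assms unfolding SR_nat_def by (blast intro: lin_hom_lin, blast)

lemma sub_functor_sel [simp]:
 "ob (sub_functor F S) V = (ob F V)\<lparr>carrier := S V\<rparr>"
 "mor (sub_functor F S) V W m = restrict (mor F V W m) (S V)"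
 by (simp_all add: sub_functor_def)

lemma SR_sub:
 assumes F: "SR_functor R F" and S: "is_subfunctor R F S"
 shows "SR_functor R (sub_functor F S)"
 unfolding SR_functor_def
proof (intro conjI allI impI ballI)
 note f = SR_functorD[OF F] and s = is_subfunctorD[OF S]
 fix V :: "('r, 'a) module" assume V: "SR_obj R V"
 show M: "module R (ob (sub_functor F S) V)" using sub_module[OF f(1) s(1)] V by simp
 show "mor (sub_functor F S) V V (SR_id V) x = x" if "x : \<U> (ob (sub_functor F S) V)" for x
  using that f(3)[OF V sub_carrier[OF s(1)[OF V]]] by simp
 fix W :: "('r, 'a) module" and m assume W: "SR_obj R W" and m: "m : SR_hom R V W"
 have "is_lin ((ob F V)\<lparr>carrier := S V\<rparr>) ((ob F W)\<lparr>carrier := S W\<rparr>) (mor F V W m)"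
  by (rule lin_sub_codomain[OF lin_sub_domain[OF f(2)[OF V W m]]]) (use sub_carrier[OF s(1)[OF V]] s(2)[OF V W m] in auto)
 then show "mor (sub_functor F S) V W m : lin_hom R (ob (sub_functor F S) V) (ob (sub_functor F S) W)"
  using lin_restrict[OF M] by simp
next
 note f = SR_functorD[OF F] and s = is_subfunctorD[OF S]
 fix U V W :: "('r, 'a) module" and m m' x
 assume o: "SR_obj R U" "SR_obj R V" "SR_obj R W" and m: "m : SR_hom R U V" "m' : SR_hom R V W"
  and x: "x : \<U> (ob (sub_functor F S) U)"
 have x': "x : S U" using x by simp
 then show "mor (sub_functor F S) U W (SR_comp U W m' m) x = mor (sub_functor F S) V W m' (mor (sub_functor F S) U V m x)"
  using f(4)[OF o m sub_carrier[OF s(1)[OF o(1)] x']] s(2)[OF o(1,2) m(1) x'] by simp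
qed

lemma coset_update [simp]: "H +>\<^bsub>M\<lparr>carrier := K\<rparr>\<^esub> x = H +>[M] x"
 by (simp add: a_r_coset_def r_coset_def)

lemma quot_functor_ob [simp]: "ob (quot_functor F S) V = quot_mod (ob F V) (S V)"
 by (simp add: quot_functor_def)

lemma quot_functor_mor_lin:
 assumes F: "SR_functor R F" and S: "is_subfunctor R F S" and V: "SR_obj R V" and W: "SR_obj R W"
  and m: "m : SR_hom R V W"
 shows "is_lin (ob F V) (quot_mod (ob F W) (S W)) (%x. S W +>[ob F W] mor F V W m x)"
  "h : S V ==> S W +>[ob F W] mor F V W m h = 0[quot_mod (ob F W) (S W)]"
proof -
 note f = SR_functorD[OF F] and s = is_subfunctorD[OF S]
 show "is_lin (ob F V) (quot_mod (ob F W) (S W)) (%x. S W +>[ob F W] mor F V W m x)"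
  by (rule lin_comp[OF f(2)[OF V W m] quot_proj_lin[OF f(1)[OF W] s(1)[OF W]]])
 show "S W +>[ob F W] mor F V W m h = 0[quot_mod (ob F W) (S W)]" if "h : S V"
  using s(2)[OF V W m that] coset_eq_zero_iff[OF f(1)[OF W] s(1)[OF W]] sub_carrier[OF s(1)[OF W]]
  by (simp add: quot_zero)
qed

lemma quot_functor_mor:
 assumes F: "SR_functor R F" and S: "is_subfunctor R F S" and V: "SR_obj R V" and W: "SR_obj R W"
  and m: "m : SR_hom R V W" and x: "x : \<U> (ob F V)"
 shows "mor (quot_functor F S) V W m (S V +>[ob F V] x) = S W +>[ob F W] mor F V W m x"
proof -
 note f = SR_functorD[OF F] and s = is_subfunctorD[OF S]
 note q = quot_functor_mor_lin[OF F S V W m]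
 have c: "S V +>[ob F V] x : \<U> (quot_mod (ob F V) (S V))" using x by (auto simp: quot_carrier)
 have "mor (quot_functor F S) V W m (S V +>[ob F V] x) = S W +>[ob F W] mor F V W m (repr (S V +>[ob F V] x))"
  using c by (simp add: quot_functor_def)
 also have "... = S W +>[ob F W] mor F V W m x"
  by (rule lin_repr[OF f(1)[OF V] quot_module[OF f(1)[OF W] s(1)[OF W]] s(1)[OF V] q(1) q(2) x])
 finally show ?thesis .
qed

text \<open>Representatives are chosen in the definition of a quotient functor; \<open>quot_functor_mor\<close> says that the choice
 does not matter.\<close>

lemma SR_quot:
 assumes F: "SR_functor R F" and S: "is_subfunctor R F S"
 shows "SR_functor R (quot_functor F S)"
 unfolding SR_functor_def
proof (intro conjI allI impI ballI)
 note f = SR_functorD[OF F] and s = is_subfunctorD[OF S]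
 fix V :: "('r, 'a) module" assume V: "SR_obj R V"
 show M: "module R (ob (quot_functor F S) V)" using quot_module[OF f(1) s(1)] V by simp
 show "mor (quot_functor F S) V V (SR_id V) X = X" if X: "X : \<U> (ob (quot_functor F S) V)" for X
 proof -
  obtain x where x: "x : \<U> (ob F V)" "X = S V +>[ob F V] x" using X by (auto simp: quot_carrier)
  show ?thesis unfolding x(2) quot_functor_mor[OF F S V V SR_id_mem[OF conjunct1[OF V[unfolded SR_obj_def]]] x(1)]
    f(3)[OF V x(1)] ..
 qed
 fix W :: "('r, 'a) module" and m assume W: "SR_obj R W" and m: "m : SR_hom R V W"
 note q = quot_functor_mor_lin[OF F S V W m]
 have "is_lin (quot_mod (ob F V) (S V)) (quot_mod (ob F W) (S W)) (%X. S W +>[ob F W] mor F V W m (repr X))"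
  by (rule lin_lift[OF f(1)[OF V] quot_module[OF f(1)[OF W] s(1)[OF W]] s(1)[OF V] q(1) q(2)])
 then show "mor (quot_functor F S) V W m : lin_hom R (ob (quot_functor F S) V) (ob (quot_functor F S) W)"
  using lin_restrict[OF M] by (simp add: quot_functor_def)
next
 note f = SR_functorD[OF F] and s = is_subfunctorD[OF S]
 fix U V W :: "('r, 'a) module" and m m' X
 assume o: "SR_obj R U" "SR_obj R V" "SR_obj R W" and m: "m : SR_hom R U V" "m' : SR_hom R V W"
  and X: "X : \<U> (ob (quot_functor F S) U)"
 obtain x where x: "x : \<U> (ob F U)" "X = S U +>[ob F U] x" using X by (auto simp: quot_carrier)
 have c: "SR_comp U W m' m : SR_hom R U W" using SR_comp_mem[OF _ _ m] o by (simp add: SR_obj_def)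
 show "mor (quot_functor F S) U W (SR_comp U W m' m) X = mor (quot_functor F S) V W m' (mor (quot_functor F S) U V m X)"
  unfolding x(2) quot_functor_mor[OF F S o(1,3) c x(1)] quot_functor_mor[OF F S o(1,2) m(1) x(1)]
   quot_functor_mor[OF F S o(2,3) m(2) lin_closed[OF f(2)[OF o(1,2) m(1)] x(1)]] f(4)[OF o m x(1)] ..
qed

lemma is_subfunctor_ker:
 assumes F: "SR_functor R F" and G: "SR_functor R G" and n: "SR_nat R F G g"
 shows "is_subfunctor R F (%V. {x : \<U> (ob F V). g V x = 0[ob G V]})"
 unfolding is_subfunctor_def
proof (intro conjI allI impI)
 note f = SR_functorD[OF F] and h = SR_functorD[OF G] and n = SR_natD[OF n]
 fix V :: "('r, 'a) module" assume V: "SR_obj R V"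
 note MF = f(1)[OF V] and MG = h(1)[OF V] and L = n(1)[OF V]
 show "submodule {x : \<U> (ob F V). g V x = 0[ob G V]} R (ob F V)"
  by (rule submoduleI2[OF MF]) (use MF MG in \<open>simp_all add: lin_zero[OF MF MG L] lin_add[OF L] lin_smult[OF L] subset_iff\<close>)
 fix W :: "('r, 'a) module" and m assume W: "SR_obj R W" and m: "m : SR_hom R V W"
 note z = lin_zero[OF MG h(1)[OF W] h(2)[OF V W m]]
 show "mor F V W m ` {x : \<U> (ob F V). g V x = 0[ob G V]} <= {x : \<U> (ob F W). g W x = 0[ob G W]}"
  using lin_closed[OF f(2)[OF V W m]] n(2)[OF V W m] z by auto
qed

lemma is_subfunctor_image:
 assumes F: "SR_functor R F" and G: "SR_functor R G" and n: "SR_nat R F G g"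
 shows "is_subfunctor R G (%V. g V ` \<U> (ob F V))"
 unfolding is_subfunctor_def
proof (intro conjI allI impI)
 note f = SR_functorD[OF F] and h = SR_functorD[OF G] and n = SR_natD[OF n]
 fix V :: "('r, 'a) module" assume V: "SR_obj R V"
 note MF = f(1)[OF V] and MG = h(1)[OF V] and L = n(1)[OF V]
 show "submodule (g V ` \<U> (ob F V)) R (ob G V)"
 proof (rule submoduleI2[OF MG])
  show "g V ` \<U> (ob F V) <= \<U> (ob G V)" using lin_closed[OF L] by auto
  show "0[ob G V] : g V ` \<U> (ob F V)" using imageI[OF mod_zero[OF MF], of "g V"] lin_zero[OF MF MG L] by simp
  fix x assume "x : g V ` \<U> (ob F V)"
  then obtain a where a: "a : \<U> (ob F V)" "x = g V a" by auto
  { fix y assume "y : g V ` \<U> (ob F V)"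
   then obtain b where b: "b : \<U> (ob F V)" "y = g V b" by auto
   show "x +[ob G V] y : g V ` \<U> (ob F V)"
    unfolding a(2) b(2) lin_add[OF L a(1) b(1), symmetric] by (rule imageI[OF mod_add[OF MF a(1) b(1)]]) }
  show "c *[ob G V] x : g V ` \<U> (ob F V)" if "c : \<U> R" for c
   unfolding a(2) lin_smult[OF L that a(1), symmetric] by (rule imageI[OF mod_smult[OF MF that a(1)]])
 qed
 fix W :: "('r, 'a) module" and m assume W: "SR_obj R W" and m: "m : SR_hom R V W"
 show "mor G V W m ` (g V ` \<U> (ob F V)) <= g W ` \<U> (ob F W)"
 proof (rule image_subsetI)
  fix y assume "y : g V ` \<U> (ob F V)"
  then obtain x where x: "x : \<U> (ob F V)" and y: "y = g V x" by auto
  show "mor G V W m y : g W ` \<U> (ob F W)"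
   unfolding y n(2)[OF V W m x, symmetric] by (rule imageI[OF lin_closed[OF f(2)[OF V W m] x]])
 qed
qed

lemma is_subfunctor_of_sub:
 assumes F: "SR_functor R F" and S: "is_subfunctor R F S" and T: "is_subfunctor R F T"
  and le: "!!V. SR_obj R V ==> T V <= S V"
 shows "is_subfunctor R (sub_functor F S) T"
 unfolding is_subfunctor_def
proof (intro conjI allI impI)
 fix V :: "('r, 'a) module" assume V: "SR_obj R V"
 show "submodule (T V) R (ob (sub_functor F S) V)"
  using sub_sub_iff[OF SR_functorD(1)[OF F V] is_subfunctorD(1)[OF S V]] is_subfunctorD(1)[OF T V] le[OF V] by simp
 fix W :: "('r, 'a) module" and m assume W: "SR_obj R W" and m: "m : SR_hom R V W"
 show "mor (sub_functor F S) V W m ` T V <= T W"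
 proof (rule image_subsetI)
  fix x assume x: "x : T V"
  show "mor (sub_functor F S) V W m x : T W"
   using is_subfunctorD(2)[OF T V W m x] le[OF V] x by auto
 qed
qed

subsection \<open>Torsion\<close>

definition from_rank :: "nat => ('r, 'v) module => (('r, 'v) module => ('v => 'v) \<times> ('v => 'v) => bool) => bool" where
 "from_rank N V Q \<longleftrightarrow>
  (ALL W n m. SR_obj R W --> has_rank R W n --> N <= n --> m : SR_hom R V W --> Q W m)"

lemma from_rankI:
 "(!!W n m. SR_obj R W ==> has_rank R W n ==> N <= n ==> m : SR_hom R V W ==> Q W m) ==> from_rank N V Q"
 by (simp add: from_rank_def)

lemma from_rankD:
 "from_rank N V Q ==> SR_obj R W ==> has_rank R W n ==> N <= n ==> m : SR_hom R V W ==> Q W m"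
 unfolding from_rank_def by blast

lemma from_rank_mono:
 assumes "EX N. from_rank N V Q" and "!!W m. SR_obj R W ==> m : SR_hom R V W ==> Q W m ==> Q' W m"
 shows "EX N. from_rank N V Q'"
 using assms unfolding from_rank_def by blast

text \<open>With \<open>N\<close> fixed, the elements killed by every morphism into rank at least \<open>N\<close> form a subfunctor. It contains the
 one generated by \<open>x\<close>, and in rank at least \<open>N\<close> it is zero, as one sees from the identity morphism.\<close>

lemma torsion_elementI:
 fixes F :: "('r, 'v, 'f) sr_functor"
 assumes F: "SR_functor R F" and V: "SR_obj R V" and x: "x : \<U> (ob F V)"
  and kill: "from_rank N V (%W m. mor F V W m x = 0[ob F W])"
 shows "torsion_element R F V x"
proof -
 note f = SR_functorD[OF F]
 define S where "S U = {y : \<U> (ob F U). from_rank N U (%W m. mor F U W m y = 0[ob F W])}" for U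
 have SI: "y : \<U> (ob F U) ==> from_rank N U (%W m. mor F U W m y = 0[ob F W]) ==> y : S U" for y U
  by (simp add: S_def)
 have SD: "y : \<U> (ob F U)"
  "SR_obj R W ==> has_rank R W n ==> N <= n ==> m : SR_hom R U W ==> mor F U W m y = 0[ob F W]"
  if "y : S U" for y U W n m
  using that from_rankD unfolding S_def by blast+
 have sf: "is_subfunctor R F S"
  unfolding is_subfunctor_def
 proof (intro conjI allI impI)
  fix U :: "('r, 'v) module" assume U: "SR_obj R U"
  note M = f(1)[OF U]
  show "submodule (S U) R (ob F U)"
  proof (rule submoduleI2[OF M])
   show "S U <= \<U> (ob F U)" using SD(1) by blast
   show "0[ob F U] : S U"
    by (rule SI[OF mod_zero[OF M] from_rankI[OF lin_zero[OF M f(1) f(2)[OF U]]]])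
   fix y assume y: "y : S U"
   { fix z assume z: "z : S U"
    show "y +[ob F U] z : S U"
    proof (rule SI[OF mod_add[OF M SD(1)[OF y] SD(1)[OF z]] from_rankI])
     fix W :: "('r, 'v) module" and n m assume W: "SR_obj R W" "has_rank R W n" "N <= n" "m : SR_hom R U W"
     show "mor F U W m (y +[ob F U] z) = 0[ob F W]"
      unfolding lin_add[OF f(2)[OF U W(1,4)] SD(1)[OF y] SD(1)[OF z]] SD(2)[OF y W] SD(2)[OF z W]
      using f(1)[OF W(1)] by simp
    qed }
   show "a *[ob F U] y : S U" if a: "a : \<U> R" for a
   proof (rule SI[OF mod_smult[OF M a SD(1)[OF y]] from_rankI])
    fix W :: "('r, 'v) module" and n m assume W: "SR_obj R W" "has_rank R W n" "N <= n" "m : SR_hom R U W"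
    show "mor F U W m (a *[ob F U] y) = 0[ob F W]"
     unfolding lin_smult[OF f(2)[OF U W(1,4)] a SD(1)[OF y]] SD(2)[OF y W]
     using f(1)[OF W(1)] a by simp
   qed
  qed
  fix U' :: "('r, 'v) module" and m assume U': "SR_obj R U'" and m: "m : SR_hom R U U'"
  show "mor F U U' m ` S U <= S U'"
  proof (rule image_subsetI)
   fix y assume y: "y : S U"
   show "mor F U U' m y : S U'"
   proof (rule SI[OF lin_closed[OF f(2)[OF U U' m] SD(1)[OF y]] from_rankI])
    fix W :: "('r, 'v) module" and n m' assume W: "SR_obj R W" "has_rank R W n" "N <= n" and m': "m' : SR_hom R U' W"
    have c: "SR_comp U W m' m : SR_hom R U W"
     using SR_comp_mem[OF _ _ m m'] U W(1) by (simp add: SR_obj_def)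
    show "mor F U' W m' (mor F U U' m y) = 0[ob F W]"
     using f(4)[OF U U' W(1) m m' SD(1)[OF y]] SD(2)[OF y W c] by simp
   qed
  qed
 qed
 have xS: "x : S V" by (rule SI[OF x kill])
 show ?thesis
  unfolding torsion_element_def
 proof (intro exI[of _ N] allI impI)
  fix n and W :: "('r, 'v) module" assume n: "N <= n" and W: "SR_obj R W & has_rank R W n"
  have WM: "module R W" using W by (simp add: SR_obj_def)
  have "S W <= {0[ob F W]}"
  proof
   fix y assume y: "y : S W"
   show "y : {0[ob F W]}"
    using SD(2)[OF y conjunct1[OF W] conjunct2[OF W] n SR_id_mem[OF WM]] f(3)[OF conjunct1[OF W] SD(1)[OF y]] by simp
  qed
  moreover have "generated_subfunctor R F V x W <= S W"
   unfolding generated_subfunctor_def using sf xS by blast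
  moreover have "0[ob F W] : generated_subfunctor R F V x W"
   unfolding generated_subfunctor_def using sub_zero[OF is_subfunctorD(1)[OF _ conjunct1[OF W]]] by blast
  ultimately show "generated_subfunctor R F V x W = {0[ob F W]}" by blast
 qed
qed

lemma homology_torsionI:
 fixes B :: "('r, 'v, 'f) sr_functor"
 assumes A: "SR_functor R A" and B: "SR_functor R B" and C: "SR_functor R C"
  and f: "SR_nat R A B f" and g: "SR_nat R B C g"
  and gf: "!!V x. SR_obj R V ==> x : \<U> (ob A V) ==> g V (f V x) = 0[ob C V]"
  and ex: "!!V x. SR_obj R V ==> x : \<U> (ob B V) ==> g V x = 0[ob C V] ==>
   EX N. from_rank N V (%W m. mor B V W m x : f W ` \<U> (ob A W))"
 shows "torsion_functor R (homology_functor A B C f g)"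
proof -
 let ?K = "%V. {x : \<U> (ob B V). g V x = 0[ob C V]}" and ?I = "%V. f V ` \<U> (ob A V)"
 note K = is_subfunctor_ker[OF B C g] and I = is_subfunctor_image[OF A B f]
 have "?I V <= ?K V" if "SR_obj R V" for V
  using gf[OF that] lin_closed[OF SR_natD(1)[OF f that]] by auto
 then have I': "is_subfunctor R (sub_functor B ?K) ?I" by (rule is_subfunctor_of_sub[OF B K I])
 note BK = SR_sub[OF B K]
 note H = SR_quot[OF BK I']
 show ?thesis
  unfolding torsion_functor_def homology_functor_def
 proof (intro conjI allI impI ballI)
  show "SR_functor R (quot_functor (sub_functor B ?K) ?I)" by (rule H)
  fix V :: "('r, 'v) module" and X
  assume V: "SR_obj R V" and X: "X : \<U> (ob (quot_functor (sub_functor B ?K) ?I) V)"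
  have "EX x:\<U> (ob (sub_functor B ?K) V). X = ?I V +>[ob (sub_functor B ?K) V] x"
   using X unfolding quot_functor_ob quot_carrier .
  then obtain x where x: "x : \<U> (ob (sub_functor B ?K) V)" and Xx: "X = ?I V +>[ob (sub_functor B ?K) V] x"
   by (rule bexE)
  have xB: "x : \<U> (ob B V)" "g V x = 0[ob C V]" using x by simp_all
  obtain N where N: "from_rank N V (%W m. mor B V W m x : f W ` \<U> (ob A W))" using ex[OF V xB] by (rule exE)
  show "torsion_element R (quot_functor (sub_functor B ?K) ?I) V X"
  proof (rule torsion_elementI[OF H V X from_rankI])
   fix W :: "('r, 'v) module" and n m assume W: "SR_obj R W" "has_rank R W n" "N <= n" and m: "m : SR_hom R V W"
   have e: "mor (sub_functor B ?K) V W m x = mor B V W m x" using xB by simp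
   note i = from_rankD[OF N W m]
   have c: "mor B V W m x : \<U> (ob (sub_functor B ?K) W)"
    using lin_closed[OF SR_functorD(2)[OF BK V W(1) m] x] unfolding e .
   show "mor (quot_functor (sub_functor B ?K) ?I) V W m X = 0[ob (quot_functor (sub_functor B ?K) ?I) W]"
    unfolding Xx quot_functor_mor[OF BK I' V W(1) m x] e quot_functor_ob quot_zero
    using coset_eq_zero_iff[OF SR_functorD(1)[OF BK W(1)] is_subfunctorD(1)[OF I' W(1)] c] i by blast
  qed
 qed
qed

lemma zero_functor_SR: "SR_functor R (zero_functor :: ('r, 'v, unit) sr_functor)"
proof -
 have M: "module R (ob zero_functor V)" for V :: "('r, 'v) module"
  by (rule moduleI[OF is_cring abelian_groupI]) (simp_all add: zero_functor_def)
 show ?thesis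
  unfolding SR_functor_def using M by (auto simp: lin_hom_def zero_functor_def PiE_def extensional_def)
qed

lemma zero_nat_SR:
 assumes F: "SR_functor R F" and G: "SR_functor R G"
 shows "SR_nat R F G (zero_nat F G)"
 unfolding SR_nat_def zero_nat_def
proof (intro conjI allI impI ballI)
 fix V :: "('r, 'a) module" assume V: "SR_obj R V"
 show "(\<lambda>x\<in>\<U> (ob F V). 0[ob G V]) : lin_hom R (ob F V) (ob G V)"
  by (rule lin_restrict[OF SR_functorD(1)[OF F V] lin_const_zero[OF SR_functorD(1)[OF G V]]])
 fix W :: "('r, 'a) module" and m x assume W: "SR_obj R W" and m: "m : SR_hom R V W" and x: "x : \<U> (ob F V)"
 show "(\<lambda>x\<in>\<U> (ob F W). 0[ob G W]) (mor F V W m x) = mor G V W m ((\<lambda>x\<in>\<U> (ob F V). 0[ob G V]) x)"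
  using lin_closed[OF SR_functorD(2)[OF F V W m] x] x
   lin_zero[OF SR_functorD(1)[OF G V] SR_functorD(1)[OF G W] SR_functorD(2)[OF G V W m]] by simp
qed

end

section \<open>Tree monomials\<close>

text \<open>The leaves are numbered from left to right, starting with \<open>k\<close>. For such trees the composition is plain
 grafting; the others differ by a permutation, which acts on the arguments.\<close>

primrec planar :: "nat => 'b btree => 'b btree" where
 "planar k (Leaf i) = Leaf k"
| "planar k (Node b s t) = Node b (planar k s) (planar (k + length (leaves s)) t)"

lemma leaves_planar: "leaves (planar k t) = [k..<k + length (leaves t)]"
proof (induction t arbitrary: k)
 case (Node b t1 t2)
 then show ?case
  using upt_add_eq_append[of k "k + length (leaves t1)" "length (leaves t2)"] by (simp add: add.assoc)
qed simp

lemma relabel_simps [simp]: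
 "relabel g (Leaf i) = Leaf (g i)" "relabel g (Node b s t) = Node b (relabel g s) (relabel g t)"
 by (simp_all add: relabel_def)

lemma relabel_planar: "relabel (%j. m + j) (planar k t) = planar (m + k) t"
 by (induction t arbitrary: k) (simp_all add: add.assoc)

lemma relabel_planar_leaves:
 "(!!i. i < length (leaves t) ==> g (k + i) = leaves t ! i) ==> relabel g (planar k t) = t"
proof (induction t arbitrary: k)
 case (Leaf i)
 then show ?case using Leaf[of 0] by simp
next
 case (Node b s t)
 have "relabel g (planar k s) = s"
 proof (rule Node.IH(1))
  fix i assume "i < length (leaves s)"
  then show "g (k + i) = leaves s ! i" using Node.prems[of i] by (simp add: nth_append)
 qed
 moreover have "relabel g (planar (k + length (leaves s)) t) = t"
 proof (rule Node.IH(2))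
  fix i assume "i < length (leaves t)"
  then show "g (k + length (leaves s) + i) = leaves t ! i"
   using Node.prems[of "length (leaves s) + i"] by (simp add: add.assoc)
 qed
 ultimately show ?case by simp
qed

lemma node_labels_planar: "node_labels (planar k t) = node_labels t"
 by (induction t arbitrary: k) simp_all

lemma planar_labelled: "node_labels t <= B ==> planar 0 t : labelled_trees B (length (leaves t))"
 by (simp add: labelled_trees_def node_labels_planar leaves_planar atLeast0LessThan)

lemma tree_comp_planar:
 "tree_comp [length (leaves s), length (leaves t)] (Node b (Leaf 0) (Leaf 1)) [planar 0 s, planar 0 t] =
  planar 0 (Node b s t)"
proof -
 have "((+) (0::nat)) = (%j. j)" by (simp add: fun_eq_iff)
 then show ?thesis
  using relabel_planar[of 0 0 s] relabel_planar[of "length (leaves s)" 0 t] by (simp add: tree_comp_def)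
qed

context base_ring begin

lemma multilin_ext_two_singles:
 assumes M: "module R M" and ne: "\<one> ~= \<zero>" and g: "g [s, t] : \<U> M"
 shows "multilin_ext R M g [single R s, single R t] = g [s, t]"
proof -
 have s: "supp R (single R u) = {u}" for u :: 'b using ne by (auto simp: supp_def single_def)
 have l: "listset [supp R (single R s), supp R (single R t)] = {[s, t]}"
  unfolding s by (auto simp: set_Cons_def)
 have "(\<Otimes>\<^bsub>R\<^esub>i\<in>{..<length [single R s, single R t]}. ([single R s, single R t] ! i) ([s, t] ! i)) = \<one>"
 proof -
  have "(\<Otimes>\<^bsub>R\<^esub>i\<in>{..<length [single R s, single R t]}. ([single R s, single R t] ! i) ([s, t] ! i)) = (\<Otimes>\<^bsub>R\<^esub>i\<in>{..<length [single R s, single R t]}. \<one>)"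
   by (rule finprod_cong) (auto simp: single_def less_Suc_eq simp_implies_def)
  then show ?thesis by simp
 qed
 moreover have "finsum M f {[s, t]} = f [s, t]" if "f [s, t] : \<U> M" for f
  using mod_finsum_insert[OF M, of "{}" "[s, t]" f] that M by simp
 ultimately show ?thesis
  unfolding multilin_ext_def list.map l using g M by simp
qed

end

context operad begin

text \<open>The index is the number of variables of the monomial. Induction on these monomials is where it enters that the
 operad is binary.\<close>

inductive mon :: "('r, 'v) module => nat => ('r, 'o, 'v) fa => bool" for V where
 mon_inc: "v : \<U> V ==> mon V 1 (inc V v)"
| mon_act: "b : \<OO> 2 ==> mon V k x ==> mon V l y ==> mon V (k + l) (act V b [x, y])"

lemma act2_closed:
 "module R V ==> b : \<OO> 2 ==> x : \<AA> V ==> y : \<AA> V ==> act V b [x, y] : \<AA> V"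
 by (rule act_mem) (simp_all add: numeral_2_eq_2)

lemma mon_closed: "mon V n x ==> module R V ==> x : \<AA> V"
 by (induction rule: mon.induct) (simp_all add: inc_closed act2_closed)

lemma mon_pos: "mon V n x ==> 1 <= n"
 by (induction rule: mon.induct) simp_all

end

locale binary_presentation = operad R P for R :: "'r ring" (structure) and P :: "('r, 'o) operad" +
 fixes B :: "'b set" and \<phi> :: "nat => ('b btree => 'r) => 'o"
 assumes hom: "operad_hom R (free_binary_operad R B) P \<phi>"
  and onto: "\<phi> n ` \<U> (op_mod (free_binary_operad R B) n) = \<U> (op_mod P n)"
  and nontrivial: "\<one> ~= \<zero>"
begin

lemma free_op_sel:
 "op_mod (free_binary_operad R B) n = free_mod R (labelled_trees B n)"
 "op_one (free_binary_operad R B) = single R (Leaf 0)"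
 by (simp_all add: free_binary_operad_def)

lemma phi_lin: "is_lin (free_mod R (labelled_trees B n)) (Op n) (\<phi> n)"
proof -
 have "\<phi> n : lin_hom R (op_mod (free_binary_operad R B) n) (op_mod P n)"
  using hom by (simp add: operad_hom_def)
 then show ?thesis unfolding free_op_sel by (rule lin_hom_lin)
qed

lemma phi_one: "\<phi> 1 (single R (Leaf 0)) = op_one P"
 using hom by (simp add: operad_hom_def free_op_sel)

lemma phi_single: "t : labelled_trees B n ==> \<phi> n (single R t) : \<OO> n"
 by (rule lin_closed[OF phi_lin single_closed])

lemma phi_relabel:
 assumes t: "t : labelled_trees B n" and s: "\<sigma> permutes {..<n}"
  and t': "relabel (inv_into UNIV \<sigma>) t : labelled_trees B n"
 shows "\<phi> n (single R (relabel (inv_into UNIV \<sigma>) t)) = op_act P n (\<phi> n (single R t)) \<sigma>"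
proof -
 have "op_act (free_binary_operad R B) n (single R t) \<sigma> = single R (relabel (inv_into UNIV \<sigma>) t)"
  using lin_ext_single[of "free_mod R (labelled_trees B n)" "%t. single R (relabel (inv_into UNIV \<sigma>) t)" t, OF free_module single_closed[OF t']]
  by (simp add: free_binary_operad_def)
 moreover have "\<phi> n (op_act (free_binary_operad R B) n (single R t) \<sigma>) = op_act P n (\<phi> n (single R t)) \<sigma>"
  using hom s single_closed[OF t] by (simp add: operad_hom_def free_op_sel)
 ultimately show ?thesis by simp
qed

text \<open>Grafting two trees on a binary vertex is an operadic composite, and \<open>\<phi>\<close> is a morphism of operads.\<close>

lemma phi_node:
 assumes "node_labels (Node b s t) <= B"
 shows "\<phi> (length (leaves s) + length (leaves t)) (single R (planar 0 (Node b s t))) =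
  op_comp P [length (leaves s), length (leaves t)] (\<phi> 2 (single R (Node b (Leaf 0) (Leaf 1))))
   [\<phi> (length (leaves s)) (single R (planar 0 s)), \<phi> (length (leaves t)) (single R (planar 0 t))]"
  "\<phi> 2 (single R (Node b (Leaf 0) (Leaf 1))) : \<OO> 2"
proof -
 let ?k = "length (leaves s)" and ?l = "length (leaves t)" and ?c = "Node b (Leaf 0) (Leaf 1)"
 let ?F = "free_binary_operad R B"
 have c: "?c : labelled_trees B 2"
  using planar_labelled[of "Node b (Leaf 0) (Leaf 0)" B] assms by (simp add: numeral_2_eq_2)
 have s: "planar 0 s : labelled_trees B ?k" and t: "planar 0 t : labelled_trees B ?l"
  by (rule planar_labelled, use assms in simp)+
 have n: "planar 0 (Node b s t) : labelled_trees B (?k + ?l)"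
  using planar_labelled[OF assms] by simp
 let ?M = "free_mod R (labelled_trees B (?k + ?l))"
 have "op_comp ?F [?k, ?l] (single R ?c) [single R (planar 0 s), single R (planar 0 t)] =
  lin_ext R ?M (%t'. multilin_ext R ?M (%ss. single R (tree_comp [?k, ?l] t' ss)) [single R (planar 0 s), single R (planar 0 t)]) (single R ?c)"
  by (simp add: free_binary_operad_def Let_def)
 moreover have m: "multilin_ext R ?M (%ss. single R (tree_comp [?k, ?l] ?c ss)) [single R (planar 0 s), single R (planar 0 t)] =
  single R (planar 0 (Node b s t))"
  using multilin_ext_two_singles[OF free_module nontrivial, of "%ss. single R (tree_comp [?k, ?l] ?c ss)" "planar 0 s" "planar 0 t"]
  unfolding tree_comp_planar using single_closed[OF n] by blast
 moreover
 have "lin_ext R ?M (%t'. multilin_ext R ?M (%ss. single R (tree_comp [?k, ?l] t' ss)) [single R (planar 0 s), single R (planar 0 t)]) (single R ?c)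
   = single R (planar 0 (Node b s t))"
  using lin_ext_single[of ?M "%t'. multilin_ext R ?M (%ss. single R (tree_comp [?k, ?l] t' ss)) [single R (planar 0 s), single R (planar 0 t)]" ?c, OF free_module]
  unfolding m using single_closed[OF n] by blast
 ultimately have e: "op_comp ?F [?k, ?l] (single R ?c) [single R (planar 0 s), single R (planar 0 t)] = single R (planar 0 (Node b s t))" by (simp only:)
 have a: "op_args ?F [?k, ?l] [single R (planar 0 s), single R (planar 0 t)]"
  using single_closed[OF s] single_closed[OF t] by (simp add: op_args_def free_op_sel)
 have cc: "single R ?c : \<U> (op_mod ?F (length [?k, ?l]))"
  using single_closed[OF c] by (simp add: free_op_sel numeral_2_eq_2)
 have h: "\<phi> (sum_list [?k, ?l]) (op_comp ?F [?k, ?l] (single R ?c) [single R (planar 0 s), single R (planar 0 t)]) =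
  op_comp P [?k, ?l] (\<phi> (length [?k, ?l]) (single R ?c)) (map2 \<phi> [?k, ?l] [single R (planar 0 s), single R (planar 0 t)])"
  using hom a cc unfolding operad_hom_def by blast
 show "\<phi> (?k + ?l) (single R (planar 0 (Node b s t))) =
  op_comp P [?k, ?l] (\<phi> 2 (single R ?c)) [\<phi> ?k (single R (planar 0 s)), \<phi> ?l (single R (planar 0 t))]"
  using h unfolding e by (simp add: numeral_2_eq_2)
 show "\<phi> 2 (single R ?c) : \<OO> 2" by (rule phi_single[OF c])
qed

lemma planar_mon:
 assumes V: "module R V"
 shows "node_labels t <= B ==> set vs <= \<U> V ==> length vs = length (leaves t) ==>
  mon V (length vs) (el V (\<phi> (length vs) (single R (planar 0 t))) vs)"
proof (induction t arbitrary: vs)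
 case (Leaf i)
 then obtain v where v: "vs = [v]" "v : \<U> V" by (cases vs) auto
 then show ?case using mon_inc[OF v(2)] phi_one by (simp add: fa_inc_def)
next
 case (Node b s t)
 let ?k = "length (leaves s)" and ?l = "length (leaves t)"
 let ?us = "take ?k vs" and ?ws = "drop ?k vs"
 let ?\<beta> = "\<phi> 2 (single R (Node b (Leaf 0) (Leaf 1)))"
 let ?\<mu> = "\<phi> ?k (single R (planar 0 s))" and ?\<nu> = "\<phi> ?l (single R (planar 0 t))"
 have l: "length ?us = ?k" "length ?ws = ?l" using Node.prems(3) by simp_all
 have vs: "set ?us <= \<U> V" "set ?ws <= \<U> V"
  using Node.prems(2) by (auto dest!: in_set_takeD in_set_dropD)
 have lab: "node_labels s <= B" "node_labels t <= B" using Node.prems(1) by simp_all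
 have m: "mon V ?k (el V ?\<mu> ?us)" "mon V ?l (el V ?\<nu> ?ws)"
  using Node.IH(1)[OF lab(1) vs(1) l(1)] Node.IH(2)[OF lab(2) vs(2) l(2)] unfolding l .
 have w: "(?\<mu>, ?us) : wd V" "(?\<nu>, ?ws) : wd V"
  using phi_single[OF planar_labelled[OF lab(1)]] phi_single[OF planar_labelled[OF lab(2)]] vs l
  unfolding wd_iff by simp_all
 note n = phi_node[OF Node.prems(1)]
 have \<beta>: "?\<beta> : \<OO> (length [(?\<mu>, ?us), (?\<nu>, ?ws)])" using n(2) by (simp add: numeral_2_eq_2)
 have s: "set [(?\<mu>, ?us), (?\<nu>, ?ws)] <= wd V" using w by simp
 have "act V ?\<beta> [el V ?\<mu> ?us, el V ?\<nu> ?ws] = el V (op_comp P [?k, ?l] ?\<beta> [?\<mu>, ?\<nu>]) (?us @ ?ws)"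
  using act_els2[OF V s \<beta>] l by simp
 also have "... = el V (\<phi> (length vs) (single R (planar 0 (Node b s t)))) vs"
  using n(1) Node.prems(3) by simp
 finally have e: "act V ?\<beta> [el V ?\<mu> ?us, el V ?\<nu> ?ws] = el V (\<phi> (length vs) (single R (planar 0 (Node b s t)))) vs" .
 have "length vs = ?k + ?l" using Node.prems(3) by simp
 then show ?case using mon_act[OF n(2) m] unfolding e by simp
qed

lemma tree_mon:
 assumes V: "module R V" and t: "t : labelled_trees B n" and vs: "set vs <= \<U> V" and l: "length vs = n"
 shows "mon V n (el V (\<phi> n (single R t)) vs)"
proof -
 have lab: "node_labels t <= B" and lt: "distinct (leaves t)" "set (leaves t) = {..<n}"
  using t by (simp_all add: labelled_trees_def)
 have ln: "length (leaves t) = n" using distinct_card[OF lt(1)] lt(2) by simp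
 let ?\<pi> = "list_perm (leaves t)"
 have "mset (leaves t) = mset [0..<n]"
  using mset_set_set[OF lt(1)] lt(2) by (simp add: atLeast0LessThan)
 then have p: "?\<pi> permutes {..<n}" by (rule list_perm_permutes)
 let ?\<sigma> = "inv_into UNIV ?\<pi>"
 have s: "?\<sigma> permutes {..<n}" by (rule permutes_inv[OF p])
 have inv: "inv_into UNIV ?\<sigma> = ?\<pi>" by (rule permutes_inv_inv[OF p])
 have r: "relabel (inv_into UNIV ?\<sigma>) (planar 0 t) = t"
  unfolding inv by (rule relabel_planar_leaves) (simp add: list_perm_def)
 have pt: "planar 0 t : labelled_trees B n" using planar_labelled[OF lab] unfolding ln .
 have e: "\<phi> n (single R t) = op_act P n (\<phi> n (single R (planar 0 t))) ?\<sigma>"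
  using phi_relabel[OF pt s] t unfolding r by simp
 let ?ws = "permute_list ?\<pi> vs"
 have pv: "?\<pi> permutes {..<length vs}" and sv: "?\<sigma> permutes {..<length ?ws}" using p s l by simp_all
 have ws: "set ?ws <= \<U> V" "length ?ws = n" using vs l pv by simp_all
 have w: "(\<phi> n (single R (planar 0 t)), ?ws) : wd V"
  using phi_single[OF pt] ws by (simp only: wd_iff)
 have sv': "?\<sigma> permutes {..<length vs}" using s l by simp
 have b: "permute_list ?\<sigma> ?ws = vs"
  using permute_list_compose[OF sv', of ?\<pi>] permutes_inv_o(1)[OF p] by simp
 have "el V (\<phi> n (single R t)) vs = el V (op_act P (length ?ws) (\<phi> n (single R (planar 0 t))) ?\<sigma>) (permute_list ?\<sigma> ?ws)"
  unfolding e b ws(2) ..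
 also have "... = el V (\<phi> n (single R (planar 0 t))) ?ws" by (rule el_sym[OF V w sv])
 finally show ?thesis using planar_mon[OF V lab ws(1)] ln ws(2) by simp
qed

text \<open>As \<open>\<phi>\<close> is surjective, every operation is a combination of images of trees, and a tree applied to variables is
 a monomial.\<close>

lemma el_mon_span:
 assumes V: "module R V" and w: "(\<mu>, vs) : wd V"
 shows "el V \<mu> vs : mspan R (\<A> V) {x. mon V (length vs) x}"
proof -
 let ?n = "length vs"
 let ?T = "free_mod R (labelled_trees B ?n)"
 have vs: "set vs <= \<U> V" "\<mu> : \<OO> ?n" using w by (simp_all add: wd_iff)
 have mc: "{x. mon V ?n x} <= \<AA> V" using mon_closed[OF _ V] by blast
 have "\<mu> : \<phi> ?n ` carrier ?T" using vs(2) onto[of ?n] unfolding free_op_sel by simp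
 then obtain x where x: "x : carrier ?T" "\<mu> = \<phi> ?n x" by blast
 have L: "is_lin ?T (\<A> V) (%x. el V (\<phi> ?n x) vs)" by (rule lin_comp[OF phi_lin el_lin[OF V vs(1)]])
 show ?thesis
  unfolding x(2)
 proof (rule lin_mspan_into[OF free_module FA_module[OF V] L _ mspan_submodule[OF FA_module[OF V] mc]])
  show "single R ` labelled_trees B ?n <= carrier ?T" by auto
  show "x : mspan R ?T (single R ` labelled_trees B ?n)" unfolding free_span by (rule x(1))
  fix s assume "s : single R ` labelled_trees B ?n"
  then obtain t where t: "t : labelled_trees B ?n" "s = single R t" by blast
  show "el V (\<phi> ?n s) vs : mspan R (\<A> V) {x. mon V ?n x}"
   unfolding t(2) by (rule mspan_base, rule CollectI, rule tree_mon[OF V t(1) vs(1) refl])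
 qed
qed

end

section \<open>Brackets of derivations of rank one\<close>

context base_ring begin

text \<open>Spare directions of \<open>W\<close> relative to \<open>j\<close>: the functionals \<open>\<eta> l\<close> are dual to the vectors \<open>e l\<close> and do not see the
 image of \<open>j\<close>.\<close>

definition fam :: "('r, 'v) module => ('r, 'w) module => ('v => 'w) => nat set => (nat => 'w) => (nat => 'w => 'r) => bool" where
 "fam V W j L e \<eta> \<longleftrightarrow> is_lin V W j & finite L &
   (ALL l:L. e l : \<U> W & is_lin W \<R> (\<eta> l) & (ALL v:\<U> V. \<eta> l (j v) = \<zero>)) &
   (ALL l:L. ALL k:L. \<eta> l (e k) = (if l = k then \<one> else \<zero>))"

lemma famD:
 assumes "fam V W j L e \<eta>"
 shows "is_lin V W j" "finite L" "l : L ==> e l : \<U> W" "l : L ==> is_lin W \<R> (\<eta> l)"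
  "l : L ==> v : \<U> V ==> \<eta> l (j v) = \<zero>"
  "l : L ==> \<eta> l (e l) = \<one>" "l : L ==> k : L ==> l ~= k ==> \<eta> l (e k) = \<zero>"
 using assms by (simp_all add: fam_def)

lemma mod_finsum_two:
 assumes M: "module R M" and f: "f 0 : \<U> M" "f 1 : \<U> M"
 shows "(\<Oplus>\<^bsub>M\<^esub>i\<in>{0, 1 :: nat}. f i) = f 0 +[M] f 1"
proof -
 have "(\<Oplus>\<^bsub>M\<^esub>i\<in>{0, 1 :: nat}. f i) = f 0 +[M] (\<Oplus>\<^bsub>M\<^esub>i\<in>{1}. f i)"
  by (rule mod_finsum_insert[OF M]) (use f in auto)
 also have "(\<Oplus>\<^bsub>M\<^esub>i\<in>{1}. f i) = f 1 +[M] (\<Oplus>\<^bsub>M\<^esub>i\<in>{}. f i)"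
  by (rule mod_finsum_insert[OF M]) (use f in auto)
 also have "... = f 1" using f M by simp
 finally show ?thesis .
qed

lemma fam_subset: "fam V W j L e \<eta> ==> K <= L ==> fam V W j K e \<eta>"
 unfolding fam_def using finite_subset[of K L] by blast

end

context operad begin

lemma act_deg:
 assumes V: "module R V" and m: "\<mu> : \<OO> (Suc (length as + length bs))"
  and ab: "set as <= \<U> V" "set bs <= \<U> V" and x: "x : fa_deg R P V n"
 shows "act V \<mu> (map (inc V) as @ x # map (inc V) bs) : fa_deg R P V (length as + length bs + n)"
proof (rule lin_mspan_into[OF FA_module[OF V] FA_module[OF V] multilinD[OF act_multilin[OF V m]] fa_deg_gen[OF V] fa_deg_submodule[OF V] _ x[unfolded fa_deg_def]])
 show "set (map (inc V) as) <= \<AA> V" "set (map (inc V) bs) <= \<AA> V"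
  using incs_closed[OF V] ab by simp_all
 fix s assume "s : {el V \<mu> vs |\<mu> vs. (\<mu>, vs) : wd V & length vs = n}"
 then obtain \<nu> us where s: "s = el V \<nu> us" and w: "(\<nu>, us) : wd V" "length us = n" by blast
 let ?o = "map (%v. (op_one P, [v]))"
 let ?B = "?o as @ (\<nu>, us) # ?o bs"
 have B: "set ?B <= wd V" using w ab by (auto intro!: inc_wd)
 have mB: "\<mu> : \<OO> (length ?B)" using m by simp
 have e: "map (inc V) as @ el V \<nu> us # map (inc V) bs = map (%(\<nu>, us). el V \<nu> us) ?B" by (simp add: fa_inc_def)
 have l: "length (concat (map snd ?B)) = length as + length bs + n"
  using w(2) by (simp add: length_concat comp_def sum_list_triv)
 show "act V \<mu> (map (inc V) as @ s # map (inc V) bs) : fa_deg R P V (length as + length bs + n)"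
  unfolding s e act_els2[OF V B mB] fa_deg_def by (rule mspan_base) (use wd_comp[OF B mB] l in blast)
qed simp

lemma Der_deg_fa_deg:
 assumes V: "module R V" and d: "d : Der_deg R P V k" and x: "x : fa_deg R P V n"
 shows "d x : fa_deg R P V (n + k)"
proof -
 have dc: "d : \<DD> V" and di: "d (inc V v) : fa_deg R P V (k + 1)" if "v : \<U> V" for v
  using d that by (simp_all add: Der_deg_def)
 have dc: "d : \<DD> V" using d by (simp add: Der_deg_def)
 show ?thesis
 proof (rule lin_mspan_into[OF FA_module[OF V] FA_module[OF V] Der_lin[OF dc] fa_deg_gen[OF V] fa_deg_submodule[OF V] _ x[unfolded fa_deg_def]])
  fix s assume "s : {el V \<mu> vs |\<mu> vs. (\<mu>, vs) : wd V & length vs = n}"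
  then obtain \<mu> vs where s: "s = el V \<mu> vs" and w: "(\<mu>, vs) : wd V" and n: "length vs = n" by blast
  have vs: "set vs <= \<U> V" "\<mu> : \<OO> (length vs)" using w by (simp_all add: wd_iff)
  have e: "d (el V \<mu> vs) = posum (\<A> V) (act V \<mu>) (%v. inc V v) (%v. d (inc V v)) vs"
   by (rule along_el[OF V V inc_closed[OF V] Der_along[OF dc] w])
  show "d s : fa_deg R P V (n + k)" unfolding s e posum_def
  proof (rule sub_finsum[OF FA_module[OF V] fa_deg_submodule[OF V]])
   fix i assume "i : {..<length vs}"
   then have i: "i < length vs" by simp
   let ?as = "take i vs" and ?bs = "drop (Suc i) vs"
   have l: "Suc (length ?as + length ?bs) = length vs" using i by simp
   have l': "length ?as + length ?bs + (k + 1) = n + k" using l n by linarith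
   have vi: "vs ! i : \<U> V" using vs(1) nth_mem[OF i] by blast
   have m: "\<mu> : \<OO> (Suc (length ?as + length ?bs))" using vs(2) unfolding l .
   have ab: "set ?as <= \<U> V" "set ?bs <= \<U> V"
    using vs(1) by (auto dest!: in_set_takeD in_set_dropD)
   show "act V \<mu> ((map (%v. inc V v) vs)[i := d (inc V (vs ! i))]) : fa_deg R P V (n + k)"
    unfolding list_updates[OF i] using act_deg[OF V m ab di[OF vi]] unfolding l' .
  qed
 qed
qed

lemma inc_deg: "v : \<U> V ==> inc V v : fa_deg R P V 1"
 unfolding fa_deg_def fa_inc_def by (rule mspan_base) (use unit_closed in \<open>force simp: wd_iff\<close>)

lemma br_rk:
 assumes W: "module R W" and x: "x : \<AA> W" and y: "y : \<AA> W"
  and f: "is_lin W \<R> f" and h: "is_lin W \<R> h"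
 shows "br W (rk W x f) (rk W y h) = rk W (rk W y h x) f -[\<D> W] rk W (rk W x f y) h"
proof -
 note A = rk[OF W f x] and B = rk[OF W h y]
 have gx: "rk W y h x : \<AA> W" and gy: "rk W x f y : \<AA> W"
  by (rule Der_mem[OF B(1) x], rule Der_mem[OF A(1) y])
 note C = rk[OF W f gx] and D = rk[OF W h gy]
 show ?thesis
 proof (rule Der_eqI[OF W br_mem[OF W A(1) B(1)] mod_minus[OF Der_module[OF W] C(1) D(1)]])
  fix v assume v: "v : \<U> W"
  have fv: "f v : \<U> R" and hv: "h v : \<U> R" using lin_closed[OF f v] lin_closed[OF h v] by simp_all
  show "br W (rk W x f) (rk W y h) (inc W v) = (rk W (rk W y h x) f -[\<D> W] rk W (rk W x f y) h) (inc W v)"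
   unfolding br_inc[OF W A(1) B(1) v] Der_minus_ev[OF W inc_closed[OF W v] C(1) D(1)] C(2)[OF v] D(2)[OF v]
    A(2)[OF v] B(2)[OF v] lin_smult[OF Der_lin[OF B(1)] fv x] lin_smult[OF Der_lin[OF A(1)] hv y] ..
 qed
qed

lemma rk_zero: "module R W ==> is_lin W \<R> f ==> rk W 0[\<A> W] f = 0[\<D> W]"
 by (rule lin_zero[OF FA_module Der_module rk_lin])

text \<open>In the applications \<open>y\<close> only contains variables that \<open>f\<close> kills.\<close>

lemma br_rk_kill:
 assumes W: "module R W" and x: "x : \<AA> W" and y: "y : \<AA> W"
  and f: "is_lin W \<R> f" and h: "is_lin W \<R> h" and k: "rk W x f y = 0[\<A> W]"
 shows "br W (rk W x f) (rk W y h) = rk W (rk W y h x) f"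
proof -
 note DM = Der_module[OF W]
 have c: "rk W (rk W y h x) f : \<DD> W" by (rule rk(1)[OF W f Der_mem[OF rk(1)[OF W h y] x]])
 have "a -[\<D> W] 0[\<D> W] = a" if "a : \<DD> W" for a
  using that DM by (simp add: mod_minus_eq mod_uminus_smult)
 then show ?thesis unfolding br_rk[OF W x y f h] k rk_zero[OF W h] using c by simp
qed

lemma rk_kill:
 assumes V: "module R V" and W: "module R W" and j: "is_lin V W j" and f: "is_lin W \<R> f"
  and x: "x : \<AA> W" and k: "!!v. v : \<U> V ==> f (j v) = \<zero>" and X: "X : \<AA> V"
 shows "rk W x f (fm V W j X) = 0[\<A> W]"
proof (rule along_unique[OF V W _ _ _ along_zero[OF V W] _ X])
 note r = rk[OF W f x]
 show "along V W (%X. fm V W j X) (%X. rk W x f (fm V W j X))"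
  by (rule along_fm_pre[OF V W W j _ Der_along[OF r(1)]])
 fix v assume v: "v : \<U> V"
 note jv = lin_closed[OF j v]
 show "rk W x f (fm V W j (inc V v)) = 0[\<A> W]"
  unfolding fm_inc[OF V W j v] r(2)[OF jv] k[OF v] by (rule mod_smult_l_null[OF FA_module[OF W] x])
 show "fm V W j (inc V v) : \<AA> W" by (rule fm_closed[OF V W j inc_closed[OF V v]])
qed (rule refl, rule fm_closed[OF V W j])

lemma Der_act2:
 assumes W: "module R W" and d: "d : \<DD> W" and b: "b : \<OO> 2"
  and xy: "x : \<AA> W" "y : \<AA> W"
 shows "d (act W b [x, y]) = act W b [d x, y] +[\<A> W] act W b [x, d y]"
proof -
 have b2: "b : \<OO> (length [x, y])" using b by (simp add: numeral_2_eq_2)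
 note A = FA_module[OF W]
 note c = act2_closed[OF W b]
 have dx: "d x : \<AA> W" "d y : \<AA> W" using Der_mem[OF d] xy by simp_all
 have "d (act W b [x, y]) = posum (\<A> W) (act W b) (%X. X) d [x, y]"
  by (rule along_act[OF Der_along[OF d] b2]) (use xy in simp)
 also have "... = act W b [d x, y] +[\<A> W] act W b [x, d y]"
 proof -
  let ?f = "%i. act W b ((map (%X. X) [x, y])[i := d ([x, y] ! i)])"
  have f0: "?f 0 = act W b [d x, y]" and f1: "?f 1 = act W b [x, d y]" by simp_all
  have fc: "?f 0 : \<AA> W" "?f 1 : \<AA> W" unfolding f0 f1 using c xy dx by blast+
  have "{..<length [x, y]} = {0, 1}" by auto
  then show ?thesis unfolding posum_def f0[symmetric] f1[symmetric] by (simp only: mod_finsum_two[of _ ?f, OF A fc])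
 qed
 finally show ?thesis .
qed

lemma act2_zero:
 assumes W: "module R W" and b: "b : \<OO> 2" and x: "x : \<AA> W"
 shows "act W b [0[\<A> W], x] = 0[\<A> W]" "act W b [x, 0[\<A> W]] = 0[\<A> W]"
proof -
 note A = FA_module[OF W]
 have l: "is_lin (\<A> W) (\<A> W) (%z. act W b ([] @ z # [x]))"
  by (rule multilinD[OF act_multilin[OF W b]]) (use x in simp_all)
 have r: "is_lin (\<A> W) (\<A> W) (%z. act W b ([x] @ z # []))"
  by (rule multilinD[OF act_multilin[OF W b]]) (use x in simp_all)
 show "act W b [0[\<A> W], x] = 0[\<A> W]" "act W b [x, 0[\<A> W]] = 0[\<A> W]"
  using lin_zero[OF A A l] lin_zero[OF A A r] by simp_all
qed

lemma mon_one_deg: "mon V n x ==> n = 1 ==> x : fa_deg R P V 1"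
proof (induction rule: mon.induct)
 case (mon_inc v)
 then show ?case by (intro inc_deg)
next
 case (mon_act b k x l y)
 then show ?case using mon_pos[OF mon_act(2)] mon_pos[OF mon_act(3)] by simp
qed

end

text \<open>A property of \<open>x\<close> of the form ``\<open>T k x\<close> lies in \<open>H k\<close> for all indices \<open>k\<close> of large size'' is linear in \<open>x\<close>.\<close>

lemma (in base_ring) eventually_span:
 fixes sz :: "'k => nat" and T :: "'k => 'm => 'n"
 assumes M: "module R M" and G: "G <= \<U> M"
  and N: "!!k. k : K ==> module R (N k)" and T: "!!k. k : K ==> is_lin M (N k) (T k)"
  and H: "!!k. k : K ==> submodule (H k) R (N k)"
  and g: "!!s. s : G ==> EX n. ALL k:K. n <= sz k --> T k s : H k" and x: "x : mspan R M G"
 shows "EX n. ALL k:K. n <= sz k --> T k x : H k"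
 using M G x
proof (induction rule: mspan_induct)
 case zero
 have "T k 0[M] : H k" if "k : K" for k
  unfolding lin_zero[OF M N[OF that] T[OF that]] by (rule sub_zero[OF H[OF that]])
 then show ?case by blast
next
 case (add y z)
 obtain m n where mn: "ALL k:K. m <= sz k --> T k y : H k" "ALL k:K. n <= sz k --> T k z : H k"
  using add.IH by (elim exE)
 have "T k (y +[M] z) : H k" if k: "k : K" and s: "m + n <= sz k" for k
  unfolding lin_add[OF T[OF k] mspan_carrier[OF M G add.hyps(1)] mspan_carrier[OF M G add.hyps(2)]]
  by (rule sub_add[OF H[OF k]]) (use mn k s in simp_all)
 then show ?case by blast
next
 case (smult a y)
 obtain m where m: "ALL k:K. m <= sz k --> T k y : H k" using smult.IH by (elim exE)
 have "T k (a *[M] y) : H k" if k: "k : K" and s: "m <= sz k" for k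
  unfolding lin_smult[OF T[OF k] smult.hyps(1) mspan_carrier[OF M G smult.hyps(2)]]
  by (rule sub_smult[OF H[OF k] smult.hyps(1)]) (use m k s in simp)
 then show ?case by blast
qed (rule g)

context binary_presentation begin

text \<open>The commutator of two derivations is a derivation. On tree monomials this only involves the Leibniz
 rule for binary operations, where the mixed terms are visibly symmetric.\<close>

lemma br_ev:
 assumes V: "module R V" and d: "d : \<DD> V" and e: "e : \<DD> V" and X: "X : \<AA> V"
 shows "br V d e X = e (d X) -[\<A> V] d (e X)"
proof -
 note A = FA_module[OF V]
 interpret N: module R "\<A> V" by (rule A)
 note Ld = Der_lin[OF d] and Le = Der_lin[OF e] and D = br_mem[OF V d e]
 have mon: "br V d e x = e (d x) -[\<A> V] d (e x)" if "mon V n x" for n x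
  using that
 proof (induction rule: mon.induct)
  case (mon_inc v)
  then show ?case by (rule br_inc[OF V d e])
 next
  case (mon_act b k x l y)
  note b = mon_act(1)
  note xy = mon_closed[OF mon_act(2) V] mon_closed[OF mon_act(3) V]
  note c = act2_closed[OF V b] and dx = Der_mem[OF d] Der_mem[OF e]
  have l: "is_lin (\<A> V) (\<A> V) (%z. act V b ([] @ z # [u]))" "is_lin (\<A> V) (\<A> V) (%z. act V b ([u] @ z # []))"
   if "u : \<AA> V" for u by (rule multilinD[OF act_multilin[OF V b]]; use that in simp)+
  have two: "g (f (act V b [x, y])) = (act V b [g (f x), y] +[\<A> V] act V b [f x, g y]) +[\<A> V]
     (act V b [g x, f y] +[\<A> V] act V b [x, g (f y)])" if f: "f : \<DD> V" and g: "g : \<DD> V" for f g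
   unfolding Der_act2[OF V f b xy] lin_add[OF Der_lin[OF g] c[OF Der_mem[OF f xy(1)] xy(2)] c[OF xy(1) Der_mem[OF f xy(2)]]]
    Der_act2[OF V g b Der_mem[OF f xy(1)] xy(2)] Der_act2[OF V g b xy(1) Der_mem[OF f xy(2)]] ..
  have dif: "act V b [e (d x) -[\<A> V] d (e x), y] = act V b [e (d x), y] -[\<A> V] act V b [d (e x), y]"
   "act V b [x, e (d y) -[\<A> V] d (e y)] = act V b [x, e (d y)] -[\<A> V] act V b [x, d (e y)]"
   using lin_minus[OF A A l(1)[OF xy(2)]] lin_minus[OF A A l(2)[OF xy(1)]] dx xy by simp_all
  have comb: "(p -[\<A> V] p') +[\<A> V] (q -[\<A> V] q') =
    ((p +[\<A> V] s) +[\<A> V] (t +[\<A> V] q)) -[\<A> V] ((p' +[\<A> V] t) +[\<A> V] (s +[\<A> V] q'))"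
   if "p : \<AA> V" "p' : \<AA> V" "q : \<AA> V" "q' : \<AA> V" "s : \<AA> V" "t : \<AA> V" for p p' q q' s t
  proof -
   have "((p +[\<A> V] s) +[\<A> V] (t +[\<A> V] q)) -[\<A> V] ((p' +[\<A> V] t) +[\<A> V] (s +[\<A> V] q')) =
    (s +[\<A> V] -[\<A> V] s) +[\<A> V] ((t +[\<A> V] -[\<A> V] t) +[\<A> V] ((p -[\<A> V] p') +[\<A> V] (q -[\<A> V] q')))"
    using that by (simp add: a_minus_def N.minus_add N.a_ac)
   then show ?thesis using that by (simp add: N.r_neg)
  qed
  show ?case
   unfolding Der_act2[OF V D b xy] mon_act.IH two[OF d e] two[OF e d] dif
   by (rule comb) (use c dx xy in simp_all)
 qed
 have L: "is_lin (\<A> V) (\<A> V) (%X. e (d X) -[\<A> V] d (e X))" by (rule lin_diff[OF A A lin_comp[OF Ld Le] lin_comp[OF Le Ld]])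
 show ?thesis
 proof (rule FA_lin_eq[OF V A Der_lin[OF D] L _ X])
  fix \<mu> vs assume w: "(\<mu>, vs) : wd V"
  show "br V d e (el V \<mu> vs) = e (d (el V \<mu> vs)) -[\<A> V] d (e (el V \<mu> vs))"
   by (rule lin_eq_on_mspan[OF A A Der_lin[OF D] L _ _ el_mon_span[OF V w]]) (use mon_closed[OF _ V] mon in auto)
 qed
qed

lemma br_lin_left:
 assumes V: "module R V" and e: "e : \<DD> V" shows "is_lin (\<D> V) (\<D> V) (%d. br V d e)"
proof (rule Der_valued_lin[OF V Der_module[OF V] br_mem[OF V _ e]])
 fix v assume v: "v : \<U> V"
 note i = inc_closed[OF V v] and A = FA_module[OF V]
 show "is_lin (\<D> V) (\<A> V) (%d. br V d e (inc V v))"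
  by (rule lin_cong[OF lin_diff[OF Der_module[OF V] A lin_comp[OF Der_ev_lin[OF i] Der_lin[OF e]] Der_ev_lin[OF Der_mem[OF e i]]]
   br_inc[OF V _ e v] Der_module[OF V]])
qed

lemma jacobi:
 assumes V: "module R V" and d: "d : \<DD> V" and e: "e : \<DD> V" and f: "f : \<DD> V"
 shows "br V (br V d e) f = br V (br V d f) e +[\<D> V] br V d (br V e f)"
proof (rule Der_eqI[OF V])
 interpret N: module R "\<A> V" using V by simp
 have N: "module R (\<A> V)" using V by simp
 fix v assume "v : \<U> V"
 then have i: "inc V v : \<AA> V" using inc_closed[OF V] by simp
 note [simp] = Der_mem[OF d] Der_mem[OF e] Der_mem[OF f] br_mem[OF V]
 note m = lin_minus[OF N N Der_lin[OF d]] lin_minus[OF N N Der_lin[OF e]] lin_minus[OF N N Der_lin[OF f]]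
 have comb: "(p -[\<A> V] q) -[\<A> V] (r -[\<A> V] s) =
   ((t -[\<A> V] r) -[\<A> V] (q -[\<A> V] u)) +[\<A> V] ((p -[\<A> V] t) -[\<A> V] (u -[\<A> V] s))"
  if "p : \<AA> V" "q : \<AA> V" "r : \<AA> V" "s : \<AA> V" "t : \<AA> V" "u : \<AA> V" for p q r s t u
 proof -
  have "((t -[\<A> V] r) -[\<A> V] (q -[\<A> V] u)) +[\<A> V] ((p -[\<A> V] t) -[\<A> V] (u -[\<A> V] s)) =
   (t +[\<A> V] -[\<A> V] t) +[\<A> V] ((u +[\<A> V] -[\<A> V] u) +[\<A> V] ((p -[\<A> V] q) -[\<A> V] (r -[\<A> V] s)))"
   using that by (simp add: a_minus_def N.minus_add N.a_ac)
  then show ?thesis using that by (simp add: N.r_neg)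
 qed
 let ?i = "inc V v"
 have a: "br V (br V d e) f ?i = (f (e (d ?i)) -[\<A> V] f (d (e ?i))) -[\<A> V] (e (d (f ?i)) -[\<A> V] d (e (f ?i)))"
  using i d e f by (simp add: br_ev[OF V] m)
 have b: "br V (br V d f) e ?i = (e (f (d ?i)) -[\<A> V] e (d (f ?i))) -[\<A> V] (f (d (e ?i)) -[\<A> V] d (f (e ?i)))"
  using i d e f by (simp add: br_ev[OF V] m)
 have c: "br V d (br V e f) ?i = (f (e (d ?i)) -[\<A> V] e (f (d ?i))) -[\<A> V] (d (f (e ?i)) -[\<A> V] d (e (f ?i)))"
  using i d e f by (simp add: br_ev[OF V] m)
 show "br V (br V d e) f ?i = (br V (br V d f) e +[\<D> V] br V d (br V e f)) ?i"
  unfolding Der_plus_ev[OF i] a b c by (rule comb) (use i in simp_all)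
qed (use V d e f in \<open>simp_all add: br_mem\<close>)

text \<open>\<open>br V (br V x y) g\<close> is a combination of \<open>br V (br V x g) y\<close> and \<open>br V x (br V y g)\<close> by the Jacobi identity, so the
 elements with this property are closed under brackets.\<close>

lemma L1_stable:
 assumes V: "module R V" and g: "g : \<DD> V"
  and deg1: "!!d. d : Der_deg R P V 1 ==> br V d g : L1 V" and d: "d : L1 V"
 shows "br V d g : L1 V"
proof -
 note sub = L1_submodule[OF V]
 note Lg = br_lin_left[OF V g]
 have D: "x : \<DD> V" if "x : L1 V" for x using that L1_carrier[OF V] by blast
 have "L1 V <= {d : L1 V. br V d g : L1 V}"
 proof (rule L1_least)
  show "submodule {d : L1 V. br V d g : L1 V} R (\<D> V)"
  proof (rule submoduleI2[OF Der_module[OF V]])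
   show "{d : L1 V. br V d g : L1 V} <= \<DD> V" using D by blast
   show "0[\<D> V] : {d : L1 V. br V d g : L1 V}"
    using lin_zero[OF Der_module[OF V] Der_module[OF V] Lg] sub_zero[OF sub] by simp
   show "x +[\<D> V] y : {d : L1 V. br V d g : L1 V}"
    if "x : {d : L1 V. br V d g : L1 V}" "y : {d : L1 V. br V d g : L1 V}" for x y
    using that lin_add[OF Lg D D, of x y] sub_add[OF sub] by simp
   show "a *[\<D> V] x : {d : L1 V. br V d g : L1 V}"
    if "a : \<U> R" "x : {d : L1 V. br V d g : L1 V}" for a x
    using that lin_smult[OF Lg that(1) D, of x] sub_smult[OF sub] by simp
  qed
  show "Der_deg R P V 1 <= {d : L1 V. br V d g : L1 V}" using L1_deg1 deg1 by blast
  fix x y assume xy: "x : {d : L1 V. br V d g : L1 V}" "y : {d : L1 V. br V d g : L1 V}"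
  then have m: "br V x y : L1 V" "br V (br V x g) y : L1 V" "br V x (br V y g) : L1 V"
   using L1_br[of x V y] L1_br[of "br V x g" V y] L1_br[of x V "br V y g"] by simp_all
  then show "br V x y : {d : L1 V. br V d g : L1 V}"
   using jacobi[OF V D D g, of x y] xy sub_add[OF sub m(2,3)] by simp
 qed
 then show ?thesis using d by blast
qed

lemma L1_stable_deg0:
 assumes V: "module R V" and g: "g : Der_deg R P V 0" and d: "d : L1 V"
 shows "br V d g : L1 V"
proof -
 have gc: "g : \<DD> V" using g by (simp add: Der_deg_def)
 show ?thesis
 proof (rule L1_stable[OF V gc _ d])
  fix d assume d: "d : Der_deg R P V 1"
  have dc: "d : \<DD> V" using d by (simp add: Der_deg_def)
  have "br V d g (inc V v) : fa_deg R P V (1 + 1)" if v: "v : \<U> V" for v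
  proof -
   have a: "d (inc V v) : fa_deg R P V (1 + 1)" using Der_deg_fa_deg[OF V d inc_deg[OF v]] .
   have b: "g (inc V v) : fa_deg R P V (1 + 0)" using Der_deg_fa_deg[OF V g inc_deg[OF v]] .
   have "g (d (inc V v)) : fa_deg R P V (1 + 1)" using Der_deg_fa_deg[OF V g a] by simp
   moreover have "d (g (inc V v)) : fa_deg R P V (1 + 1)" using Der_deg_fa_deg[OF V d b] by simp
   ultimately show ?thesis
    unfolding br_inc[OF V dc gc v] by (rule sub_minus[OF FA_module[OF V] fa_deg_submodule[OF V]])
  qed
  then have "br V d g : Der_deg R P V 1" using br_mem[OF V dc gc] by (simp add: Der_deg_def)
  then show "br V d g : L1 V" by (rule L1_deg1)
 qed
qed

text \<open>Put \<open>X\<close> and \<open>Y\<close> into the product \<open>b(e\<^sub>p, e\<^sub>q)\<close> one after the other, by brackets with \<open>X \<otimes> \<eta>\<^sub>p\<close> and \<open>Y \<otimes> \<eta>\<^sub>q\<close>. Each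
 factor is shorter than the product, so that dropping one spare direction, which is needed to apply the
 induction hypothesis to \<open>\<eta>\<^sub>p\<close> or \<open>\<eta>\<^sub>q\<close>, leaves enough of them.\<close>

lemma mon_L1:
 assumes V: "module R V" and W: "module R W"
 shows "mon V n x ==> ALL L f. fam V W j L e \<eta> --> is_lin W \<R> f --> (ALL l:L. f (e l) = \<zero>) -->
  (ALL v:\<U> V. f (j v) = \<zero>) --> n <= card L --> 2 <= n --> rk W (fm V W j x) f : L1 W"
proof (induction rule: mon.induct)
 case (mon_inc v)
 then show ?case by simp
next
 case (mon_act b k x l y)
 show ?case
 proof (intro allI impI)
 fix L f
 assume fam: "fam V W j L e \<eta>" and f: "is_lin W \<R> f" and fe: "ALL l:L. f (e l) = \<zero>"
  and fj: "ALL v:\<U> V. f (j v) = \<zero>" and card: "k + l <= card L" and two: "2 <= k + l"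
 note b = mon_act.hyps(1) and F = famD[OF fam]
 note j = F(1)
 have kl: "1 <= k" "1 <= l" using mon_pos[OF mon_act.hyps(2)] mon_pos[OF mon_act.hyps(3)] .
 have kc: "k <= card L - 1" "l <= card L - 1" using kl card by linarith+
 have cL: "2 <= card L" using card two by linarith
 obtain p where p: "p : L" using cL by (metis card.empty equals0I not_numeral_le_zero)
 have cp: "card (L - {p}) = card L - 1" using p F(2) by simp
 then have "L - {p} ~= {}" using cL by (metis card.empty diff_is_0_eq not_one_le_zero numeral_le_one_iff one_add_one order_trans semiring_norm(69))
 then obtain q where q: "q : L" "p ~= q" by blast
 have xy: "x : \<AA> V" "y : \<AA> V" using mon_closed[OF mon_act.hyps(2) V] mon_closed[OF mon_act.hyps(3) V] .
 let ?X = "fm V W j x" and ?Y = "fm V W j y"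
 have XY: "?X : \<AA> W" "?Y : \<AA> W" using fm_closed[OF V W j] xy by simp_all
 have stab: "br W d (rk W (fm V W j z) (\<eta> s)) : L1 W"
  if s: "s : L" and d: "d : L1 W" and z: "mon V n z" and n: "n <= card L - 1"
   and IH: "ALL L f. fam V W j L e \<eta> --> is_lin W \<R> f --> (ALL l:L. f (e l) = \<zero>) -->
    (ALL v:\<U> V. f (j v) = \<zero>) --> n <= card L --> 2 <= n --> rk W (fm V W j z) f : L1 W"
  for s d z n
 proof (cases "n = 1")
  case True
  have "z : fa_deg R P V 1" by (rule mon_one_deg[OF z True])
  then have "fm V W j z : fa_deg R P W (0 + 1)" using fm_fa_deg[OF V W j] by simp
  then have "rk W (fm V W j z) (\<eta> s) : Der_deg R P W 0" by (rule rk_deg[OF W F(4)[OF s]])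
  then show ?thesis by (rule L1_stable_deg0[OF W _ d])
 next
  case False
  then have n2: "2 <= n" using mon_pos[OF z] by linarith
  have "rk W (fm V W j z) (\<eta> s) : L1 W"
  proof (rule IH[rule_format, of "L - {s}" "\<eta> s"])
   show "fam V W j (L - {s}) e \<eta>" by (rule fam_subset[OF fam]) blast
   show "is_lin W \<R> (\<eta> s)" by (rule F(4)[OF s])
   show "\<eta> s (e l) = \<zero>" if "l : L - {s}" for l using F(7)[OF s, of l] that by blast
   show "\<eta> s (j v) = \<zero>" if "v : \<U> V" for v by (rule F(5)[OF s that])
   show "n <= card (L - {s})" using n s F(2) by simp
   show "2 <= n" by (rule n2)
  qed
  then show ?thesis by (rule L1_br[OF d])
 qed
 have ec: "inc W (e p) : \<AA> W" "inc W (e q) : \<AA> W"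
  using inc_closed[OF W F(3)[OF p]] inc_closed[OF W F(3)[OF q(1)]] .
 let ?z0 = "act W b [inc W (e p), inc W (e q)]" and ?z1 = "act W b [?X, inc W (e q)]" and ?z2 = "act W b [?X, ?Y]"
 note c = act2_closed[OF W b]
 have zc: "?z0 : \<AA> W" "?z1 : \<AA> W" "?z2 : \<AA> W" by (rule c, (rule ec XY)+)+
 note g1 = rk[OF W F(4)[OF p] XY(1)] and g2 = rk[OF W F(4)[OF q(1)] XY(2)]
 have w0: "(b, [e p, e q]) : wd W" using b F(3)[OF p] F(3)[OF q(1)] by (simp add: wd_iff numeral_2_eq_2)
 have "el W b [e p, e q] : fa_deg R P W (1 + 1)"
  unfolding fa_deg_def by (rule mspan_base) (use w0 in force)
 then have "?z0 : fa_deg R P W (1 + 1)" using act_incs[OF W w0] by simp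
 then have d0: "rk W ?z0 f : L1 W" by (intro L1_deg1 rk_deg[OF W f])
 have k0: "rk W ?z0 f ?X = 0[\<A> W]" by (rule rk_kill[OF V W j f zc(1) bspec[OF fj] xy(1)])
 have e1: "rk W ?X (\<eta> p) ?z0 = ?z1"
  unfolding Der_act2[OF W g1(1) b ec] g1(2)[OF F(3)[OF p]] g1(2)[OF F(3)[OF q(1)]] F(6)[OF p] F(7)[OF p q]
  using FA_module[OF W] XY ec zc(2) act2_zero[OF W b] by simp
 have d1: "rk W ?z1 f : L1 W"
  using stab[OF p d0 mon_act.hyps(2) kc(1) mon_act.IH(1)]
  unfolding br_rk_kill[OF W zc(1) XY(1) f F(4)[OF p] k0] e1 .
 have k1: "rk W ?z1 f ?Y = 0[\<A> W]" by (rule rk_kill[OF V W j f zc(2) bspec[OF fj] xy(2)])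
 have gX: "rk W ?Y (\<eta> q) ?X = 0[\<A> W]" by (rule rk_kill[OF V W j F(4)[OF q(1)] XY(2) F(5)[OF q(1)] xy(1)])
 have e2: "rk W ?Y (\<eta> q) ?z1 = ?z2"
  unfolding Der_act2[OF W g2(1) b XY(1) ec(2)] g2(2)[OF F(3)[OF q(1)]] F(6)[OF q(1)] gX
  using FA_module[OF W] XY ec zc act2_zero[OF W b] by simp
 have d2: "rk W ?z2 f : L1 W"
  using stab[OF q(1) d1 mon_act.hyps(3) kc(2) mon_act.IH(2)]
  unfolding br_rk_kill[OF W zc(2) XY(2) f F(4)[OF q(1)] k1] e2 .
 have "b : \<OO> (length [x, y])" using b by (simp add: numeral_2_eq_2)
 then have "fm V W j (act V b [x, y]) = ?z2" using fm_act[OF V W j, of b "[x, y]"] xy by simp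
 then show "rk W (fm V W j (act V b [x, y])) f : L1 W" using d2 by simp
 qed
qed

lemma fpos_L1:
 fixes V :: "('r, 'v) module"
 assumes V: "module R V" and x: "x : fpos V"
 shows "EX M. ALL (W :: ('r, 'w) module) j L e \<eta> f. module R W --> fam V W j L e \<eta> --> is_lin W \<R> f -->
  (ALL l:L. f (e l) = \<zero>) --> (ALL v:\<U> V. f (j v) = \<zero>) --> M <= card L --> rk W (fm V W j x) f : L1 W"
proof -
 let ?K = "{(W :: ('r, 'w) module, j, L, e, \<eta>, f). module R W & fam V W j L e \<eta> & is_lin W \<R> f &
  (ALL l:L. f (e l) = \<zero>) & (ALL v:\<U> V. f (j v) = \<zero>)}"
 let ?sz = "%(W :: ('r, 'w) module, j :: 'v => 'w, L :: nat set, e :: nat => 'w, \<eta> :: nat => 'w => 'r, f :: 'w => 'r). card L"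
 let ?T = "%(W :: ('r, 'w) module, j, L :: nat set, e :: nat => 'w, \<eta> :: nat => 'w => 'r, f) x. rk W (fm V W j x) f"
 note A = FA_module[OF V]
 have lin: "is_lin (\<A> V) (\<D> W) (%x. rk W (fm V W j x) f)"
  if "module R W" "fam V W j L e \<eta>" "is_lin W \<R> f" for W :: "('r, 'w) module" and j L e \<eta> f
  by (rule lin_comp[OF fm_lin[OF V that(1) famD(1)[OF that(2)]] rk_lin[OF that(1,3)]])
 have ev: "EX n. ALL k:?K. n <= ?sz k --> ?T k x : L1 (fst k)"
  if G: "G <= \<AA> V" and g: "!!s. s : G ==> EX n. ALL k:?K. n <= ?sz k --> ?T k s : L1 (fst k)" and x: "x : mspan R (\<A> V) G" for G x
  by (rule eventually_span[where N = "%k. \<D> (fst k)" and T = ?T and H = "%k. L1 (fst k)", OF A G _ _ _ g x])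
   (auto simp: L1_submodule lin)
 have "EX n. ALL k:?K. n <= ?sz k --> ?T k x : L1 (fst k)"
 proof (rule ev[OF fa_deg_gen[OF V] _ x[unfolded fpos_def]])
  fix s assume "s : {el V \<mu> vs | \<mu> vs. (\<mu>, vs) : wd V & 2 <= length vs}"
  then obtain \<mu> vs where s: "s = el V \<mu> vs" and w: "(\<mu>, vs) : wd V" and n: "2 <= length vs" by blast
  show "EX n. ALL k:?K. n <= ?sz k --> ?T k s : L1 (fst k)"
   unfolding s
  proof (rule ev[OF _ _ el_mon_span[OF V w]])
   show "{x. mon V (length vs) x} <= \<AA> V" using mon_closed[OF _ V] by blast
   fix z assume "z : {x. mon V (length vs) x}"
   then have z: "mon V (length vs) z" by simp
   show "EX n. ALL k:?K. n <= ?sz k --> ?T k z : L1 (fst k)"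
    by (rule exI[of _ "length vs"]) (use mon_L1[OF V _ z] n in fastforce)
  qed
 qed
 then show ?thesis by fastforce
qed

end

section \<open>Substituting a vector for the linear variable\<close>

context base_ring begin

text \<open>The linear map that puts \<open>e\<close> in place of the linear variable and maps the other ones by \<open>i\<close>.\<close>

definition sb :: "('r, 'w) module => 'w => ('v => 'w) => 'r \<times> 'v => 'w" where
 "sb W e i = (%p. fst p *[W] e +[W] i (snd p))"

lemma sb_lin:
 assumes V: "module R V" and W: "module R W" and e: "e : \<U> W" and i: "is_lin V W i"
 shows "is_lin (R_plus R V) W (sb W e i)"
proof -
 have RV: "module R (R_plus R V)" using V by simp
 show ?thesis
  unfolding sb_def by (rule lin_plus[OF RV W lin_comp[OF lin_fst lin_smult_elem[OF W e]] lin_comp[OF lin_snd i]])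
qed

lemma sb_apply:
 assumes V: "module R V" and W: "module R W" and e: "e : \<U> W" and i: "is_lin V W i"
 shows "v : \<U> V ==> sb W e i (\<zero>, v) = i v" "a : \<U> R ==> sb W e i (a, 0[V]) = a *[W] e"
 using lin_closed[OF i] lin_zero[OF V W i] W e by (simp_all add: sb_def)

lemma sb_kill:
 assumes V: "module R V" and W: "module R W" and e: "e : \<U> W" and i: "is_lin V W i" and f: "is_lin W \<R> f"
  and fe: "f e = \<zero>" and fi: "!!v. v : \<U> V ==> f (i v) = \<zero>" and p: "p : \<U> (R_plus R V)"
 shows "f (sb W e i p) = \<zero>"
proof -
 obtain a v where p': "p = (a, v)" "a : \<U> R" "v : \<U> V" using p by auto
 have "f (a *[W] e +[W] i v) = f (a *[W] e) \<oplus> f (i v)"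
  using lin_add[OF f mod_smult[OF W p'(2) e] lin_closed[OF i p'(3)]] by simp
 also have "... = \<zero>" using lin_smult[OF f p'(2) e] fe fi[OF p'(3)] p'(2) by simp
 finally show ?thesis unfolding p'(1) sb_def by simp
qed

text \<open>After one spare direction is used for the linear variable, the others remain spare.\<close>

lemma fam_sb:
 assumes V: "module R V" and W: "module R W" and F: "fam V W i L e \<eta>" and q: "q : L"
 shows "fam (R_plus R V) W (sb W (e q) i) (L - {q}) e \<eta>"
proof -
 note f = famD[OF F]
 show ?thesis
  unfolding fam_def
 proof (intro conjI ballI)
  show "is_lin (R_plus R V) W (sb W (e q) i)" by (rule sb_lin[OF V W f(3)[OF q] f(1)])
  show "finite (L - {q})" using f(2) by simp
  fix l assume l: "l : L - {q}"
  then have lL: "l : L" "l ~= q" by simp_all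
  show "e l : \<U> W" "is_lin W \<R> (\<eta> l)" using f(3,4) lL by simp_all
  show "\<eta> l (sb W (e q) i p) = \<zero>" if "p : \<U> (R_plus R V)" for p
   by (rule sb_kill[OF V W f(3)[OF q] f(1) f(4)[OF lL(1)] f(7)[OF lL(1) q lL(2)] f(5)[OF lL(1)] that])
  fix k assume "k : L - {q}"
  then have k: "k : L" by simp
  show "\<eta> l (e k) = (if l = k then \<one> else \<zero>)" by (cases "l = k") (use f(6)[OF lL(1)] f(7)[OF lL(1) k] in auto)
 qed
qed

lemma mod_minus_swap:
 assumes M: "module R M" and x: "x : \<U> M" and y: "y : \<U> M"
 shows "-[M] (x -[M] y) = y -[M] x"
proof -
 interpret M: module R M by fact
 show ?thesis using x y by (simp add: a_minus_def M.minus_add M.a_comm)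
qed

lemma mod_minus_cancel:
 assumes M: "module R M" and x: "x : \<U> M" and y: "y : \<U> M" and z: "z : \<U> M"
 shows "(x -[M] z) -[M] (y -[M] z) = x -[M] y"
proof -
 interpret M: module R M by fact
 have "(x -[M] z) -[M] (y -[M] z) = (x +[M] -[M] z) +[M] (z +[M] -[M] y)"
  using x y z by (simp add: a_minus_def M.minus_add M.a_comm)
 also have "... = x +[M] (-[M] z +[M] z) +[M] -[M] y" using x y z by (simp add: M.a_assoc)
 also have "... = x -[M] y" using x y z by (simp add: a_minus_def M.l_neg)
 finally show ?thesis .
qed

end

context operad begin

abbreviation "ps V W e i \<equiv> fm (RP V) W (sb W e i)"

lemma inc_zero: "module R V ==> inc V 0[V] = 0[\<A> V]"
 by (rule lin_zero[OF _ FA_module inc_lin])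

lemma ps_inc:
 assumes V: "module R V" and W: "module R W" and e: "e : \<U> W" and i: "is_lin V W i"
 shows "v : \<U> V ==> ps V W e i (inc (RP V) (\<zero>, v)) = inc W (i v)"
  "a : \<U> R ==> ps V W e i (inc (RP V) (a, 0[V])) = inc W (a *[W] e)"
 using fm_inc[OF RP_module[OF V] W sb_lin[OF V W e i]] sb_apply[OF V W e i] V by simp_all

lemma lin_word_along:
 assumes V: "module R V" and W: "module R W" and h: "!!X. X : \<AA> (RP V) ==> h X : \<AA> W"
  and E: "along (RP V) W h E" and m: "\<mu> : \<OO> (length vs + 1)" and vs: "set vs <= \<U> V" and a: "a : \<U> R"
  and hv: "!!v. v : \<U> V ==> h (inc (RP V) (\<zero>, v)) = k v"
  and Ev: "!!v. v : \<U> V ==> E (inc (RP V) (\<zero>, v)) = 0[\<A> W]"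
  and Ea: "E (inc (RP V) (a, 0[V])) = z"
 shows "E (el (RP V) \<mu> (lin_word V \<R> vs a)) = act W \<mu> (map k vs @ [z])"
proof -
 note RV = RP_module[OF V]
 have w: "(\<mu>, map (%v. (\<zero>, v)) vs @ [(a, 0[V])]) : wd (RP V)"
  using lin_word_wd[OF V reg_module m vs, of a] a by (simp add: lin_word_def)
 have hc: "h (inc (RP V) p) : \<AA> W" if "p : \<U> (RP V)" for p by (rule h[OF inc_closed[OF RV that]])
 have "E (el (RP V) \<mu> (map (%v. (\<zero>, v)) vs @ [(a, 0[V])])) =
  act W \<mu> (map (%p. h (inc (RP V) p)) (map (%v. (\<zero>, v)) vs) @ [E (inc (RP V) (a, 0[V]))])"
  by (rule along_last[OF RV W hc E w]) (use vs Ev in auto)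
 also have "map (%p. h (inc (RP V) p)) (map (%v. (\<zero>, v)) vs) = map k vs"
  using vs hv by auto
 finally show ?thesis unfolding Ea by (simp add: lin_word_def)
qed

lemma rk_ps_word:
 assumes V: "module R V" and W: "module R W" and e: "e : \<U> W" and i: "is_lin V W i" and f: "is_lin W \<R> f"
  and w: "w : \<AA> W" and fe: "f e = \<one>" and fi: "!!v. v : \<U> V ==> f (i v) = \<zero>"
  and m: "\<mu> : \<OO> (length vs + 1)" and vs: "set vs <= \<U> V" and a: "a : \<U> R"
 shows "rk W w f (ps V W e i (el (RP V) \<mu> (lin_word V \<R> vs a))) = act W \<mu> (map (%v. inc W (i v)) vs @ [a *[\<A> W] w])"
proof -
 note RV = RP_module[OF V] and j = sb_lin[OF V W e i] and r = rk[OF W f w] and p = ps_inc[OF V W e i]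
 have E: "along (RP V) W (%X. ps V W e i X) (%X. rk W w f (ps V W e i X))"
  by (rule along_fm_pre[OF RV W W j _ Der_along[OF r(1)]])
 show ?thesis
 proof (rule lin_word_along[OF V W fm_closed[OF RV W j] E m vs a p(1)])
  show "rk W w f (ps V W e i (inc (RP V) (\<zero>, v))) = 0[\<A> W]" if v: "v : \<U> V" for v
   unfolding p(1)[OF v] r(2)[OF lin_closed[OF i v]] fi[OF v] by (rule mod_smult_l_null[OF FA_module[OF W] w])
  have "f (a *[W] e) = a" using lin_smult[OF f a e] fe a by simp
  then show "rk W w f (ps V W e i (inc (RP V) (a, 0[V]))) = a *[\<A> W] w"
   unfolding p(2)[OF a] r(2)[OF mod_smult[OF W a e]] by simp
 qed
qed

text \<open>\<open>ps V W e i y\<close> is \<open>y\<close> with \<open>e\<close> in its linear argument. As \<open>f\<close> only sees \<open>e'\<close>, the left-hand side replaces the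
 linear argument of \<open>y\<close> by the value of \<open>D\<close>, which is also how \<open>D\<close> acts on \<open>y\<close>.\<close>

lemma subst_pt:
 assumes V: "module R V" and W: "module R W" and e: "e : \<U> W" "e' : \<U> W" and i: "is_lin V W i"
  and f: "is_lin W \<R> f" and fe: "f e' = \<one>" and fi: "!!v. v : \<U> V ==> f (i v) = \<zero>"
  and D: "D : Der_pt R P V" and y: "y : LV V"
 shows "rk W (ps V W e i (D (u0 V))) f (ps V W e' i y) = ps V W e i (D y)"
proof -
 note RV = RP_module[OF V] and d = Der_ptD[OF V D]
 note j = sb_lin[OF V W e(1) i] and j' = sb_lin[OF V W e(2) i]
 note w = fm_closed[OF RV W j d(3)]
 show ?thesis
 proof (rule fa_lin_eq[OF V reg_module FA_module[OF W] _ _ _ y])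
  show "is_lin (\<A> (RP V)) (\<A> W) (%y. rk W (ps V W e i (D (u0 V))) f (ps V W e' i y))"
   by (rule lin_comp[OF fm_lin[OF RV W j'] Der_lin[OF rk(1)[OF W f w]]])
  show "is_lin (\<A> (RP V)) (\<A> W) (%y. ps V W e i (D y))"
   by (rule lin_comp[OF Der_lin[OF d(1)] fm_lin[OF RV W j]])
  fix \<mu> vs a assume m: "\<mu> : \<OO> (length vs + 1)" and vs: "set vs <= \<U> V" and "a : carrier \<R>"
  then have a: "a : \<U> R" by simp
  let ?Xs = "map (%v. inc (RP V) (\<zero>, v)) vs @ [a *[\<A> (RP V)] D (u0 V)]"
  have Xs: "set ?Xs <= \<AA> (RP V)"
   using vs a d(3) RV V inc_closed[OF RV] by auto
  have mX: "\<mu> : \<OO> (length ?Xs)" using m by simp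
  have "map (ps V W e i) ?Xs = map (%v. inc W (i v)) vs @ [a *[\<A> W] ps V W e i (D (u0 V))]"
   using vs ps_inc(1)[OF V W e(1) i] lin_smult[OF fm_lin[OF RV W j] a d(3)] by auto
  then have s: "ps V W e i (D (el (RP V) \<mu> (lin_word V \<R> vs a))) =
   act W \<mu> (map (%v. inc W (i v)) vs @ [a *[\<A> W] ps V W e i (D (u0 V))])"
   unfolding Der_pt_word[OF V D m vs a] fm_act[OF RV W j mX Xs] by (rule arg_cong)
  show "rk W (ps V W e i (D (u0 V))) f (ps V W e' i (el (RP V) \<mu> (lin_word V \<R> vs a))) =
   ps V W e i (D (el (RP V) \<mu> (lin_word V \<R> vs a)))"
   unfolding s by (rule rk_ps_word[OF V W e(2) i f w fe fi m vs a])
 qed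
qed

text \<open>The special case in which a vector is moved into the linear argument: it changes the direction used there.\<close>

lemma subst_var:
 assumes V: "module R V" and W: "module R W" and e: "e : \<U> W" "e' : \<U> W" and i: "is_lin V W i"
  and f: "is_lin W \<R> f" and fe: "f e' = \<one>" and fi: "!!v. v : \<U> V ==> f (i v) = \<zero>"
  and y: "y : LV V"
 shows "rk W (inc W e) f (ps V W e' i y) = ps V W e i y"
proof -
 note RV = RP_module[OF V]
 note j = sb_lin[OF V W e(1) i] and j' = sb_lin[OF V W e(2) i]
 note w = inc_closed[OF W e(1)]
 show ?thesis
 proof (rule fa_lin_eq[OF V reg_module FA_module[OF W] _ _ _ y])
  show "is_lin (\<A> (RP V)) (\<A> W) (%y. rk W (inc W e) f (ps V W e' i y))"
   by (rule lin_comp[OF fm_lin[OF RV W j'] Der_lin[OF rk(1)[OF W f w]]])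
  show "is_lin (\<A> (RP V)) (\<A> W) (%y. ps V W e i y)" by (rule fm_lin[OF RV W j])
  fix \<mu> vs a assume m: "\<mu> : \<OO> (length vs + 1)" and vs: "set vs <= \<U> V" and a': "a : carrier \<R>"
  then have a: "a : \<U> R" by simp
  have wV: "(\<mu>, lin_word V \<R> vs a) : wd (RP V)" by (rule lin_word_wd[OF V reg_module m vs a'])
  have ws: "map (sb W e i) (lin_word V \<R> vs a) = map i vs @ [a *[W] e]"
   using vs sb_apply[OF V W e(1) i] a by (auto simp: lin_word_def)
  have ww: "(\<mu>, map i vs @ [a *[W] e]) : wd W" using wd_map[OF j wV] unfolding ws .
  have "ps V W e i (el (RP V) \<mu> (lin_word V \<R> vs a)) = act W \<mu> (map (inc W) (map i vs @ [a *[W] e]))"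
   unfolding fm_el[OF RV W j wV] ws act_incs[OF W ww] ..
  also have "... = act W \<mu> (map (%v. inc W (i v)) vs @ [a *[\<A> W] inc W e])"
   using lin_smult[OF inc_lin[OF W] a e(1)] by (simp add: comp_def)
  finally have s: "ps V W e i (el (RP V) \<mu> (lin_word V \<R> vs a)) =
   act W \<mu> (map (%v. inc W (i v)) vs @ [a *[\<A> W] inc W e])" .
  show "rk W (inc W e) f (ps V W e' i (el (RP V) \<mu> (lin_word V \<R> vs a))) =
   ps V W e i (el (RP V) \<mu> (lin_word V \<R> vs a))"
   unfolding s by (rule rk_ps_word[OF V W e(2) i f w fe fi m vs a])
 qed
qed

subsection \<open>Surjectivity up to torsion\<close>

text \<open>\<open>f\<close> detects exactly the occurrence of \<open>e\<close>, and replacing that occurrence by the linear variable undoes the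
 substitution. So every value is attained once \<open>W\<close> has one spare direction.\<close>

lemma Phi_ps:
 assumes V: "SR_obj R V" and W: "SR_obj R W" and m: "(i, r) : SR_hom R V W" and e: "e : \<U> W"
  and f: "is_lin W \<R> f" and fe: "f e = \<one>" and fi: "!!v. v : \<U> V ==> f (i v) = \<zero>" and D: "D : Der_pt R P V"
 shows "Phi R P W (rk W (ps V W e i (D (u0 V))) f) = Sm V W i r D"
proof -
 note MV = SR_obj_module[OF V] and MW = SR_obj_module[OF W]
 note RV = RP_module[OF MV] and RW = RP_module[OF MW]
 note i = SR_homD(1)[OF m] and d = Der_ptD[OF MV D]
 note j = sb_lin[OF MV MW e i] and p = ps_inc[OF MV MW e i]
 note k = SR_homD(1)[OF dsum_map_SR_hom[OF MV MW m]]
 note Dl = Der_lin[OF Df(1)[OF MW f]]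
 have iz: "i 0[V] = 0[W]" by (rule lin_zero[OF MV MW i])
 have E: "along (RP V) (RP W) (%X. iota W (ps V W e i X)) (%X. Df W f (iota W (ps V W e i X)))"
  by (rule along_fm_pre[OF RV MW RW j fm_closed[OF MW RW iota_lin[OF MW]] Df_iota_along[OF MW f]])
 have "Df W f (iota W (ps V W e i (D (u0 V)))) = fm (RP V) (RP W) (dsum_map \<R> V id i) (D (u0 V))"
 proof (rule fa_lin_eq[OF MV reg_module FA_module[OF RW] _ fm_lin[OF RV RW k] _ d(2)])
  show "is_lin (\<A> (RP V)) (\<A> (RP W)) (%y. Df W f (iota W (ps V W e i y)))"
   by (rule lin_comp[OF lin_comp[OF fm_lin[OF RV MW j] fm_lin[OF MW RW iota_lin[OF MW]]] Dl])
  fix \<mu> vs a assume n: "\<mu> : \<OO> (length vs + 1)" "set vs <= \<U> V" "a : carrier \<R>"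
  then have a: "a : \<U> R" by simp
  have iv: "set (map i vs) <= \<U> W" using n(2) lin_closed[OF i] by auto
  have ww: "(\<mu>, lin_word W \<R> (map i vs) a) : wd (RP W)" by (rule lin_word_wd[OF MW reg_module _ iv n(3)]) (use n(1) in simp)
  have em: "map (dsum_map \<R> V id i) (lin_word V \<R> vs a) = lin_word W \<R> (map i vs) a"
   using n iz MV by (auto simp: lin_word_def dsum_map_apply)
  have hc: "iota W (ps V W e i X) : \<AA> (RP W)" if "X : \<AA> (RP V)" for X
   by (rule fm_closed[OF MW RW iota_lin[OF MW] fm_closed[OF RV MW j that]])
  have "Df W f (iota W (ps V W e i (el (RP V) \<mu> (lin_word V \<R> vs a)))) =
   act (RP W) \<mu> (map (%v. inc (RP W) (\<zero>, i v)) vs @ [inc (RP W) (a, 0[W])])"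
  proof (rule lin_word_along[OF MV RW hc E n(1,2) a])
   fix v assume v: "v : \<U> V"
   note ivc = lin_closed[OF i v]
   show "iota W (ps V W e i (inc (RP V) (\<zero>, v))) = inc (RP W) (\<zero>, i v)"
    unfolding p(1)[OF v] by (rule fm_inc[OF MW RW iota_lin[OF MW] ivc])
   show "Df W f (iota W (ps V W e i (inc (RP V) (\<zero>, v)))) = 0[\<A> (RP W)]"
    unfolding p(1)[OF v] Df_iota_inc[OF MW f ivc] fi[OF v] using inc_zero[OF RW] by simp
  next
   have "f (a *[W] e) = a" using lin_smult[OF f a e] fe a by simp
   then show "Df W f (iota W (ps V W e i (inc (RP V) (a, 0[V])))) = inc (RP W) (a, 0[W])"
    unfolding p(2)[OF a] Df_iota_inc[OF MW f mod_smult[OF MW a e]] by simp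
  qed
  also have "... = act (RP W) \<mu> (map (inc (RP W)) (lin_word W \<R> (map i vs) a))"
   by (simp add: lin_word_def comp_def)
  also have "... = fm (RP V) (RP W) (dsum_map \<R> V id i) (el (RP V) \<mu> (lin_word V \<R> vs a))"
   unfolding act_incs[OF RW ww] fm_el[OF RV RW k lin_word_wd[OF MV reg_module n]] em ..
  finally show "Df W f (iota W (ps V W e i (el (RP V) \<mu> (lin_word V \<R> vs a)))) =
   fm (RP V) (RP W) (dsum_map \<R> V id i) (el (RP V) \<mu> (lin_word V \<R> vs a))" .
 qed
 then show ?thesis
  unfolding Phi_ex(2)[OF W fm_closed[OF RV MW j d(3)] f] using Sm_pt[OF MV MW m d(3)] pt_of_u0[OF MV D] by simp
qed

end

section \<open>The kernel of the divergence up to torsion\<close>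

context binary_presentation begin

text \<open>This is the bracket of \<open>x \<otimes> \<eta>\<^sub>l\<close>, which lies in the Lie algebra by \<open>fpos_L1\<close>, with \<open>e\<^sub>l \<otimes> f\<close>, which has degree zero.\<close>

lemma rk_mod_L1:
 fixes V :: "('r, 'v) module"
 assumes V: "SR_obj R V" and x: "x : fpos V" and f: "is_lin V \<R> f"
 shows "EX M. ALL (W :: ('r, 'w) module) i r L e \<eta> l. module R W --> (i, r) : SR_hom R V W --> fam V W i L e \<eta> -->
  (ALL l:L. r (e l) = 0[V]) --> M <= card L --> l : L -->
  Fm V W (i, r) (rk V x f) -[\<D> W] rk W (ps V W (e l) i (Phi R P V (rk V x f) (u0 V))) (\<eta> l) : L1 W"
proof -
 note M = SR_obj_module[OF V]
 note RV = RP_module[OF M] and xc = fpos_carrier[OF M x]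
 obtain N where N: "ALL (W :: ('r, 'w) module) j L e \<eta> f. module R W --> fam V W j L e \<eta> --> is_lin W \<R> f -->
  (ALL l:L. f (e l) = \<zero>) --> (ALL v:\<U> V. f (j v) = \<zero>) --> N <= card L --> rk W (fm V W j x) f : L1 W"
  using fpos_L1[OF M x] by (rule exE)
 show ?thesis
 proof (intro exI[of _ "Suc N"] allI impI)
  fix W :: "('r, 'w) module" and i r L e \<eta> l
  assume W: "module R W" and m: "(i, r) : SR_hom R V W" and F: "fam V W i L e \<eta>" and re: "ALL l:L. r (e l) = 0[V]"
   and c: "Suc N <= card L" and l: "l : L"
  note F' = famD[OF F] and ir = SR_homD[OF m]
  note el = F'(3)[OF l] and \<eta>l = F'(4)[OF l]
  let ?x = "fm V W i x" and ?f = "%w. f (r w)"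
  note fr = lin_comp[OF ir(2) f] and x' = fm_closed[OF M W ir(1) xc]
  note ie = inc_closed[OF W el] and DW = Der_module[OF W] and L1W = L1_submodule[OF W]
  have c1: "rk W ?x (\<eta> l) : L1 W"
  proof (rule N[rule_format, of W i "L - {l}" e \<eta> "\<eta> l"])
   show "module R W" "is_lin W \<R> (\<eta> l)" by fact+
   show "fam V W i (L - {l}) e \<eta>" by (rule fam_subset[OF F]) blast
   show "\<eta> l (e k) = \<zero>" if "k : L - {l}" for k using F'(7)[OF l, of k] that by blast
   show "\<eta> l (i v) = \<zero>" if "v : \<U> V" for v by (rule F'(5)[OF l that])
   show "N <= card (L - {l})" using c l F'(2) by simp
  qed
  have "rk W (inc W (e l)) ?f : Der_deg R P W 0" by (rule rk_deg[OF W fr]) (use inc_deg[OF el] in simp)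
  then have b: "br W (rk W ?x (\<eta> l)) (rk W (inc W (e l)) ?f) : L1 W" by (rule L1_stable_deg0[OF W _ c1])
  have k: "rk W ?x (\<eta> l) (inc W (e l)) = ?x"
   unfolding rk(2)[OF W \<eta>l x' el] F'(6)[OF l] by (rule mod_smult_one[OF FA_module[OF W] x'])
  note g = rk[OF W fr ie] and dD = delta_Df(2)[OF M f xc]
  note y = LV_carrier[OF M dD] and j = sb_lin[OF M W el ir(1)]
  have s: "rk W (inc W (e l)) ?f ?x = ps V W (e l) i (Df V f (iota V x))"
  proof (rule along_unique[OF M W _ _ _ _ _ xc])
   show "along V W (%X. fm V W i X) (%X. rk W (inc W (e l)) ?f (fm V W i X))"
    by (rule along_fm_pre[OF M W W ir(1) _ Der_along[OF g(1)]])
   show "along V W (%X. ps V W (e l) i (iota V X)) (%X. ps V W (e l) i (Df V f (iota V X)))"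
    by (rule along_fm_post[OF M RV W j fm_closed[OF M RV iota_lin[OF M]] Df_iota_along[OF M f]])
   fix v assume v: "v : \<U> V"
   note iv = lin_closed[OF ir(1) v]
   have fv: "f v : \<U> R" using lin_closed[OF f v] by simp
   show "fm V W i (inc V v) : \<AA> W" by (rule fm_closed[OF M W ir(1) inc_closed[OF M v]])
   show "ps V W (e l) i (iota V (inc V v)) = fm V W i (inc V v)"
    unfolding fm_inc[OF M RV iota_lin[OF M] v] fm_inc[OF M W ir(1) v] by (rule ps_inc(1)[OF M W el ir(1) v])
   show "rk W (inc W (e l)) ?f (fm V W i (inc V v)) = ps V W (e l) i (Df V f (iota V (inc V v)))"
    unfolding fm_inc[OF M W ir(1) v] g(2)[OF iv] Df_iota_inc[OF M f v] ps_inc(2)[OF M W el ir(1) fv] ir(3)[OF v]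
    by (rule lin_smult[OF inc_lin[OF W] fv el, symmetric])
  qed
  have P: "Phi R P V (rk V x f) (u0 V) = Df V f (iota V x)"
   unfolding Phi_ex(2)[OF V xc f] by (rule pt_u0[OF M y])
  note a1 = rk(1)[OF W \<eta>l fm_closed[OF RV W j y]] and a2 = rk(1)[OF W fr x']
  have "-[\<D> W] (rk W (ps V W (e l) i (Df V f (iota V x))) (\<eta> l) -[\<D> W] rk W ?x ?f) : L1 W"
   by (rule sub_uminus[OF DW L1W b[unfolded br_rk[OF W x' ie \<eta>l fr] k s]])
  then show "Fm V W (i, r) (rk V x f) -[\<D> W] rk W (ps V W (e l) i (Phi R P V (rk V x f) (u0 V))) (\<eta> l) : L1 W"
   unfolding mod_minus_swap[OF DW a1 a2] P Fm_rk[OF M W m f xc] .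
 qed
qed

lemma Fm_mod_L1:
 fixes V :: "('r, 'v) module"
 assumes V: "SR_obj R V" and d: "d : Der_plus R P V"
 shows "EX M. ALL (W :: ('r, 'w) module) i r L e \<eta> l. module R W --> (i, r) : SR_hom R V W --> fam V W i L e \<eta> -->
  (ALL l:L. r (e l) = 0[V]) --> M <= card L --> l : L -->
  Fm V W (i, r) d -[\<D> W] rk W (ps V W (e l) i (Phi R P V d (u0 V))) (\<eta> l) : L1 W"
proof -
 note M = SR_obj_module[OF V]
 note RV = RP_module[OF M] and dc = Der_plus_carrier[OF M d]
 obtain B' \<beta> where B: "dual_basis V B' \<beta>" using SR_obj_basis[OF V] .
 note b = dual_basisD[OF B]
 have db: "d (inc V c) : fpos V" if "c : B'" for c by (rule Der_plus_fpos[OF M d b(2)[OF that]])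
 have rb: "rk V (d (inc V c)) (\<beta> c) : \<DD> V" if "c : B'" for c
  by (rule rk(1)[OF M b(3)[OF that] fpos_carrier[OF M db[OF that]]])
 let ?Q = "%d N. ALL (W :: ('r, 'w) module) i r L e \<eta> l. module R W --> (i, r) : SR_hom R V W --> fam V W i L e \<eta> -->
  (ALL l:L. r (e l) = 0[V]) --> N <= card L --> l : L -->
  Fm V W (i, r) d -[\<D> W] rk W (ps V W (e l) i (Phi R P V d (u0 V))) (\<eta> l) : L1 W"
 have "ALL c:B'. EX N. ?Q (rk V (d (inc V c)) (\<beta> c)) N"
  by (intro ballI rk_mod_L1[OF V db b(3)])
 then have "EX N. ALL c:B'. ?Q (rk V (d (inc V c)) (\<beta> c)) (N c)" by (rule bchoice)
 then obtain N where N: "ALL c:B'. ?Q (rk V (d (inc V c)) (\<beta> c)) (N c)" by (rule exE)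
 show ?thesis
 proof (intro exI[of _ "sum N B'"] allI impI)
  fix W :: "('r, 'w) module" and i r L e \<eta> l
  assume W: "module R W" and m: "(i, r) : SR_hom R V W" and F: "fam V W i L e \<eta>" and re: "ALL l:L. r (e l) = 0[V]"
   and c: "sum N B' <= card L" and l: "l : L"
  note F' = famD[OF F] and ir = SR_homD[OF m] and DV = Der_module[OF M] and DW = Der_module[OF W]
  note j = sb_lin[OF M W F'(3)[OF l] ir(1)]
  let ?T = "%d. Fm V W (i, r) d -[\<D> W] rk W (ps V W (e l) i (Phi R P V d (u0 V))) (\<eta> l)"
  have T2: "is_lin (\<D> V) (\<D> W) (%d. rk W (ps V W (e l) i (Phi R P V d (u0 V))) (\<eta> l))"
   by (rule lin_comp[OF lin_comp[OF lin_comp[OF Phi_lin(1)[OF V] Der_ev_lin[OF u0_closed[OF M]]] fm_lin[OF RV W j]]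
    rk_lin[OF W F'(4)[OF l]]])
  have T: "is_lin (\<D> V) (\<D> W) ?T" by (rule lin_diff[OF DV DW Fm_lin[OF M W m] T2])
  have "?T d = ?T (\<Oplus>\<^bsub>\<D> V\<^esub>c\<in>B'. rk V (d (inc V c)) (\<beta> c))" by (rule arg_cong[OF Der_rk_sum[OF M B dc]])
  also have "... = (\<Oplus>\<^bsub>\<D> W\<^esub>c\<in>B'. ?T (rk V (d (inc V c)) (\<beta> c)))"
   by (rule lin_finsum[OF DV DW T b(1) rb])
  also have "... : L1 W"
  proof (rule sub_finsum[OF DW L1_submodule[OF W]])
   fix c' assume c': "c' : B'"
   have "N c' <= card L" using member_le_sum[OF c', of N] b(1) c by simp
   then show "?T (rk V (d (inc V c')) (\<beta> c')) : L1 W"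
    using bspec[OF N c'] W m F re l by blast
  qed
  finally show "?T d : L1 W" .
 qed
qed

text \<open>Write \<open>D(e)\<close> for the value of \<open>D\<close> with \<open>e\<close> in its linear argument, and \<open>ED\<close> for the action of \<open>E\<close> on the value of
 \<open>D\<close>. The bracket of \<open>D(e\<^sub>q) \<otimes> \<eta>\<^sub>p\<close> and \<open>E(e\<^sub>p) \<otimes> \<eta>\<^sub>q\<close> is \<open>ED(e\<^sub>p) \<otimes> \<eta>\<^sub>p - DE(e\<^sub>q) \<otimes> \<eta>\<^sub>q\<close>. The two terms use
 different directions; the bracket of \<open>DE(e\<^sub>q) \<otimes> \<eta>\<^sub>p\<close> with \<open>e\<^sub>p \<otimes> \<eta>\<^sub>q\<close> is \<open>DE(e\<^sub>p) \<otimes> \<eta>\<^sub>p - DE(e\<^sub>q) \<otimes> \<eta>\<^sub>q\<close>, and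
 the difference of both is the claim.\<close>

lemma commutator_L1:
 fixes V :: "('r, 'v) module"
 assumes V: "SR_obj R V" and D: "D : Der_pt_plus R P V" and E: "E : Der_pt_plus R P V"
 shows "EX M. ALL (W :: ('r, 'w) module) i L e \<eta> p. module R W --> fam V W i L e \<eta> --> M <= card L --> p : L -->
  rk W (ps V W (e p) i ((pl (RP V) D E -[\<D> (RP V)] pl (RP V) E D) (u0 V))) (\<eta> p) : L1 W"
proof -
 note M = SR_obj_module[OF V]
 note RV = RP_module[OF M]
 have D1: "D : Der_pt R P V" "D (u0 V) : fpos (RP V)" and E1: "E : Der_pt R P V" "E (u0 V) : fpos (RP V)"
  using D E by (simp_all add: Der_pt_plus_iff[OF V])
 note d = Der_ptD[OF M D1(1)] and de = Der_ptD[OF M E1(1)]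
 let ?z = "D (E (u0 V))"
 have z: "?z : fpos (RP V)"
  using pl_pt_plus[OF V E D] pl_pt(2)[OF M E1(1) D1(1)] by (simp add: Der_pt_plus_iff[OF V])
 have zL: "?z : LV V" by (rule Der_pt_LV[OF M D1(1) de(2)])
 have EyL: "E (D (u0 V)) : LV V" by (rule Der_pt_LV[OF M E1(1) d(2)])
 note zc = LV_carrier[OF M zL] and Eyc = LV_carrier[OF M EyL]
 have val: "(pl (RP V) D E -[\<D> (RP V)] pl (RP V) E D) (u0 V) = E (D (u0 V)) -[\<A> (RP V)] ?z"
  unfolding Der_minus_ev[OF RV u0_closed[OF M] pl(1)[OF RV d(1) de(1)] pl(1)[OF RV de(1) d(1)]]
   pl_pt(2)[OF M D1(1) E1(1)] pl_pt(2)[OF M E1(1) D1(1)] ..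
 let ?Q = "%x N. ALL (W :: ('r, 'w) module) j L e \<eta> f. module R W --> fam (RP V) W j L e \<eta> --> is_lin W \<R> f -->
  (ALL l:L. f (e l) = \<zero>) --> (ALL v:\<U> (RP V). f (j v) = \<zero>) --> N <= card L --> rk W (fm (RP V) W j x) f : L1 W"
 obtain N1 where N1: "?Q (D (u0 V)) N1" using fpos_L1[OF RV D1(2)] by (rule exE)
 obtain N2 where N2: "?Q (E (u0 V)) N2" using fpos_L1[OF RV E1(2)] by (rule exE)
 obtain N3 where N3: "?Q ?z N3" using fpos_L1[OF RV z] by (rule exE)
 show ?thesis
 proof (intro exI[of _ "N1 + N2 + N3 + 2"] allI impI)
  fix W :: "('r, 'w) module" and i L e \<eta> p
  assume W: "module R W" and F: "fam V W i L e \<eta>" and c: "N1 + N2 + N3 + 2 <= card L" and p: "p : L"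
  note F' = famD[OF F]
  note i = F'(1)
  have cp: "card (L - {p}) = card L - 1" using p F'(2) by simp
  have "L - {p} ~= {}"
  proof
   assume "L - {p} = {}"
   then have "card (L - {p}) = 0" by (simp only: card.empty)
   then show False using cp c by linarith
  qed
  then obtain q where q: "q : L" "q ~= p" by blast
  have cpq: "card (L - {s} - {t}) = card L - 2" if "s : L" "t : L" "s ~= t" for s t
   using that F'(2) by simp
  note DW = Der_module[OF W] and L1W = L1_submodule[OF W]
  have in_L1: "rk W (ps V W (e s) i x) (\<eta> t) : L1 W"
   if s: "s : L" and t: "t : L" "s ~= t" and N: "?Q x n" and n: "n <= card L - 2" for s t x n
  proof (rule N[rule_format, of W "sb W (e s) i" "L - {s} - {t}" e \<eta> "\<eta> t"])
   show "module R W" by (rule W)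
   show "fam (RP V) W (sb W (e s) i) (L - {s} - {t}) e \<eta>"
    by (rule fam_subset[OF fam_sb[OF M W F s]]) blast
   show "is_lin W \<R> (\<eta> t)" by (rule F'(4)[OF t(1)])
   show "\<eta> t (e l) = \<zero>" if "l : L - {s} - {t}" for l using F'(7)[OF t(1), of l] that by blast
   show "\<eta> t (sb W (e s) i v) = \<zero>" if "v : \<U> (RP V)" for v
    by (rule sb_kill[OF M W F'(3)[OF s] i F'(4)[OF t(1)] F'(7)[OF t(1) s t(2)[symmetric]] F'(5)[OF t(1)] that])
   show "n <= card (L - {s} - {t})" using n cpq[OF s t] by simp
  qed
  have n: "N1 <= card L - 2" "N2 <= card L - 2" "N3 <= card L - 2" using c by linarith+
  let ?p = "%x. ps V W (e p) i x" and ?q = "%x. ps V W (e q) i x"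
  have c1: "rk W (?q (D (u0 V))) (\<eta> p) : L1 W" by (rule in_L1[OF q(1) p q(2) N1 n(1)])
  have c2: "rk W (?p (E (u0 V))) (\<eta> q) : L1 W" by (rule in_L1[OF p q(1) q(2)[symmetric] N2 n(2)])
  have c3: "rk W (?q ?z) (\<eta> p) : L1 W" by (rule in_L1[OF q(1) p q(2) N3 n(3)])
  note jp = sb_lin[OF M W F'(3)[OF p] i] and jq = sb_lin[OF M W F'(3)[OF q(1)] i]
  have pc: "?p x : \<AA> W" if "x : \<AA> (RP V)" for x by (rule fm_closed[OF RV W jp that])
  have qc: "?q x : \<AA> W" if "x : \<AA> (RP V)" for x by (rule fm_closed[OF RV W jq that])
  have s1: "rk W (?p (E (u0 V))) (\<eta> q) (?q (D (u0 V))) = ?p (E (D (u0 V)))"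
   by (rule subst_pt[OF M W F'(3)[OF p] F'(3)[OF q(1)] i F'(4)[OF q(1)] F'(6)[OF q(1)] F'(5)[OF q(1)] E1(1) d(2)])
  have s2: "rk W (?q (D (u0 V))) (\<eta> p) (?p (E (u0 V))) = ?q ?z"
   by (rule subst_pt[OF M W F'(3)[OF q(1)] F'(3)[OF p] i F'(4)[OF p] F'(6)[OF p] F'(5)[OF p] D1(1) de(2)])
  have b1: "rk W (?p (E (D (u0 V)))) (\<eta> p) -[\<D> W] rk W (?q ?z) (\<eta> q) : L1 W"
   using L1_br[OF c1 c2] unfolding br_rk[OF W qc[OF d(3)] pc[OF de(3)] F'(4)[OF p] F'(4)[OF q(1)]] s1 s2 .
  have "rk W (inc W (e p)) (\<eta> q) : Der_deg R P W 0"
   by (rule rk_deg[OF W F'(4)[OF q(1)]]) (use inc_deg[OF F'(3)[OF p]] in simp)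
  then have b2': "br W (rk W (?q ?z) (\<eta> p)) (rk W (inc W (e p)) (\<eta> q)) : L1 W" by (rule L1_stable_deg0[OF W _ c3])
  have s3: "rk W (inc W (e p)) (\<eta> q) (?q ?z) = ?p ?z"
   by (rule subst_var[OF M W F'(3)[OF p] F'(3)[OF q(1)] i F'(4)[OF q(1)] F'(6)[OF q(1)] F'(5)[OF q(1)] zL])
  have s4: "rk W (?q ?z) (\<eta> p) (inc W (e p)) = ?q ?z"
   unfolding rk(2)[OF W F'(4)[OF p] qc[OF zc] F'(3)[OF p]] F'(6)[OF p] by (rule mod_smult_one[OF FA_module[OF W] qc[OF zc]])
  have b2: "rk W (?p ?z) (\<eta> p) -[\<D> W] rk W (?q ?z) (\<eta> q) : L1 W"
   using b2' unfolding br_rk[OF W qc[OF zc] inc_closed[OF W F'(3)[OF p]] F'(4)[OF p] F'(4)[OF q(1)]] s3 s4 .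
  note r1 = rk(1)[OF W F'(4)[OF p] pc[OF Eyc]] and r2 = rk(1)[OF W F'(4)[OF p] pc[OF zc]]
   and r3 = rk(1)[OF W F'(4)[OF q(1)] qc[OF zc]]
  have "rk W (?p (E (D (u0 V)))) (\<eta> p) -[\<D> W] rk W (?p ?z) (\<eta> p) : L1 W"
   using sub_minus[OF DW L1W b1 b2] unfolding mod_minus_cancel[OF DW r1 r2 r3] .
  moreover have "rk W (?p (E (D (u0 V)) -[\<A> (RP V)] ?z)) (\<eta> p) = rk W (?p (E (D (u0 V)))) (\<eta> p) -[\<D> W] rk W (?p ?z) (\<eta> p)"
   by (rule lin_minus[OF FA_module[OF RV] DW lin_comp[OF fm_lin[OF RV W jp] rk_lin[OF W F'(4)[OF p]]] Eyc zc])
  ultimately show "rk W (?p ((pl (RP V) D E -[\<D> (RP V)] pl (RP V) E D) (u0 V))) (\<eta> p) : L1 W"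
   unfolding val by simp
 qed
qed

lemma Cm_L1:
 fixes V :: "('r, 'v) module"
 assumes V: "SR_obj R V" and D: "D : Cm V"
 shows "EX M. ALL (W :: ('r, 'w) module) i L e \<eta> p. module R W --> fam V W i L e \<eta> --> M <= card L --> p : L -->
  rk W (ps V W (e p) i (D (u0 V))) (\<eta> p) : L1 W"
proof -
 note M = SR_obj_module[OF V]
 note RV = RP_module[OF M] and u = u0_closed[OF M]
 let ?K = "{(W :: ('r, 'w) module, i, L, e, \<eta>, p). module R W & fam V W i L e \<eta> & p : L}"
 let ?sz = "%(W :: ('r, 'w) module, i :: 'v => 'w, L :: nat set, e :: nat => 'w, \<eta> :: nat => 'w => 'r, p :: nat). card L"
 let ?T = "%(W :: ('r, 'w) module, i, L :: nat set, e, \<eta>, p) D. rk W (ps V W (e p) i (D (u0 V))) (\<eta> p)"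
 have lin: "is_lin (\<D> (RP V)) (\<D> W) (%D. rk W (ps V W (e p) i (D (u0 V))) (\<eta> p))"
  if W: "module R W" and F: "fam V W i L e \<eta>" and p: "p : L" for W :: "('r, 'w) module" and i L e \<eta> p
  by (rule lin_comp[OF lin_comp[OF Der_ev_lin[OF u] fm_lin[OF RV W sb_lin[OF M W famD(3)[OF F p] famD(1)[OF F]]]]
   rk_lin[OF W famD(4)[OF F p]]])
 have "EX n. ALL k:?K. n <= ?sz k --> ?T k D : L1 (fst k)"
 proof (rule eventually_span[where N = "%k. \<D> (fst k)" and T = ?T and H = "%k. L1 (fst k)",
    OF Der_module[OF RV] _ _ _ _ _ D[unfolded Cm_alt[OF V]]])
  show "{pl (RP V) D E -[\<D> (RP V)] pl (RP V) E D | D E. D : Der_pt_plus R P V & E : Der_pt_plus R P V} <= \<DD> (RP V)"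
   using Cm_gen[OF V] sub_carrier[OF Der_pt_plus_submodule[OF V]] by blast
  fix s assume "s : {pl (RP V) D E -[\<D> (RP V)] pl (RP V) E D | D E. D : Der_pt_plus R P V & E : Der_pt_plus R P V}"
  then obtain D E where s: "s = pl (RP V) D E -[\<D> (RP V)] pl (RP V) E D" and DE: "D : Der_pt_plus R P V" "E : Der_pt_plus R P V"
   by blast
  obtain n where n: "ALL (W :: ('r, 'w) module) i L e \<eta> p. module R W --> fam V W i L e \<eta> --> n <= card L --> p : L -->
    rk W (ps V W (e p) i (s (u0 V))) (\<eta> p) : L1 W" using commutator_L1[OF V DE] unfolding s by (rule exE)
  show "EX n. ALL k:?K. n <= ?sz k --> ?T k s : L1 (fst k)" by (rule exI[of _ n]) (use n in auto)
 qed (auto simp: L1_submodule lin)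
 then show ?thesis by fastforce
qed

end

section \<open>Complementary vectors over a principal ideal domain\<close>

context base_ring begin

text \<open>Fewer linear conditions than independent vectors have a nonzero common solution. Elimination over a domain
 must not divide: \<open>g(w\<^sub>0) w - g(w) w\<^sub>0\<close> is killed by \<open>g\<close>, and the functionals \<open>\<gamma> c\<close> with \<open>c\<close> other than the pivot certify that
 the new vectors are again independent.\<close>

lemma common_kernel:
 fixes W :: "('r, 'w) module" and \<gamma> :: "'c => 'w => 'r"
 assumes D: "domain R" and W: "module R W" and "finite I" and g: "!!i. i : I ==> is_lin W \<R> (g i)"
 shows "ALL C w. finite C --> card I < card C --> (ALL c:C. w c : \<U> W & is_lin W \<R> (\<gamma> c) & \<gamma> c (w c) ~= \<zero>) -->
  (ALL c:C. ALL c':C. c ~= c' --> \<gamma> c (w c') = \<zero>) -->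
  (EX x:mspan R W (w ` C). x ~= 0[W] & (ALL i:I. g i x = \<zero>))"
 using assms(3) g
proof (induction I)
 case empty
 show ?case
 proof (intro allI impI)
  fix C and w :: "'c => 'w"
  assume C: "finite C" "card {} < card C" and w: "ALL c:C. w c : \<U> W & is_lin W \<R> (\<gamma> c) & \<gamma> c (w c) ~= \<zero>"
  obtain c where c: "c : C" using C by fastforce
  have "w c ~= 0[W]"
  proof
   assume "w c = 0[W]"
   moreover have "\<gamma> c 0[W] = \<zero>" using lin_zero[OF W reg_module, of "\<gamma> c"] w c by simp
   moreover have "\<gamma> c (w c) ~= \<zero>" using w c by blast
   ultimately show False by simp
  qed
  then show "EX x:mspan R W (w ` C). x ~= 0[W] & (ALL i:{}. g i x = \<zero>)"
   using mspan_base[of "w c" "w ` C" W] c by blast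
 qed
next
 case (insert i0 I)
 interpret D: domain R by (rule D)
 have gi: "is_lin W \<R> (g i0)" and gI: "!!i. i : I ==> is_lin W \<R> (g i)" using insert.prems by simp_all
 note IH = insert.IH[OF gI]
 show ?case
 proof (intro allI impI)
  fix C and w :: "'c => 'w"
  assume C: "finite C" "card (insert i0 I) < card C"
   and w: "ALL c:C. w c : \<U> W & is_lin W \<R> (\<gamma> c) & \<gamma> c (w c) ~= \<zero>"
   and o: "ALL c:C. ALL c':C. c ~= c' --> \<gamma> c (w c') = \<zero>"
  have cI: "Suc (card I) < card C" using C(2) insert.hyps by simp
  have wc: "w c : \<U> W" and \<gamma>l: "is_lin W \<R> (\<gamma> c)" and \<gamma>n: "\<gamma> c (w c) ~= \<zero>" if "c : C" for c using w that by simp_all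
  have wC: "w ` C <= \<U> W" using wc by auto
  \<comment> \<open>It suffices to find a vector for \<open>I\<close> in a span on which \<open>g i0\<close> vanishes.\<close>
  have red: "EX x:mspan R W (w ` C). x ~= 0[W] & (ALL i:insert i0 I. g i x = \<zero>)"
   if ex: "EX x:mspan R W S. x ~= 0[W] & (ALL i:I. g i x = \<zero>)" and S: "S <= mspan R W (w ` C)"
    and k: "!!s. s : S ==> g i0 s = \<zero>" for S
  proof -
   obtain x where x: "x : mspan R W S" "x ~= 0[W]" "ALL i:I. g i x = \<zero>" using ex by blast
   have Sc: "S <= \<U> W" using S mspan_carrier[OF W wC] by blast
   have "g i0 x = (%_. 0[\<R>]) x"
    by (rule lin_eq_on_mspan[OF W reg_module gi lin_const_zero[OF reg_module] Sc _ x(1)]) (simp add: k)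
   moreover have "x : mspan R W (w ` C)" by (rule subsetD[OF mspan_least[OF mspan_submodule[OF W wC] S] x(1)])
   ultimately show ?thesis using x(2,3) by auto
  qed
  show "EX x:mspan R W (w ` C). x ~= 0[W] & (ALL i:insert i0 I. g i x = \<zero>)"
  proof (cases "ALL c:C. g i0 (w c) = \<zero>")
   case True
   show ?thesis
   proof (rule red)
    show "EX x:mspan R W (w ` C). x ~= 0[W] & (ALL i:I. g i x = \<zero>)"
     using IH[rule_format, of C w] C(1) cI w o by simp
    show "w ` C <= mspan R W (w ` C)" by (rule subsetI, rule mspan_base)
    show "g i0 s = \<zero>" if "s : w ` C" for s using True that by blast
   qed
  next
   case False
   then obtain c0 where c0: "c0 : C" "g i0 (w c0) ~= \<zero>" by blast
   have gR: "g i0 (w c) : \<U> R" if "c : C" for c using lin_closed[OF gi wc[OF that]] by simp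
   let ?u = "%c. g i0 (w c0) *[W] w c -[W] g i0 (w c) *[W] w c0"
   have sm: "g i0 (w c0) *[W] w c : \<U> W" "g i0 (w c) *[W] w c0 : \<U> W" if "c : C" for c
    using gR c0 wc that W by simp_all
   have uc: "?u c : \<U> W" if "c : C" for c using sm[OF that] W by simp
   have fu: "f (?u c) = g i0 (w c0) \<otimes> f (w c) \<ominus> g i0 (w c) \<otimes> f (w c0)" if f: "is_lin W \<R> f" and c: "c : C" for f c
   proof -
    have "f (?u c) = f (g i0 (w c0) *[W] w c) -[\<R>] f (g i0 (w c) *[W] w c0)"
     by (rule lin_minus[OF W reg_module f sm[OF c]])
    also have "... = (g i0 (w c0) \<otimes> f (w c)) -[\<R>] (g i0 (w c) \<otimes> f (w c0))"
     using lin_smult[OF f gR[OF c0(1)] wc[OF c]] lin_smult[OF f gR[OF c] wc[OF c0(1)]] by simp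
    also have "... = g i0 (w c0) \<otimes> f (w c) \<ominus> g i0 (w c) \<otimes> f (w c0)"
    proof -
     have "-[\<R>] a = \<ominus> a" for a by (simp add: a_inv_def reg_mod_def m_inv_def)
     then show ?thesis by (simp add: a_minus_def)
    qed
    finally show ?thesis .
   qed
   have fR: "f (w c) : \<U> R" if "is_lin W \<R> f" "c : C" for f c using lin_closed[OF that(1) wc[OF that(2)]] by simp
   have mz: "\<gamma> c (?u c') = g i0 (w c0) \<otimes> \<gamma> c (w c')" if c: "c : C - {c0}" and c': "c' : C - {c0}" for c c'
   proof -
    have "\<gamma> c (w c0) = \<zero>" using o c c0(1) by blast
    then show ?thesis using fu[OF \<gamma>l, of c c'] c c' gR c0(1) fR[OF \<gamma>l, of c c'] by (simp add: a_minus_def)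
   qed
   show ?thesis
   proof (rule red[of "?u ` (C - {c0})"])
    have "ALL c:C - {c0}. ?u c : \<U> W & is_lin W \<R> (\<gamma> c) & \<gamma> c (?u c) ~= \<zero>"
    proof
     fix c assume c: "c : C - {c0}"
     then have cC: "c : C" by simp
     have "\<gamma> c (?u c) ~= \<zero>"
      unfolding mz[OF c c] using D.integral[OF _ gR[OF c0(1)] fR[OF \<gamma>l[OF cC] cC]] c0(2) \<gamma>n[OF cC] by blast
     then show "?u c : \<U> W & is_lin W \<R> (\<gamma> c) & \<gamma> c (?u c) ~= \<zero>" using uc[OF cC] \<gamma>l[OF cC] by blast
    qed
    moreover have "ALL c:C - {c0}. ALL c':C - {c0}. c ~= c' --> \<gamma> c (?u c') = \<zero>"
    proof (intro ballI impI)
     fix c c' assume c: "c : C - {c0}" "c' : C - {c0}" "c ~= c'"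
     have "\<gamma> c (w c') = \<zero>" using o c by blast
     then show "\<gamma> c (?u c') = \<zero>" unfolding mz[OF c(1,2)] using gR[OF c0(1)] by simp
    qed
    moreover have "finite (C - {c0})" "card I < card (C - {c0})" using C(1) cI c0(1) by simp_all
    ultimately show "EX x:mspan R W (?u ` (C - {c0})). x ~= 0[W] & (ALL i:I. g i x = \<zero>)"
     using IH[rule_format, of "C - {c0}" ?u] by blast
    note ms = mspan_submodule[OF W wC]
    show "?u ` (C - {c0}) <= mspan R W (w ` C)"
    proof (rule image_subsetI)
     fix c assume "c : C - {c0}"
     then have c: "c : C" by simp
     have "w c : mspan R W (w ` C)" "w c0 : mspan R W (w ` C)" by (rule mspan_base, use c c0 in blast)+
     then show "?u c : mspan R W (w ` C)"
      by (intro sub_minus[OF W ms] sub_smult[OF ms gR[OF c0(1)]] sub_smult[OF ms gR[OF c]])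
    qed
    show "g i0 s = \<zero>" if s: "s : ?u ` (C - {c0})" for s
    proof -
     obtain c where c: "c : C" "s = ?u c" using s by blast
     show ?thesis unfolding c(2) fu[OF gi c(1)] using gR[OF c(1)] gR[OF c0(1)] by (simp add: m_comm a_minus_def r_neg)
    qed
   qed
  qed
 qed
qed

lemma functional_ideal:
 assumes W: "module R W" and x: "x : \<U> W"
 shows "ideal {h x | h. is_lin W \<R> h} R"
proof (rule idealI)
 let ?J = "{h x | h. is_lin W \<R> h}"
 show "ring R" by (rule ring_axioms)
 have JI: "h x : ?J" if "is_lin W \<R> h" for h using that by blast
 have Jc: "h x : \<U> R" if "is_lin W \<R> h" for h using lin_closed[OF that x] by simp
 have mult: "a \<otimes> y : ?J" if a: "a : \<U> R" and y: "y : ?J" for a y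
 proof -
  obtain h where h: "is_lin W \<R> h" "y = h x" using y by blast
  show ?thesis unfolding h(2) using JI[OF lin_scale[OF reg_module h(1) a]] by simp
 qed
 show "subgroup ?J (add_monoid R)"
 proof (rule add.subgroupI)
  show "?J <= \<U> R" using Jc by blast
  show "?J ~= {}" using JI[OF lin_const_zero[OF reg_module]] by blast
  fix y assume y: "y : ?J"
  then have yc: "y : \<U> R" using Jc by blast
  have "\<ominus> \<one> \<otimes> y : ?J" by (rule mult[OF _ y]) simp
  then show "\<ominus> y : ?J" using yc by (simp add: l_minus)
  fix z assume z: "z : ?J"
  obtain h k where h: "is_lin W \<R> h" "y = h x" and k: "is_lin W \<R> k" "z = k x" using y z by blast
  show "y \<oplus> z : ?J" unfolding h(2) k(2) using JI[OF lin_plus[OF W reg_module h(1) k(1)]] by simp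
 qed
 fix a y assume y: "y : ?J" and a: "a : \<U> R"
 then have yc: "y : \<U> R" using Jc by blast
 show m: "a \<otimes> y : ?J" by (rule mult[OF a y])
 then show "y \<otimes> a : ?J" using m_comm[OF yc a] by simp
qed

text \<open>Take a nonzero common zero \<open>x\<close> and let \<open>d\<close> generate the ideal of values of functionals at \<open>x\<close>. All coordinates of
 \<open>x\<close> are multiples of \<open>d\<close>, so \<open>x = d e\<close>; then some functional takes the value 1 at \<open>e\<close>, and \<open>e\<close> is still a zero
 since \<open>d\<close> can be cancelled.\<close>

lemma unimodular_kernel_vector:
 assumes PD: "principal_domain R" and W: "module R W" and C: "dual_basis W C \<gamma>"
  and I: "finite I" "card I < card C" and g: "!!i. i : I ==> is_lin W \<R> (g i)"
 obtains e h where "e : \<U> W" "is_lin W \<R> h" "h e = \<one>" "!!i. i : I ==> g i e = \<zero>"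
proof -
 interpret PD: principal_domain R by (rule PD)
 note c = dual_basisD[OF C]
 have w: "ALL d:C. d : \<U> W & is_lin W \<R> (\<gamma> d) & \<gamma> d d ~= \<zero>" "ALL d:C. ALL d':C. d ~= d' --> \<gamma> d d' = \<zero>"
  using c(2,3,4) PD.one_not_zero by auto
 have "EX x:mspan R W ((%c. c) ` C). x ~= 0[W] & (ALL i:I. g i x = \<zero>)"
  by (rule common_kernel[OF PD.domain_axioms W I(1), where g = g and \<gamma> = \<gamma>, rule_format]) (use g w I(2) c(1) in auto)
 then obtain x where x: "x : mspan R W C" "x ~= 0[W]" "!!i. i : I ==> g i x = \<zero>" by auto
 have xc: "x : \<U> W" by (rule mspan_carrier[OF W _ x(1)]) (use c(2) in blast)
 let ?J = "{h x | h. is_lin W \<R> h}"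
 obtain d where d: "d : \<U> R" "?J = PIdl d" using PD.exists_gen[OF functional_ideal[OF W xc]] by blast
 have "d : ?J" unfolding d(2) by (rule cgenideal_self[OF d(1)])
 then obtain h where h: "is_lin W \<R> h" "d = h x" by blast
 have "EX t:\<U> R. \<gamma> b x = t \<otimes> d" if "b : C" for b
 proof -
  have "\<gamma> b x : PIdl d" unfolding d(2)[symmetric] using c(3)[OF that] by blast
  then show ?thesis unfolding cgenideal_def by blast
 qed
 then obtain t where t: "!!b. b : C ==> t b : \<U> R" "!!b. b : C ==> \<gamma> b x = t b \<otimes> d" by metis
 let ?e = "\<Oplus>\<^bsub>W\<^esub>b\<in>C. t b *[W] b"
 have tb: "t b *[W] b : \<U> W" if "b : C" for b using t(1)[OF that] c(2)[OF that] W by simp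
 have ec: "?e : \<U> W" by (rule mod_finsum_closed[OF W tb])
 interpret W: module R W by (rule W)
 have dx: "d *[W] ?e = x"
 proof -
  have "d *[W] ?e = (\<Oplus>\<^bsub>W\<^esub>b\<in>C. d *[W] (t b *[W] b))"
   by (rule W.finsum_smult_ldistr[OF c(1) d(1)]) (use tb in auto)
  also have "... = (\<Oplus>\<^bsub>W\<^esub>b\<in>C. \<gamma> b x *[W] b)"
  proof (rule mod_finsum_cong[OF W refl])
   fix b assume b: "b : C"
   show "d *[W] (t b *[W] b) = \<gamma> b x *[W] b"
    unfolding t(2)[OF b] using W.smult_assoc1[OF d(1) t(1)[OF b] c(2)[OF b]] m_comm[OF d(1) t(1)[OF b]] by simp
   show "\<gamma> b x *[W] b : \<U> W" using lin_closed[OF c(3)[OF b] xc] c(2)[OF b] W by simp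
  qed
  also have "... = x" by (rule c(5)[OF xc])
  finally show ?thesis .
 qed
 have dn: "d ~= \<zero>" using dx x(2) ec W by auto
 have cancel: "f ?e = a" if f: "is_lin W \<R> f" and a: "a : \<U> R" "f x = d \<otimes> a" for f a
 proof -
  have "d \<otimes> f ?e = d \<otimes> a" using lin_smult[OF f d(1) ec] a(2) unfolding dx by simp
  then show ?thesis using PD.m_lcancel[OF dn d(1) _ a(1)] lin_closed[OF f ec] by simp
 qed
 show thesis
 proof (rule that[OF ec h(1)])
  show "h ?e = \<one>" by (rule cancel[OF h(1)]) (use h(2) d(1) in simp_all)
  show "g i ?e = \<zero>" if "i : I" for i by (rule cancel[OF g[OF that]]) (use x(3)[OF that] d(1) in simp_all)
 qed
qed

text \<open>The next vector is chosen to be killed by \<open>r\<close> and by the previous functionals. Its functional is made to vanish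
 on the image of \<open>i\<close> and on the previous vectors by composing with the projection \<open>\<pi>\<close> along them.\<close>

lemma fam_exists:
 assumes PD: "principal_domain R" and V: "module R V" and W: "module R W" and m: "(i, r) : SR_hom R V W"
  and B: "dual_basis V B \<beta>" and C: "dual_basis W C \<gamma>"
 shows "card B + k <= card C ==> EX e \<eta>. fam V W i {..<k} e \<eta> & (ALL l<k. r (e l) = 0[V])"
proof (induction k)
 have i: "is_lin V W i" and r: "is_lin W V r" and ri: "!!v. v : \<U> V ==> r (i v) = v"
  using m by (auto simp: SR_hom_def lin_hom_iff)
 note b = dual_basisD[OF B]
 {
  case 0
  show ?case by (intro exI) (simp add: fam_def i)
 next
  case (Suc k)
  then obtain e \<eta> where F: "fam V W i {..<k} e \<eta>" and re: "ALL l<k. r (e l) = 0[V]" by auto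
  note F' = famD[OF F]
  have el: "e l : \<U> W" and \<eta>l: "is_lin W \<R> (\<eta> l)" if "l < k" for l using F'(3,4) that by simp_all
  let ?I = "Inl ` B \<union> Inr ` {..<k}"
  define g where "g = (%s. case s of Inl b => (%w. \<beta> b (r w)) | Inr l => \<eta> l)"
  have g: "is_lin W \<R> (g s)" if "s : ?I" for s
   using that lin_comp[OF r b(3)] \<eta>l by (auto simp: g_def)
  have fI: "finite ?I" using b(1) by simp
  have "card ?I = card B + k"
   using b(1) by (subst card_Un_disjoint) (auto simp: card_image)
  then have cI: "card ?I < card C" using Suc.prems by simp
  have "EX x h. x : \<U> W & is_lin W \<R> h & h x = \<one> & (ALL s:?I. g s x = \<zero>)"
   by (rule unimodular_kernel_vector[OF PD W C fI cI, where g = g]) (use g in blast)+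
  then obtain x h where x: "x : \<U> W" and h: "is_lin W \<R> h" "h x = \<one>" and "ALL s:?I. g s x = \<zero>"
   by (elim exE conjE)
  then have gx: "g s x = \<zero>" if "s : ?I" for s using that by (elim bspec)
  have rx: "r x = 0[V]"
  proof -
   have "r x = (\<Oplus>\<^bsub>V\<^esub>b\<in>B. \<beta> b (r x) *[V] b)" by (rule b(5)[OF lin_closed[OF r x], symmetric])
   also have "... = (\<Oplus>\<^bsub>V\<^esub>b\<in>B. 0[V])"
   proof (rule mod_finsum_cong[OF V refl])
    fix c assume c: "c : B"
    have "\<beta> c (r x) = \<zero>" using gx[of "Inl c"] c by (simp add: g_def)
    then show "\<beta> c (r x) *[V] c = 0[V]" using b(2)[OF c] V by simp
   qed (rule mod_zero[OF V])
   also have "... = 0[V]" by (rule mod_finsum_zero[OF V refl])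
   finally show ?thesis .
  qed
  have \<eta>x: "\<eta> l x = \<zero>" if "l < k" for l using gx[of "Inr l"] that by (simp add: g_def)
  define \<pi> where "\<pi> w = w -[W] (i (r w) +[W] (\<Oplus>\<^bsub>W\<^esub>l\<in>{..<k}. \<eta> l w *[W] e l))" for w
  have \<pi>l: "is_lin W W \<pi>"
   unfolding \<pi>_def
  proof (rule lin_diff[OF W W lin_ident lin_plus[OF W W lin_comp[OF r i] lin_finsum_fun[OF W W]]])
   show "is_lin W W (%w. \<eta> l w *[W] e l)" if "l : {..<k}" for l
    by (rule lin_comp[OF \<eta>l lin_smult_elem[OF W el]]) (use that in simp_all)
  qed simp
  interpret W: module R W by (rule W)
  have \<pi>0: "\<pi> w = w" if w: "w : \<U> W" and rw: "r w = 0[V]" and \<eta>w: "!!l. l < k ==> \<eta> l w = \<zero>" for w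
  proof -
   have "(\<Oplus>\<^bsub>W\<^esub>l\<in>{..<k}. \<eta> l w *[W] e l) = (\<Oplus>\<^bsub>W\<^esub>l\<in>{..<k}. 0[W])"
    by (rule mod_finsum_cong[OF W refl]) (use \<eta>w el W in simp_all)
   also have "... = 0[W]" by (rule mod_finsum_zero[OF W refl])
   finally show ?thesis unfolding \<pi>_def rw lin_zero[OF V W i] using w W by (simp add: mod_minus_eq mod_uminus_smult)
  qed
  have \<pi>i: "\<pi> (i v) = 0[W]" if v: "v : \<U> V" for v
  proof -
   have "(\<Oplus>\<^bsub>W\<^esub>l\<in>{..<k}. \<eta> l (i v) *[W] e l) = (\<Oplus>\<^bsub>W\<^esub>l\<in>{..<k}. 0[W])"
    by (rule mod_finsum_cong[OF W refl]) (use F'(5) v el W in simp_all)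
   also have "... = 0[W]" by (rule mod_finsum_zero[OF W refl])
   finally show ?thesis unfolding \<pi>_def ri[OF v] using lin_closed[OF i v] W by (simp add: a_minus_def W.r_neg)
  qed
  have \<pi>e: "\<pi> (e n) = 0[W]" if n: "n < k" for n
  proof -
   have "(\<Oplus>\<^bsub>W\<^esub>l\<in>{..<k}. \<eta> l (e n) *[W] e l) = (\<Oplus>\<^bsub>W\<^esub>l\<in>{..<k}. if n = l then e l else 0[W])"
   proof (rule mod_finsum_cong[OF W refl])
    fix l assume l: "l : {..<k}"
    show "\<eta> l (e n) *[W] e l = (if n = l then e l else 0[W])"
     using F'(6)[OF l] F'(7)[OF l, of n] n el[of l] l W by auto
    show "(if n = l then e l else 0[W]) : \<U> W" using el[of l] l W by simp
   qed
   also have "... = e n" using W.finsum_singleton[of n "{..<k}" e] n el by auto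
   finally show ?thesis
    unfolding \<pi>_def using re n lin_zero[OF V W i] el[OF n] W by (simp add: a_minus_def W.r_neg)
  qed
  have h0: "h 0[W] = \<zero>" using lin_zero[OF W reg_module h(1)] by simp
  let ?e = "e(k := x)" and ?\<eta> = "\<eta>(k := (%w. h (\<pi> w)))"
  have "fam V W i {..<Suc k} ?e ?\<eta>"
   unfolding fam_def
  proof (intro conjI ballI)
   show "is_lin V W i" by (rule i)
   show "finite {..<Suc k}" by simp
   fix l assume l: "l : {..<Suc k}"
   show "?e l : \<U> W" using x el[of l] l by auto
   show "is_lin W \<R> (?\<eta> l)" using lin_comp[OF \<pi>l h(1)] \<eta>l[of l] l by auto
   show "?\<eta> l (i v) = \<zero>" if "v : \<U> V" for v
    using \<pi>i[OF that] h0 F'(5)[of l v] that l by auto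
   fix n assume n: "n : {..<Suc k}"
   show "?\<eta> l (?e n) = (if l = n then \<one> else \<zero>)"
   proof (cases "l = k")
    case True
    then show ?thesis
     using \<pi>0[OF x rx \<eta>x] h \<pi>e[of n] h0 n by (auto simp: less_Suc_eq)
   next
    case False
    then have lk: "l < k" using l by simp
    show ?thesis
     using \<eta>x[OF lk] F'(6)[of l] F'(7)[of l n] lk n by (auto simp: less_Suc_eq)
   qed
  qed
  moreover have "ALL l<Suc k. r (?e l) = 0[V]" using re rx by (simp add: less_Suc_eq)
  ultimately show ?case by blast
 }
qed

end

section \<open>The functors in the sequence\<close>

context operad begin

text \<open>Precomposition with \<open>V \<mapsto> R \<oplus> V\<close>.\<close>

lemma shift_functor_SR:
 fixes F :: "('r, 'r \<times> 'v, 'f) sr_functor"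
 assumes F: "SR_functor R F" shows "SR_functor R (shift_functor R F)"
 unfolding SR_functor_def
proof (intro conjI allI impI ballI)
 note f = SR_functorD[OF F]
 have mor: "mor (shift_functor R F) V W m =
  mor F (R_plus R V) (R_plus R W) (dsum_map \<R> V id (fst m), dsum_map \<R> W id (snd m))" for V W :: "('r, 'v) module" and m
  by (simp add: shift_functor_def case_prod_beta')
 have ob: "ob (shift_functor R F) V = ob F (R_plus R V)" for V :: "('r, 'v) module" by (simp add: shift_functor_def)
 {
  fix V :: "('r, 'v) module" assume V: "SR_obj R V"
  note RV = SR_obj_R_plus[OF V]
  show "module R (ob (shift_functor R F) V)" unfolding ob by (rule f(1)[OF RV])
  have "(dsum_map \<R> V id (fst (SR_id V)), dsum_map \<R> V id (snd (SR_id V))) = SR_id (R_plus R V)"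
   by (auto simp: SR_id_def dsum_map_def fun_eq_iff restrict_def)
  then show "mor (shift_functor R F) V V (SR_id V) x = x" if "x : \<U> (ob (shift_functor R F) V)" for x
   unfolding mor using f(3)[OF RV] that by (simp add: ob)
  fix W :: "('r, 'v) module" and m assume W: "SR_obj R W" and m: "m : SR_hom R V W"
  have m': "(dsum_map \<R> V id (fst m), dsum_map \<R> W id (snd m)) : SR_hom R (R_plus R V) (R_plus R W)"
   by (rule dsum_map_SR_hom[OF SR_obj_module[OF V] SR_obj_module[OF W]]) (use m in simp)
  show "mor (shift_functor R F) V W m : lin_hom R (ob (shift_functor R F) V) (ob (shift_functor R F) W)"
   unfolding mor ob using F RV SR_obj_R_plus[OF W] m' unfolding SR_functor_def by blast
 }
 fix U V W :: "('r, 'v) module" and m m' x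
 assume o: "SR_obj R U" "SR_obj R V" "SR_obj R W" and m: "m : SR_hom R U V" and m': "m' : SR_hom R V W"
  and x: "x : \<U> (ob (shift_functor R F) U)"
 let ?n = "(dsum_map \<R> U id (fst m), dsum_map \<R> V id (snd m))" and ?n' = "(dsum_map \<R> V id (fst m'), dsum_map \<R> W id (snd m'))"
 have n: "?n : SR_hom R (R_plus R U) (R_plus R V)"
  by (rule dsum_map_SR_hom[OF SR_obj_module[OF o(1)] SR_obj_module[OF o(2)]]) (use m in simp)
 have n': "?n' : SR_hom R (R_plus R V) (R_plus R W)"
  by (rule dsum_map_SR_hom[OF SR_obj_module[OF o(2)] SR_obj_module[OF o(3)]]) (use m' in simp)
 have c: "fst m u : \<U> V" if "u : \<U> U" for u
  using lin_closed[of U V "fst m"] m that by (simp add: SR_hom_iff lin_hom_iff)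
 have c': "snd m' w : \<U> V" if "w : \<U> W" for w
  using lin_closed[of W V "snd m'"] m' that by (simp add: SR_hom_iff lin_hom_iff)
 have e: "(dsum_map \<R> U id (fst (SR_comp U W m' m)), dsum_map \<R> W id (snd (SR_comp U W m' m))) =
  SR_comp (R_plus R U) (R_plus R W) ?n' ?n"
  using c c' by (auto simp: SR_comp_def dsum_map_def fun_eq_iff restrict_def compose_def)
 show "mor (shift_functor R F) U W (SR_comp U W m' m) x =
  mor (shift_functor R F) V W m' (mor (shift_functor R F) U V m x)"
  unfolding mor e
  by (rule f(4)[OF SR_obj_R_plus[OF o(1)] SR_obj_R_plus[OF o(2)] SR_obj_R_plus[OF o(3)] n n']) (use x in \<open>simp add: ob\<close>)
qed

lemma nat_proj:
 fixes F :: "('r, 'v, 'f) sr_functor" and G :: "('r, 'v, 'g) sr_functor"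
 assumes F: "SR_functor R F" and G: "SR_functor R G" and S: "is_subfunctor R G S" and n: "SR_nat R F G \<eta>"
 shows "SR_nat R F (quot_functor G S) (%V. \<lambda>x\<in>\<U> (ob F V). S V +>[ob G V] \<eta> V x)"
 unfolding SR_nat_def
proof (intro conjI allI impI ballI)
 note n = SR_natD[OF n]
 fix V :: "('r, 'v) module" assume V: "SR_obj R V"
 show "(\<lambda>x\<in>\<U> (ob F V). S V +>[ob G V] \<eta> V x) : lin_hom R (ob F V) (ob (quot_functor G S) V)"
  unfolding quot_functor_ob
  by (rule lin_restrict[OF SR_functorD(1)[OF F V]],
    rule lin_comp[OF n(1)[OF V] quot_proj_lin[OF SR_functorD(1)[OF G V] is_subfunctorD(1)[OF S V]]])
 fix W :: "('r, 'v) module" and m x assume W: "SR_obj R W" and m: "m : SR_hom R V W" and x: "x : \<U> (ob F V)"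
 note y = lin_closed[OF SR_functorD(2)[OF F V W m] x]
 show "(\<lambda>x\<in>\<U> (ob F W). S W +>[ob G W] \<eta> W x) (mor F V W m x) =
  mor (quot_functor G S) V W m ((\<lambda>x\<in>\<U> (ob F V). S V +>[ob G V] \<eta> V x) x)"
  using y x n(2)[OF V W m x] quot_functor_mor[OF G S V W m lin_closed[OF n(1)[OF V] x]] by simp
qed

end

context operad begin

lemma Der_functor_sel [simp]: "ob (Der_functor R P) V = \<D> V" "mor (Der_functor R P) V W m = Fm V W m"
 by (simp_all add: Der_functor_def)

lemma Der_functor_SR: "SR_functor R (Der_functor R P :: ('r, 'v, ('r, 'o, 'v) der) sr_functor)"
 unfolding SR_functor_def
proof (intro conjI allI impI ballI)
 fix V :: "('r, 'v) module" assume "SR_obj R V"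
 then have V: "module R V" by (rule SR_obj_module)
 show "module R (ob (Der_functor R P) V)" using V by simp
 { fix d assume "d : \<U> (ob (Der_functor R P) V)"
  then have d: "d : \<DD> V" by simp
  have m: "(\<lambda>v\<in>\<U> V. v, \<lambda>v\<in>\<U> V. v) : SR_hom R V V" using SR_id_mem[OF V] by (simp add: SR_id_def)
  note F = Fm[OF V V m d]
  have "Fm V V (\<lambda>v\<in>\<U> V. v, \<lambda>v\<in>\<U> V. v) d = d"
  proof (rule Der_eqI[OF V F(1) d])
   fix v assume v: "v : \<U> V"
   have dv: "d (inc V v) : \<AA> V" by (rule Der_inc_mem[OF V d v])
   have "fm V V (\<lambda>v\<in>\<U> V. v) (d (inc V v)) = fm V V (%v. v) (d (inc V v))"
    by (rule fm_cong[OF _ V V SR_homD(1)[OF m] dv]) simp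
   then show "Fm V V (\<lambda>v\<in>\<U> V. v, \<lambda>v\<in>\<U> V. v) d (inc V v) = d (inc V v)"
    unfolding F(2)[OF v] using fm_ident[OF V dv] v by simp
  qed
  then show "mor (Der_functor R P) V V (SR_id V) d = d" by (simp add: SR_id_def) }
 fix W :: "('r, 'v) module" and m assume "SR_obj R W" and m: "m : SR_hom R V W"
 then have W: "module R W" by (simp add: SR_obj_module)
 obtain i r where ir: "m = (i, r)" by (rule prod.exhaust)
 show "mor (Der_functor R P) V W m : lin_hom R (ob (Der_functor R P) V) (ob (Der_functor R P) W)"
  using Fm_lin[OF V W m[unfolded ir]] unfolding Der_functor_sel lin_hom_iff ir by (simp add: Der_map_def)
next
 fix U V W :: "('r, 'v) module" and m m' d
 assume o: "SR_obj R U" "SR_obj R V" "SR_obj R W" and m: "m : SR_hom R U V" and m': "m' : SR_hom R V W"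
  and "d : \<U> (ob (Der_functor R P) U)"
 then have d: "d : \<DD> U" by simp
 note U = SR_obj_module[OF o(1)] and V = SR_obj_module[OF o(2)] and W = SR_obj_module[OF o(3)]
 obtain i r where ir: "m = (i, r)" by (rule prod.exhaust)
 obtain i' r' where ir': "m' = (i', r')" by (rule prod.exhaust)
 note m = m[unfolded ir] and m' = m'[unfolded ir']
 let ?j = "compose (\<U> U) i' i" and ?s = "compose (\<U> W) r r'"
 have c: "(?j, ?s) : SR_hom R U W" using SR_comp_mem[OF U W m m'] by (simp add: SR_comp_def)
 note F = Fm[OF U W c d] and F1 = Fm[OF U V m d] and l = SR_homD[OF m] and l' = SR_homD[OF m']
 note F2 = Fm[OF V W m' F1(1)]
 have "Fm U W (?j, ?s) d = Fm V W (i', r') (Fm U V (i, r) d)"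
 proof (rule Der_eqI[OF W F(1) F2(1)])
  fix w assume w: "w : \<U> W"
  note rw = lin_closed[OF l'(2) w]
  note rrw = lin_closed[OF l(2) rw]
  have dx: "d (inc U (r (r' w))) : \<AA> U" by (rule Der_inc_mem[OF U d rrw])
  have "fm U W ?j (d (inc U (r (r' w)))) = fm U W (%v. i' (i v)) (d (inc U (r (r' w))))"
   by (rule fm_cong[OF _ U W SR_homD(1)[OF c] dx]) (simp add: compose_def)
  then show "Fm U W (?j, ?s) d (inc W w) = Fm V W (i', r') (Fm U V (i, r) d) (inc W w)"
   unfolding F(2)[OF w] F2(2)[OF w] F1(2)[OF rw] fm_fm[OF U V W l(1) l'(1) dx] using w by (simp add: compose_def)
 qed
 then show "mor (Der_functor R P) U W (SR_comp U W m' m) d = mor (Der_functor R P) V W m' (mor (Der_functor R P) U V m d)"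
  by (simp add: SR_comp_def ir ir')
qed

lemma Der_plus_subfunctor: "is_subfunctor R (Der_functor R P :: ('r, 'v, ('r, 'o, 'v) der) sr_functor) (Der_plus R P)"
 unfolding is_subfunctor_def
proof (intro conjI allI impI)
 fix V :: "('r, 'v) module" assume V: "SR_obj R V"
 note M = SR_obj_module[OF V]
 show "submodule (Der_plus R P V) R (ob (Der_functor R P) V)" using Der_plus_submodule[OF M] by simp
 fix W :: "('r, 'v) module" and m assume W: "SR_obj R W" and m: "m : SR_hom R V W"
 then show "mor (Der_functor R P) V W m ` Der_plus R P V <= Der_plus R P W"
  using Fm_plus[OF M W, of "fst m" "snd m"] by auto
qed

lemma L1_subfunctor: "is_subfunctor R (Der_functor R P :: ('r, 'v, ('r, 'o, 'v) der) sr_functor) (Der_Lie1 R P)"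
 unfolding is_subfunctor_def
proof (intro conjI allI impI)
 fix V :: "('r, 'v) module" assume V: "SR_obj R V"
 note M = SR_obj_module[OF V]
 show "submodule (Der_Lie1 R P V) R (ob (Der_functor R P) V)" using L1_submodule[OF M] by simp
 fix W :: "('r, 'v) module" and m assume W: "SR_obj R W" and m: "m : SR_hom R V W"
 then show "mor (Der_functor R P) V W m ` Der_Lie1 R P V <= Der_Lie1 R P W"
  using Fm_L1[OF M SR_obj_module[OF W], of "fst m" "snd m"] by auto
qed

lemma shift_Der_sel [simp]:
 "ob (shift_functor R (Der_functor R P)) V = \<D> (RP V)"
 "mor (shift_functor R (Der_functor R P)) V W m = Sm V W (fst m) (snd m)"
 by (simp_all add: shift_functor_def case_prod_beta')

lemmas shift_Der_SR = shift_functor_SR[OF Der_functor_SR]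

lemma Der_pt_plus_subfunctor:
 "is_subfunctor R (shift_functor R (Der_functor R P) :: ('r, 'v, ('r, 'o, 'r \<times> 'v) der) sr_functor) (Der_pt_plus R P)"
 unfolding is_subfunctor_def
proof (intro conjI allI impI)
 fix V :: "('r, 'v) module" assume V: "SR_obj R V"
 show "submodule (Der_pt_plus R P V) R (ob (shift_functor R (Der_functor R P)) V)"
  using Der_pt_plus_submodule[OF V] by simp
 fix W :: "('r, 'v) module" and m assume W: "SR_obj R W" and m: "m : SR_hom R V W"
 then show "mor (shift_functor R (Der_functor R P)) V W m ` Der_pt_plus R P V <= Der_pt_plus R P W"
  using Sm_Der_pt_plus[OF V W, of "fst m" "snd m"] by auto
qed

lemma Cm_subfunctor:
 "is_subfunctor R (shift_functor R (Der_functor R P) :: ('r, 'v, ('r, 'o, 'r \<times> 'v) der) sr_functor) (Der_pt_plus_comm R P)"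
 unfolding is_subfunctor_def
proof (intro conjI allI impI)
 fix V :: "('r, 'v) module" assume V: "SR_obj R V"
 show "submodule (Cm V) R (ob (shift_functor R (Der_functor R P)) V)"
  using Cm_submodule(1)[OF V] by simp
 fix W :: "('r, 'v) module" and m assume W: "SR_obj R W" and m: "m : SR_hom R V W"
 then show "mor (shift_functor R (Der_functor R P)) V W m ` Cm V <= Cm W"
  using Sm_Cm[OF V W, of "fst m" "snd m"] by auto
qed

abbreviation "FL \<equiv> Der_Lie1_functor R P"
abbreviation "FD \<equiv> Der_plus_functor R P"
abbreviation "FP \<equiv> Der_pt_plus_functor R P"
abbreviation "FT \<equiv> trace_functor R P"

lemma FL_SR: "SR_functor R (FL :: ('r, 'v, ('r, 'o, 'v) der) sr_functor)"
 unfolding Der_Lie1_functor_def by (rule SR_sub[OF Der_functor_SR L1_subfunctor])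

lemma FD_SR: "SR_functor R (FD :: ('r, 'v, ('r, 'o, 'v) der) sr_functor)"
 unfolding Der_plus_functor_def by (rule SR_sub[OF Der_functor_SR Der_plus_subfunctor])

lemma FP_SR: "SR_functor R (FP :: ('r, 'v, ('r, 'o, 'r \<times> 'v) der) sr_functor)"
 unfolding Der_pt_plus_functor_def by (rule SR_sub[OF shift_Der_SR Der_pt_plus_subfunctor])

lemma FP_Cm: "is_subfunctor R (FP :: ('r, 'v, ('r, 'o, 'r \<times> 'v) der) sr_functor) (Der_pt_plus_comm R P)"
 unfolding Der_pt_plus_functor_def
 by (rule is_subfunctor_of_sub[OF shift_Der_SR Der_pt_plus_subfunctor Cm_subfunctor Cm_submodule(2)])

lemma FT_SR: "SR_functor R (FT :: ('r, 'v, ('r, 'o, 'r \<times> 'v) der set) sr_functor)"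
 unfolding trace_functor_def by (rule SR_quot[OF FP_SR FP_Cm])

lemma F_sel [simp]:
 "ob FL V = (\<D> V)\<lparr>carrier := L1 V\<rparr>" "mor FL V W m = restrict (Fm V W m) (L1 V)"
 "ob FD V = (\<D> V)\<lparr>carrier := Der_plus R P V\<rparr>" "mor FD V W m = restrict (Fm V W m) (Der_plus R P V)"
 "ob FP V = (\<D> (RP V))\<lparr>carrier := Der_pt_plus R P V\<rparr>"
 "mor FP V W m = restrict (Sm V W (fst m) (snd m)) (Der_pt_plus R P V)"
 by (simp_all add: Der_Lie1_functor_def Der_plus_functor_def Der_pt_plus_functor_def)

lemma Phi_SR_nat:
 "SR_nat R (FD :: ('r, 'v, ('r, 'o, 'v) der) sr_functor) FP (%V. restrict (Phi R P V) (Der_plus R P V))"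
 unfolding SR_nat_def
proof (intro conjI allI impI ballI)
 fix V :: "('r, 'v) module" assume V: "SR_obj R V"
 note M = SR_obj_module[OF V]
 have sub: "Der_plus R P V <= \<DD> V" using Der_plus_carrier[OF M] by blast
 have "is_lin ((\<D> V)\<lparr>carrier := Der_plus R P V\<rparr>) ((\<D> (RP V))\<lparr>carrier := Der_pt_plus R P V\<rparr>) (Phi R P V)"
  by (rule lin_sub_codomain[OF lin_sub_domain[OF Phi_lin(1)[OF V] sub]]) (use Phi_plus[OF V] in simp)
 then have "restrict (Phi R P V) (\<U> ((\<D> V)\<lparr>carrier := Der_plus R P V\<rparr>)) :
  lin_hom R ((\<D> V)\<lparr>carrier := Der_plus R P V\<rparr>) ((\<D> (RP V))\<lparr>carrier := Der_pt_plus R P V\<rparr>)"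
  by (rule lin_restrict[OF sub_module[OF Der_module[OF M] Der_plus_submodule[OF M]]])
 then show "restrict (Phi R P V) (Der_plus R P V) : lin_hom R (ob FD V) (ob FP V)" by simp
 fix W :: "('r, 'v) module" and m d assume W: "SR_obj R W" and m: "m : SR_hom R V W" and "d : \<U> (ob FD V)"
 then have d: "d : Der_plus R P V" by simp
 have m': "(fst m, snd m) : SR_hom R V W" using m by simp
 have "Fm V W m d : Der_plus R P W" using Fm_plus[OF M W m' d] by simp
 then show "restrict (Phi R P W) (Der_plus R P W) (mor FD V W m d) = mor FP V W m (restrict (Phi R P V) (Der_plus R P V) d)"
  using d Phi_plus[OF V d] Phi_nat[OF V W m' Der_plus_carrier[OF M d]] by simp
qed

lemma Div_SR_nat: "SR_nat R (FD :: ('r, 'v, ('r, 'o, 'v) der) sr_functor) FT (Div R P)"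
proof -
 have "Div R P = (%V :: ('r, 'v) module. \<lambda>x\<in>\<U> (ob FD V). Cm V +>[ob FP V] restrict (Phi R P V) (Der_plus R P V) x)"
  by (auto simp: Div_def Der_pt_plus_mod_def fun_eq_iff)
 then show ?thesis using nat_proj[OF FD_SR FP_SR FP_Cm Phi_SR_nat] unfolding trace_functor_def by simp
qed

lemma Div_L1_SR_nat: "SR_nat R (FL :: ('r, 'v, ('r, 'o, 'v) der) sr_functor) FT (%V. restrict (Div R P V) (L1 V))"
 unfolding SR_nat_def
proof (intro conjI allI impI ballI)
 note n = SR_natD[OF Div_SR_nat]
 fix V :: "('r, 'v) module" assume V: "SR_obj R V"
 note M = SR_obj_module[OF V]
 have "is_lin ((ob FD V)\<lparr>carrier := L1 V\<rparr>) (ob FT V) (Div R P V)"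
  by (rule lin_sub_domain[OF n(1)[OF V]]) (use L1_plus[OF V] in simp)
 then have "is_lin ((\<D> V)\<lparr>carrier := L1 V\<rparr>) (ob FT V) (Div R P V)" by simp
 then have "restrict (Div R P V) (\<U> ((\<D> V)\<lparr>carrier := L1 V\<rparr>)) : lin_hom R ((\<D> V)\<lparr>carrier := L1 V\<rparr>) (ob FT V)"
  by (rule lin_restrict[OF sub_module[OF Der_module[OF M] L1_submodule[OF M]]])
 then show "restrict (Div R P V) (L1 V) : lin_hom R (ob FL V) (ob FT V)" by simp
 fix W :: "('r, 'v) module" and m d assume W: "SR_obj R W" and m: "m : SR_hom R V W" and "d : \<U> (ob FL V)"
 then have d: "d : L1 V" "d : Der_plus R P V" using L1_plus[OF V] by auto
 have m': "(fst m, snd m) : SR_hom R V W" using m by simp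
 have "Fm V W m d : L1 W" using Fm_L1[OF M SR_obj_module[OF W] m' d(1)] by simp
 then show "restrict (Div R P W) (L1 W) (mor FL V W m d) = mor FT V W m (restrict (Div R P V) (L1 V) d)"
  using n(2)[OF V W m, of d] d by simp
qed

lemma Div_image_subfunctor: "is_subfunctor R (FT :: ('r, 'v, ('r, 'o, 'r \<times> 'v) der set) sr_functor) (Div_image R P)"
proof -
 have e: "Div_image R P = (%V :: ('r, 'v) module. restrict (Div R P V) (L1 V) ` \<U> (ob FL V))"
  by (simp add: Div_image_def fun_eq_iff)
 show ?thesis by (subst e) (rule is_subfunctor_image[OF FL_SR FT_SR Div_L1_SR_nat])
qed

abbreviation "FC \<equiv> trace_mod_image_functor R P"

lemma FC_SR: "SR_functor R (FC :: ('r, 'v, ('r, 'o, 'r \<times> 'v) der set set) sr_functor)"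
 unfolding trace_mod_image_functor_def by (rule SR_quot[OF FT_SR Div_image_subfunctor])

lemma Div_mod_image_SR_nat: "SR_nat R (FD :: ('r, 'v, ('r, 'o, 'v) der) sr_functor) FC (Div_mod_image R P)"
proof -
 have "Div_mod_image R P = (%V :: ('r, 'v) module. \<lambda>x\<in>\<U> (ob FD V). Div_image R P V +>[ob FT V] Div R P V x)"
  by (simp add: Div_mod_image_def fun_eq_iff)
 then show ?thesis using nat_proj[OF FD_SR FT_SR Div_image_subfunctor Div_SR_nat] unfolding trace_mod_image_functor_def by simp
qed

lemma Lie1_inclusion_SR_nat: "SR_nat R (FL :: ('r, 'v, ('r, 'o, 'v) der) sr_functor) FD (Lie1_inclusion R P)"
 unfolding SR_nat_def
proof (intro conjI allI impI ballI)
 fix V :: "('r, 'v) module" assume V: "SR_obj R V"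
 note M = SR_obj_module[OF V]
 show "Lie1_inclusion R P V : lin_hom R (ob FL V) (ob FD V)"
  using L1_plus[OF V] sub_add[OF L1_submodule[OF M]] sub_smult[OF L1_submodule[OF M]]
  by (auto simp: lin_hom_def Lie1_inclusion_def)
 fix W :: "('r, 'v) module" and m d assume W: "SR_obj R W" and m: "m : SR_hom R V W" and "d : \<U> (ob FL V)"
 then have d: "d : L1 V" "d : Der_plus R P V" using L1_plus[OF V] by auto
 have "Fm V W m d : L1 W" using Fm_L1[OF M SR_obj_module[OF W], of "fst m" "snd m" d] m d(1) by simp
 then show "Lie1_inclusion R P W (mor FL V W m d) = mor FD V W m (Lie1_inclusion R P V d)"
  using d by (simp add: Lie1_inclusion_def)
qed

lemma FC_ob: "ob FC V = quot_mod (ob FT V) (Div_image R P V)" "ob FT V = quot_mod (ob FP V) (Cm V)"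
 by (simp_all add: trace_mod_image_functor_def trace_functor_def)

lemma Div_mod_image_zero_iff:
 assumes V: "SR_obj R V" and d: "d : Der_plus R P V"
 shows "Div_mod_image R P V d = 0[ob FC V] \<longleftrightarrow> (EX d':L1 V. Phi R P V d -[\<D> (RP V)] Phi R P V d' : Cm V)"
proof -
 note M = SR_obj_module[OF V]
 note S = is_subfunctorD(1)[OF Div_image_subfunctor V] and N = SR_functorD(1)[OF FT_SR V]
 note FPm = SR_functorD(1)[OF FP_SR V] and C = is_subfunctorD(1)[OF FP_Cm V]
 have Dc: "Div R P V d : \<U> (ob FT V)" using lin_closed[OF SR_natD(1)[OF Div_SR_nat V]] d by simp
 have val: "Div R P V e = Cm V +>[ob FP V] Phi R P V e" if "e : Der_plus R P V" for e
  using that by (simp add: Div_def Der_pt_plus_mod_def)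
 have "Div_mod_image R P V d = 0[ob FC V] \<longleftrightarrow> Div R P V d : Div_image R P V"
  unfolding FC_ob(1) quot_zero using coset_eq_zero_iff[OF N S Dc] d by (simp add: Div_mod_image_def)
 also have "... \<longleftrightarrow> (EX d':L1 V. Div R P V d = Div R P V d')" by (auto simp: Div_image_def)
 also have "... \<longleftrightarrow> (EX d':L1 V. Phi R P V d -[\<D> (RP V)] Phi R P V d' : Cm V)"
 proof (rule bex_cong[OF refl])
  fix d' assume "d' : L1 V"
  then have d': "d' : Der_plus R P V" using L1_plus[OF V] by blast
  note p = Phi_plus[OF V d] Phi_plus[OF V d']
  have "Phi R P V d -[ob FP V] Phi R P V d' = Phi R P V d -[\<D> (RP V)] Phi R P V d'"
   using sub_minus_eq[OF Der_module[OF RP_module[OF M]] Der_pt_plus_submodule[OF V] p] by simp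
  then show "Div R P V d = Div R P V d' \<longleftrightarrow> Phi R P V d -[\<D> (RP V)] Phi R P V d' : Cm V"
   unfolding val[OF d] val[OF d'] using coset_eq_iff[OF FPm C, of "Phi R P V d" "Phi R P V d'"] p by simp
 qed
 finally show ?thesis .
qed

end

section \<open>Exactness up to torsion\<close>

lemma (in base_ring) mod_minus_add:
 assumes M: "module R M" and x: "x : \<U> M" and y: "y : \<U> M"
 shows "(x -[M] y) +[M] y = x"
proof -
 interpret M: module R M by fact
 show ?thesis using x y by (simp add: a_minus_def M.a_assoc M.l_neg)
qed

context binary_presentation begin

text \<open>Subtracting \<open>d'\<close> reduces to a derivation whose divergence is a sum of commutators; then combine \<open>Fm_mod_L1\<close>
 and \<open>Cm_L1\<close> for one spare direction.\<close>

lemma kernel_stably_L1: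
 fixes V :: "('r, 'v) module"
 assumes PD: "principal_domain R" and V: "SR_obj R V" and x: "x : Der_plus R P V"
  and d': "d' : L1 V" and k: "Phi R P V x -[\<D> (RP V)] Phi R P V d' : Cm V"
 shows "EX N. from_rank N V (%W m. Fm V W m x : L1 W)"
proof -
 note M = SR_obj_module[OF V]
 note RV = RP_module[OF M] and DV = Der_module[OF M]
 have d'p: "d' : Der_plus R P V" using L1_plus[OF V] d' by blast
 note xc = Der_plus_carrier[OF M x] and d'c = Der_plus_carrier[OF M d'p]
 let ?d = "x -[\<D> V] d'"
 have d: "?d : Der_plus R P V" by (rule sub_minus[OF DV Der_plus_submodule[OF M] x d'p])
 have Pd: "Phi R P V ?d : Cm V"
  using k unfolding lin_minus[OF DV Der_module[OF RV] Phi_lin(1)[OF V] xc d'c] .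
 obtain N1 where N1: "ALL (W :: ('r, 'v) module) i r L e \<eta> l. module R W --> (i, r) : SR_hom R V W --> fam V W i L e \<eta> -->
  (ALL l:L. r (e l) = 0[V]) --> N1 <= card L --> l : L -->
  Fm V W (i, r) ?d -[\<D> W] rk W (ps V W (e l) i (Phi R P V ?d (u0 V))) (\<eta> l) : L1 W"
  using Fm_mod_L1[OF V d] by (rule exE)
 obtain N2 where N2: "ALL (W :: ('r, 'v) module) i L e \<eta> p. module R W --> fam V W i L e \<eta> --> N2 <= card L --> p : L -->
  rk W (ps V W (e p) i (Phi R P V ?d (u0 V))) (\<eta> p) : L1 W"
  using Cm_L1[OF V Pd] by (rule exE)
 obtain B' \<beta> where B: "dual_basis V B' \<beta>" using SR_obj_basis[OF V] .
 let ?k = "Suc (N1 + N2)"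
 show ?thesis
 proof (intro exI[of _ "card B' + ?k"] from_rankI)
  fix W :: "('r, 'v) module" and n m
  assume W: "SR_obj R W" and n: "has_rank R W n" and le: "card B' + ?k <= n" and m: "m : SR_hom R V W"
  note MW = SR_obj_module[OF W]
  obtain i r where ir: "m = (i, r)" by (rule prod.exhaust)
  note m = m[unfolded ir]
  obtain C \<gamma> where C: "dual_basis W C \<gamma>" "card C = n" using has_rank_dual_basis[OF MW n] .
  obtain e \<eta> where F: "fam V W i {..<?k} e \<eta>" and re: "ALL l<?k. r (e l) = 0[V]"
   using fam_exists[OF PD M MW m B C(1), of ?k] le C(2) by auto
  note DW = Der_module[OF MW] and L1W = L1_submodule[OF MW]
  note F' = famD[OF F]
  let ?z = "rk W (ps V W (e 0) i (Phi R P V ?d (u0 V))) (\<eta> 0)"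
  have z: "?z : L1 W"
   by (rule N2[rule_format, OF MW F]) simp_all
  have a: "Fm V W (i, r) ?d -[\<D> W] ?z : L1 W"
   by (rule N1[rule_format, OF MW m F]) (use re in simp_all)
  note fl = Fm_lin[OF M MW m]
  have c: "Fm V W (i, r) ?d : \<DD> W" "Fm V W (i, r) x : \<DD> W" "Fm V W (i, r) d' : \<DD> W"
   using lin_closed[OF fl] Der_plus_carrier[OF M d] xc d'c by simp_all
  have zc: "?z : \<DD> W" by (rule sub_carrier[OF L1W z])
  have "Fm V W (i, r) ?d : L1 W"
   using sub_add[OF L1W a z] mod_minus_add[OF DW c(1) zc] by simp
  then have "Fm V W (i, r) x -[\<D> W] Fm V W (i, r) d' : L1 W"
   unfolding lin_minus[OF DV DW fl xc d'c] .
  then have "Fm V W (i, r) x : L1 W"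
   using sub_add[OF L1W _ Fm_L1[OF M MW m d']] mod_minus_add[OF DW c(2,3)] by metis
  then show "Fm V W m x : L1 W" unfolding ir .
 qed
qed

lemma Phi_stably_onto:
 fixes V :: "('r, 'v) module"
 assumes PD: "principal_domain R" and V: "SR_obj R V" and D: "D : Der_pt_plus R P V"
 shows "EX N. from_rank N V (%W m. EX d:Der_plus R P W. Phi R P W d = Sm V W (fst m) (snd m) D)"
proof -
 note M = SR_obj_module[OF V]
 note RV = RP_module[OF M]
 have D': "D : Der_pt R P V" "D (u0 V) : fpos (RP V)" using D by (simp_all add: Der_pt_plus_iff[OF V])
 obtain B' \<beta> where B: "dual_basis V B' \<beta>" using SR_obj_basis[OF V] .
 show ?thesis
 proof (intro exI[of _ "card B' + 1"] from_rankI)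
  fix W :: "('r, 'v) module" and n m
  assume W: "SR_obj R W" and n: "has_rank R W n" and le: "card B' + 1 <= n" and m: "m : SR_hom R V W"
  note MW = SR_obj_module[OF W]
  obtain i r where ir: "m = (i, r)" by (rule prod.exhaust)
  note m = m[unfolded ir]
  obtain C \<gamma> where C: "dual_basis W C \<gamma>" "card C = n" using has_rank_dual_basis[OF MW n] .
  obtain e \<eta> where F: "fam V W i {..<1} e \<eta>"
   using fam_exists[OF PD M MW m B C(1), of 1] le C(2) by auto
  have o: "(0::nat) : {..<1}" by simp
  note F' = famD[OF F]
  have "rk W (ps V W (e 0) i (D (u0 V))) (\<eta> 0) : Der_plus R P W"
   by (rule rk_plus[OF MW F'(4)[OF o] fm_fpos[OF RV MW sb_lin[OF M MW F'(3)[OF o] F'(1)] D'(2)]])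
  moreover have "Phi R P W (rk W (ps V W (e 0) i (D (u0 V))) (\<eta> 0)) = Sm V W i r D"
   by (rule Phi_ps[OF V W m F'(3)[OF o] F'(4)[OF o] F'(6)[OF o] F'(5)[OF o] D'(1)])
  ultimately show "EX d:Der_plus R P W. Phi R P W d = Sm V W (fst m) (snd m) D" unfolding ir by auto
 qed
qed

lemma exact_up_to_torsion:
 assumes PD: "principal_domain R"
 shows "short_exact_up_to_torsion R (FL :: ('r, 'v, ('r, 'o, 'v) der) sr_functor) FD FC
  (Lie1_inclusion R P) (Div_mod_image R P)"
proof -
 let ?F = "FL :: ('r, 'v, ('r, 'o, 'v) der) sr_functor"
 have complex: "Div_mod_image R P V (Lie1_inclusion R P V x) = 0[ob FC V]"
  if V: "SR_obj R V" and x: "x : \<U> (ob ?F V)" for V :: "('r, 'v) module" and x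
 proof -
  note M = SR_obj_module[OF V]
  have xL: "x : L1 V" "x : Der_plus R P V" using x L1_plus[OF V] by auto
  have "Phi R P V x -[\<D> (RP V)] Phi R P V x = 0[\<D> (RP V)]"
   using mod_minus_zero_iff[OF Der_module[OF RP_module[OF M]]] lin_closed[OF Phi_lin(1)[OF V] Der_plus_carrier[OF M xL(2)]] by blast
  then have "Phi R P V x -[\<D> (RP V)] Phi R P V x : Cm V" using sub_zero[OF Cm_submodule(1)[OF V]] by simp
  then have "Div_mod_image R P V x = 0[ob FC V]" using Div_mod_image_zero_iff[OF V xL(2)] xL(1) by blast
  then show ?thesis using xL(1) by (simp add: Lie1_inclusion_def)
 qed
 have t1: "torsion_functor R (homology_functor zero_functor ?F FD (zero_nat zero_functor ?F) (Lie1_inclusion R P))"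
 proof (rule homology_torsionI[OF zero_functor_SR FL_SR FD_SR zero_nat_SR[OF zero_functor_SR FL_SR] Lie1_inclusion_SR_nat])
  fix V :: "('r, 'v) module" and x assume V: "SR_obj R V"
  note M = SR_obj_module[OF V]
  show "Lie1_inclusion R P V (zero_nat zero_functor FL V y) = 0[ob FD V]" if "y : \<U> (ob zero_functor V)" for y
   using that sub_zero[OF L1_submodule[OF M]] by (simp add: zero_nat_def Lie1_inclusion_def)
  assume x: "x : \<U> (ob ?F V)" and z: "Lie1_inclusion R P V x = 0[ob FD V]"
  have xz: "x = 0[ob ?F V]" using x z by (simp add: Lie1_inclusion_def)
  show "EX N. from_rank N V (%W m. mor ?F V W m x : zero_nat zero_functor FL W ` \<U> (ob zero_functor W))"
  proof (intro exI[of _ "0::nat"] from_rankI)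
   fix W :: "('r, 'v) module" and n m assume W: "SR_obj R W" and m: "m : SR_hom R V W"
   have "mor ?F V W m x = 0[ob ?F W]"
    unfolding xz by (rule lin_zero[OF SR_functorD(1)[OF FL_SR V] SR_functorD(1)[OF FL_SR W] SR_functorD(2)[OF FL_SR V W m]])
   then show "mor ?F V W m x : zero_nat zero_functor FL W ` \<U> (ob zero_functor W)"
    by (simp add: zero_nat_def zero_functor_def)
  qed
 qed
 have t2: "torsion_functor R (homology_functor ?F FD FC (Lie1_inclusion R P) (Div_mod_image R P))"
 proof (rule homology_torsionI[OF FL_SR FD_SR FC_SR Lie1_inclusion_SR_nat Div_mod_image_SR_nat])
  fix V :: "('r, 'v) module" and x
  assume V: "SR_obj R V"
  show "Div_mod_image R P V (Lie1_inclusion R P V y) = 0[ob FC V]" if "y : \<U> (ob FL V)" for y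
   by (rule complex[OF V that])
  assume "x : \<U> (ob FD V)" and z: "Div_mod_image R P V x = 0[ob FC V]"
  then have x: "x : Der_plus R P V" by simp
  obtain d' where d': "d' : L1 V" "Phi R P V x -[\<D> (RP V)] Phi R P V d' : Cm V"
   using z unfolding Div_mod_image_zero_iff[OF V x] by (rule bexE)
  have im: "y : Lie1_inclusion R P W ` \<U> (ob FL W)" if "y : L1 W" for y and W :: "('r, 'v) module"
   using that by (auto simp: Lie1_inclusion_def)
  show "EX N. from_rank N V (%W m. mor FD V W m x : Lie1_inclusion R P W ` \<U> (ob FL W))"
   by (rule from_rank_mono[OF kernel_stably_L1[OF PD V x d']]) (use x im in simp)
 qed
 have t3: "torsion_functor R (homology_functor FD (FC :: ('r, 'v, ('r, 'o, 'r \<times> 'v) der set set) sr_functor) zero_functor (Div_mod_image R P) (zero_nat FC zero_functor))"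
 proof (rule homology_torsionI[OF FD_SR FC_SR zero_functor_SR Div_mod_image_SR_nat zero_nat_SR[OF FC_SR zero_functor_SR]])
  fix V :: "('r, 'v) module" and X assume V: "SR_obj R V"
  note M = SR_obj_module[OF V]
  show "zero_nat FC zero_functor V (Div_mod_image R P V d) = 0[ob zero_functor V]" if "d : \<U> (ob FD V)" for d
   using lin_closed[OF SR_natD(1)[OF Div_mod_image_SR_nat V] that] by (simp add: zero_nat_def)
  assume X: "X : \<U> (ob FC V)"
  obtain T where T: "T : \<U> (ob FT V)" "X = Div_image R P V +>[ob FT V] T"
   using X unfolding FC_ob(1) quot_carrier by (rule bexE)
  obtain D where D: "D : \<U> (ob FP V)" "T = Cm V +>[ob FP V] D"
   using T(1) unfolding FC_ob(2) quot_carrier by (rule bexE)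
  have Dp: "D : Der_pt_plus R P V" using D(1) by simp
  show "EX N. from_rank N V (%W m. mor FC V W m X : Div_mod_image R P W ` \<U> (ob FD W))"
  proof (rule from_rank_mono[OF Phi_stably_onto[OF PD V Dp]])
   fix W :: "('r, 'v) module" and m
   assume a: "SR_obj R W" "m : SR_hom R V W"
   assume "EX d:Der_plus R P W. Phi R P W d = Sm V W (fst m) (snd m) D"
   then obtain d where d: "d : Der_plus R P W" "Phi R P W d = Sm V W (fst m) (snd m) D" by blast
   have "mor FT V W m T = Cm W +>[ob FP W] mor FP V W m D"
    unfolding D(2) trace_functor_def by (rule quot_functor_mor[OF FP_SR FP_Cm V a D(1)])
   also have "... = Div R P W d" using d Dp by (simp add: Div_def Der_pt_plus_mod_def)
   finally have e: "mor FT V W m T = Div R P W d" .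
   have "mor FC V W m X = Div_image R P W +>[ob FT W] mor FT V W m T"
    unfolding T(2) trace_mod_image_functor_def by (rule quot_functor_mor[OF FT_SR Div_image_subfunctor V a T(1)])
   also have "... = Div_mod_image R P W d" unfolding e using d(1) by (simp add: Div_mod_image_def)
   finally show "mor FC V W m X : Div_mod_image R P W ` \<U> (ob FD W)" using d(1) by simp
  qed
 qed
 show ?thesis
  unfolding short_exact_up_to_torsion_def
  using FL_SR FD_SR FC_SR Lie1_inclusion_SR_nat Div_mod_image_SR_nat complex t1 t2 t3 by blast
qed

end

theorem theorem3:
 fixes R :: "'r ring" and P :: "('r, 'o) operad" and B :: "'b set"
 assumes "principal_domain R"
  and "binary_operad R B P"
 shows "short_exact_up_to_torsion R
  (Der_Lie1_functor R P :: ('r, 'v, ('r, 'o, 'v) der) sr_functor)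
  (Der_plus_functor R P)
  (trace_mod_image_functor R P)
  (Lie1_inclusion R P)
  (Div_mod_image R P)"
proof -
 interpret PD: principal_domain R by fact
 obtain \<phi> where "operad_hom R (free_binary_operad R B) P \<phi>"
  "\<forall>n. \<phi> n ` \<U> (op_mod (free_binary_operad R B) n) = \<U> (op_mod P n)"
  using assms(2) by (auto simp: binary_operad_def)
 moreover have "operad R P" using assms(2) by (simp add: binary_operad_def)
 ultimately interpret binary_presentation R P B \<phi>
  by (simp add: binary_presentation_def binary_presentation_axioms_def PD.one_not_zero)
 show ?thesis by (rule exact_up_to_torsion[OF assms(1)])
qed

end
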